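(* Let $\{A'_{n,m}\}$ be a fixed admissible family (defined in the context). Let $k$ be a nonnegative integer, and for $1\le j\le k$ let $C'_{j}$ be either $A'_{m+2,m}$ for some $m\ge1$ (depending on $j$) or $B_{2}=\{z(1\,2)\}$. Let $n=\sum_{j=1}^{k}D(C'_{j})$, where $D(A'_{m+2,m})=m+2$ and $D(B_2)=2$. Let $C'$ be the set of all classes in $H_{k}\big(\mathrm{cell}(n,2);\mathbb{Q}\big)$ of the form $z'(e_{1})|\cdots|z'(e_{k})$, where each $z'(e_{j})$ is a properly ordered injected cycle arising from an element of $C'_{j}$, and all $n$ labels are used. Then the $\mathbb{Q}$-span of $C'$ is isomorphic, as an $S_n$-representation, to \[ \mathrm{Ind}^{S_{n}}_{S_{D(C'_{1})}\times \cdots \times S_{D(C'_{k})}}V_{C'_{1}}\boxtimes\cdots \boxtimes V_{C'_{k}}, \] where $V_{C'_{j}}=\bigwedge^{2}\mathrm{Std}_{m+2}$ if $C'_{j}=A'_{m+2,m}$, and $V_{C'_{j}}=\mathrm{Triv}_{2}$ if $C'_{j}=B_{2}$. Moreover, if exactly $d$ of the sets $C'_{j}$ are equal to $B_{2}$, and we only allow high-insertion to the immediate right of the $1$-cycle that precedes the cycle coming from such a $C'_{j}$ (at the far left if $C'_{1}=B_{2}$), as well as to the immediate right of the $1$-cycle coming from $C'_{k}$ (that is, only the $d+1$ maps $[\iota_{j-1}]$ for $j$ with $C'_j=B_2$, and $[\iota_k]$), then $C'$ generates a free $\mathrm{FI}_{d+1}$-submodule of $H_{k}\big(\mathrm{cell}(\bullet,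 2);\mathbb{Q}\big)$ isomorphic to \[ M^{\mathrm{FI}_{d+1}}\big(\mathrm{Ind}^{S_{n}}_{S_{D(C'_{1})}\times \cdots \times S_{D(C'_{k})}}V_{C'_{1}}\boxtimes\cdots \boxtimes V_{C'_{k}}\big). \]
   Context: Cells. A symbol on a finite set $S$ of positive integers (labels) is a sequence $\alpha_1|\cdots|\alpha_r$ of nonempty blocks, each a string of labels, with every element of $S$ occurring exactly once. $\mathrm{cell}(S)$ is the polyhedral cell complex with one cell of dimension $|S|-r$ for each symbol on $S$ with $r$ blocks; $f$ is a face of $g$ iff the symbol of $g$ is obtained from that of $f$ by deleting bars and shuffling the merged blocks (keeping the internal order of each original block). $\mathrm{cell}(S,2)$ is the subcomplex of cells all of whose blocks have at most $2$ elements; $\mathrm{cell}(n)=\mathrm{cell}([n])$, $\mathrm{cell}(n,2)=\mathrm{cell}([n],2)$, $[n]=\{1,\dots,n\}$. The boundary of a one-block cell $g$ is $\sum \pm\,\alpha|\beta$ over all ways to split $g$ into two complementary nonempty subwords $\alpha,\beta$, the sign being that of the permutation taking the word $g$ to the word $\alpha\beta$; and $\partial(g_1|g_2)=\partial g_1|g_2+(-1)^{b(g_1)}g_1|\partial g_2$ with $b$ the number of blocks. $S_n$ acts by permuting labels, so $H_k(\mathrm{cell}(n,2);\mathbb{Q})$ is an $S_n$-representation. The concatenation product $z_1|z_2$ of cycles on disjoint label sets is the bilinear extension of concatenation of symbols; it is well defined on homology classes. Basis. A singleton is a one-element block; a block is a follower if the preceding block is a singleton whose element is less than every element of the block. A symbol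 $e$ on $[n]$ is critical if its blocks have at most $2$ elements, every two consecutive singletons are in decreasing order, and every $2$-element block with decreasing elements is a follower. Put $z(i)=i$; $z(a\,b)=a\,b+b\,a$ for $a<b$; and for $a<b<c$ let $z(a|c\,b)$ be the image, under the order-preserving relabeling $1,2,3\mapsto a,b,c$, of $z(1|3\,2):=\partial(3\,2\,1)$ (boundary taken in $\mathrm{cell}(3)$). A critical symbol is uniquely a concatenation of pieces $i$; $a\,b$ ($a<b$); $a|c\,b$ ($a<b<c$), and $z(e)$ is the concatenation product of the corresponding cycles. By a theorem of Alpert the classes $z(e)$, $e$ critical with exactly $k$ two-element blocks, form a basis of $H_k(\mathrm{cell}(n,2);\mathbb{Q})$. Sets. For $n\ge3$, $1\le m\le n-2$, $A_{n,m}$ is the set of basis elements $z(e)$ of $H_1(\mathrm{cell}(n,2);\mathbb{Q})$ with $e=i_{1}|\cdots|i_{m}|i_{m+1}\,i_{m+2}|i_{m+3}|\cdots|i_{n}$, the $i_j$ a permutation of $[n]$, $i_1>\cdots>i_m$, $i_{m+3}>\cdots>i_n$, $i_{m+1}>i_{m+2}>i_m$. For $n\ge2$, $0\le m\le n-2$, $B_{n,m}$ is the set of those with $e$ of the same shape, $i_1>\cdots>i_m$, $i_{m+3}>\cdots>i_n$, $i_{m+2}>i_{m+1}$. High insertion. The barriers of a critical $e$ are its pieces of type $a\,b$ and $a|c\,b$; for $0\le j\le k$ ($k$ the number of barriers) $\iota_j(e)$ is the critical symbol obtained by inserting the singleton block $n+1$ immediately after the $j$-th barrier (at the far left if $j=0$),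 and $[\iota_j]:H_k(\mathrm{cell}(n,2);\mathbb{Q})\to H_k(\mathrm{cell}(n+1,2);\mathbb{Q})$ is linear with $z(e)\mapsto z(\iota_j(e))$. On a concatenation product of $k$ $1$-cycles, $[\iota_j](z_1|\cdots|z_k)=z_1|\cdots|z_j|(n+1)|z_{j+1}|\cdots|z_k$ in homology. $\mathrm{FI}_d$. $\mathrm{FI}_d$ has objects $[n]$ and morphisms $(f,g)$ with $f$ an injection and $g$ a $d$-coloring of the complement of the image of $f$; composition is $(f,g)\circ(f',g')=(f\circ f',h)$, $h(x)=g(x)$ if $x\notin\mathrm{im} f$, $h(x)=g'(f^{-1}(x))$ otherwise. An $\mathrm{FI}_d$-module over $\mathbb{Q}$ is a functor from $\mathrm{FI}_d$ to $\mathbb{Q}$-vector spaces. Put $M^{\mathrm{FI}_d}(m)=\mathbb{Q}[\mathrm{Hom}_{\mathrm{FI}_d}([m],\bullet)]$ and $M^{\mathrm{FI}_d}(U_m)=M^{\mathrm{FI}_d}(m)\otimes_{\mathbb{Q}[S_m]}U_m$ for an $S_m$-representation $U_m$; a module is free if it is isomorphic to some $\bigoplus_m M^{\mathrm{FI}_d}(U_m)$. By work of Alpert, $H_k(\mathrm{cell}(\bullet,2);\mathbb{Q})$ with any $d$ of the maps $[\iota_j]$ is an $\mathrm{FI}_d$-module (each chosen map is induced by the standard inclusion $[n]\to[n+1]$ with $n+1$ given the corresponding color). The submodule generated by a subspace (or subset) and chosen maps is the smallest sequence of $S_n$-subrepresentations containing it and closed under the chosen maps. Admissible family. A family of finite sets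 $A'_{n,m}\subset H_1(\mathrm{cell}(n,2);\mathbb{Q})$, $n\ge3$, $1\le m\le n-2$, is admissible if for all $n,m$: (1) the elements of $A'_{n,m}$ are linearly independent and $|A'_{n,m}|=|A_{n,m}|$; (2) the spans of $B_{n,0}\cup\bigcup_{1\le l\le m}(A'_{n,l}\cup B_{n,l})$ and $B_{n,0}\cup\bigcup_{1\le l\le m}(A_{n,l}\cup B_{n,l})$ are equal; (3) the span of $A'_{n,m}$ is the degree $n$ term of the $\mathrm{FI}_1$-submodule of $H_1(\mathrm{cell}(\bullet,2);\mathbb{Q})$ generated by the span of $A'_{m+2,m}$ and $[\iota_1]$, and this submodule is free; (4) the span of $A'_{m+2,m}$ is isomorphic to $\bigwedge^2\mathrm{Std}_{m+2}$ as an $S_{m+2}$-representation and lies in the degree $m+2$ term of the $\mathrm{FI}_1$-submodule generated by the span of $A'_{3,1}$ and $[\iota_0]$. $\mathrm{Std}_r$ and $\mathrm{Triv}_r$ are the standard and trivial representations of $S_r$. A properly ordered injected cycle arising from a cycle on labels $[r]$ is its image under the relabeling by an order-preserving bijection $[r]\to S$, $S$ a set of $r$ labels. *)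

theory Defs
  imports Complex_Main "HOL-Library.Poly_Mapping" "HOL-Library.FuncSet" "HOL-Combinatorics.Permutations"
    "HOL-Algebra.Module"
begin

section \<open>Free rational vector spaces\<close>

type_synonym 'a fvec = "'a \<Rightarrow>\<^sub>0 rat"

abbreviation gen :: "'a \<Rightarrow> 'a fvec" where
  "gen x \<equiv> Poly_Mapping.single x 1"

definition qscale :: "rat \<Rightarrow> 'a fvec \<Rightarrow> 'a fvec" where
  "qscale q c = Poly_Mapping.map ((*) q) c"

lemma lookup_qscale [simp]: "Poly_Mapping.lookup (qscale q c) x = q * Poly_Mapping.lookup c x"
  by (simp add: qscale_def Poly_Mapping.map.rep_eq when_def)

global_interpretation fvec: vector_space "qscale :: rat \<Rightarrow> 'a fvec \<Rightarrow> 'a fvec"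
  by unfold_locales (simp_all add: poly_mapping_eq_iff fun_eq_iff lookup_add algebra_simps)

definition linext :: "('a \<Rightarrow> 'b fvec) \<Rightarrow> 'a fvec \<Rightarrow> 'b fvec" where
  "linext f c = (\<Sum>a\<in>Poly_Mapping.keys c. qscale (Poly_Mapping.lookup c a) (f a))"

lemma linext_superset:
  assumes "finite A" "Poly_Mapping.keys c \<subseteq> A"
  shows "linext f c = (\<Sum>a\<in>A. qscale (Poly_Mapping.lookup c a) (f a))"
  unfolding linext_def using assms
  by (intro sum.mono_neutral_left) (auto simp: in_keys_iff)

lemma linext_zero [simp]: "linext f 0 = 0"
  by (simp add: linext_def)

lemma linext_gen [simp]: "linext f (gen a) = f a"
  by (simp add: linext_def)

lemma linext_add: "linext f (c + d) = linext f c + linext f d"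
proof -
  let ?A = "Poly_Mapping.keys c \<union> Poly_Mapping.keys d"
  have "linext f (c + d) = (\<Sum>a\<in>?A. qscale (Poly_Mapping.lookup (c + d) a) (f a))"
    by (rule linext_superset) (use Poly_Mapping.keys_add[of c d] in auto)
  also have "\<dots> = linext f c + linext f d"
    by (subst (1 2) linext_superset[of ?A])
       (auto simp: lookup_add fvec.scale_left_distrib sum.distrib)
  finally show ?thesis .
qed

lemma linext_scale: "linext f (qscale q c) = qscale q (linext f c)"
proof -
  have "linext f (qscale q c) =
      (\<Sum>a\<in>Poly_Mapping.keys c. qscale (Poly_Mapping.lookup (qscale q c) a) (f a))"
    by (rule linext_superset) (auto simp: in_keys_iff)
  thus ?thesis
    by (simp add: linext_def fvec.scale_sum_right)
qed

lemma linext_diff: "linext f (c - d) = linext f c - linext f d"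
  using linext_add[of f "c - d" d] by simp

lemma linext_minus: "linext f (- c) = - linext f c"
  using linext_diff[of f 0 c] by simp

lemma fvec_induct [consumes 1, case_names gen add scale zero]:
  assumes "Poly_Mapping.keys c \<subseteq> X"
    and "\<And>x. x \<in> X \<Longrightarrow> P (gen x)"
    and "\<And>c d. P c \<Longrightarrow> P d \<Longrightarrow> P (c + d)"
    and "\<And>q c. P c \<Longrightarrow> P (qscale q c)"
    and "P 0"
  shows "P (c :: 'a fvec)"
proof -
  have eq: "c = (\<Sum>a\<in>Poly_Mapping.keys c. qscale (Poly_Mapping.lookup c a) (gen a))"
    by (rule poly_mapping_eqI)
       (simp add: lookup_sum lookup_single when_def if_distrib[of "(*) _"] in_keys_iff cong: if_cong)
  have "finite A \<Longrightarrow> A \<subseteq> X \<Longrightarrow> P (\<Sum>a\<in>A. qscale (Poly_Mapping.lookup c a) (gen a))" for A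
    by (induction A rule: finite_induct) (auto intro: assms)
  from this[of "Poly_Mapping.keys c"] assms(1) eq show ?thesis by simp
qed

lemma fvec_induct_all [case_names gen add scale zero]:
  assumes "\<And>x. P (gen x)"
    and "\<And>c d. P c \<Longrightarrow> P d \<Longrightarrow> P (c + d)"
    and "\<And>q c. P c \<Longrightarrow> P (qscale q c)"
    and "P 0"
  shows "P (c :: 'a fvec)"
  by (rule fvec_induct[OF subset_UNIV]) (use assms in auto)

lemma keys_linext:
  assumes "Poly_Mapping.keys c \<subseteq> X" "\<And>x. x \<in> X \<Longrightarrow> Poly_Mapping.keys (f x) \<subseteq> Y"
  shows "Poly_Mapping.keys (linext f c) \<subseteq> Y"
  using assms(1)
proof (induction c rule: fvec_induct)
  case (add c d)
  then show ?case using Poly_Mapping.keys_add[of "linext f c" "linext f d"] by (auto simp: linext_add)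
next
  case (scale q c)
  then show ?case by (auto simp: linext_scale in_keys_iff)
qed (use assms(2) in auto)

lemma linext_cong:
  assumes "\<And>x. x \<in> Poly_Mapping.keys c \<Longrightarrow> f x = g x"
  shows "linext f c = linext g c"
  using assms by (simp add: linext_def)

section \<open>Symbols, cells and the boundary\<close>

type_synonym symb = "nat list list"
type_synonym chain = "symb fvec"

abbreviation labels :: "symb \<Rightarrow> nat set" where
  "labels e \<equiv> set (concat e)"

definition cell :: "nat set \<Rightarrow> symb set" where
  "cell S = {e. [] \<notin> set e \<and> distinct (concat e) \<and> labels e = S}"

definition cell2 :: "nat set \<Rightarrow> symb set" where
  "cell2 S = {e \<in> cell S. \<forall>g\<in>set e. length g \<le> 2}"

definition word_sign :: "'a list \<Rightarrow> 'a list \<Rightarrow> int" where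
  "word_sign g w = sign (THE p. p permutes {..<length g} \<and> permute_list p g = w)"

text \<open>A split of the word \<open>g\<close> into complementary nonempty subwords is given by the set \<open>I\<close> of
  positions that go to the first subword.\<close>
definition bd_block :: "nat list \<Rightarrow> chain" where
  "bd_block g = (\<Sum>I | I \<subseteq> {..<length g} \<and> I \<noteq> {} \<and> I \<noteq> {..<length g}.
     qscale (of_int (word_sign g (nths g I @ nths g (- I)))) (gen [nths g I, nths g (- I)]))"

text \<open>Concatenation of symbols on non-disjoint label sets is not defined; setting it to zero makes
  the product bilinear on all chains.\<close>
definition scat :: "symb \<Rightarrow> symb \<Rightarrow> chain" where
  "scat e e' = (if labels e \<inter> labels e' = {} then gen (e @ e') else 0)"

definition cprod :: "chain \<Rightarrow> chain \<Rightarrow> chain" where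
  "cprod c d = linext (\<lambda>e. linext (scat e) d) c"

fun bd_symb :: "symb \<Rightarrow> chain" where
  "bd_symb [] = 0"
| "bd_symb (g # e) = cprod (bd_block g) (gen e) - cprod (gen [g]) (bd_symb e)"

definition bd :: "chain \<Rightarrow> chain" where
  "bd = linext bd_symb"

text \<open>Relabeling along \<open>f\<close>, used both for the action of \<open>S\<^sub>n\<close> and for injections of labels. Symbols on whose labels \<open>f\<close> is not injective are sent to zero, so that this is a chain map for
  every \<open>f\<close>.\<close>
definition rsymb :: "(nat \<Rightarrow> nat) \<Rightarrow> symb \<Rightarrow> chain" where
  "rsymb f e = (if inj_on f (labels e) then gen (map (map f) e) else 0)"

definition crelabel :: "(nat \<Rightarrow> nat) \<Rightarrow> chain \<Rightarrow> chain" where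
  "crelabel f = linext (rsymb f)"

lemma cprod_gen [simp]: "cprod (gen e) (gen e') = scat e e'"
  by (simp add: cprod_def)

lemma cprod_zero [simp]: "cprod 0 d = 0" "cprod c 0 = 0"
  by (simp_all add: cprod_def linext_def)

lemma cprod_add_left: "cprod (c + c') d = cprod c d + cprod c' d"
  by (simp add: cprod_def linext_add)

lemma cprod_scale_left: "cprod (qscale q c) d = qscale q (cprod c d)"
  by (simp add: cprod_def linext_scale)

lemma cprod_add_right: "cprod c (d + d') = cprod c d + cprod c d'"
  by (simp add: cprod_def linext_def linext_add[unfolded linext_def] sum.distrib
      fvec.scale_right_distrib)

lemma cprod_scale_right: "cprod c (qscale q d) = qscale q (cprod c d)"
  unfolding cprod_def linext_scale
  by (simp add: linext_def fvec.scale_sum_right mult.left_commute)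

lemma cprod_diff_left: "cprod (c - c') d = cprod c d - cprod c' d"
  using cprod_add_left[of "c - c'" c' d] by simp

lemma cprod_diff_right: "cprod c (d - d') = cprod c d - cprod c d'"
  using cprod_add_right[of c "d - d'" d'] by simp

lemmas cprod_lin = cprod_add_left cprod_scale_left cprod_add_right cprod_scale_right
  cprod_diff_left cprod_diff_right

lemma scat_assoc: "cprod (scat e e') (gen e'') = cprod (gen e) (scat e' e'')"
  by (auto simp: scat_def)

lemma cprod_assoc: "cprod (cprod x y) z = cprod x (cprod y z)"
proof (induction x rule: fvec_induct_all)
  case (gen e)
  show ?case
  proof (induction y rule: fvec_induct_all)
    case (gen e')
    show ?case
      by (induction z rule: fvec_induct_all) (simp_all add: cprod_lin scat_assoc)
  qed (simp_all add: cprod_lin)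
qed (simp_all add: cprod_lin)

lemma keys_cprod:
  assumes "Poly_Mapping.keys c \<subseteq> X" "Poly_Mapping.keys d \<subseteq> Y"
    "\<And>e e'. e \<in> X \<Longrightarrow> e' \<in> Y \<Longrightarrow> labels e \<inter> labels e' = {} \<Longrightarrow> e @ e' \<in> Z"
  shows "Poly_Mapping.keys (cprod c d) \<subseteq> Z"
  unfolding cprod_def
  by (rule keys_linext[OF assms(1)], rule keys_linext[OF assms(2)]) (auto simp: scat_def assms(3))

lemma bd_add: "bd (c + d) = bd c + bd d"
  and bd_scale: "bd (qscale q c) = qscale q (bd c)"
  and bd_diff: "bd (c - d) = bd c - bd d"
  and bd_gen [simp]: "bd (gen e) = bd_symb e"
  and bd_zero [simp]: "bd 0 = 0"
  by (simp_all add: bd_def linext_add linext_scale linext_diff)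

lemma crelabel_add: "crelabel f (c + d) = crelabel f c + crelabel f d"
  and crelabel_scale: "crelabel f (qscale q c) = qscale q (crelabel f c)"
  and crelabel_diff: "crelabel f (c - d) = crelabel f c - crelabel f d"
  and crelabel_gen [simp]: "crelabel f (gen e) = rsymb f e"
  and crelabel_zero [simp]: "crelabel f 0 = 0"
  by (simp_all add: crelabel_def linext_add linext_scale linext_diff)

text \<open>The general form of the Leibniz rule for the boundary of a concatenation.\<close>
lemma bd_symb_append:
  assumes "distinct (concat (e @ e'))"
  shows "bd_symb (e @ e') =
    cprod (bd_symb e) (gen e') + qscale ((-1) ^ length e) (cprod (gen e) (bd_symb e'))"
  using assms
proof (induction e)
  case Nil
  have "cprod (gen []) x = x" for x
    by (induction x rule: fvec_induct_all) (simp_all add: cprod_lin, simp add: scat_def)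
  then show ?case by simp
next
  case (Cons g e)
  have d1: "labels e \<inter> labels e' = {}" and d2: "labels [g] \<inter> labels e = {}"
    using Cons.prems by auto
  have g1: "gen (e @ e') = cprod (gen e) (gen e')" and g2: "gen (g # e) = cprod (gen [g]) (gen e)"
    using d1 d2 by (auto simp: scat_def)
  have IH: "bd_symb (e @ e') =
      cprod (bd_symb e) (gen e') + qscale ((-1) ^ length e) (cprod (gen e) (bd_symb e'))"
    using Cons by simp
  show ?case
    unfolding append_Cons bd_symb.simps g1 g2 IH
    by (simp only: cprod_lin cprod_assoc) (simp add: fvec.scale_minus_left)
qed

definition valid :: "symb set" where
  "valid = {e. [] \<notin> set e \<and> distinct (concat e)}"

definition valid2 :: "symb set" where
  "valid2 = {e \<in> valid. \<forall>g\<in>set e. length g \<le> 2}"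

lemma valid2_eq: "valid2 = (\<Union>S. cell2 S)"
  by (auto simp: valid2_def valid_def cell2_def cell_def)

lemma set_nths_compl: "set (nths g I) \<union> set (nths g (- I)) = set g"
  unfolding set_nths by (force simp: in_set_conv_nth)

lemma nths_nonempty:
  assumes "I \<subseteq> {..<length g}" "I \<noteq> {}" "I \<noteq> {..<length g}"
  shows "nths g I \<noteq> []" "nths g (- I) \<noteq> []"
proof -
  obtain i where "i \<in> I" "i < length g" using assms by auto
  hence "g ! i \<in> set (nths g I)" by (auto simp: set_nths)
  thus "nths g I \<noteq> []" by auto
  obtain i where "i \<notin> I" "i < length g" using assms by auto
  hence "g ! i \<in> set (nths g (- I))" by (auto simp: set_nths)
  thus "nths g (- I) \<noteq> []" by auto
qed

lemma nths_disjoint: "distinct g \<Longrightarrow> set (nths g I) \<inter> set (nths g (- I)) = {}"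
  by (auto simp: set_nths nth_eq_iff_index_eq)

lemma length_nths_le: "length (nths g I) \<le> length g"
  unfolding length_nths
  by (rule order_trans[OF card_mono[of "{..<length g}"]]) auto

lemma finite_splits: "finite {I. I \<subseteq> {..<length g} \<and> I \<noteq> {} \<and> I \<noteq> {..<length g}}"
  by (rule finite_subset[of _ "Pow {..<length g}"]) auto

lemma keys_sum_sub:
  assumes "\<And>i. i \<in> A \<Longrightarrow> Poly_Mapping.keys (f i) \<subseteq> Y"
  shows "Poly_Mapping.keys (sum f A) \<subseteq> Y"
  using assms Poly_Mapping.keys_sum[of f A] by blast

lemma keys_bd_block:
  "Poly_Mapping.keys (bd_block g) \<subseteq> {[a, b] | a b. a \<noteq> [] \<and> b \<noteq> [] \<and> set a \<union> set b = set g \<and>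
     length a \<le> length g \<and> length b \<le> length g \<and>
     (distinct g \<longrightarrow> distinct a \<and> distinct b \<and> set a \<inter> set b = {})}"
  unfolding bd_block_def
proof (rule keys_sum_sub)
  fix I assume "I \<in> {I. I \<subseteq> {..<length g} \<and> I \<noteq> {} \<and> I \<noteq> {..<length g}}"
  thus "Poly_Mapping.keys (qscale (of_int (word_sign g (nths g I @ nths g (- I))))
          (gen [nths g I, nths g (- I)])) \<subseteq> {[a, b] | a b. a \<noteq> [] \<and> b \<noteq> [] \<and> set a \<union> set b = set g \<and>
     length a \<le> length g \<and> length b \<le> length g \<and>
     (distinct g \<longrightarrow> distinct a \<and> distinct b \<and> set a \<inter> set b = {})}"
    using nths_nonempty[of I g] nths_disjoint[of g I] set_nths_compl[of g I]
    by (auto simp: in_keys_iff lookup_single when_def length_nths_le split: if_splits)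
qed

definition same_labels :: "symb \<Rightarrow> symb set" where
  "same_labels e = {e'. labels e' = labels e \<and> length e' = Suc (length e) \<and>
     (e \<in> valid \<longrightarrow> e' \<in> valid) \<and> (e \<in> valid2 \<longrightarrow> e' \<in> valid2)}"

lemma keys_bd_symb:
  assumes "e \<in> valid" shows "Poly_Mapping.keys (bd_symb e) \<subseteq> same_labels e"
  using assms
proof (induction e)
  case (Cons g e)
  have v: "e \<in> valid" using Cons.prems by (auto simp: valid_def)
  have 1: "Poly_Mapping.keys (cprod (bd_block g) (gen e)) \<subseteq> same_labels (g # e)"
    by (rule keys_cprod[OF keys_bd_block, of _ "{e}"])
       (use Cons.prems in \<open>auto simp: same_labels_def valid2_def valid_def\<close>)
  have 2: "Poly_Mapping.keys (cprod (gen [g]) (bd_symb e)) \<subseteq> same_labels (g # e)"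
    by (rule keys_cprod[OF _ Cons.IH[OF v], of _ "{[g]}"])
       (use Cons.prems in \<open>auto simp: same_labels_def valid2_def valid_def\<close>)
  show ?case using 1 2 Poly_Mapping.keys_diff[of "cprod (bd_block g) (gen e)"] by fastforce
qed simp

section \<open>Relabeling is a chain map\<close>

lemma crelabel_cprod: "crelabel f (cprod x y) = cprod (crelabel f x) (crelabel f y)"
proof (induction x rule: fvec_induct_all)
  case (gen e)
  show ?case
  proof (induction y rule: fvec_induct_all)
    case (gen e')
    have l: "labels (map (map f) e) = f ` labels e" for e by auto
    show ?case
    proof (cases "inj_on f (labels e) \<and> inj_on f (labels e') \<and> labels e \<inter> labels e' = {}")
      case True
      hence "labels e - labels e' = labels e" "labels e' - labels e = labels e'" by blast+
      hence "inj_on f (labels e \<union> labels e') \<longleftrightarrow> f ` labels e \<inter> f ` labels e' = {}"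
        using True by (simp only: inj_on_Un simp_thms)
      moreover have "labels (e @ e') = labels e \<union> labels e'" by auto
      ultimately show ?thesis using True unfolding crelabel_gen cprod_gen
        by (simp only: rsymb_def scat_def l if_True crelabel_gen cprod_gen simp_thms) (auto simp: l)
    next
      case False
      have ne: "f ` labels e \<inter> f ` labels e' \<noteq> {}" if "labels e \<inter> labels e' \<noteq> {}"
        using that by blast
      have "\<not> inj_on f (labels (e @ e'))" if "\<not> inj_on f (labels e) \<or> \<not> inj_on f (labels e')"
        using that by (auto simp: inj_on_Un)
      then show ?thesis using False ne
        by (auto simp: rsymb_def scat_def l)
    qed
  qed (simp_all add: cprod_lin crelabel_add crelabel_scale)
qed (simp_all add: cprod_lin crelabel_add crelabel_scale)

lemma word_sign_map:
  assumes "inj_on f (set g)" "set w \<subseteq> set g"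
  shows "word_sign (map f g) (map f w) = word_sign g w"
proof -
  have "(p permutes {..<length (map f g)} \<and> permute_list p (map f g) = map f w) \<longleftrightarrow>
        (p permutes {..<length g} \<and> permute_list p g = w)" for p
  proof (cases "p permutes {..<length g}")
    case True
    have "map f (permute_list p g) = map f w \<longleftrightarrow> permute_list p g = w"
      by (rule inj_on_map_eq_map, rule inj_on_subset[OF assms(1)]) (use assms True in auto)
    thus ?thesis using True by (simp add: permute_list_map)
  qed simp
  thus ?thesis unfolding word_sign_def by (simp only:)
qed

lemma linext_sum: "linext f (sum c A) = (\<Sum>i\<in>A. linext f (c i))"
  by (induction A rule: infinite_finite_induct) (auto simp: linext_add)

lemma crelabel_bd_block:
  "crelabel f (bd_block g) = (if inj_on f (set g) then bd_block (map f g) else 0)"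
proof -
  have *: "rsymb f [nths g I, nths g (- I)] = (if inj_on f (set g)
     then gen [nths (map f g) I, nths (map f g) (- I)] else 0)" for I
    using set_nths_compl[of g I] by (simp add: rsymb_def nths_map)
  show ?thesis
  proof (cases "inj_on f (set g)")
    case True
    have "word_sign (map f g) (nths (map f g) I @ nths (map f g) (- I)) =
          word_sign g (nths g I @ nths g (- I))" for I
      unfolding nths_map map_append[symmetric] using True set_nths_compl[of g I]
      by (intro word_sign_map) auto
    thus ?thesis using True
      by (simp add: bd_block_def crelabel_def linext_sum linext_scale *)
  next
    case False
    thus ?thesis
      by (simp add: bd_block_def crelabel_def linext_sum linext_scale *)
  qed
qed

lemma bd_rsymb:
  assumes "e \<in> valid"
  shows "crelabel f (bd_symb e) = bd (rsymb f e)"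
  using assms
proof (induction e)
  case Nil
  then show ?case by (simp add: rsymb_def)
next
  case (Cons g e)
  have v: "e \<in> valid" and d: "set g \<inter> labels e = {}" and ge: "distinct g" "g \<noteq> []"
    using Cons.prems by (auto simp: valid_def)
  have lm: "labels (map (map f) e) = f ` labels e" by auto
  have eq: "crelabel f (bd_symb (g # e)) =
     cprod (if inj_on f (set g) then bd_block (map f g) else 0) (rsymb f e)
     - cprod (rsymb f [g]) (bd (rsymb f e))"
    by (simp add: crelabel_diff crelabel_cprod crelabel_bd_block Cons.IH[OF v])
  show ?case
  proof (cases "inj_on f (set g) \<and> inj_on f (labels e)")
    case False
    hence "\<not> inj_on f (labels (g # e))" by (auto simp: inj_on_Un)
    with False show ?thesis unfolding eq by (auto simp: rsymb_def)
  next
    case True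
    show ?thesis
    proof (cases "f ` set g \<inter> f ` labels e = {}")
      case disj: True
      have "inj_on f (labels (g # e))" using True disj d
        by (auto simp: inj_on_Un)
      thus ?thesis unfolding eq using True by (simp add: rsymb_def)
    next
      case False
      have ni: "\<not> inj_on f (labels (g # e))" using False d by (auto simp: inj_on_def)
      have me: "map (map f) e \<in> valid"
        using v True by (auto simp: valid_def distinct_map map_concat[symmetric])
      have "Poly_Mapping.keys (cprod (bd_block (map f g)) (gen (map (map f) e))) \<subseteq> {}"
      proof (rule keys_cprod[OF keys_bd_block, of _ "{map (map f) e}"])
        fix u v
        assume u: "u \<in> {[a, b] | a b. a \<noteq> [] \<and> b \<noteq> [] \<and> set a \<union> set b = set (map f g) \<and>
            length a \<le> length (map f g) \<and> length b \<le> length (map f g) \<and>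
            (distinct (map f g) \<longrightarrow> distinct a \<and> distinct b \<and> set a \<inter> set b = {})}"
          and v: "v \<in> {map (map f) e}" and uv: "labels u \<inter> labels v = {}"
        from u have lu: "labels u = f ` set g" by auto
        from v have lv: "labels v = f ` labels e" by (simp only: lm singleton_iff)
        from uv False show "u @ v \<in> {}" unfolding lu lv by blast
      qed simp
      hence 1: "cprod (bd_block (map f g)) (gen (map (map f) e)) = 0" by simp
      have "Poly_Mapping.keys (cprod (gen [map f g]) (bd_symb (map (map f) e))) \<subseteq> {}"
      proof (rule keys_cprod[OF _ keys_bd_symb[OF me], of _ "{[map f g]}"])
        fix u v
        assume u: "u \<in> {[map f g]}" and v: "v \<in> same_labels (map (map f) e)"
          and uv: "labels u \<inter> labels v = {}"
        from u have lu: "labels u = f ` set g" by auto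
        from v have lv: "labels v = f ` labels e" by (simp only: lm same_labels_def mem_Collect_eq)
        from uv False show "u @ v \<in> {}" unfolding lu lv by blast
      qed simp
      hence 2: "cprod (gen [map f g]) (bd_symb (map (map f) e)) = 0" by simp
      show ?thesis unfolding eq using True ni 1 2 by (simp add: rsymb_def)
    qed
  qed
qed


lemma bd_crelabel:
  assumes "Poly_Mapping.keys c \<subseteq> valid"
  shows "bd (crelabel f c) = crelabel f (bd c)"
  using assms
  by (induction c rule: fvec_induct)
     (simp_all add: bd_rsymb bd_add bd_scale crelabel_add crelabel_scale)

section \<open>Rational homology\<close>

text \<open>All complexes \<open>cell(S,2)\<close> are treated at once: the chains supported on \<open>valid2\<close> form the
  direct sum of the cellular chain complexes of \<open>cell(S,2)\<close> over all finite \<open>S\<close>, and the type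
  \<open>hmlg\<close> below is the total homology of this direct sum, i.e. the direct sum of all
  \<open>H\<^sub>k(cell(S,2); \<rat>)\<close>. The summands are the subspaces \<open>H k S\<close>.\<close>

definition C2 :: "chain set" where
  "C2 = {c. Poly_Mapping.keys c \<subseteq> valid2}"

definition hrel :: "chain \<Rightarrow> chain \<Rightarrow> bool" where
  "hrel x y \<longleftrightarrow> x \<in> C2 \<and> bd x = 0 \<and> y \<in> C2 \<and> bd y = 0 \<and> x - y \<in> bd ` C2"

lemma hrelI:
  assumes "x \<in> C2" "bd x = 0" "y \<in> C2" "bd y = 0" "x - y = bd c" "c \<in> C2"
  shows "hrel x y"
  using assms by (auto simp: hrel_def)

lemma C2_zero [simp]: "0 \<in> C2"
  and C2_add: "c \<in> C2 \<Longrightarrow> d \<in> C2 \<Longrightarrow> c + d \<in> C2"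
  and C2_scale: "c \<in> C2 \<Longrightarrow> qscale q c \<in> C2"
  using Poly_Mapping.keys_add[of c d] by (auto simp: C2_def in_keys_iff)

lemma C2_diff: "c \<in> C2 \<Longrightarrow> d \<in> C2 \<Longrightarrow> c - d \<in> C2"
  and C2_minus: "c \<in> C2 \<Longrightarrow> - c \<in> C2"
  using Poly_Mapping.keys_diff[of c d] by (auto simp: C2_def)

lemma bd_minus: "bd (- c) = - bd c"
  by (simp add: bd_def linext_minus)

lemma part_equivp_hrel: "part_equivp hrel"
proof (rule part_equivpI)
  have "bd 0 \<in> bd ` C2" by (rule imageI) simp
  thus "\<exists>x. hrel x x" by (intro exI[of _ 0]) (simp add: hrel_def)
  show "symp hrel"
  proof (rule sympI)
    fix x y assume *: "hrel x y"
    then obtain c where "c \<in> C2" "x - y = bd c" by (auto simp: hrel_def)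
    hence "y - x = bd (- c)" "- c \<in> C2" by (auto simp: bd_minus C2_minus algebra_simps)
    with * show "hrel y x" by (auto simp: hrel_def)
  qed
  show "transp hrel"
  proof (rule transpI)
    fix x y z assume *: "hrel x y" "hrel y z"
    then obtain c d where "c \<in> C2" "x - y = bd c" "d \<in> C2" "y - z = bd d"
      by (auto simp: hrel_def)
    hence "x - z = bd (c + d)" "c + d \<in> C2"
      by (auto simp: bd_add C2_add algebra_simps)
    with * show "hrel x z" by (auto simp: hrel_def)
  qed
qed

quotient_type hmlg = chain / partial: hrel
  by (rule part_equivp_hrel)

instantiation hmlg :: ab_group_add
begin

lift_definition zero_hmlg :: hmlg is "0 :: chain"
  by (auto simp: hrel_def intro: image_eqI[of _ _ 0])

lift_definition plus_hmlg :: "hmlg \<Rightarrow> hmlg \<Rightarrow> hmlg" is "(+) :: chain \<Rightarrow> _"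
proof -
  fix x x' y y' assume *: "hrel x x'" "hrel y y'"
  then obtain c d where "c \<in> C2" "x - x' = bd c" "d \<in> C2" "y - y' = bd d"
    by (auto simp: hrel_def)
  hence "(x + y) - (x' + y') = bd (c + d)" "c + d \<in> C2"
    by (auto simp: bd_add C2_add algebra_simps)
  with * show "hrel (x + y) (x' + y')"
    by (intro hrelI) (auto simp: hrel_def bd_add C2_add)
qed

lift_definition uminus_hmlg :: "hmlg \<Rightarrow> hmlg" is "uminus :: chain \<Rightarrow> _"
proof -
  fix x x' assume *: "hrel x x'"
  then obtain c where "c \<in> C2" "x - x' = bd c"
    by (auto simp: hrel_def)
  hence "(- x) - (- x') = bd (- c)" "- c \<in> C2"
    by (auto simp: bd_minus C2_minus algebra_simps)
  with * show "hrel (- x) (- x')"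
    by (intro hrelI) (auto simp: hrel_def bd_minus C2_minus)
qed

definition minus_hmlg :: "hmlg \<Rightarrow> hmlg \<Rightarrow> hmlg" where
  "minus_hmlg x y = x + - y"

lemma hrel_refl: "hrel x x \<longleftrightarrow> x \<in> C2 \<and> bd x = 0"
  by (auto simp: hrel_def intro: image_eqI[of _ _ 0])

instance
proof
  fix a b c :: hmlg
  show "a + b + c = a + (b + c)"
    by transfer (simp add: hrel_refl C2_add bd_add algebra_simps)
  show "a + b = b + a"
    by transfer (simp add: hrel_refl C2_add bd_add algebra_simps)
  show "0 + a = a"
    by transfer (simp add: hrel_refl)
  show "- a + a = 0"
    by transfer (simp add: hrel_refl)
  show "a - b = a + - b"
    by (fact minus_hmlg_def)
qed

end

lift_definition hscale :: "rat \<Rightarrow> hmlg \<Rightarrow> hmlg" is "qscale"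
proof -
  fix q x x' assume *: "hrel x x'"
  then obtain c where "c \<in> C2" "x - x' = bd c"
    by (auto simp: hrel_def)
  hence "qscale q x - qscale q x' = bd (qscale q c)" "qscale q c \<in> C2"
    by (auto simp: bd_scale C2_scale fvec.scale_right_diff_distrib[symmetric])
  with * show "hrel (qscale q x) (qscale q x')"
    by (intro hrelI) (auto simp: hrel_def bd_scale C2_scale)
qed

global_interpretation hm: vector_space hscale
  by unfold_locales
     (transfer, simp add: hrel_refl C2_add bd_add C2_scale bd_scale fvec.scale_right_distrib
        fvec.scale_left_distrib)+

text \<open>The class of a cycle (a junk value for chains that are not cycles of some \<open>cell(S,2)\<close>).\<close>
abbreviation hclass :: "chain \<Rightarrow> hmlg" where
  "hclass \<equiv> abs_hmlg"

definition H :: "nat \<Rightarrow> nat set \<Rightarrow> hmlg set" where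
  "H k S = {hclass c | c. Poly_Mapping.keys c \<subseteq> {e \<in> cell2 S. card S - length e = k} \<and> bd c = 0}"

lift_definition hrelabel :: "(nat \<Rightarrow> nat) \<Rightarrow> hmlg \<Rightarrow> hmlg" is crelabel
proof -
  fix f x x' assume *: "hrel x x'"
  have v: "valid2 \<subseteq> valid" by (auto simp: valid2_def)
  have cl: "crelabel f c \<in> C2" if "c \<in> C2" for c
    unfolding C2_def crelabel_def mem_Collect_eq
  proof (rule keys_linext)
    show "Poly_Mapping.keys c \<subseteq> valid2" using that by (simp add: C2_def)
    show "Poly_Mapping.keys (rsymb f e) \<subseteq> valid2" if "e \<in> valid2" for e
      using that by (auto simp: rsymb_def valid2_def valid_def distinct_map map_concat[symmetric])
  qed
  have b: "bd (crelabel f c) = crelabel f (bd c)" if "c \<in> C2" for c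
    using that v by (intro bd_crelabel) (auto simp: C2_def)
  from * obtain c where "c \<in> C2" "x - x' = bd c" by (auto simp: hrel_def)
  hence "crelabel f x - crelabel f x' = bd (crelabel f c)" "crelabel f c \<in> C2"
    by (auto simp: b cl crelabel_diff[symmetric])
  with * show "hrel (crelabel f x) (crelabel f x')" by (auto simp: hrel_def b cl)
qed

lemma C2_cprod: "c \<in> C2 \<Longrightarrow> d \<in> C2 \<Longrightarrow> cprod c d \<in> C2"
  unfolding C2_def mem_Collect_eq
  by (erule keys_cprod, assumption) (auto simp: valid2_def valid_def)

definition twist :: "chain \<Rightarrow> chain" where
  "twist = linext (\<lambda>e. qscale ((-1) ^ length e) (gen e))"

lemma twist_lin: "twist (c + d) = twist c + twist d" "twist (qscale q c) = qscale q (twist c)"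
  "twist (c - d) = twist c - twist d" "twist 0 = 0"
  by (simp_all add: twist_def linext_add linext_scale linext_diff)

lemma C2_twist: "c \<in> C2 \<Longrightarrow> twist c \<in> C2"
  unfolding C2_def twist_def mem_Collect_eq
  by (erule keys_linext) (auto simp: in_keys_iff lookup_single when_def split: if_splits)

lemma twist_twist: "twist (twist c) = c"
  by (induction c rule: fvec_induct_all)
     (simp_all add: twist_lin, simp add: twist_def linext_scale flip: power_mult_distrib)

lemma bd_twist:
  assumes "Poly_Mapping.keys c \<subseteq> valid" shows "bd (twist c) = - twist (bd c)"
  using assms
proof (induction c rule: fvec_induct)
  case (gen e)
  have "twist d = qscale ((-1) ^ Suc (length e)) d" if "Poly_Mapping.keys d \<subseteq> same_labels e" for d
    using that
    by (induction d rule: fvec_induct)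
       (simp_all add: twist_lin fvec.scale_right_distrib fvec.scale_left_commute,
        simp add: twist_def same_labels_def)
  from this[OF keys_bd_symb[OF gen]]
  show ?case by (simp add: twist_def linext_scale bd_scale)
qed (simp_all add: twist_lin bd_add bd_scale)

lemma scat_overlap:
  assumes "labels e \<inter> labels e' \<noteq> {}" "e \<in> valid" "e' \<in> valid"
  shows "cprod (bd_symb e) (gen e') = 0" "cprod (gen e) (bd_symb e') = 0"
proof -
  have "Poly_Mapping.keys (cprod (bd_symb e) (gen e')) \<subseteq> {}"
    by (rule keys_cprod[OF keys_bd_symb[OF assms(2)], of _ "{e'}"])
       (use assms(1) in \<open>simp_all add: same_labels_def\<close>)
  thus "cprod (bd_symb e) (gen e') = 0" by simp
  have "Poly_Mapping.keys (cprod (gen e) (bd_symb e')) \<subseteq> {}"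
    by (rule keys_cprod[OF _ keys_bd_symb[OF assms(3)], of _ "{e}"])
       (use assms(1) in \<open>simp_all add: same_labels_def\<close>)
  thus "cprod (gen e) (bd_symb e') = 0" by simp
qed

lemma bd_cprod:
  assumes "Poly_Mapping.keys x \<subseteq> valid" "Poly_Mapping.keys y \<subseteq> valid"
  shows "bd (cprod x y) = cprod (bd x) y + cprod (twist x) (bd y)"
  using assms(1)
proof (induction x rule: fvec_induct)
  case (gen e)
  note e = gen
  show ?case using assms(2)
  proof (induction y rule: fvec_induct)
    case (gen e')
    show ?case
    proof (cases "labels e \<inter> labels e' = {}")
      case True
      hence "distinct (concat (e @ e'))" using e gen by (simp add: valid_def)
      from bd_symb_append[OF this] True show ?thesis
        by (simp add: scat_def twist_def cprod_lin)
    next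
      case False
      then show ?thesis using scat_overlap[OF False e gen]
        by (simp add: scat_def twist_def cprod_lin)
    qed
  qed (simp_all add: cprod_lin bd_add bd_scale fvec.scale_right_distrib algebra_simps)
qed (simp_all add: cprod_lin bd_add bd_scale twist_lin fvec.scale_right_distrib algebra_simps)

lift_definition hprod :: "hmlg \<Rightarrow> hmlg \<Rightarrow> hmlg" is cprod
proof -
  fix x x' y y' assume *: "hrel x x'" "hrel y y'"
  then obtain c d where cd: "c \<in> C2" "x - x' = bd c" "d \<in> C2" "y - y' = bd d"
    by (auto simp: hrel_def)
  have C: "x \<in> C2" "x' \<in> C2" "y \<in> C2" "y' \<in> C2" and
    Z: "bd x = 0" "bd x' = 0" "bd y = 0" "bd y' = 0" using * by (auto simp: hrel_def)
  have V: "Poly_Mapping.keys u \<subseteq> valid" if "u \<in> C2" for u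
    using that by (auto simp: C2_def valid2_def)
  have b: "bd (cprod u v) = cprod (bd u) v + cprod (twist u) (bd v)" if "u \<in> C2" "v \<in> C2" for u v
    using that V by (intro bd_cprod)
  have "cprod x y - cprod x' y' = cprod (bd c) y + cprod x' (bd d)"
    by (simp add: cd(2,4)[symmetric] cprod_lin)
  also have "\<dots> = bd (cprod c y + cprod (twist x') d)"
    using cd C Z by (simp add: bd_add b C2_twist twist_twist bd_twist V twist_lin)
  finally have "cprod x y - cprod x' y' \<in> bd ` C2"
    using cd C by (auto intro!: imageI C2_add C2_cprod C2_twist)
  thus "hrel (cprod x y) (cprod x' y')"
    using C Z by (simp add: hrel_def C2_cprod b)
qed

text \<open>The empty concatenation is the class of the empty symbol in \<open>H 0 {}\<close>.\<close>
definition hprods :: "hmlg list \<Rightarrow> hmlg" where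
  "hprods xs = foldr hprod xs (hclass (gen []))"

section \<open>Critical symbols, the basis cycles and high insertion\<close>

definition follower :: "symb \<Rightarrow> nat \<Rightarrow> bool" where
  "follower e i \<longleftrightarrow> 0 < i \<and> i < length e \<and> (\<exists>a. e ! (i - 1) = [a] \<and> (\<forall>b\<in>set (e ! i). a < b))"

definition critical :: "nat \<Rightarrow> symb \<Rightarrow> bool" where
  "critical n e \<longleftrightarrow> e \<in> cell2 {1..n} \<and>
     (\<forall>i a b. Suc i < length e \<and> e ! i = [a] \<and> e ! Suc i = [b] \<longrightarrow> a > b) \<and>
     (\<forall>i a b. i < length e \<and> e ! i = [a, b] \<and> a > b \<longrightarrow> follower e i)"

definition barrier :: "symb \<Rightarrow> bool" where
  "barrier p \<longleftrightarrow> (\<exists>a b. p = [[a, b]] \<and> a < b) \<or> (\<exists>a b c. p = [[a], [c, b]] \<and> a < b \<and> b < c)"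

definition piece :: "symb \<Rightarrow> bool" where
  "piece p \<longleftrightarrow> (\<exists>i. p = [[i]]) \<or> barrier p"

text \<open>Only meaningful for critical symbols, which have exactly one such decomposition.\<close>
definition pieces :: "symb \<Rightarrow> symb list" where
  "pieces e = (THE ps. (\<forall>p\<in>set ps. piece p) \<and> concat ps = e)"

fun zpiece :: "symb \<Rightarrow> chain" where
  "zpiece [[i]] = gen [[i]]"
| "zpiece [[a, b]] = gen [[a, b]] + gen [[b, a]]"
| "zpiece [[a], [c, b]] = crelabel (id(1 := a, 2 := b, 3 := c)) (bd (gen [[3, 2, 1]]))"
| "zpiece _ = 0"

definition zclass :: "symb \<Rightarrow> hmlg" where
  "zclass e = hclass (foldr cprod (map zpiece (pieces e)) (gen []))"

definition num_pairs :: "symb \<Rightarrow> nat" where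
  "num_pairs e = length (filter (\<lambda>g. length g = 2) e)"

fun insert_after :: "nat \<Rightarrow> symb \<Rightarrow> symb list \<Rightarrow> symb list" where
  "insert_after 0 x ps = x # ps"
| "insert_after (Suc j) x [] = [x]"
| "insert_after (Suc j) x (p # ps) = p # insert_after (if barrier p then j else Suc j) x ps"

definition iota_symb :: "nat \<Rightarrow> nat \<Rightarrow> symb \<Rightarrow> symb" where
  "iota_symb n j e = concat (insert_after j [[Suc n]] (pieces e))"

text \<open>\<open>[\<iota>\<^sub>j]\<close> in degrees \<open>k\<close> and \<open>n\<close>. The condition determines the map on \<open>H k {1..n}\<close>, where the
  classes of the critical symbols form a basis; elsewhere its values are irrelevant.\<close>
definition iota :: "nat \<Rightarrow> nat \<Rightarrow> nat \<Rightarrow> hmlg \<Rightarrow> hmlg" where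
  "iota k n j = (SOME f. Vector_Spaces.linear hscale hscale f \<and>
     (\<forall>e. critical n e \<and> num_pairs e = k \<longrightarrow> f (zclass e) = zclass (iota_symb n j e)))"

text \<open>The symbol \<open>i\<^sub>1|\<dots>|i\<^sub>m|i\<^sub>m\<^sub>+\<^sub>1 i\<^sub>m\<^sub>+\<^sub>2|i\<^sub>m\<^sub>+\<^sub>3|\<dots>|i\<^sub>n\<close>; lists are indexed from 0.\<close>
definition one_pair_symb :: "nat \<Rightarrow> nat list \<Rightarrow> symb" where
  "one_pair_symb m is =
     map (\<lambda>i. [i]) (take m is) @ [[is ! m, is ! (m + 1)]] @ map (\<lambda>i. [i]) (drop (m + 2) is)"

definition A_set :: "nat \<Rightarrow> nat \<Rightarrow> hmlg set" where
  "A_set n m = {zclass (one_pair_symb m is) | is. distinct is \<and> set is = {1..n} \<and>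
     sorted_wrt (>) (take m is) \<and> sorted_wrt (>) (drop (m + 2) is) \<and>
     is ! m > is ! (m + 1) \<and> is ! (m + 1) > is ! (m - 1)}"

definition B_set :: "nat \<Rightarrow> nat \<Rightarrow> hmlg set" where
  "B_set n m = {zclass (one_pair_symb m is) | is. distinct is \<and> set is = {1..n} \<and>
     sorted_wrt (>) (take m is) \<and> sorted_wrt (>) (drop (m + 2) is) \<and>
     is ! (m + 1) > is ! m}"

text \<open>\<open>generated k J N X n\<close> is the degree \<open>n\<close> term of the submodule of \<open>H\<^sub>k(cell(\<bullet>,2))\<close> generated by
  the subset \<open>X\<close> of its degree \<open>N\<close> term and the maps \<open>[\<iota>\<^sub>j]\<close>, \<open>j \<in> J\<close>.\<close>
definition stable_seq :: "nat \<Rightarrow> nat set \<Rightarrow> (nat \<Rightarrow> hmlg set) \<Rightarrow> bool" where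
  "stable_seq k J W \<longleftrightarrow> (\<forall>n. hm.subspace (W n) \<and> W n \<subseteq> H k {1..n} \<and>
     (\<forall>\<sigma>. \<sigma> permutes {1..n} \<longrightarrow> hrelabel \<sigma> ` W n \<subseteq> W n) \<and>
     (\<forall>j\<in>J. iota k n j ` W n \<subseteq> W (Suc n)))"

definition generated :: "nat \<Rightarrow> nat set \<Rightarrow> nat \<Rightarrow> hmlg set \<Rightarrow> nat \<Rightarrow> hmlg set" where
  "generated k J N X n = \<Inter> {W n | W. stable_seq k J W \<and> X \<subseteq> W N}"

section \<open>Rational vector spaces and representations of symmetric groups\<close>

definition rat_ring :: "rat ring" where
  "rat_ring = \<lparr>carrier = UNIV, mult = (*), one = 1, zero = 0, add = (+)\<rparr>"

type_synonym 'v qmod = "(rat, 'v) module"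

definition lin_map :: "'v qmod \<Rightarrow> 'w qmod \<Rightarrow> ('v \<Rightarrow> 'w) \<Rightarrow> bool" where
  "lin_map V W T \<longleftrightarrow> T \<in> carrier V \<rightarrow> carrier W \<and>
     (\<forall>x\<in>carrier V. \<forall>y\<in>carrier V. T (x \<oplus>\<^bsub>V\<^esub> y) = T x \<oplus>\<^bsub>W\<^esub> T y) \<and>
     (\<forall>q. \<forall>x\<in>carrier V. T (q \<odot>\<^bsub>V\<^esub> x) = q \<odot>\<^bsub>W\<^esub> T x)"

definition lin_iso :: "'v qmod \<Rightarrow> 'w qmod \<Rightarrow> ('v \<Rightarrow> 'w) \<Rightarrow> bool" where
  "lin_iso V W T \<longleftrightarrow> lin_map V W T \<and> bij_betw T (carrier V) (carrier W)"

type_synonym 'v rep = "'v qmod \<times> ((nat \<Rightarrow> nat) \<Rightarrow> 'v \<Rightarrow> 'v)"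

definition is_rep :: "nat \<Rightarrow> 'v rep \<Rightarrow> bool" where
  "is_rep n R \<longleftrightarrow> Module.module rat_ring (fst R) \<and>
     (\<forall>\<sigma>. \<sigma> permutes {1..n} \<longrightarrow> lin_map (fst R) (fst R) (snd R \<sigma>)) \<and>
     (\<forall>x\<in>carrier (fst R). snd R id x = x) \<and>
     (\<forall>\<sigma> \<tau>. \<sigma> permutes {1..n} \<and> \<tau> permutes {1..n} \<longrightarrow>
        (\<forall>x\<in>carrier (fst R). snd R (\<sigma> \<circ> \<tau>) x = snd R \<sigma> (snd R \<tau> x)))"

definition rep_iso :: "nat \<Rightarrow> 'v rep \<Rightarrow> 'w rep \<Rightarrow> bool" where
  "rep_iso n R R' \<longleftrightarrow> is_rep n R \<and> is_rep n R' \<and>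
     (\<exists>T. lin_iso (fst R) (fst R') T \<and>
        (\<forall>\<sigma>. \<sigma> permutes {1..n} \<longrightarrow> (\<forall>x\<in>carrier (fst R). T (snd R \<sigma> x) = snd R' \<sigma> (T x))))"

text \<open>A linear subspace of the homology as a module record; with \<open>hrelabel\<close> as the action it is a
  representation if it is stable.\<close>
definition hsub :: "hmlg set \<Rightarrow> hmlg qmod" where
  "hsub W = \<lparr>carrier = W, mult = undefined, one = undefined, zero = 0, add = (+), smult = hscale\<rparr>"

text \<open>\<open>presented X R\<close> is the free rational vector space on \<open>X\<close> modulo the span of \<open>R\<close>, its elements
  being cosets. \<open>induced R' h\<close> is the map from such a space to one with relations \<open>R'\<close> that is induced
  by the map \<open>h\<close> on generators.\<close>
definition coset :: "'a fvec set \<Rightarrow> 'a fvec \<Rightarrow> 'a fvec set" where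
  "coset R c = {c + r | r. r \<in> fvec.span R}"

definition presented :: "'a set \<Rightarrow> 'a fvec set \<Rightarrow> ('a fvec set) qmod" where
  "presented X R = \<lparr>carrier = coset R ` {c. Poly_Mapping.keys c \<subseteq> X},
     mult = undefined, one = undefined, zero = coset R 0,
     add = (\<lambda>a b. {c + d | c d. c \<in> a \<and> d \<in> b}),
     smult = (\<lambda>q a. {qscale q c + r | c r. c \<in> a \<and> r \<in> fvec.span R})\<rparr>"

definition induced :: "'b fvec set \<Rightarrow> ('a \<Rightarrow> 'b) \<Rightarrow> 'a fvec set \<Rightarrow> 'b fvec set" where
  "induced R' h a = (\<Union>c\<in>a. coset R' (linext (\<lambda>x. gen (h x)) c))"

text \<open>The tensor product of a list of vector spaces is presented by tuples modulo multilinearity.\<close>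
definition tuples :: "'v qmod list \<Rightarrow> 'v list set" where
  "tuples Vs = {vs. length vs = length Vs \<and> (\<forall>i<length Vs. vs ! i \<in> carrier (Vs ! i))}"

definition multilin_rels :: "'v qmod list \<Rightarrow> 'v list fvec set" where
  "multilin_rels Vs =
     {gen (vs[i := x \<oplus>\<^bsub>Vs ! i\<^esub> y]) - gen (vs[i := x]) - gen (vs[i := y]) | vs i x y.
        vs \<in> tuples Vs \<and> i < length Vs \<and> x \<in> carrier (Vs ! i) \<and> y \<in> carrier (Vs ! i)} \<union>
     {gen (vs[i := q \<odot>\<^bsub>Vs ! i\<^esub> x]) - qscale q (gen (vs[i := x])) | vs i q x.
        vs \<in> tuples Vs \<and> i < length Vs \<and> x \<in> carrier (Vs ! i)}"

definition ext_square_rels :: "'v qmod \<Rightarrow> 'v list fvec set" where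
  "ext_square_rels V = multilin_rels [V, V] \<union> {gen [v, v] | v. v \<in> carrier V}"

definition ext_square :: "'v rep \<Rightarrow> ('v list fvec set) rep" where
  "ext_square R = (presented (tuples [fst R, fst R]) (ext_square_rels (fst R)),
     \<lambda>\<sigma>. induced (ext_square_rels (fst R)) (map (snd R \<sigma>)))"

definition std_rep :: "nat \<Rightarrow> (nat \<Rightarrow> rat) rep" where
  "std_rep r = (\<lparr>carrier = {x. (\<forall>i. i \<notin> {1..r} \<longrightarrow> x i = 0) \<and> (\<Sum>i=1..r. x i) = 0},
      mult = undefined, one = undefined, zero = (\<lambda>_. 0),
      add = (\<lambda>x y i. x i + y i), smult = (\<lambda>q x i. q * x i)\<rparr>,
     \<lambda>\<sigma> x i. x (inv_into UNIV \<sigma> i))"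

text \<open>The trivial representation on the vector space with the single basis element \<open>[]\<close>.\<close>
definition triv_rep :: "('v list fvec set) rep" where
  "triv_rep = (presented {[]} {}, \<lambda>\<sigma> x. x)"

text \<open>The Young subgroup \<open>S\<^bsub>n\<^sub>1\<^esub> \<times> \<dots> \<times> S\<^bsub>n\<^sub>k\<^esub>\<close> for \<open>ns = [n\<^sub>1,\<dots>,n\<^sub>k]\<close>, embedded via consecutive
  intervals, and the component of its elements in the \<open>j\<close>-th factor (\<open>j\<close> counted from 0).\<close>
definition offset :: "nat list \<Rightarrow> nat \<Rightarrow> nat" where
  "offset ns j = sum_list (take j ns)"

definition young :: "nat list \<Rightarrow> (nat \<Rightarrow> nat) set" where
  "young ns = {\<sigma>. \<sigma> permutes {1..sum_list ns} \<and>
     (\<forall>j<length ns. \<sigma> ` {offset ns j + 1..offset ns j + ns ! j} =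
        {offset ns j + 1..offset ns j + ns ! j})}"

definition young_comp :: "nat list \<Rightarrow> nat \<Rightarrow> (nat \<Rightarrow> nat) \<Rightarrow> nat \<Rightarrow> nat" where
  "young_comp ns j \<sigma> i = (if i \<in> {1..ns ! j} then \<sigma> (offset ns j + i) - offset ns j else i)"

definition outer_tensor :: "nat list \<Rightarrow> 'v rep list \<Rightarrow> ('v list fvec set) rep" where
  "outer_tensor ns Rs = (presented (tuples (map fst Rs)) (multilin_rels (map fst Rs)),
     \<lambda>\<sigma>. induced (multilin_rels (map fst Rs))
       (\<lambda>vs. map (\<lambda>j. snd (Rs ! j) (young_comp ns j \<sigma>) (vs ! j)) [0..<length Rs]))"

text \<open>For a right action \<open>act\<close> of a group \<open>G\<close> of permutations on \<open>X\<close>, the vector space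
  \<open>\<rat>[X] \<otimes>\<^bsub>\<rat>[G]\<^esub> V\<close> is presented by the pairs \<open>x \<otimes> v\<close> modulo the following relations.\<close>
definition bal_rels ::
  "'x set \<Rightarrow> ('x \<Rightarrow> (nat \<Rightarrow> nat) \<Rightarrow> 'x) \<Rightarrow> (nat \<Rightarrow> nat) set \<Rightarrow> 'v rep \<Rightarrow> ('x \<times> 'v) fvec set" where
  "bal_rels X act G R =
     {gen (x, u \<oplus>\<^bsub>fst R\<^esub> v) - gen (x, u) - gen (x, v) | x u v.
        x \<in> X \<and> u \<in> carrier (fst R) \<and> v \<in> carrier (fst R)} \<union>
     {gen (x, q \<odot>\<^bsub>fst R\<^esub> v) - qscale q (gen (x, v)) | x q v. x \<in> X \<and> v \<in> carrier (fst R)} \<union>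
     {gen (act x h, v) - gen (x, snd R h v) | x h v. x \<in> X \<and> h \<in> G \<and> v \<in> carrier (fst R)}"

definition Ind :: "nat \<Rightarrow> (nat \<Rightarrow> nat) set \<Rightarrow> 'v rep \<Rightarrow> (((nat \<Rightarrow> nat) \<times> 'v) fvec set) rep" where
  "Ind n G R =
     (let S = {\<tau>. \<tau> permutes {1..n}}; rels = bal_rels S (\<lambda>\<tau> g. \<tau> \<circ> g) G R
      in (presented (S \<times> carrier (fst R)) rels, \<lambda>\<sigma>. induced rels (\<lambda>(\<tau>, v). (\<sigma> \<circ> \<tau>, v))))"

section \<open>\<open>FI\<^sub>d\<close>-modules\<close>

text \<open>The colors are \<open>0,\<dots>,d-1\<close>.\<close>

type_synonym mor = "(nat \<Rightarrow> nat) \<times> (nat \<Rightarrow> nat)"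

definition FI_hom :: "nat \<Rightarrow> nat \<Rightarrow> nat \<Rightarrow> mor set" where
  "FI_hom d m n = {(f, g). f \<in> {1..m} \<rightarrow>\<^sub>E {1..n} \<and> inj_on f {1..m} \<and>
     g \<in> ({1..n} - f ` {1..m}) \<rightarrow>\<^sub>E {..<d}}"

text \<open>\<open>FI_comp l m n \<phi> \<psi>\<close> is \<open>\<phi> \<circ> \<psi>\<close> for \<open>\<psi> : [l] \<rightarrow> [m]\<close> and \<open>\<phi> : [m] \<rightarrow> [n]\<close>.\<close>
definition FI_comp :: "nat \<Rightarrow> nat \<Rightarrow> nat \<Rightarrow> mor \<Rightarrow> mor \<Rightarrow> mor" where
  "FI_comp l m n \<phi> \<psi> = (case \<phi> of (f, g) \<Rightarrow> case \<psi> of (f', g') \<Rightarrow>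
     (compose {1..l} f f',
      \<lambda>x\<in>{1..n} - (f \<circ> f') ` {1..l}.
        if x \<notin> f ` {1..m} then g x else g' (inv_into {1..m} f x)))"

definition perm_mor :: "nat \<Rightarrow> (nat \<Rightarrow> nat) \<Rightarrow> mor" where
  "perm_mor n \<sigma> = (restrict \<sigma> {1..n}, \<lambda>_. undefined)"

definition std_incl :: "nat \<Rightarrow> nat \<Rightarrow> mor" where
  "std_incl n c = (\<lambda>i\<in>{1..n}. i, \<lambda>_\<in>{Suc n}. c)"

text \<open>The second component takes source, target and morphism.\<close>
type_synonym 'v fimod = "(nat \<Rightarrow> 'v qmod) \<times> (nat \<Rightarrow> nat \<Rightarrow> mor \<Rightarrow> 'v \<Rightarrow> 'v)"

definition FI_module :: "nat \<Rightarrow> 'v fimod \<Rightarrow> bool" where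
  "FI_module d M \<longleftrightarrow>
     (\<forall>n. Module.module rat_ring (fst M n)) \<and>
     (\<forall>m n. \<forall>\<phi>\<in>FI_hom d m n. lin_map (fst M m) (fst M n) (snd M m n \<phi>)) \<and>
     (\<forall>n. \<forall>x\<in>carrier (fst M n). snd M n n (perm_mor n id) x = x) \<and>
     (\<forall>l m n. \<forall>\<phi>\<in>FI_hom d m n. \<forall>\<psi>\<in>FI_hom d l m. \<forall>x\<in>carrier (fst M l).
        snd M l n (FI_comp l m n \<phi> \<psi>) x = snd M m n \<phi> (snd M l m \<psi> x))"

definition FI_iso :: "nat \<Rightarrow> 'v fimod \<Rightarrow> 'w fimod \<Rightarrow> bool" where
  "FI_iso d M M' \<longleftrightarrow> FI_module d M \<and> FI_module d M' \<and>
     (\<exists>T. (\<forall>n. lin_iso (fst M n) (fst M' n) (T n)) \<and>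
        (\<forall>m n. \<forall>\<phi>\<in>FI_hom d m n. \<forall>x\<in>carrier (fst M m).
           T n (snd M m n \<phi> x) = snd M' m n \<phi> (T m x)))"

definition FI_submodule :: "nat \<Rightarrow> 'v fimod \<Rightarrow> (nat \<Rightarrow> 'v set) \<Rightarrow> bool" where
  "FI_submodule d M W \<longleftrightarrow> (\<forall>n. submodule (W n) rat_ring (fst M n)) \<and>
     (\<forall>m n. \<forall>\<phi>\<in>FI_hom d m n. snd M m n \<phi> ` W m \<subseteq> W n)"

definition restrict_FI :: "'v fimod \<Rightarrow> (nat \<Rightarrow> 'v set) \<Rightarrow> 'v fimod" where
  "restrict_FI M W = (\<lambda>n. (fst M n)\<lparr>carrier := W n\<rparr>, snd M)"

text \<open>\<open>M\<^bsup>FI\<^sub>d\<^esup>(U) = \<rat>[Hom([m], \<bullet>)] \<otimes>\<^bsub>\<rat>[S\<^sub>m]\<^esub> U\<close> for a representation \<open>U\<close> of \<open>S\<^sub>m\<close>.\<close>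
definition MFI_rels :: "nat \<Rightarrow> nat \<Rightarrow> 'v rep \<Rightarrow> nat \<Rightarrow> (mor \<times> 'v) fvec set" where
  "MFI_rels d m U n = bal_rels (FI_hom d m n) (\<lambda>\<phi> \<sigma>. FI_comp m m n \<phi> (perm_mor m \<sigma>))
     {\<sigma>. \<sigma> permutes {1..m}} U"

definition MFI :: "nat \<Rightarrow> nat \<Rightarrow> 'v rep \<Rightarrow> ((mor \<times> 'v) fvec set) fimod" where
  "MFI d m U = (\<lambda>n. presented (FI_hom d m n \<times> carrier (fst U)) (MFI_rels d m U n),
     \<lambda>n n' \<phi>. induced (MFI_rels d m U n') (\<lambda>(\<psi>, u). (FI_comp m n n' \<phi> \<psi>, u)))"

definition FI_direct_sum :: "(nat \<Rightarrow> 'v fimod) \<Rightarrow> (nat \<Rightarrow> 'v) fimod" where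
  "FI_direct_sum Ms =
     (\<lambda>n. \<lparr>carrier = {x. (\<forall>m. x m \<in> carrier (fst (Ms m) n)) \<and>
                          finite {m. x m \<noteq> \<zero>\<^bsub>fst (Ms m) n\<^esub>}},
        mult = undefined, one = undefined, zero = (\<lambda>m. \<zero>\<^bsub>fst (Ms m) n\<^esub>),
        add = (\<lambda>x y m. x m \<oplus>\<^bsub>fst (Ms m) n\<^esub> y m), smult = (\<lambda>q x m. q \<odot>\<^bsub>fst (Ms m) n\<^esub> x m)\<rparr>,
      \<lambda>n n' \<phi> x m. snd (Ms m) n n' \<phi> (x m))"

text \<open>It is no restriction to take the representations \<open>U\<^sub>m\<close> on the type of the module itself, since
  \<open>U\<^sub>m\<close> embeds into the degree \<open>m\<close> term of \<open>\<Oplus>\<^sub>m M(U\<^sub>m)\<close>.\<close>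
definition FI_free :: "nat \<Rightarrow> 'v fimod \<Rightarrow> bool" where
  "FI_free d M \<longleftrightarrow> (\<exists>U :: nat \<Rightarrow> 'v rep.
     (\<forall>m. is_rep m (U m)) \<and> FI_iso d M (FI_direct_sum (\<lambda>m. MFI d m (U m))))"

text \<open>\<open>H_FI k js M\<close>: \<open>M\<close> is the \<open>FI\<^sub>d\<close>-module \<open>H\<^sub>k(cell(\<bullet>,2))\<close> with the maps \<open>[\<iota>\<^sub>j]\<close> for the \<open>d\<close> entries
  \<open>j\<close> of \<open>js\<close>, the entry at position \<open>c\<close> belonging to color \<open>c\<close>. As permutations and standard
  inclusions generate \<open>FI\<^sub>d\<close>, this determines \<open>M\<close>.\<close>
definition H_FI :: "nat \<Rightarrow> nat list \<Rightarrow> hmlg fimod \<Rightarrow> bool" where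
  "H_FI k js M \<longleftrightarrow> FI_module (length js) M \<and> (\<forall>n. fst M n = hsub (H k {1..n})) \<and>
     (\<forall>n \<sigma>. \<sigma> permutes {1..n} \<longrightarrow> (\<forall>x\<in>H k {1..n}. snd M n n (perm_mor n \<sigma>) x = hrelabel \<sigma> x)) \<and>
     (\<forall>n. \<forall>c<length js. \<forall>x\<in>H k {1..n}. snd M n (Suc n) (std_incl n c) x = iota k n (js ! c) x)"

section \<open>Admissible families and concatenation products of cycles\<close>

definition admissible :: "(nat \<Rightarrow> nat \<Rightarrow> hmlg set) \<Rightarrow> bool" where
  "admissible A' \<longleftrightarrow> (\<forall>n m. 3 \<le> n \<and> 1 \<le> m \<and> m \<le> n - 2 \<longrightarrow>
     finite (A' n m) \<and> A' n m \<subseteq> H 1 {1..n} \<and>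
     hm.independent (A' n m) \<and> card (A' n m) = card (A_set n m) \<and>
     hm.span (B_set n 0 \<union> (\<Union>l\<in>{1..m}. A' n l \<union> B_set n l)) =
       hm.span (B_set n 0 \<union> (\<Union>l\<in>{1..m}. A_set n l \<union> B_set n l)) \<and>
     (let W = generated 1 {1} (m + 2) (hm.span (A' (m + 2) m)) in
        hm.span (A' n m) = W n \<and>
        (\<exists>M. H_FI 1 [1] M \<and> FI_submodule 1 M W \<and> FI_free 1 (restrict_FI M W))) \<and>
     rep_iso (m + 2) (hsub (hm.span (A' (m + 2) m)), hrelabel) (ext_square (std_rep (m + 2))) \<and>
     hm.span (A' (m + 2) m) \<subseteq> generated 1 {0} 3 (hm.span (A' 3 1)) (m + 2))"

text \<open>\<open>TypeA m\<close> stands for \<open>A'\<^bsub>m+2,m\<^esub>\<close> and \<open>TypeB\<close> for \<open>B\<^sub>2\<close>.\<close>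
datatype ctype = TypeA nat | TypeB

fun ctype_deg :: "ctype \<Rightarrow> nat" where
  "ctype_deg (TypeA m) = m + 2"
| "ctype_deg TypeB = 2"

fun ctype_set :: "(nat \<Rightarrow> nat \<Rightarrow> hmlg set) \<Rightarrow> ctype \<Rightarrow> hmlg set" where
  "ctype_set A' (TypeA m) = A' (m + 2) m"
| "ctype_set A' TypeB = {zclass [[1, 2]]}"

fun ctype_rep :: "ctype \<Rightarrow> ((nat \<Rightarrow> rat) list fvec set) rep" where
  "ctype_rep (TypeA m) = ext_square (std_rep (m + 2))"
| "ctype_rep TypeB = triv_rep"

definition ordered_injected :: "nat \<Rightarrow> nat set \<Rightarrow> hmlg \<Rightarrow> hmlg \<Rightarrow> bool" where
  "ordered_injected r S x y \<longleftrightarrow>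
     (\<exists>f. bij_betw f {1..r} S \<and> strict_mono_on {1..r} f \<and> y = hrelabel f x)"

definition concat_products :: "(nat \<Rightarrow> nat \<Rightarrow> hmlg set) \<Rightarrow> ctype list \<Rightarrow> nat \<Rightarrow> hmlg set" where
  "concat_products A' Cs n = {hprods ys | ys S. length ys = length Cs \<and>
     (\<forall>j<length Cs. \<exists>x\<in>ctype_set A' (Cs ! j). ordered_injected (ctype_deg (Cs ! j)) (S j) x (ys ! j)) \<and>
     (\<forall>i<length Cs. \<forall>j<length Cs. i \<noteq> j \<longrightarrow> S i \<inter> S j = {}) \<and>
     (\<Union>j<length Cs. S j) = {1..n}}"

definition Ind_ctypes ::
  "ctype list \<Rightarrow> (((nat \<Rightarrow> nat) \<times> (nat \<Rightarrow> rat) list fvec set list fvec set) fvec set) rep" where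
  "Ind_ctypes Cs = (let ns = map ctype_deg Cs in
     Ind (sum_list ns) (young ns) (outer_tensor ns (map ctype_rep Cs)))"

text \<open>The indices of the allowed high insertions. Positions in \<open>Cs\<close> are counted from 0, so a set
  \<open>C'\<^sub>j = B\<^sub>2\<close>, which allows \<open>[\<iota>\<^bsub>j-1\<^esub>]\<close>, contributes its own position.\<close>
definition insertion_indices :: "ctype list \<Rightarrow> nat list" where
  "insertion_indices Cs = filter (\<lambda>i. Cs ! i = TypeB) [0..<length Cs] @ [length Cs]"

end

theory Submission
  imports Defs
begin

text \<open>The proof exhibits an explicit basis of the submodule and reads both isomorphisms off
  from it.

  A critical symbol splits uniquely into \<^emph>\<open>letters\<close> followed by a decreasing
  run of singletons. A letter \<open>(D,u,v)\<close> stands for the decreasing run of the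
  singletons in \<open>D\<close> together with the two-element block \<open>u v\<close> that ends
  it; for \<open>v < u\<close> the last singleton \<open>Min D\<close> belongs to a barrier
  \<open>a|c b\<close>. The class of the symbol is the concatenation product of the
  one-dimensional classes of its letters and of the class \<open>sing_class D\<close> of the
  trailing singletons. That these \<^emph>\<open>words\<close> form a basis of the homology
  (Alpert's theorem) is proved here by a matching of the non-critical cells: splitting the first
  bad block, or merging the first bad pair of singletons, pairs them up, and for a suitable order
  on symbols the boundary of the larger cell of a pair has the smaller one as its leading term,
  while the cycle of a critical symbol has that symbol as its leading term. So cells, boundaries
  and cycles form a triangular basis of the chains (\<open>word_class_coeffs_zero\<close>,
  \<open>H_span_word_class\<close>).

  Let an admissible family \<open>A'\<close> be given. The letters with decreasing pair on a fixed
  set of \<open>m + 2\<close> labels are as many as the elements of \<open>A' (m + 2) m\<close>,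
  so a bijection replaces the class of such a letter by the properly ordered injected class of an
  element of the family. Admissibility says that the new classes, together with those of the
  letters with increasing pair and padded by singletons on the right, still span the first
  homology; an induction on the number of letters then shows that the words in the new classes
  span, and since there are as many of them as before, they are again a basis
  (\<open>adm_word_class_basis\<close>).

  High insertions combine to maps \<open>insert_sing P\<close> which put the set \<open>P
  i\<close> of new singletons after the \<open>i\<close>-th barrier. Singletons commute up to
  homology, so this is compatible with concatenation of arbitrary one-dimensional classes
  (\<open>insert_sing_spaced\<close>), and relabeling followed by insertion is an
  \<open>FI\<^sub>d\<close>-module structure on homology whose generated submodules are spanned by
  the images under all morphisms (\<open>generated_FI_span\<close>).

  Now apply an order-preserving injection with a coloring to a shuffle of a concatenation product
  of elements of the sets \<open>A' (m + 2) m\<close> and \<open>{z(1 2)}\<close>. The new labels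
  can only appear directly before a factor \<open>z(1 2)\<close> or at the very end. A factor from
  \<open>A'\<close> therefore remains one new letter, a factor \<open>z(u v)\<close> absorbs the
  singletons inserted before it and becomes the letter \<open>(P,u,v)\<close>, and the rest
  becomes the trailing run. So the result is a basis word, and injection, coloring, shuffle and
  factors can be recovered from it (\<open>K_word\<close>, \<open>word_inj\<close>). This
  independence says exactly that the obvious surjections from the tensor product, the induced
  representation and \<open>M(U)\<close>, each given by generators and relations, to the spans in
  homology have no kernel.\<close>

section \<open>Boundaries of short blocks\<close>

text \<open>On a word without repetitions the permutation in the definition of
  \<open>word_sign\<close> is unique.\<close>
lemma word_sign_permute_list:
  assumes "distinct g" "p permutes {..<length g}"
  shows "word_sign g (permute_list p g) = sign p"
proof -
  have "(THE q. q permutes {..<length g} \<and> permute_list q g = permute_list p g) = p"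
  proof (rule the_equality)
    fix q assume q: "q permutes {..<length g} \<and> permute_list q g = permute_list p g"
    show "q = p"
    proof
      fix i
      show "q i = p i"
      proof (cases "i < length g")
        case True
        hence "g ! q i = g ! p i" using q assms(2) permute_list_nth[of q g i] permute_list_nth[of p g i] by simp
        moreover have "q i < length g" "p i < length g"
          using True permutes_in_image[of _ "{..<length g}" i] q assms(2) by simp_all
        ultimately show ?thesis by (simp add: nth_eq_iff_index_eq[OF assms(1)])
      next
        case False
        thus ?thesis using q assms(2) by (simp add: permutes_def)
      qed
    qed
  qed (use assms in simp)
  thus ?thesis by (simp add: word_sign_def)
qed

lemma bd_block_single [simp]: "bd_block [a] = 0"
proof -
  have "{I. I \<subseteq> {..<length [a]} \<and> I \<noteq> {} \<and> I \<noteq> {..<length [a]}} = {}"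
    by (auto simp: lessThan_Suc)
  thus ?thesis unfolding bd_block_def by (simp only: sum.empty)
qed

lemma splits2: "{I. I \<subseteq> {..<length [a,b]} \<and> I \<noteq> {} \<and> I \<noteq> {..<length [a,b]}} = {{0},{1}}"
  by (auto simp: lessThan_Suc)

lemma bd_block_pair:
  assumes "a \<noteq> b"
  shows "bd_block [a, b] = gen [[a],[b]] - gen [[b],[a]]"
proof -
  have 1: "word_sign [a,b] [a,b] = 1"
    using word_sign_permute_list[of "[a,b]" id] assms by simp
  have p: "transpose 0 (Suc 0) permutes {..<length [a,b]}"
    by (rule permutes_swap_id) auto
  have 2: "word_sign [a,b] [b,a] = -1"
    using word_sign_permute_list[OF _ p] assms by (simp add: permute_list_def sign_swap_id)
  have n: "nths [a,b] {0} = [a]" "nths [a,b] (-{0}) = [b]" "nths [a,b] {Suc 0} = [b]"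
    "nths [a,b] (-{Suc 0}) = [a]"
    by (auto simp: nths_Cons)
  show ?thesis unfolding bd_block_def splits2
    using assms by (simp add: n 1 2)
qed

lemma splits3: "{I. I \<subseteq> {..<length [a,b,c]} \<and> I \<noteq> {} \<and> I \<noteq> {..<length [a,b,c]}}
   = {{0},{1},{2},{0,1},{0,2},{1,2}}"
proof -
  have e: "{..<length [a,b,c]} = {0,1,2}" by auto
  show ?thesis unfolding e
  proof (intro equalityI subsetI)
    fix I :: "nat set"
    assume "I \<in> {I. I \<subseteq> {0,1,2} \<and> I \<noteq> {} \<and> I \<noteq> {0,1,2}}"
    hence I: "I \<subseteq> {0,1,2}" "I \<noteq> {}" "I \<noteq> {0,1,2}" by auto
    from I(1) have "I = (if 0 \<in> I then {0} else {}) \<union> (if 1 \<in> I then {1} else {}) \<union> (if 2 \<in> I then {2} else {})"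
      by auto
    thus "I \<in> {{0},{1},{2},{0,1},{0,2},{1,2}}"
      using I(2,3) by (cases "0 \<in> I"; cases "1 \<in> I"; cases "2 \<in> I") (simp_all add: insert_commute)
  next
    fix I :: "nat set"
    assume I: "I \<in> {{0},{1},{2},{0,1},{0,2},{1,2}}"
    have "\<not> (0 \<in> I \<and> 1 \<in> I \<and> 2 \<in> I)" using I by (elim insertE emptyE) simp_all
    hence "I \<noteq> {0,1,2}" by (rule contrapos_nn) simp
    moreover have "I \<subseteq> {0,1,2}" "I \<noteq> {}" using I by (elim insertE emptyE; simp)+
    ultimately show "I \<in> {I. I \<subseteq> {0,1,2} \<and> I \<noteq> {} \<and> I \<noteq> {0,1,2}}" by simp
  qed
qed

lemma bd_321:
  "bd_block [3,2,1] = gen [[3],[2,1]] - gen [[2],[3,1]] + gen [[1],[3,2]]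
    + gen [[3,2],[1]] - gen [[3,1],[2]] + gen [[2,1],[3]]"
proof -
  let ?g = "[3,2,Suc 0]"
  let ?t = "transpose 0 (Suc 0)" and ?s = "transpose (Suc 0) (Suc (Suc 0))"
  have pt: "?t permutes {..<length ?g}" and ps: "?s permutes {..<length ?g}"
    by (rule permutes_swap_id; simp)+
  have sg: "word_sign ?g (permute_list p ?g) = sign p" if "p permutes {..<length ?g}" for p
    using that by (intro word_sign_permute_list) auto
  have st: "sign ?t = -1" "sign ?s = -1" by (simp_all add: sign_swap_id)
  have ft: "permutation ?t" "permutation ?s" by (simp_all add: permutation_swap_id)
  have w: "word_sign ?g [3,2,Suc 0] = 1" "word_sign ?g [2,3,Suc 0] = -1" "word_sign ?g [3,Suc 0,2] = -1"
    "word_sign ?g [Suc 0,3,2] = 1" "word_sign ?g [2,Suc 0,3] = 1"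
    using sg[of id] sg[OF pt] sg[OF ps] sg[OF permutes_compose[OF pt ps]] sg[OF permutes_compose[OF ps pt]]
    by (simp_all add: permute_list_def st sign_compose ft transpose_def)
  have n: "nths ?g {0} = [3]" "nths ?g (-{0}) = [2,Suc 0]" "nths ?g {Suc 0} = [2]" "nths ?g (-{Suc 0}) = [3,Suc 0]"
    "nths ?g {2} = [Suc 0]" "nths ?g (-{2}) = [3,2]" "nths ?g {0,Suc 0} = [3,2]" "nths ?g (-{0,Suc 0}) = [Suc 0]"
    "nths ?g {0,2} = [3,Suc 0]" "nths ?g (-{0,2}) = [2]" "nths ?g {Suc 0,2} = [2,Suc 0]" "nths ?g (-{Suc 0,2}) = [3]"
    by (simp_all add: nths_Cons numeral_2_eq_2)
  show ?thesis unfolding bd_block_def splits3 One_nat_def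
    by (simp add: n w doubleton_eq_iff)
qed

lemma cprod_Nil_left [simp]: "cprod (gen []) x = x"
  by (induction x rule: fvec_induct_all) (simp_all add: cprod_lin, simp add: scat_def)

lemma cprod_Nil_right [simp]: "cprod x (gen []) = x"
  by (induction x rule: fvec_induct_all) (simp_all add: cprod_lin, simp add: scat_def)

lemma zpiece_barrier3:
  assumes "a < b" "b < c"
  shows "zpiece [[a],[c,b]] = gen [[c],[b,a]] - gen [[b],[c,a]] + gen [[a],[c,b]]
    + gen [[c,b],[a]] - gen [[c,a],[b]] + gen [[b,a],[c]]"
proof -
  define f where "f = id(1 := a, 2 := b, 3 := c)"
  have f: "f 1 = a" "f (Suc 0) = a" "f 2 = b" "f 3 = c" by (simp_all add: f_def)
  have i: "inj_on f {1,2,3}" using assms by (auto simp: inj_on_def f)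
  have *: "rsymb f e = gen (map (map f) e)" if "labels e \<subseteq> {1,2,3}" for e
    using inj_on_subset[OF i that] by (simp only: rsymb_def if_True)
  have "zpiece [[a],[c,b]] = crelabel f (bd_block [3,2,1])"
    by (simp add: f_def)
  also have "\<dots> = gen [[c],[b,a]] - gen [[b],[c,a]] + gen [[a],[c,b]]
    + gen [[c,b],[a]] - gen [[c,a],[b]] + gen [[b,a],[c]]"
    unfolding bd_321 crelabel_diff crelabel_add crelabel_gen by (simp add: * f)
  finally show ?thesis .
qed

lemma bd_symb_singles [simp]: "bd_symb (map (\<lambda>i. [i]) xs) = 0"
  by (induction xs) auto

lemma bd_zpiece_barrier3:
  assumes "a < b" "b < c"
  shows "bd (zpiece [[a],[c,b]]) = 0"
  using assms unfolding zpiece_barrier3[OF assms]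
  by (simp add: bd_diff bd_add bd_block_pair cprod_lin scat_def)

lemma bd_zpiece_pair: "a \<noteq> b \<Longrightarrow> bd (zpiece [[a,b]]) = 0"
  by (simp add: bd_add bd_block_pair)

section \<open>A matching of the non-critical symbols\<close>

text \<open>The only information about the preceding blocks on which the conditions on the next
  block depend: the entry of the preceding block if that is a singleton.\<close>
definition single_of :: "nat list \<Rightarrow> nat option" where
  "single_of g = (case g of [a] \<Rightarrow> Some a | _ \<Rightarrow> None)"

text \<open>The condition of a critical symbol on a block in the context of its predecessor, so
  that critical symbols can be treated by recursion from the left.\<close>
definition ok_block :: "nat option \<Rightarrow> nat list \<Rightarrow> bool" where
  "ok_block ctx g = (case g of [a] \<Rightarrow> (\<forall>p. ctx = Some p \<longrightarrow> a < p)
     | [u,v] \<Rightarrow> u < v \<or> (v < u \<and> (\<exists>p. ctx = Some p \<and> p < v)) | _ \<Rightarrow> False)"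

lemma single_of_simps [simp]: "single_of [] = None" "single_of [a] = Some a" "single_of [u,v] = None"
  by (simp_all add: single_of_def)

lemma ok_block_simps [simp]: "ok_block ctx [a] \<longleftrightarrow> (\<forall>p. ctx = Some p \<longrightarrow> a < p)"
  "ok_block ctx [u,v] \<longleftrightarrow> u < v \<or> (v < u \<and> (\<exists>p. ctx = Some p \<and> p < v))" "\<not> ok_block ctx []"
  by (simp_all add: ok_block_def)

fun good :: "nat option \<Rightarrow> symb \<Rightarrow> bool" where
  "good ctx [] = True"
| "good ctx (g # e) = (ok_block ctx g \<and> good (single_of g) e)"

definition end_ctx :: "nat option \<Rightarrow> symb \<Rightarrow> nat option" where
  "end_ctx ctx e = (if e = [] then ctx else single_of (last e))"

lemma end_ctx_simps [simp]: "end_ctx ctx [] = ctx" "end_ctx ctx (g # e) = end_ctx (single_of g) e"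
  by (simp_all add: end_ctx_def)

lemma end_ctx_append [simp]: "end_ctx ctx (P @ Q) = end_ctx (end_ctx ctx P) Q"
  by (induction P arbitrary: ctx) auto

lemma good_append [simp]: "good ctx (P @ Q) \<longleftrightarrow> good ctx P \<and> good (end_ctx ctx P) Q"
  by (induction P arbitrary: ctx) auto

lemma longest_good_prefix:
  assumes "\<not> good ctx e"
  obtains P g R where "e = P @ g # R" "good ctx P" "\<not> ok_block (end_ctx ctx P) g"
  using assms
proof (induction e arbitrary: ctx thesis)
  case (Cons g e)
  show ?case
  proof (cases "ok_block ctx g")
    case True
    with Cons.prems have "\<not> good (single_of g) e" by simp
    then obtain P h R where "e = P @ h # R" "good (single_of g) P" "\<not> ok_block (end_ctx (single_of g) P) h"
      using Cons.IH by blast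
    with True show ?thesis by (intro Cons.prems(1)[of "g # P" h R]) auto
  next
    case False
    show ?thesis by (rule Cons.prems(1)[of "[]" g e]) (use False in auto)
  qed
qed simp

text \<open>The position of the first bad block makes the matching well defined.\<close>
lemma longest_good_prefix_unique:
  assumes "P @ g # R = P' @ g' # R'" "good ctx P" "\<not> ok_block (end_ctx ctx P) g"
    "good ctx P'" "\<not> ok_block (end_ctx ctx P') g'"
  shows "P = P' \<and> g = g' \<and> R = R'"
  using assms
proof (induction P arbitrary: P' ctx)
  case Nil
  then show ?case by (cases P') auto
next
  case (Cons h P)
  then show ?case by (cases P') auto
qed

text \<open>The first bad block of a non-critical symbol is either a decreasing pair that is no
  follower or a singleton larger than the singleton before it; passing between \<open>b a\<close>
  and \<open>a|b\<close> exchanges the two kinds. The good prefix extends over \<open>[a]\<close>,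
  so that \<open>[b]\<close> is the first bad block of the second symbol.\<close>
definition matched :: "symb \<Rightarrow> symb \<Rightarrow> bool" where
  "matched e' e \<longleftrightarrow> (\<exists>P a b R. e' = P @ [b,a] # R \<and> e = P @ [a] # [b] # R \<and> a < b \<and>
     good None (P @ [[a]]))"

lemma matchedE:
  assumes "matched e' e"
  obtains P a b R where "e' = P @ [b,a] # R" "e = P @ [a] # [b] # R" "a < b" "good None P"
    "\<not> ok_block (end_ctx None P) [b,a]" "good None (P @ [[a]])" "\<not> ok_block (end_ctx None (P @ [[a]])) [b]"
proof -
  obtain P a b R where *: "e' = P @ [b,a] # R" "e = P @ [a] # [b] # R" "a < b" "good None (P @ [[a]])"
    using assms by (auto simp: matched_def)
  show ?thesis by (rule that[OF *(1-3)]) (use * in auto)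
qed

lemma matched_fun: "matched e' e \<Longrightarrow> matched e' f \<Longrightarrow> e = f"
proof -
  assume "matched e' e" "matched e' f"
  from matchedE[OF this(1)] obtain P a b R where 1: "e' = P @ [b,a] # R" "e = P @ [a] # [b] # R" "good None P"
    "\<not> ok_block (end_ctx None P) [b,a]" by metis
  from matchedE[OF \<open>matched e' f\<close>] obtain Q c d T where 2: "e' = Q @ [d,c] # T" "f = Q @ [c] # [d] # T" "good None Q"
    "\<not> ok_block (end_ctx None Q) [d,c]" by metis
  from longest_good_prefix_unique[OF 1(1)[unfolded 2(1), symmetric] 1(3,4) 2(3,4)] show "e = f"
    using 1 2 by simp
qed

lemma matched_inj: "matched e e' \<Longrightarrow> matched f e' \<Longrightarrow> e = f"
proof -
  assume "matched e e'" "matched f e'"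
  from matchedE[OF this(1)] obtain P a b R where 1: "e = P @ [b,a] # R" "e' = P @ [a] # [b] # R"
    "good None (P @ [[a]])" "\<not> ok_block (end_ctx None (P @ [[a]])) [b]" by metis
  from matchedE[OF \<open>matched f e'\<close>] obtain Q c d T where 2: "f = Q @ [d,c] # T" "e' = Q @ [c] # [d] # T"
    "good None (Q @ [[c]])" "\<not> ok_block (end_ctx None (Q @ [[c]])) [d]" by metis
  have "(P @ [[a]]) @ [b] # R = (Q @ [[c]]) @ [d] # T" using 1(2) 2(2) by simp
  from longest_good_prefix_unique[OF this 1(3,4) 2(3,4)] show "e = f"
    using 1 2 by simp
qed

lemma matched_not_good: "matched e' e \<Longrightarrow> \<not> good None e' \<and> \<not> good None e"
  by (elim matchedE) auto

lemma matched_disjoint: "matched e' e \<Longrightarrow> \<not> matched e f"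
proof
  assume "matched e' e" "matched e f"
  from matchedE[OF this(1)] obtain P a b R where 1: "e = P @ [a] # [b] # R"
    "good None (P @ [[a]])" "\<not> ok_block (end_ctx None (P @ [[a]])) [b]" by metis
  from matchedE[OF \<open>matched e f\<close>] obtain Q c d T where 2: "e = Q @ [d,c] # T" "good None Q"
    "\<not> ok_block (end_ctx None Q) [d,c]" by metis
  have "(P @ [[a]]) @ [b] # R = Q @ [d,c] # T" using 1 2 by simp
  from longest_good_prefix_unique[OF this 1(2,3) 2(2,3)] show False by simp
qed

text \<open>With \<open>matched_inj\<close>, \<open>matched_fun\<close> and
  \<open>matched_disjoint\<close>, every symbol is critical, the target or the source of the
  matching, and exactly one of these.\<close>
lemma matched_cases:
  assumes "e \<in> valid2"
  shows "good None e \<or> (\<exists>e'. matched e' e) \<or> (\<exists>f. matched e f)"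
proof (cases "good None e")
  case False
  then obtain P g R where *: "e = P @ g # R" "good None P" "\<not> ok_block (end_ctx None P) g"
    by (rule longest_good_prefix)
  have g: "g \<noteq> []" "length g \<le> 2" and d: "distinct (concat e)"
    using assms * by (auto simp: valid2_def valid_def)
  show ?thesis
  proof (cases "\<exists>b. g = [b]")
    case True
    then obtain b where b: "g = [b]" by blast
    with * obtain a where a: "end_ctx None P = Some a" "\<not> b < a" by auto
    hence "P \<noteq> []" by auto
    then obtain Q h where P: "P = Q @ [h]" by (metis append_butlast_last_id)
    with a have "single_of h = Some a" by simp
    hence h: "h = [a]" by (auto simp: single_of_def split: list.splits)
    have "a \<noteq> b" using d unfolding *(1) P h b by auto
    hence "matched (Q @ [b,a] # R) e" unfolding matched_def
      using * a P h b by (intro exI[of _ Q] exI[of _ a] exI[of _ b] exI[of _ R]) auto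
    thus ?thesis by blast
  next
    case False
    with g obtain b a where ba: "g = [b,a]"
      by (cases g; cases "tl g") auto
    have "a \<noteq> b" using d unfolding *(1) ba by auto
    with * ba have "a < b" "\<forall>p. end_ctx None P = Some p \<longrightarrow> \<not> p < a" by auto
    moreover have "end_ctx None P \<noteq> Some a"
    proof
      assume e: "end_ctx None P = Some a"
      hence "P \<noteq> []" by auto
      then obtain Q h where P: "P = Q @ [h]" by (metis append_butlast_last_id)
      with e have "single_of h = Some a" by simp
      hence "h = [a]" by (auto simp: single_of_def split: list.splits)
      thus False using d unfolding *(1) P ba by auto
    qed
    ultimately have "matched e (P @ [a] # [b] # R)" unfolding matched_def
      using * ba by (intro exI[of _ P] exI[of _ a] exI[of _ b] exI[of _ R]) (auto simp: not_less le_less)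
    thus ?thesis by blast
  qed
qed simp

section \<open>The order on symbols\<close>

text \<open>Leading terms are taken with respect to the lexicographic order given by these ranks.
  An increasing pair beats all singletons, which makes a good symbol larger than the terms of the
  boundary of its blocks; a bad decreasing pair is lowest, so that splitting one increases the
  symbol.\<close>
definition block_rank :: "nat option \<Rightarrow> nat list \<Rightarrow> nat" where
  "block_rank ctx g = (case g of [a] \<Rightarrow> (if \<forall>p. ctx = Some p \<longrightarrow> a < p then 3 else 1)
     | [u,v] \<Rightarrow> if u < v then 4 else if \<exists>p. ctx = Some p \<and> p < v then 2 else 0 | _ \<Rightarrow> 0)"

lemma block_rank_simps [simp]: "block_rank ctx [a] = (if \<forall>p. ctx = Some p \<longrightarrow> a < p then 3 else 1)"
  "block_rank ctx [u,v] = (if u < v then 4 else if \<exists>p. ctx = Some p \<and> p < v then 2 else 0)"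
  by (simp_all add: block_rank_def)

text \<open>Among blocks of one rank the smaller first entry wins, so that \<open>a|b\<close>
  leads the boundary of \<open>b a\<close> for \<open>a < b\<close>.\<close>
definition block_less :: "nat option \<Rightarrow> nat list \<Rightarrow> nat list \<Rightarrow> bool" where
  "block_less ctx g h \<longleftrightarrow> block_rank ctx g < block_rank ctx h \<or> (block_rank ctx g = block_rank ctx h \<and> hd h < hd g)"

fun symb_less :: "nat option \<Rightarrow> symb \<Rightarrow> symb \<Rightarrow> bool" where
  "symb_less ctx (g # e) (h # f) \<longleftrightarrow> block_less ctx g h \<or> (g = h \<and> symb_less (single_of g) e f)"
| "symb_less ctx _ _ \<longleftrightarrow> False"

lemma symb_less_irrefl: "\<not> symb_less ctx e e"
  by (induction e arbitrary: ctx) (auto simp: block_less_def)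

lemma symb_less_trans: "symb_less ctx e f \<Longrightarrow> symb_less ctx f g \<Longrightarrow> symb_less ctx e g"
proof (induction ctx e f arbitrary: g rule: symb_less.induct)
  case (1 ctx b e c f)
  then show ?case by (cases g) (auto simp: block_less_def)
qed auto

lemma symb_less_append_left [simp]: "symb_less ctx (P @ e) (P @ f) \<longleftrightarrow> symb_less (end_ctx ctx P) e f"
  by (induction P arbitrary: ctx) (auto simp: block_less_def)

text \<open>Comparisons that are decided within \<open>y\<close> and \<open>x\<close>, and hence
  survive concatenation.\<close>
definition below :: "nat option \<Rightarrow> symb \<Rightarrow> symb set" where
  "below ctx x = {y. \<forall>U V. symb_less ctx (y @ U) (x @ V)}"

lemma below_ConsI: "block_less ctx g h \<Longrightarrow> g # y \<in> below ctx (h # x)"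
  by (simp add: below_def)

lemma below_prefix: "y \<in> below (end_ctx ctx P) x \<Longrightarrow> P @ y \<in> below ctx (P @ x)"
  by (simp add: below_def)

text \<open>A block of a good symbol with nonzero boundary is a pair; either of its entries, as a
  singleton, has smaller rank than the pair in the same context.\<close>
lemma keys_bd_good:
  assumes "good ctx P" "distinct (concat P)"
  shows "Poly_Mapping.keys (bd_symb P) \<subseteq> below ctx P"
  using assms
proof (induction P arbitrary: ctx)
  case (Cons g P)
  have 1: "Poly_Mapping.keys (cprod (bd_block g) (gen P)) \<subseteq> below ctx (g # P)"
  proof (cases "\<exists>a. g = [a]")
    case False
    with Cons.prems obtain u v where g: "g = [u,v]"
      by (cases g; cases "tl g"; cases "tl (tl g)") (auto simp: ok_block_def)
    have uv: "u \<noteq> v" using Cons.prems g by auto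
    have b: "block_less ctx [u] [u,v]" "block_less ctx [v] [u,v]"
      using Cons.prems g by (auto simp: block_less_def)
    show ?thesis unfolding g bd_block_pair[OF uv]
    proof (rule keys_cprod[where X = "{[[u],[v]],[[v],[u]]}" and Y = "{P}"])
      show "Poly_Mapping.keys (gen [[u],[v]] - gen [[v],[u]]) \<subseteq> {[[u],[v]],[[v],[u]]}"
        using Poly_Mapping.keys_diff[of "gen [[u],[v]]" "gen [[v],[u]]"] by auto
    qed (use b in \<open>auto intro!: below_ConsI\<close>)
  qed auto
  have 2: "Poly_Mapping.keys (cprod (gen [g]) (bd_symb P)) \<subseteq> below ctx (g # P)"
    by (rule keys_cprod[where X = "{[g]}" and Y = "below (single_of g) P"])
       (use Cons in \<open>auto simp: below_prefix[of _ ctx "[g]", simplified]\<close>)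
  show ?case using 1 2 Poly_Mapping.keys_diff[of "cprod (bd_block g) (gen P)" "cprod (gen [g]) (bd_symb P)"]
    by auto
qed simp

lemma lookup_keys_irrefl: "Poly_Mapping.keys c \<subseteq> {y. symb_less ctx y e} \<Longrightarrow> Poly_Mapping.lookup c e = 0"
  using symb_less_irrefl[of ctx e] by (auto simp: in_keys_iff)

text \<open>The terms where an earlier or later block is split are smaller by
  \<open>keys_bd_good\<close> or because they keep the low-ranked block \<open>b a\<close>; of the
  two terms from that block, \<open>a|b\<close> is the larger one.\<close>
lemma bd_matched:
  assumes "matched e' e" "e' \<in> valid"
  obtains r q where "bd (gen e') = qscale q (gen e) + r" "q \<noteq> 0" "Poly_Mapping.keys r \<subseteq> {y. symb_less None y e}"
proof -
  from assms(1) obtain P a b R where *: "e' = P @ [b,a] # R" "e = P @ [a] # [b] # R" "a < b" "good None P"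
    "good None (P @ [[a]])" by (rule matchedE)
  have d: "distinct (concat (P @ ([b,a] # R)))" "distinct (concat P)"
    using assms(2) * by (auto simp: valid_def)
  have disj: "labels P \<inter> labels R = {}" "a \<notin> labels P" "b \<notin> labels P" "a \<notin> labels R" "b \<notin> labels R"
    using d by auto
  let ?s = "(-1) ^ length P :: rat"
  let ?A = "cprod (bd_symb P) (gen ([b,a] # R))"
  let ?B = "gen (P @ [b] # [a] # R)"
  let ?C = "cprod (gen P) (cprod (gen [[b,a]]) (bd_symb R))"
  have "bd (gen e') = ?A + qscale ?s (cprod (gen P) (bd_symb ([b,a] # R)))"
    using bd_symb_append[OF d(1)] by (simp add: *)
  also have "bd_symb ([b,a] # R) = gen ([b] # [a] # R) - gen ([a] # [b] # R) - cprod (gen [[b,a]]) (bd_symb R)"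
    using *(3) disj by (simp add: bd_block_pair cprod_lin scat_def)
  also have "cprod (gen P) \<dots> = ?B - gen e - ?C"
    using disj * by (simp add: cprod_lin scat_def)
  finally have eq: "bd (gen e') = qscale (- ?s) (gen e) + (?A + qscale ?s ?B - qscale ?s ?C)"
    by (simp add: fvec.scale_right_diff_distrib fvec.scale_minus_left)
  have kA: "Poly_Mapping.keys ?A \<subseteq> {y. symb_less None y e}"
    by (rule keys_cprod[OF keys_bd_good[OF *(4) d(2)], of _ "{[b,a] # R}"])
       (auto simp: * below_def)
  have "symb_less None (P @ [b] # [a] # R) e" using * by (auto simp: block_less_def)
  hence kB: "Poly_Mapping.keys (qscale ?s ?B) \<subseteq> {y. symb_less None y e}"
    by (auto simp: in_keys_iff lookup_single when_def split: if_splits)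
  have okk: "block_less (end_ctx None P) [b,a] [a]" using *(3,5) by (auto simp: block_less_def)
  have "Poly_Mapping.keys ?C \<subseteq> {y. symb_less None y e}"
    by (rule keys_cprod[of _ "{P}" _ "{y. \<exists>z. y = [b,a] # z}"], simp,
        rule keys_cprod[of _ "{[[b,a]]}" _ UNIV]) (use okk in \<open>auto simp: *\<close>)
  hence kC: "Poly_Mapping.keys (qscale ?s ?C) \<subseteq> {y. symb_less None y e}"
    by (auto simp: in_keys_iff)
  show ?thesis
  proof (rule that[OF eq])
    show "Poly_Mapping.keys (?A + qscale ?s ?B - qscale ?s ?C) \<subseteq> {y. symb_less None y e}"
      using kA kB kC Poly_Mapping.keys_add[of ?A "qscale ?s ?B"]
        Poly_Mapping.keys_diff[of "?A + qscale ?s ?B" "qscale ?s ?C"] by blast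
  qed simp
qed

section \<open>Unitriangular families\<close>

lemma strict_order_maximal:
  assumes "finite A" "A \<noteq> {}" "\<And>x. \<not> r x x" "\<And>x y z. r x y \<Longrightarrow> r y z \<Longrightarrow> r x z"
  shows "\<exists>m\<in>A. \<forall>x\<in>A. \<not> r m x"
  using assms(1,2)
proof (induction A rule: finite_ne_induct)
  case (insert a F)
  then obtain m where m: "m \<in> F" "\<forall>x\<in>F. \<not> r m x" by blast
  show ?case
  proof (cases "r m a")
    case True
    have "\<not> r a x" if "x \<in> insert a F" for x
      using that m True assms(3)[of a] assms(4)[of m a x] by auto
    thus ?thesis by blast
  qed (use m in auto)
qed (use assms(3) in auto)

text \<open>A largest element among those with nonzero coefficient cannot be cancelled.\<close>
lemma triangular_coeffs_zero:
  fixes v :: "'a \<Rightarrow> 'a fvec"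
  assumes r: "\<And>x. \<not> r x x" "\<And>x y z. r x y \<Longrightarrow> r y z \<Longrightarrow> r x z"
    and v: "\<And>x. x \<in> A \<Longrightarrow> Poly_Mapping.lookup (v x) x \<noteq> 0"
      "\<And>x. x \<in> A \<Longrightarrow> Poly_Mapping.keys (v x) \<subseteq> insert x {y. r y x}"
    and "finite A" "(\<Sum>x\<in>A. qscale (c x) (v x)) = 0" "x \<in> A"
  shows "c x = 0"
proof (rule ccontr)
  assume "c x \<noteq> 0"
  with assms have "finite {x\<in>A. c x \<noteq> 0}" "{x\<in>A. c x \<noteq> 0} \<noteq> {}" by auto
  from strict_order_maximal[where r = r, OF this r(1)] r(2) obtain m where m: "m \<in> A" "c m \<noteq> 0"
    "\<forall>x\<in>A. c x \<noteq> 0 \<longrightarrow> \<not> r m x" by auto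
  have z: "c x * Poly_Mapping.lookup (v x) m = 0" if "x \<in> A - {m}" for x
  proof (cases "c x = 0")
    case False
    hence "\<not> r m x" using m that by auto
    hence "m \<notin> Poly_Mapping.keys (v x)" using v(2)[of x] that by auto
    thus ?thesis by (simp add: in_keys_iff)
  qed simp
  have "0 = Poly_Mapping.lookup (\<Sum>x\<in>A. qscale (c x) (v x)) m" using assms by simp
  also have "\<dots> = (\<Sum>x\<in>A. c x * Poly_Mapping.lookup (v x) m)" by (simp add: lookup_sum)
  also have "\<dots> = c m * Poly_Mapping.lookup (v m) m"
    using m \<open>finite A\<close> by (subst sum.remove[of A m]) (auto intro!: sum.neutral z)
  finally show False using m v(1) by simp
qed

lemma triangular_span:
  fixes v :: "'a \<Rightarrow> 'a fvec"
  assumes r: "\<And>x. \<not> r x x" "\<And>x y z. r x y \<Longrightarrow> r y z \<Longrightarrow> r x z"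
    and v: "\<And>x. x \<in> A \<Longrightarrow> Poly_Mapping.lookup (v x) x \<noteq> 0"
      "\<And>x. x \<in> A \<Longrightarrow> Poly_Mapping.keys (v x) \<subseteq> A \<inter> insert x {y. r y x}"
    and "finite A" "Poly_Mapping.keys c \<subseteq> A"
  shows "c \<in> fvec.span (v ` A)"
proof -
  have g: "gen x \<in> fvec.span (v ` A)" if "x \<in> A" for x
    using that
  proof (induction "card {y \<in> A. r y x}" arbitrary: x rule: less_induct)
    case less
    define q where "q = Poly_Mapping.lookup (v x) x"
    define w where "w = v x - qscale q (gen x)"
    have "y \<in> A \<and> r y x" if "y \<in> Poly_Mapping.keys w" for y
    proof -
      have "y \<noteq> x" using that by (auto simp: w_def q_def in_keys_iff lookup_minus)
      hence "y \<in> Poly_Mapping.keys (v x)" using that by (auto simp: w_def in_keys_iff lookup_minus lookup_single)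
      with v(2)[OF less.prems] \<open>y \<noteq> x\<close> show ?thesis by auto
    qed
    hence kw: "Poly_Mapping.keys w \<subseteq> {y \<in> A. r y x}" by auto
    have "w \<in> fvec.span (v ` A)" using kw
    proof (induction w rule: fvec_induct)
      case (gen y)
      have "{z \<in> A. r z y} \<subset> {z \<in> A. r z x}"
        using gen r by blast
      hence "card {z \<in> A. r z y} < card {z \<in> A. r z x}"
        using \<open>finite A\<close> by (intro psubset_card_mono) auto
      thus ?case using less.hyps gen by blast
    qed (auto intro: fvec.span_add fvec.span_scale fvec.span_zero)
    hence "qscale (1/q) (v x - w) \<in> fvec.span (v ` A)"
      using less.prems by (intro fvec.span_scale fvec.span_diff) (auto intro: fvec.span_base)
    moreover have "qscale (1/q) (v x - w) = gen x"
      using v(1)[OF less.prems] by (simp add: w_def q_def)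
    ultimately show ?case by simp
  qed
  show ?thesis using assms(6)
    by (induction c rule: fvec_induct) (auto intro: g fvec.span_add fvec.span_scale fvec.span_zero)
qed

section \<open>Cycles and their classes\<close>

definition cyc :: "chain set" where
  "cyc = {c \<in> C2. bd c = 0}"

lemma cyc_zero [simp]: "0 \<in> cyc"
  and cyc_add: "c \<in> cyc \<Longrightarrow> d \<in> cyc \<Longrightarrow> c + d \<in> cyc"
  and cyc_scale: "c \<in> cyc \<Longrightarrow> qscale q c \<in> cyc"
  by (auto simp: cyc_def C2_add C2_scale bd_add bd_scale)

lemma cyc_hrel: "c \<in> cyc \<longleftrightarrow> hrel c c"
  by (simp add: cyc_def hrel_refl)

lemma hclass_add: "c \<in> cyc \<Longrightarrow> d \<in> cyc \<Longrightarrow> hclass (c + d) = hclass c + hclass d"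
  by (simp add: plus_hmlg.abs_eq cyc_hrel)

lemma hclass_scale: "c \<in> cyc \<Longrightarrow> hclass (qscale q c) = hscale q (hclass c)"
  by (simp add: hscale.abs_eq cyc_hrel)

lemma hclass_zero [simp]: "hclass 0 = 0"
  by (simp add: zero_hmlg.abs_eq)

lemma hclass_eq_iff: "c \<in> cyc \<Longrightarrow> d \<in> cyc \<Longrightarrow> hclass c = hclass d \<longleftrightarrow> c - d \<in> bd ` C2"
  using Quotient_rel[OF Quotient_hmlg, of c d] by (auto simp: cyc_hrel) (auto simp: hrel_def)

lemma hclass_sum:
  "(\<And>i. i \<in> A \<Longrightarrow> c i \<in> cyc) \<Longrightarrow>
   (\<Sum>i\<in>A. qscale (q i) (c i)) \<in> cyc \<and>
   hclass (\<Sum>i\<in>A. qscale (q i) (c i)) = (\<Sum>i\<in>A. hscale (q i) (hclass (c i)))"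
  by (induction A rule: infinite_finite_induct) (auto simp: cyc_add cyc_scale hclass_add hclass_scale)

lemma hclass_cprod: "c \<in> cyc \<Longrightarrow> d \<in> cyc \<Longrightarrow> hclass (cprod c d) = hprod (hclass c) (hclass d)"
  by (simp add: hprod.abs_eq cyc_hrel)

lemma valid2_valid: "e \<in> valid2 \<Longrightarrow> e \<in> valid"
  by (simp add: valid2_def)

lemma C2_valid: "c \<in> C2 \<Longrightarrow> Poly_Mapping.keys c \<subseteq> valid"
  by (auto simp: C2_def valid2_def)

lemma cyc_cprod: "c \<in> cyc \<Longrightarrow> d \<in> cyc \<Longrightarrow> cprod c d \<in> cyc"
  by (simp add: cyc_def C2_cprod bd_cprod C2_valid)

lemma C2_bd: "c \<in> C2 \<Longrightarrow> bd c \<in> C2"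
  unfolding C2_def mem_Collect_eq bd_def
  by (erule keys_linext) (use keys_bd_symb in \<open>auto simp: same_labels_def valid2_def\<close>)

lemma length_2_cases: "length g \<le> 2 \<Longrightarrow> g \<noteq> [] \<Longrightarrow> (\<exists>a. g = [a]) \<or> (\<exists>a b. g = [a,b])"
  by (cases g; cases "tl g") auto

text \<open>For blocks with at most two elements, \<open>\<partial>\<^sup>2 = 0\<close> follows
  from the Leibniz rule, as the boundary of a block consists of singletons.\<close>
lemma bd_bd_symb: "e \<in> valid2 \<Longrightarrow> bd (bd_symb e) = 0"
proof (induction e)
  case (Cons g e)
  have e: "e \<in> valid2" and g: "length g \<le> 2" "g \<noteq> []" "distinct g"
    using Cons.prems by (auto simp: valid2_def valid_def)
  have V: "Poly_Mapping.keys (bd_block g) \<subseteq> valid" "Poly_Mapping.keys (bd_symb e) \<subseteq> valid"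
    "Poly_Mapping.keys (gen [g]) \<subseteq> valid" "Poly_Mapping.keys (gen e) \<subseteq> valid"
    using keys_bd_block[of g] keys_bd_symb[OF valid2_valid[OF e]] e g
    by (auto simp: same_labels_def valid_def valid2_def)
  have "bd (bd_block g) = 0 \<and> twist (bd_block g) = bd_block g"
    using length_2_cases[OF g(1,2)] g(3) by (auto simp: bd_block_pair bd_diff twist_lin) (simp_all add: twist_def)
  moreover have "twist (gen [g]) = - gen [g]"
    by (simp add: twist_def fvec.scale_minus_left)
  ultimately show ?case
    using V Cons.IH[OF e] by (simp add: bd_diff bd_cprod)
qed simp

lemma bd_bd: "c \<in> C2 \<Longrightarrow> bd (bd c) = 0"
  unfolding C2_def mem_Collect_eq
  by (induction c rule: fvec_induct) (simp_all add: bd_bd_symb bd_add bd_scale)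

lemma boundary_cyc: "c \<in> C2 \<Longrightarrow> bd c \<in> cyc"
  by (simp add: cyc_def C2_bd bd_bd)

lemma hclass_boundary: "c \<in> C2 \<Longrightarrow> hclass (bd c) = 0"
  using hclass_eq_iff[OF boundary_cyc cyc_zero, of c] by simp

section \<open>Letters and words\<close>

type_synonym letter = "nat set \<times> nat \<times> nat"

text \<open>A letter \<open>(D,u,v)\<close> encodes a decreasing run of singletons followed by the
  block \<open>u v\<close>. If the pair decreases, it has to follow the last singleton of the run,
  that is \<open>Min D\<close>.\<close>
definition letter_ok :: "letter \<Rightarrow> bool" where
  "letter_ok = (\<lambda>(D,u,v). finite D \<and> u \<notin> D \<and> v \<notin> D \<and> (u < v \<or> (v < u \<and> D \<noteq> {} \<and> Min D < v)))"

definition letter_labels :: "letter \<Rightarrow> nat set" where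
  "letter_labels = (\<lambda>(D,u,v). insert u (insert v D))"

definition singles :: "nat set \<Rightarrow> symb" where
  "singles D = map (\<lambda>i. [i]) (rev (sorted_list_of_set D))"

definition letter_symb :: "letter \<Rightarrow> symb" where
  "letter_symb = (\<lambda>(D,u,v). singles D @ [[u,v]])"

text \<open>For a decreasing pair the last singleton of the run is part of the barrier.\<close>
definition letter_cycle :: "letter \<Rightarrow> chain" where
  "letter_cycle = (\<lambda>(D,u,v). if u < v then cprod (gen (singles D)) (zpiece [[u,v]])
     else cprod (gen (singles (D - {Min D}))) (zpiece [[Min D],[u,v]]))"

text \<open>Words exhaust the labels: \<open>D\<close> is the set of the trailing singletons.\<close>
fun word_on :: "nat set \<Rightarrow> letter list \<Rightarrow> nat set \<Rightarrow> bool" where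
  "word_on S [] D \<longleftrightarrow> finite S \<and> D = S"
| "word_on S (l # ls) D \<longleftrightarrow> finite S \<and> letter_ok l \<and> letter_labels l \<subseteq> S \<and> word_on (S - letter_labels l) ls D"

definition word_symb :: "letter list \<Rightarrow> nat set \<Rightarrow> symb" where
  "word_symb ls D = concat (map letter_symb ls) @ singles D"

definition word_cycle :: "letter list \<Rightarrow> nat set \<Rightarrow> chain" where
  "word_cycle ls D = foldr cprod (map letter_cycle ls) (gen (singles D))"

definition letter_class :: "letter \<Rightarrow> hmlg" where
  "letter_class l = hclass (letter_cycle l)"

definition sing_class :: "nat set \<Rightarrow> hmlg" where
  "sing_class D = hclass (gen (singles D))"

definition word_class :: "letter list \<Rightarrow> nat set \<Rightarrow> hmlg" where
  "word_class ls D = foldr hprod (map letter_class ls) (sing_class D)"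

text \<open>Additive form of the condition in \<open>H\<close>, which avoids truncated
  subtraction.\<close>
definition kcell :: "nat \<Rightarrow> nat set \<Rightarrow> symb set" where
  "kcell k S = {e \<in> cell2 S. length e + k = card S}"

lemma letter_labels_finite: "letter_ok l \<Longrightarrow> finite (letter_labels l)"
  by (auto simp: letter_ok_def letter_labels_def split: prod.splits)

lemma word_on_finite: "word_on S ls D \<Longrightarrow> finite S \<and> finite D"
  by (induction ls arbitrary: S) auto

lemma singles_empty [simp]: "singles {} = []"
  by (simp add: singles_def)

lemma singles_decreasing: "sorted_wrt (>) xs \<Longrightarrow> singles (set xs) = map (\<lambda>i. [i]) xs"
proof -
  assume *: "sorted_wrt (>) xs"
  have s: "sorted (rev xs)" "distinct (rev xs)"
    using * by (auto simp: sorted_wrt_rev strict_sorted_iff)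
      (metis strict_sorted_iff sorted_wrt_rev distinct_rev rev_rev_ident)+
  show ?thesis
    using sorted_list_of_set.idem_if_sorted_distinct[OF s] by (simp add: singles_def)
qed

lemma sorted_wrt_rev_list: "finite D \<Longrightarrow> sorted_wrt (>) (rev (sorted_list_of_set D))"
  by (simp add: sorted_wrt_rev)

lemma obtain_decreasing:
  assumes "finite D" obtains xs where "sorted_wrt (>) xs" "set xs = D" "singles D = map (\<lambda>i. [i]) xs"
    "distinct xs" "length xs = card D"
  by (rule that[of "rev (sorted_list_of_set D)"]) (use assms in \<open>auto simp: singles_def sorted_wrt_rev_list\<close>)

lemma singles_insert_min:
  assumes "finite D" "\<And>d. d \<in> D \<Longrightarrow> a < d"
  shows "singles (insert a D) = singles D @ [[a]]"
proof -
  obtain xs where xs: "sorted_wrt (>) xs" "set xs = D" "singles D = map (\<lambda>i. [i]) xs"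
    using obtain_decreasing[OF assms(1)] by metis
  have "sorted_wrt (>) (xs @ [a])" using xs assms by (auto simp: sorted_wrt_append)
  from singles_decreasing[OF this] xs show ?thesis by simp
qed

lemma singles_Min:
  assumes "finite D" "D \<noteq> {}"
  shows "singles D = singles (D - {Min D}) @ [[Min D]]"
proof -
  have "singles (insert (Min D) (D - {Min D})) = singles (D - {Min D}) @ [[Min D]]"
    by (rule singles_insert_min) (use assms in \<open>auto simp: order.strict_iff_order\<close>)
  moreover have "insert (Min D) (D - {Min D}) = D" using assms by (intro insert_Diff Min_in)
  ultimately show ?thesis by simp
qed

lemma labels_singles [simp]: "finite D \<Longrightarrow> (\<Union>x\<in>set (singles D). set x) = D"
  by (auto simp: singles_def)

lemma end_ctx_singles: "finite D \<Longrightarrow> end_ctx None (singles D) = (if D = {} then None else Some (Min D))"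
  using arg_cong[OF singles_Min[of D], of "end_ctx None"] by (cases "D = {}") auto

lemma good_singles: "finite D \<Longrightarrow> good None (singles D)"
proof -
  assume "finite D"
  have "good ctx (map (\<lambda>i. [i]) xs)" if "sorted_wrt (>) xs" "\<And>p x. ctx = Some p \<Longrightarrow> x \<in> set xs \<Longrightarrow> x < p" for ctx xs
    using that by (induction xs arbitrary: ctx) (simp, fastforce)
  thus ?thesis using obtain_decreasing[OF \<open>finite D\<close>] by (metis option.distinct(1))
qed

lemma singles_valid: "finite D \<Longrightarrow> singles D \<in> kcell 0 D"
  by (auto simp: kcell_def cell2_def cell_def singles_def concat_map_singleton)

lemma kcell_append: "e \<in> kcell i S \<Longrightarrow> f \<in> kcell j T \<Longrightarrow> S \<inter> T = {} \<Longrightarrow> finite S \<Longrightarrow> finite T \<Longrightarrow>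
  e @ f \<in> kcell (i + j) (S \<union> T)"
  by (auto simp: kcell_def cell2_def cell_def card_Un_disjoint)

lemma kcell_sub: "kcell k S \<subseteq> cell2 S" "kcell k S \<subseteq> valid2"
  by (auto simp: kcell_def valid2_eq)

lemma kcell_labels: "e \<in> kcell k S \<Longrightarrow> labels e = S"
  by (auto simp: kcell_def cell2_def cell_def)

text \<open>The six terms of \<open>z(a|c b)\<close> are compared directly; the context of the
  preceding singletons matters for \<open>b|c a\<close> and its relatives, whose first block may
  be good or bad.\<close>
lemma letter_cycle_leading:
  assumes "letter_ok l"
  shows "\<exists>r. letter_cycle l = gen (letter_symb l) + r \<and> Poly_Mapping.keys r \<subseteq> below None (letter_symb l) \<inter> kcell 1 (letter_labels l) \<and>
    letter_symb l \<in> kcell 1 (letter_labels l) \<and> bd (letter_cycle l) = 0 \<and> good None (letter_symb l) \<and> end_ctx None (letter_symb l) = None"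
proof -
  obtain D u v where l: "l = (D,u,v)" by (cases l)
  have D: "finite D" "u \<notin> D" "v \<notin> D" "u \<noteq> v" using assms by (auto simp: letter_ok_def l)
  have labl: "letter_labels l = D \<union> {u,v}" by (auto simp: letter_labels_def l)
  have k1: "[[u,v]] \<in> kcell 1 {u,v}" "[[v,u]] \<in> kcell 1 {u,v}"
    using D by (auto simp: kcell_def cell2_def cell_def)
  show ?thesis
  proof (cases "u < v")
    case True
    have eq: "letter_cycle l = gen (letter_symb l) + gen (singles D @ [[v,u]])"
      using D True by (simp add: letter_cycle_def l letter_symb_def cprod_lin scat_def)
    have "singles D @ [[v,u]] \<in> below None (letter_symb l)"
      unfolding letter_symb_def l using True by (auto intro!: below_prefix below_ConsI simp: block_less_def)
    moreover have "singles D @ [[v,u]] \<in> kcell 1 (letter_labels l)" "letter_symb l \<in> kcell 1 (letter_labels l)"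
      using kcell_append[OF singles_valid[OF D(1)] k1(1)] kcell_append[OF singles_valid[OF D(1)] k1(2)] D
      by (simp_all add: letter_labels_def letter_symb_def l)
    moreover have "bd (letter_cycle l) = 0"
    proof -
      have "Poly_Mapping.keys (zpiece [[u,v]]) \<subseteq> valid"
        using D(4) Poly_Mapping.keys_add[of "gen [[u,v]]" "gen [[v,u]]"] by (auto simp: valid_def)
      moreover have "Poly_Mapping.keys (gen (singles D)) \<subseteq> valid"
        using singles_valid[OF D(1)] kcell_sub(2) by (auto simp: valid2_def)
      ultimately show ?thesis
        using True bd_zpiece_pair[OF D(4)]
        by (simp add: letter_cycle_def l bd_cprod del: zpiece.simps) (simp add: singles_def)
    qed
    moreover have "good None (letter_symb l)" "end_ctx None (letter_symb l) = None"
      using good_singles[OF D(1)] True by (simp_all add: letter_symb_def l)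
    ultimately show ?thesis using eq by auto
  next
    case False
    with assms have vu: "v < u" "D \<noteq> {}" "Min D < v" by (auto simp: letter_ok_def l)
    define a where "a = Min D"
    define D' where "D' = D - {a}"
    have a: "a < v" "a < u" "a \<noteq> u" "a \<noteq> v" using vu by (auto simp: a_def)
    have aD: "a \<in> D" using D vu by (auto simp: a_def)
    have D': "finite D'" "a \<notin> D'" "u \<notin> D'" "v \<notin> D'" "D = insert a D'"
      using D aD by (auto simp: D'_def)
    have lD: "\<And>d. d \<in> D' \<Longrightarrow> a < d" using D by (auto simp: D'_def a_def order.strict_iff_order)
    have sD: "singles D = singles D' @ [[a]]"
      using singles_Min[of D] D vu by (simp add: D'_def a_def)
    let ?T = "{[[u],[v,a]], [[v],[u,a]], [[u,v],[a]], [[u,a],[v]], [[v,a],[u]]}"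
    let ?r = "gen [[u],[v,a]] - gen [[v],[u,a]] + gen [[u,v],[a]] - gen [[u,a],[v]] + gen [[v,a],[u]]"
    have kr: "Poly_Mapping.keys ?r \<subseteq> ?T"
      by (auto simp: in_keys_iff lookup_add lookup_minus lookup_single when_def split: if_splits)
    have z: "zpiece [[a],[u,v]] = gen [[a],[u,v]] + ?r"
      unfolding zpiece_barrier3[OF a(1) vu(1)] by simp
    have eq: "letter_cycle l = gen (letter_symb l) + cprod (gen (singles D')) ?r"
      using False D' a unfolding letter_cycle_def l prod.case letter_symb_def sD a_def[symmetric] D'_def[symmetric] z
        cprod_add_right by (simp add: scat_def)
    have "singles D' @ t \<in> below None (letter_symb l) \<inter> kcell 1 (letter_labels l)" if "t \<in> ?T" for t
    proof
      have c: "end_ctx None (singles D') = (if D' = {} then None else Some (Min D'))"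
        using end_ctx_singles[OF D'(1)] .
      have ca: "\<forall>p. end_ctx None (singles D') = Some p \<longrightarrow> a < p" using lD D' by (auto simp: c)
      have "block_less (end_ctx None (singles D')) (hd t) [a]"
        using that a vu ca by (auto simp: block_less_def split: if_splits)
      hence "t \<in> below (end_ctx None (singles D')) [[a],[u,v]]"
        using that by (auto intro!: below_ConsI)
      thus "singles D' @ t \<in> below None (letter_symb l)"
        using below_prefix by (simp add: letter_symb_def l sD)
      have "t \<in> kcell 1 {a,u,v}" using that a D vu by (auto simp: kcell_def cell2_def cell_def)
      from kcell_append[OF singles_valid[OF D'(1)] this] show "singles D' @ t \<in> kcell 1 (letter_labels l)"
        using D' by (simp add: labl insert_commute)
    qed
    hence "Poly_Mapping.keys (cprod (gen (singles D')) ?r) \<subseteq> below None (letter_symb l) \<inter> kcell 1 (letter_labels l)"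
      by (intro keys_cprod[OF _ kr, of _ "{singles D'}"]) auto
    moreover have "letter_symb l \<in> kcell 1 (letter_labels l)"
      using kcell_append[OF singles_valid[OF D(1)] k1(1)] D by (simp add: letter_labels_def letter_symb_def l)
    moreover have "bd (letter_cycle l) = 0"
    proof -
      have v: "[[a],[u,v]] \<in> valid" "\<And>t. t \<in> ?T \<Longrightarrow> t \<in> valid" using a D by (auto simp: valid_def)
      have "Poly_Mapping.keys (zpiece [[a],[u,v]]) \<subseteq> valid"
        unfolding z using kr v Poly_Mapping.keys_add[of "gen [[a],[u,v]]" ?r] by auto
      moreover have "Poly_Mapping.keys (gen (singles D')) \<subseteq> valid"
        using singles_valid[OF D'(1)] kcell_sub(2) by (auto simp: valid2_def)
      ultimately show ?thesis
        using False bd_zpiece_barrier3[OF a(1) vu(1)]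
        unfolding letter_cycle_def l prod.case a_def[symmetric] D'_def[symmetric]
        by (simp add: bd_cprod del: zpiece.simps) (simp add: singles_def)
    qed
    moreover have "good None (letter_symb l)" "end_ctx None (letter_symb l) = None"
      using good_singles[OF D(1)] vu D by (simp_all add: letter_symb_def l end_ctx_singles)
    ultimately show ?thesis using eq by auto
  qed
qed

lemma letter_cycle_cyc: "letter_ok l \<Longrightarrow> letter_cycle l \<in> cyc"
  and keys_letter_cycle: "letter_ok l \<Longrightarrow> Poly_Mapping.keys (letter_cycle l) \<subseteq> kcell 1 (letter_labels l)"
proof -
  assume "letter_ok l"
  from letter_cycle_leading[OF this] obtain r where r: "letter_cycle l = gen (letter_symb l) + r"
    "Poly_Mapping.keys r \<subseteq> kcell 1 (letter_labels l)" "letter_symb l \<in> kcell 1 (letter_labels l)" "bd (letter_cycle l) = 0" by blast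
  show "Poly_Mapping.keys (letter_cycle l) \<subseteq> kcell 1 (letter_labels l)"
    unfolding r(1) using r(2,3) Poly_Mapping.keys_add[of "gen (letter_symb l)" r] by auto
  thus "letter_cycle l \<in> cyc" using r(4) kcell_sub(2) unfolding cyc_def C2_def by blast
qed

lemma singles_cyc: "finite D \<Longrightarrow> gen (singles D) \<in> cyc"
  using singles_valid[of D] kcell_sub(2) by (auto simp: cyc_def C2_def) (simp add: singles_def)

text \<open>Leading terms multiply because a letter ends with a pair, so that nothing before it
  influences the ranks of the following blocks.\<close>
lemma word_cycle_leading:
  assumes "word_on S ls D"
  shows "\<exists>r. word_cycle ls D = gen (word_symb ls D) + r \<and>
    Poly_Mapping.keys r \<subseteq> {y. symb_less None y (word_symb ls D)} \<inter> kcell (length ls) S \<and>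
    word_symb ls D \<in> kcell (length ls) S \<and> word_cycle ls D \<in> cyc \<and> good None (word_symb ls D) \<and> hclass (word_cycle ls D) = word_class ls D"
  using assms
proof (induction ls arbitrary: S)
  case Nil
  then show ?case using singles_valid[of S]
    by (auto simp: word_symb_def word_cycle_def singles_cyc good_singles word_class_def sing_class_def)
next
  case (Cons l ls)
  have w: "word_on (S - letter_labels l) ls D" and l: "letter_ok l" "letter_labels l \<subseteq> S" "finite S" using Cons.prems by auto
  from Cons.IH[OF w] obtain r' where r': "word_cycle ls D = gen (word_symb ls D) + r'"
    "Poly_Mapping.keys r' \<subseteq> {y. symb_less None y (word_symb ls D)} \<inter> kcell (length ls) (S - letter_labels l)"
    "word_symb ls D \<in> kcell (length ls) (S - letter_labels l)" "word_cycle ls D \<in> cyc" "good None (word_symb ls D)"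
    "hclass (word_cycle ls D) = word_class ls D" by blast
  from letter_cycle_leading[OF l(1)] obtain r where r: "letter_cycle l = gen (letter_symb l) + r"
    "Poly_Mapping.keys r \<subseteq> below None (letter_symb l) \<inter> kcell 1 (letter_labels l)"
    "letter_symb l \<in> kcell 1 (letter_labels l)" "good None (letter_symb l)" "end_ctx None (letter_symb l) = None" by blast
  have word_symb: "word_symb (l # ls) D = letter_symb l @ word_symb ls D" by (simp add: word_symb_def)
  have kc: "a @ b \<in> kcell (length (l # ls)) S" if "a \<in> kcell 1 (letter_labels l)" "b \<in> kcell (length ls) (S - letter_labels l)" for a b
  proof -
    have "letter_labels l \<union> (S - letter_labels l) = S" using l by auto
    with kcell_append[OF that] l letter_labels_finite[OF l(1)] show ?thesis by simp
  qed
  let ?r1 = "cprod (gen (letter_symb l)) r'" and ?r2 = "cprod r (word_cycle ls D)"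
  have "labels (letter_symb l) \<inter> labels (word_symb ls D) = {}"
    unfolding kcell_labels[OF r(3)] kcell_labels[OF r'(3)] by blast
  hence "cprod (gen (letter_symb l)) (gen (word_symb ls D)) = gen (word_symb (l # ls) D)"
    unfolding word_symb cprod_gen scat_def by (rule if_P)
  hence eq: "word_cycle (l # ls) D = gen (word_symb (l # ls) D) + (?r1 + ?r2)"
    using r(1) r'(1) by (simp add: word_cycle_def cprod_lin)
  have k': "Poly_Mapping.keys (word_cycle ls D) \<subseteq> kcell (length ls) (S - letter_labels l)"
    unfolding r'(1) using r'(2,3) Poly_Mapping.keys_add[of "gen (word_symb ls D)" r'] by auto
  have "Poly_Mapping.keys ?r1 \<subseteq> {y. symb_less None y (word_symb (l # ls) D)} \<inter> kcell (length (l # ls)) S"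
    by (rule keys_cprod[OF _ r'(2), of _ "{letter_symb l}"]) (use r kc in \<open>auto simp: word_symb\<close>)
  moreover have "Poly_Mapping.keys ?r2 \<subseteq> {y. symb_less None y (word_symb (l # ls) D)} \<inter> kcell (length (l # ls)) S"
    by (rule keys_cprod[OF r(2) k']) (use kc in \<open>auto simp: word_symb below_def\<close>)
  ultimately have "Poly_Mapping.keys (?r1 + ?r2) \<subseteq> {y. symb_less None y (word_symb (l # ls) D)} \<inter> kcell (length (l # ls)) S"
    using Poly_Mapping.keys_add[of ?r1 ?r2] by blast
  moreover have "word_symb (l # ls) D \<in> kcell (length (l # ls)) S" unfolding word_symb using r(3) r'(3) by (rule kc)
  moreover have "good None (word_symb (l # ls) D)" unfolding word_symb using r r' by simp
  moreover have "word_cycle (l # ls) D \<in> cyc"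
    using cyc_cprod[OF letter_cycle_cyc[OF l(1)] r'(4)] by (simp add: word_cycle_def)
  moreover have "hclass (word_cycle (l # ls) D) = word_class (l # ls) D"
    using hclass_cprod[OF letter_cycle_cyc[OF l(1)] r'(4)] r'(6) by (simp add: word_cycle_def word_class_def letter_class_def)
  ultimately show ?case using eq by blast
qed

text \<open>The end of the first letter is the first two-element block.\<close>
lemma word_symb_inj:
  assumes "word_symb ls D = word_symb ls' D'" "word_on S ls D" "word_on S' ls' D'"
  shows "ls = ls' \<and> D = D'"
  using assms
proof (induction ls arbitrary: ls' S S')
  have tw: "takeWhile (\<lambda>g. length g = 1) (singles D @ [u,v] # e) = singles D" for D u v e
    by (subst takeWhile_append2) (auto simp: singles_def)
  have tw': "takeWhile (\<lambda>g. length g = 1) (singles D) = singles D" for D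
    by (auto simp: takeWhile_eq_all_conv singles_def)
  have si: "singles D = singles D' \<Longrightarrow> finite D \<Longrightarrow> finite D' \<Longrightarrow> D = D'" for D D'
    by (metis labels_singles)
  {
    case Nil
    then show ?case
    proof (cases ls')
      case Nil': Nil
      thus ?thesis using Nil si[of D D'] word_on_finite by (auto simp: word_symb_def)
    next
      case (Cons l ls2)
      obtain C u v where l: "l = (C,u,v)" by (cases l)
      have "takeWhile (\<lambda>g. length g = 1) (word_symb ls' D') = singles C"
        using tw by (simp add: Cons word_symb_def letter_symb_def l)
      moreover have e: "word_symb ls' D' = singles D" using Nil(1) by (simp add: word_symb_def)
      ultimately have "singles D = singles C" by (simp only: tw')
      with e show ?thesis by (simp add: Cons word_symb_def letter_symb_def l)
    qed
  next
    case (Cons l ls)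
    obtain C u v where l: "l = (C,u,v)" by (cases l)
    have t1: "takeWhile (\<lambda>g. length g = 1) (word_symb (l # ls) D) = singles C"
      using tw by (simp add: word_symb_def letter_symb_def l)
    show ?case
    proof (cases ls')
      case Nil
      hence e: "word_symb (l # ls) D = singles D'" using Cons.prems(1) by (simp add: word_symb_def)
      with t1 have "singles D' = singles C" by (simp only: tw')
      with e show ?thesis by (simp add: word_symb_def letter_symb_def l)
    next
      case (Cons l' ls2)
      obtain C' u' v' where l': "l' = (C',u',v')" by (cases l')
      have "takeWhile (\<lambda>g. length g = 1) (word_symb ls' D') = singles C'"
        using tw by (simp add: Cons word_symb_def letter_symb_def l')
      with t1 Cons.prems(1) have s: "singles C = singles C'" by simp
      moreover have "finite C" "finite C'" using Cons.prems(2,3) by (auto simp: Cons letter_ok_def l l')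
      ultimately have C: "C = C'" by (rule si)
      have "word_symb ls D = word_symb ls2 D'" "u = u'" "v = v'"
        using Cons.prems(1) C by (auto simp: Cons word_symb_def letter_symb_def l l')
      with Cons.IH[of ls2] Cons.prems(2,3) show ?thesis by (auto simp: Cons l l' C)
    qed
  }
qed

text \<open>The set \<open>C\<close> collects the singletons read so far; the next pair closes a
  letter.\<close>
lemma good_word:
  assumes "e \<in> valid2" "finite C" "labels e \<inter> C = {}" "good (end_ctx None (singles C)) e"
  shows "\<exists>ls D. word_on (C \<union> labels e) ls D \<and> word_symb ls D = singles C @ e"
  using assms
proof (induction e arbitrary: C)
  case Nil
  then show ?case by (intro exI[of _ "[]"] exI[of _ C]) (simp add: word_symb_def)
next
  case (Cons g e)
  have e: "e \<in> valid2" and g: "length g \<le> 2" "g \<noteq> []" "distinct g" "set g \<inter> labels e = {}"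
    using Cons.prems by (auto simp: valid2_def valid_def)
  have fe: "finite (labels e)" by simp
  from length_2_cases[OF g(1,2)] show ?case
  proof (elim disjE exE)
    fix a assume a: "g = [a]"
    have "\<And>d. d \<in> C \<Longrightarrow> a < d"
      using Cons.prems(2,4) a Min_le[OF Cons.prems(2)]
      by (auto simp: end_ctx_singles split: if_splits intro: less_le_trans)
    with Cons.prems have s: "singles (insert a C) = singles C @ [[a]]" by (intro singles_insert_min) auto
    have "\<exists>ls D. word_on (insert a C \<union> labels e) ls D \<and> word_symb ls D = singles (insert a C) @ e"
      by (rule Cons.IH[OF e]) (use Cons.prems g a s in auto)
    moreover have "insert a C \<union> labels e = C \<union> labels (g # e)" using a by auto
    ultimately show ?thesis using s a by simp
  next
    fix u v assume uv: "g = [u,v]"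
    have "\<exists>ls D. word_on ({} \<union> labels e) ls D \<and> word_symb ls D = singles {} @ e"
      by (rule Cons.IH[OF e]) (use Cons.prems uv in auto)
    then obtain ls D where *: "word_on (labels e) ls D" "word_symb ls D = e" by auto
    have l: "letter_ok (C,u,v)" using Cons.prems uv
      by (auto simp: letter_ok_def end_ctx_singles split: if_splits)
    have "C \<union> labels (g # e) - letter_labels (C,u,v) = labels e"
      using g Cons.prems(3) by (auto simp: uv letter_labels_def)
    hence "word_on (C \<union> labels (g # e)) ((C,u,v) # ls) D"
      using l *(1) Cons.prems(2) by (auto simp: letter_labels_def uv)
    moreover have "word_symb ((C,u,v) # ls) D = singles C @ g # e"
      using *(2) by (simp add: word_symb_def letter_symb_def uv)
    ultimately show ?thesis by blast
  qed
qed

section \<open>The basis theorem\<close>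

lemma length_concat_ge: "[] \<notin> set e \<Longrightarrow> length e \<le> length (concat e)"
proof (induction e)
  case (Cons g e)
  then show ?case by (cases g) auto
qed simp

lemma cell2_kcell: "e \<in> cell2 S \<Longrightarrow> e \<in> kcell (card S - length e) S"
proof -
  assume e: "e \<in> cell2 S"
  have "card (labels e) = length (concat e)"
    using e by (intro distinct_card) (auto simp: cell2_def cell_def)
  with e length_concat_ge[of e] show ?thesis by (auto simp: kcell_def cell2_def cell_def)
qed

lemma finite_cell2: "finite S \<Longrightarrow> finite (cell2 S)"
proof -
  assume S: "finite S"
  let ?B = "{g. set g \<subseteq> S \<and> length g \<le> 2}"
  have "cell2 S \<subseteq> {e. set e \<subseteq> ?B \<and> length e \<le> card S}"
  proof
    fix e assume e: "e \<in> cell2 S"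
    have 1: "set e \<subseteq> ?B" using e by (auto simp: cell2_def cell_def)
    have "length e \<le> length (concat e)" using e length_concat_ge by (auto simp: cell2_def cell_def)
    moreover have "length (concat e) = card (labels e)"
      using e by (intro distinct_card[symmetric]) (auto simp: cell2_def cell_def)
    moreover have "labels e = S" using e by (simp add: cell2_def cell_def)
    ultimately have "length e \<le> card S" by (simp only:)
    with 1 show "e \<in> {e. set e \<subseteq> ?B \<and> length e \<le> card S}" by simp
  qed
  moreover have "finite {e. set e \<subseteq> ?B \<and> length e \<le> card S}"
    by (intro finite_lists_length_le S)
  ultimately show ?thesis by (rule finite_subset)
qed

lemma span_image_sum:
  assumes "finite A" "c \<in> fvec.span (v ` A)"
  shows "\<exists>\<alpha>. c = (\<Sum>x\<in>A. qscale (\<alpha> x) (v x))"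
  using assms(2)
proof (induction rule: fvec.span_induct_alt)
  case base
  show ?case by (rule exI[of _ "\<lambda>_. 0"]) simp
next
  case (step q x y)
  then obtain a \<alpha> where "x = v a" "a \<in> A" "y = (\<Sum>x\<in>A. qscale (\<alpha> x) (v x))" by blast
  moreover have "(\<Sum>x\<in>A. qscale (if x = a then q else 0) (v x)) = qscale q (v a)"
    using \<open>a \<in> A\<close> assms(1) by (subst sum.remove[of A a]) (auto intro!: sum.neutral)
  ultimately have "qscale q x + y = (\<Sum>x\<in>A. qscale ((if x = a then q else 0) + \<alpha> x) (v x))"
    by (simp add: fvec.scale_left_distrib sum.distrib)
  thus ?case by (intro exI[of _ "\<lambda>x. (if x = a then q else 0) + \<alpha> x"])
qed

text \<open>The choices are unique by \<open>word_symb_inj\<close> and \<open>matched_inj\<close>.\<close>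
definition word_of :: "symb \<Rightarrow> letter list \<times> nat set" where
  "word_of e = (SOME (ls,D). \<exists>S. word_on S ls D \<and> word_symb ls D = e)"

definition match_source :: "symb \<Rightarrow> symb" where
  "match_source e = (SOME e'. matched e' e)"

text \<open>The basis element with leading term \<open>e\<close>: a boundary if \<open>e\<close>
  is the target of the matching, a cycle of a word if \<open>e\<close> is critical, and the cell
  itself otherwise.\<close>
definition tri_basis :: "symb \<Rightarrow> chain" where
  "tri_basis e = (if \<exists>e'. matched e' e then bd (gen (match_source e))
     else if good None e then word_cycle (fst (word_of e)) (snd (word_of e)) else gen e)"

lemma match_source: "matched e' e \<Longrightarrow> match_source e = e'"
  unfolding match_source_def using matched_inj by blast

lemma word_on_labels: "word_on S ls D \<Longrightarrow> word_symb ls D \<in> kcell (length ls) S"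
  using word_cycle_leading by blast

lemma word_of:
  assumes "word_on S ls D"
  shows "word_of (word_symb ls D) = (ls, D)"
proof -
  have "(\<lambda>(ls',D'). \<exists>S. word_on S ls' D' \<and> word_symb ls' D' = word_symb ls D) (ls, D)" using assms by auto
  hence "(\<lambda>(ls',D'). \<exists>S. word_on S ls' D' \<and> word_symb ls' D' = word_symb ls D) (word_of (word_symb ls D))"
    unfolding word_of_def by (rule someI)
  thus ?thesis using word_symb_inj[OF _ _ assms] by (cases "word_of (word_symb ls D)") auto
qed

lemma good_word_of:
  assumes "e \<in> kcell k S" "good None e"
  shows "\<exists>ls D. word_on S ls D \<and> word_symb ls D = e \<and> length ls = k"
proof -
  have "e \<in> valid2" "labels e = S" using assms kcell_sub(2) kcell_labels by auto
  with good_word[of e "{}"] assms obtain ls D where *: "word_on S ls D" "word_symb ls D = e" by auto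
  have "length e + length ls = card S" "length e + k = card S"
    using word_on_labels[OF *(1)] assms *(2) by (simp_all add: kcell_def)
  hence "length ls = k" by simp
  with * show ?thesis by blast
qed

lemma kcell_matched:
  assumes "matched e' e" "e \<in> kcell k S"
  shows "e' \<in> kcell (Suc k) S"
proof -
  from assms(1) obtain P a b R where *: "e' = P @ [b,a] # R" "e = P @ [a] # [b] # R" "a < b"
    by (rule matchedE)
  thus ?thesis using assms(2) by (auto simp: kcell_def cell2_def cell_def)
qed

lemma keys_bd_kcell: "e \<in> kcell (Suc k) S \<Longrightarrow> Poly_Mapping.keys (bd (gen e)) \<subseteq> kcell k S"
proof -
  assume e: "e \<in> kcell (Suc k) S"
  hence "e \<in> valid2" using kcell_sub by blast
  show ?thesis
  proof
    fix x assume "x \<in> Poly_Mapping.keys (bd (gen e))"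
    hence "x \<in> same_labels e" using keys_bd_symb[OF valid2_valid[OF \<open>e \<in> valid2\<close>]] by auto
    hence x: "labels x = labels e" "length x = Suc (length e)" "x \<in> valid2"
      using \<open>e \<in> valid2\<close> by (simp_all only: same_labels_def mem_Collect_eq simp_thms)
    from x(1) have "labels x = S" using kcell_labels[OF e] by (simp only:)
    with x(2,3) e show "x \<in> kcell k S"
      by (simp add: kcell_def cell2_def cell_def valid2_def valid_def)
  qed
qed

lemma tri_basis_props:
  assumes "e \<in> kcell k S"
  shows "Poly_Mapping.lookup (tri_basis e) e \<noteq> 0"
    "Poly_Mapping.keys (tri_basis e) \<subseteq> kcell k S \<inter> insert e {y. symb_less None y e}"
proof -
  have "\<exists>r q. tri_basis e = qscale q (gen e) + r \<and> q \<noteq> 0 \<and> Poly_Mapping.keys r \<subseteq> {y. symb_less None y e} \<and>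
    Poly_Mapping.keys (tri_basis e) \<subseteq> kcell k S"
  proof (cases "\<exists>e'. matched e' e")
    case True
    then obtain e' where e': "matched e' e" by blast
    hence v: "tri_basis e = bd (gen e')" using True by (auto simp: tri_basis_def match_source simp del: bd_gen)
    have k: "e' \<in> kcell (Suc k) S" using kcell_matched[OF e' assms] .
    hence "e' \<in> valid" using kcell_sub(2) valid2_valid by blast
    from bd_matched[OF e' this] obtain r q where "bd (gen e') = qscale q (gen e) + r" "q \<noteq> 0"
      "Poly_Mapping.keys r \<subseteq> {y. symb_less None y e}" .
    with keys_bd_kcell[OF k] show ?thesis unfolding v by blast
  next
    case False
    show ?thesis
    proof (cases "good None e")
      case True
      from good_word_of[OF assms this] obtain ls D where w: "word_on S ls D" "word_symb ls D = e" "length ls = k" by blast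
      have v: "tri_basis e = word_cycle ls D" using False True word_of[OF w(1)] w(2) by (auto simp: tri_basis_def)
      from word_cycle_leading[OF w(1)] obtain r where r: "word_cycle ls D = gen e + r"
         "Poly_Mapping.keys r \<subseteq> {y. symb_less None y e} \<inter> kcell k S" unfolding w by blast
      have "Poly_Mapping.keys (gen e + r) \<subseteq> kcell k S"
        using r(2) assms Poly_Mapping.keys_add[of "gen e" r] by auto
      with r show ?thesis unfolding v by (intro exI[of _ r] exI[of _ 1]) auto
    next
      case False
      with \<open>\<nexists>e'. matched e' e\<close> have "tri_basis e = gen e" by (simp add: tri_basis_def)
      thus ?thesis using assms by (intro exI[of _ 0] exI[of _ 1]) auto
    qed
  qed
  then obtain r q where r: "tri_basis e = qscale q (gen e) + r" "q \<noteq> 0" "Poly_Mapping.keys r \<subseteq> {y. symb_less None y e}"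
    "Poly_Mapping.keys (tri_basis e) \<subseteq> kcell k S" by blast
  have "Poly_Mapping.lookup r e = 0" using lookup_keys_irrefl[OF r(3)] .
  thus "Poly_Mapping.lookup (tri_basis e) e \<noteq> 0" using r(1,2) by (simp add: lookup_add)
  show "Poly_Mapping.keys (tri_basis e) \<subseteq> kcell k S \<inter> insert e {y. symb_less None y e}"
    using r(4) r(3) unfolding r(1) using Poly_Mapping.keys_add[of "qscale q (gen e)" r]
    by (auto simp: in_keys_iff lookup_single when_def split: if_splits)
qed

lemma tri_basis_coeffs_zero:
  assumes "finite A" "A \<subseteq> valid2" "(\<Sum>x\<in>A. qscale (c x) (tri_basis x)) = 0" "x \<in> A"
  shows "c x = 0"
proof (rule triangular_coeffs_zero[where r = "symb_less None" and A = A and v = tri_basis])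
  fix e assume "e \<in> A"
  hence "e \<in> cell2 (labels e)" using assms(2) by (auto simp: valid2_eq cell2_def cell_def)
  note cell2_kcell[OF this]
  from tri_basis_props[OF this] show "Poly_Mapping.lookup (tri_basis e) e \<noteq> 0"
    "Poly_Mapping.keys (tri_basis e) \<subseteq> insert e {y. symb_less None y e}" by auto
qed (use symb_less_irrefl symb_less_trans assms in auto)

lemma tri_basis_span:
  assumes "finite S" "Poly_Mapping.keys c \<subseteq> kcell k S"
  shows "\<exists>\<alpha>. c = (\<Sum>x\<in>kcell k S. qscale (\<alpha> x) (tri_basis x))"
proof (rule span_image_sum)
  show f: "finite (kcell k S)" using finite_cell2[OF assms(1)] by (simp add: kcell_def)
  show "c \<in> fvec.span (tri_basis ` kcell k S)"
    by (rule triangular_span[where r = "symb_less None", OF _ _ _ _ f assms(2)])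
       (use tri_basis_props in \<open>auto simp: symb_less_irrefl intro: symb_less_trans\<close>)
qed

text \<open>Boundaries are indexed by the targets; the cells at the sources are not cycles, and
  \<open>match_to\<close> relates the two by the boundary map.\<close>
definition match_targets :: "symb set" where "match_targets = {e. \<exists>e'. matched e' e}"
definition match_sources :: "symb set" where "match_sources = {e. \<exists>f. matched e f}"

lemma tri_basis_cyc:
  assumes "e \<in> kcell k S" "e \<notin> match_sources"
  shows "tri_basis e \<in> cyc" "e \<in> match_targets \<Longrightarrow> tri_basis e \<in> bd ` C2"
    "e \<notin> match_targets \<Longrightarrow> \<exists>ls D. word_on S ls D \<and> length ls = k \<and> word_symb ls D = e \<and> tri_basis e = word_cycle ls D"
proof -
  have e: "e \<in> valid2" using assms kcell_sub by blast
  have u: "tri_basis e \<in> bd ` C2 \<and> tri_basis e \<in> cyc" if match_targets: "e \<in> match_targets"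
  proof -
    from match_targets obtain e' where e': "matched e' e" by (auto simp: match_targets_def)
    hence v: "tri_basis e = bd (gen e')" by (auto simp: tri_basis_def match_source simp del: bd_gen)
    have "gen e' \<in> C2" using kcell_matched[OF e' assms(1)] kcell_sub(2)[of "Suc k" S] by (auto simp: C2_def)
    thus ?thesis unfolding v using boundary_cyc by blast
  qed
  thus "e \<in> match_targets \<Longrightarrow> tri_basis e \<in> bd ` C2" by blast
  have g: "\<exists>ls D. word_on S ls D \<and> length ls = k \<and> word_symb ls D = e \<and> tri_basis e = word_cycle ls D" if "e \<notin> match_targets"
  proof -
    have "good None e" using matched_cases[OF e] that assms by (auto simp: match_targets_def match_sources_def)
    from good_word_of[OF assms(1) this] obtain ls D where w: "word_on S ls D" "word_symb ls D = e" "length ls = k" by blast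
    have v: "tri_basis e = word_cycle ls D"
      using that \<open>good None e\<close> word_of[OF w(1)] w(2) by (auto simp: tri_basis_def match_targets_def)
    with w show ?thesis by blast
  qed
  thus "e \<notin> match_targets \<Longrightarrow> \<exists>ls D. word_on S ls D \<and> length ls = k \<and> word_symb ls D = e \<and> tri_basis e = word_cycle ls D" .
  show "tri_basis e \<in> cyc"
  proof (cases "e \<in> match_targets")
    case False
    then obtain ls D where "word_on S ls D" "tri_basis e = word_cycle ls D" using g by blast
    moreover have "word_cycle ls D \<in> cyc" using word_cycle_leading[OF \<open>word_on S ls D\<close>] by blast
    ultimately show ?thesis by simp
  qed (use u in blast)
qed

lemma vtri_match_sources:
  assumes "e \<in> match_sources" shows "\<exists>f. matched e f \<and> tri_basis e = gen e \<and> tri_basis f = bd (gen e)"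
proof -
  from assms obtain f where f: "matched e f" by (auto simp: match_sources_def)
  have "\<not> good None e" "\<nexists>e'. matched e' e" using matched_not_good[OF f] f matched_disjoint by blast+
  moreover have "tri_basis f = bd (gen e)" using f by (auto simp: tri_basis_def match_source simp del: bd_gen)
  ultimately have "tri_basis e = gen e" by (simp add: tri_basis_def)
  thus ?thesis using f \<open>tri_basis f = bd (gen e)\<close> by blast
qed

definition match_to :: "symb \<Rightarrow> symb" where "match_to e = (THE f. matched e f)"

lemma match_to: "matched e f \<Longrightarrow> match_to e = f"
  unfolding match_to_def using matched_fun by blast

lemma match_to_matched: "e \<in> match_sources \<Longrightarrow> matched e (match_to e)"
  using match_to by (auto simp: match_sources_def)

lemma match_to_inj: "inj_on match_to match_sources"
proof (rule inj_onI)
  fix e f assume "e \<in> match_sources" "f \<in> match_sources" "match_to e = match_to f"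
  with match_to_matched[of e] match_to_matched[of f] show "e = f" using matched_inj by auto
qed

lemma match_to_valid2: "e \<in> valid2 \<Longrightarrow> e \<in> match_sources \<Longrightarrow> match_to e \<in> valid2 \<and> labels (match_to e) = labels e"
proof -
  assume e: "e \<in> valid2" "e \<in> match_sources"
  from match_to_matched[OF e(2)] obtain P a b R where *: "e = P @ [b,a] # R" "match_to e = P @ [a] # [b] # R" "a < b"
    by (rule matchedE)
  thus ?thesis using e by (auto simp: valid2_def valid_def)
qed

lemma bd_match_sources_sum:
  assumes A: "finite A" "A \<subseteq> match_sources"
  shows "bd (\<Sum>e\<in>A. qscale (\<alpha> e) (tri_basis e)) = (\<Sum>x\<in>match_to ` A. qscale (\<alpha> (the_inv_into match_sources match_to x)) (tri_basis x))"
proof -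
  have "bd (\<Sum>e\<in>A. qscale (\<alpha> e) (tri_basis e)) = (\<Sum>e\<in>A. qscale (\<alpha> e) (bd (tri_basis e)))"
    using A(1) by (induction A rule: finite_induct) (auto simp: bd_add bd_scale)
  also have "\<dots> = (\<Sum>e\<in>A. qscale (\<alpha> e) (tri_basis (match_to e)))"
    by (intro sum.cong refl arg_cong2[of _ _ _ _ qscale]) (use A vtri_match_sources match_to in fastforce)
  also have "\<dots> = (\<Sum>x\<in>match_to ` A. qscale (\<alpha> (the_inv_into match_sources match_to x)) (tri_basis x))"
    by (subst sum.reindex) (use A in \<open>auto intro: inj_on_subset[OF match_to_inj] intro!: sum.cong simp: the_inv_into_f_f[OF match_to_inj] subset_iff\<close>)
  finally show ?thesis .
qed

definition words_on :: "nat \<Rightarrow> nat set \<Rightarrow> (letter list \<times> nat set) set" where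
  "words_on k S = {(ls,D). word_on S ls D \<and> length ls = k}"

definition words :: "(letter list \<times> nat set) set" where
  "words = {(ls,D). \<exists>S. word_on S ls D}"

text \<open>A relation between classes of words says that a combination of the triangular basis at
  critical symbols is a boundary. By the matching, boundaries are combinations of the triangular
  basis at targets; these are disjoint from the critical symbols.\<close>
theorem word_class_coeffs_zero:
  assumes "finite W" "W \<subseteq> words" "(\<Sum>w\<in>W. hscale (c w) (case_prod word_class w)) = 0" "w \<in> W"
  shows "c w = 0"
proof -
  let ?z = "\<lambda>w. case_prod word_cycle w" and ?s = "\<lambda>w. case_prod word_symb w"
  have zc: "?z w \<in> cyc" "hclass (?z w) = case_prod word_class w" if "w \<in> W" for w
  proof -
    from that assms obtain ls D S where w: "w = (ls,D)" "word_on S ls D" by (cases w) (auto simp: words_def)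
    show "?z w \<in> cyc" "hclass (?z w) = case_prod word_class w"
      using word_cycle_leading[OF w(2)] by (auto simp: w(1) simp del: split_paired_Ex)
  qed
  have sv: "?s w \<in> valid2" "good None (?s w)" "tri_basis (?s w) = ?z w" if "w \<in> W" for w
  proof -
    from that assms obtain ls D S where w: "w = (ls,D)" "word_on S ls D" by (cases w) (auto simp: words_def)
    show "?s w \<in> valid2" "good None (?s w)" using word_cycle_leading[OF w(2)] kcell_sub(2) by (auto simp: w)
    thus "tri_basis (?s w) = ?z w" using word_of[OF w(2)] matched_not_good by (auto simp: tri_basis_def w)
  qed
  have inj: "inj_on ?s W"
  proof (rule inj_onI)
    fix w w' assume w: "w \<in> W" "w' \<in> W" "?s w = ?s w'"
    obtain ls D ls' D' where e: "w = (ls,D)" "w' = (ls',D')" by (cases w, cases w')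
    hence "(ls,D) \<in> words" "(ls',D') \<in> words" using w(1,2) assms(2) by blast+
    then obtain S S' where "word_on S ls D" "word_on S' ls' D'" unfolding words_def by blast
    with word_symb_inj[of ls D ls' D'] w(3) show "w = w'" by (simp add: e)
  qed
  let ?x = "\<Sum>w\<in>W. qscale (c w) (?z w)"
  have "?x \<in> cyc \<and> hclass ?x = (\<Sum>w\<in>W. hscale (c w) (hclass (?z w)))"
    by (rule hclass_sum) (rule zc(1))
  moreover have "(\<Sum>w\<in>W. hscale (c w) (hclass (?z w))) = 0"
    unfolding assms(3)[symmetric] by (intro sum.cong refl arg_cong2[of _ _ _ _ hscale] zc(2))
  ultimately have x: "?x \<in> cyc" "hclass ?x = hclass 0" by (simp_all only: hclass_zero)
  from x(2) have "?x - 0 \<in> bd ` C2" by (rule hclass_eq_iff[OF x(1) cyc_zero, THEN iffD1])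
  then obtain b where b: "?x = bd b" "b \<in> C2" unfolding diff_zero by (rule imageE)
  define \<S> where "\<S> = labels ` Poly_Mapping.keys b"
  (* The bounding chain may involve several label sets; all cells on these are a finite set closed
     under passing to lower terms. *)
  define A where "A = (\<Union>S\<in>\<S>. cell2 S)"
  have fA: "finite A" unfolding A_def \<S>_def by (auto intro!: finite_cell2)
  have "b \<in> fvec.span (tri_basis ` A)"
  proof (rule triangular_span[where r = "symb_less None", OF _ _ _ _ fA])
    have bv: "Poly_Mapping.keys b \<subseteq> valid2" using b by (simp add: C2_def)
    show "Poly_Mapping.keys b \<subseteq> A"
    proof
      fix e assume e: "e \<in> Poly_Mapping.keys b"
      with bv have "e \<in> cell2 (labels e)" by (auto simp: valid2_def valid_def cell2_def cell_def)
      thus "e \<in> A" using e by (auto simp: A_def \<S>_def)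
    qed
    fix e assume "e \<in> A"
    then obtain S where S: "S \<in> \<S>" "e \<in> cell2 S" by (auto simp: A_def)
    note vt = tri_basis_props[OF cell2_kcell[OF S(2)]]
    show "Poly_Mapping.lookup (tri_basis e) e \<noteq> 0" by (rule vt(1))
    have "kcell (card S - length e) S \<subseteq> A" using kcell_sub(1) S by (auto simp: A_def)
    with vt(2) show "Poly_Mapping.keys (tri_basis e) \<subseteq> A \<inter> insert e {y. symb_less None y e}" by blast
  qed (auto simp: symb_less_irrefl intro: symb_less_trans)
  from span_image_sum[OF fA this] obtain \<alpha> where \<alpha>: "b = (\<Sum>x\<in>A. qscale (\<alpha> x) (tri_basis x))" by blast
  have Av: "A \<subseteq> valid2" by (auto simp: A_def valid2_eq)
  have bx: "bd (tri_basis x) = 0" if x: "x \<in> A - match_sources" for x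
  proof -
    from x Av have "x \<in> cell2 (labels x)" by (auto simp: valid2_eq cell2_def cell_def)
    note cell2_kcell[OF this]
    from tri_basis_cyc(1)[OF this] x show ?thesis by (simp add: cyc_def)
  qed
  have "b = (\<Sum>x\<in>A - match_sources. qscale (\<alpha> x) (tri_basis x)) + (\<Sum>x\<in>A \<inter> match_sources. qscale (\<alpha> x) (tri_basis x))"
    unfolding \<alpha> using fA by (subst sum.union_disjoint[symmetric]) (auto intro!: sum.cong)
  moreover have "bd (\<Sum>x\<in>A - match_sources. qscale (\<alpha> x) (tri_basis x)) = 0"
  proof -
    have "bd (\<Sum>x\<in>B. qscale (\<alpha> x) (tri_basis x)) = 0" if "finite B" "B \<subseteq> A - match_sources" for B
      using that by (induction B rule: finite_induct) (use bx in \<open>auto simp: bd_add bd_scale\<close>)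
    thus ?thesis using fA by blast
  qed
  ultimately have xb: "?x = (\<Sum>x\<in>match_to ` (A \<inter> match_sources). qscale (\<alpha> (the_inv_into match_sources match_to x)) (tri_basis x))"
    using b(1) bd_match_sources_sum[of "A \<inter> match_sources" \<alpha>] fA by (simp add: bd_add)
  have xw: "?x = (\<Sum>x\<in>?s ` W. qscale (c (the_inv_into W ?s x)) (tri_basis x))"
    using sv by (subst sum.reindex[OF inj]) (auto intro!: sum.cong simp: the_inv_into_f_f[OF inj] comp_def)
  have dis: "match_to ` (A \<inter> match_sources) \<inter> ?s ` W = {}"
  proof -
    have "\<not> good None (match_to x)" if "x \<in> match_sources" for x
      using match_to_matched[OF that] matched_not_good by blast
    moreover have "good None (?s w)" if "w \<in> W" for w using sv(2)[OF that] .
    ultimately show ?thesis by (intro equals0I) (elim IntE imageE, metis IntD2)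
  qed
  define \<gamma> where "\<gamma> x = (if x \<in> ?s ` W then c (the_inv_into W ?s x) else - \<alpha> (the_inv_into match_sources match_to x))" for x
  have "(\<Sum>x\<in>?s ` W \<union> match_to ` (A \<inter> match_sources). qscale (\<gamma> x) (tri_basis x)) =
    (\<Sum>x\<in>?s ` W. qscale (\<gamma> x) (tri_basis x)) + (\<Sum>x\<in>match_to ` (A \<inter> match_sources). qscale (\<gamma> x) (tri_basis x))"
    by (rule sum.union_disjoint) (use fA assms(1) dis in auto)
  also have "(\<Sum>x\<in>?s ` W. qscale (\<gamma> x) (tri_basis x)) = ?x"
    unfolding xw by (intro sum.cong) (auto simp: \<gamma>_def)
  also have "(\<Sum>x\<in>match_to ` (A \<inter> match_sources). qscale (\<gamma> x) (tri_basis x)) = - ?x"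
  proof -
    have "\<gamma> x = - \<alpha> (the_inv_into match_sources match_to x)" if "x \<in> match_to ` (A \<inter> match_sources)" for x
      using dis that unfolding \<gamma>_def by (intro if_not_P) blast
    thus ?thesis unfolding xb sum_negf[symmetric] fvec.scale_minus_left[symmetric]
      by (intro sum.cong) simp_all
  qed
  finally have "(\<Sum>x\<in>?s ` W \<union> match_to ` (A \<inter> match_sources). qscale (\<gamma> x) (tri_basis x)) = 0" by simp
  moreover have "?s ` W \<union> match_to ` (A \<inter> match_sources) \<subseteq> valid2"
    using sv(1) match_to_valid2 Av by (intro Un_least image_subsetI) auto
  ultimately have "\<gamma> (?s w) = 0" using fA assms(1,4) by (intro tri_basis_coeffs_zero) auto
  thus ?thesis using assms(4) by (simp add: \<gamma>_def the_inv_into_f_f[OF inj])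
qed

text \<open>Expand a cycle in the triangular basis: the targets contribute boundaries, and the
  coefficients at the sources vanish because the images of those elements under the boundary are
  independent.\<close>
theorem H_span_word_class:
  assumes "finite S"
  shows "H k S \<subseteq> hm.span (case_prod word_class ` words_on k S)"
proof
  fix z assume "z \<in> H k S"
  then obtain c where c: "z = hclass c" "Poly_Mapping.keys c \<subseteq> {e \<in> cell2 S. card S - length e = k}" "bd c = 0"
    by (auto simp: H_def)
  have kc: "Poly_Mapping.keys c \<subseteq> kcell k S"
  proof
    fix e assume "e \<in> Poly_Mapping.keys c"
    with c have "e \<in> cell2 S" "card S - length e = k" by auto
    thus "e \<in> kcell k S" using cell2_kcell[of e S] by simp
  qed
  from tri_basis_span[OF assms kc] obtain \<alpha> where \<alpha>: "c = (\<Sum>x\<in>kcell k S. qscale (\<alpha> x) (tri_basis x))" by blast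
  let ?K = "kcell k S"
  have f: "finite ?K" using finite_cell2[OF assms] by (simp add: kcell_def)
  let ?c1 = "\<Sum>x\<in>?K - match_sources. qscale (\<alpha> x) (tri_basis x)"
  have c1: "?c1 \<in> cyc \<and> hclass ?c1 = (\<Sum>x\<in>?K - match_sources. hscale (\<alpha> x) (hclass (tri_basis x)))"
    by (rule hclass_sum) (use tri_basis_cyc in auto)
  have split: "c = ?c1 + (\<Sum>x\<in>?K \<inter> match_sources. qscale (\<alpha> x) (tri_basis x))"
    unfolding \<alpha> using f by (subst sum.union_disjoint[symmetric]) (auto intro!: sum.cong)
  hence "bd (\<Sum>x\<in>?K \<inter> match_sources. qscale (\<alpha> x) (tri_basis x)) = 0"
    using c(3) c1 by (simp add: bd_add cyc_def)
  hence *: "(\<Sum>x\<in>match_to ` (?K \<inter> match_sources). qscale (\<alpha> (the_inv_into match_sources match_to x)) (tri_basis x)) = 0"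
    using bd_match_sources_sum[of "?K \<inter> match_sources" \<alpha>] f by simp
  have mv: "match_to ` (?K \<inter> match_sources) \<subseteq> valid2" using match_to_valid2 kcell_sub(2)[of k S] by blast
  have z: "\<alpha> (the_inv_into match_sources match_to x) = 0" if "x \<in> match_to ` (?K \<inter> match_sources)" for x
    by (rule tri_basis_coeffs_zero[of "match_to ` (?K \<inter> match_sources)" "\<lambda>x. \<alpha> (the_inv_into match_sources match_to x)"])
       (use that f mv * in auto)
  have "\<alpha> x = 0" if "x \<in> ?K \<inter> match_sources" for x
    using z[OF imageI[OF that]] the_inv_into_f_f[OF match_to_inj, of x] that by simp
  hence "c = ?c1" unfolding split by simp
  hence "z = (\<Sum>x\<in>?K - match_sources. hscale (\<alpha> x) (hclass (tri_basis x)))" using c1 c(1) by simp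
  moreover have "hclass (tri_basis x) \<in> hm.span (case_prod word_class ` words_on k S)" if x: "x \<in> ?K - match_sources" for x
  proof (cases "x \<in> match_targets")
    case True
    thus ?thesis using tri_basis_cyc(2)[of x k S] x hclass_boundary by (auto simp: hm.span_zero)
  next
    case False
    with tri_basis_cyc(3)[of x k S] x obtain ls D where "word_on S ls D" "length ls = k" "tri_basis x = word_cycle ls D" by auto
    hence "hclass (tri_basis x) = case_prod word_class (ls,D)" "(ls,D) \<in> words_on k S"
      using word_cycle_leading[of S ls D] by (auto simp: words_on_def)
    thus ?thesis by (simp only: hm.span_base imageI)
  qed
  ultimately show "z \<in> hm.span (case_prod word_class ` words_on k S)"
    by (auto intro!: hm.span_sum hm.span_scale)
qed

section \<open>The concatenation product in homology\<close>

global_interpretation hp: vector_space_pair hscale hscale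
  by unfold_locales

abbreviation hlinear :: "(hmlg \<Rightarrow> hmlg) \<Rightarrow> bool" where
  "hlinear \<equiv> Vector_Spaces.linear hscale hscale"

lemma hlinearI: "(\<And>x y. f (x + y) = f x + f y) \<Longrightarrow> (\<And>q x. f (hscale q x) = hscale q (f x)) \<Longrightarrow> hlinear f"
  by (simp add: Vector_Spaces.linear_iff hm.vector_space_axioms)

lemma hlinear_add: "hlinear f \<Longrightarrow> f (x + y) = f x + f y"
  and hlinear_scale: "hlinear f \<Longrightarrow> f (hscale q x) = hscale q (f x)"
  and hlinear_zero: "hlinear f \<Longrightarrow> f 0 = 0"
  by (simp_all add: hp.linear_add hp.linear_scale hp.linear_0)

lemma hmlg_cases [case_names cyc]:
  obtains c where "c \<in> cyc" "x = hclass c"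
proof -
  have "hrel (rep_hmlg x) (rep_hmlg x)" by (rule Quotient_rep_reflp[OF Quotient_hmlg])
  thus ?thesis using Quotient_abs_rep[OF Quotient_hmlg, of x] that cyc_hrel by metis
qed

lemma hprod_add_left: "hprod (x + y) z = hprod x z + hprod y z"
  and hprod_add_right: "hprod z (x + y) = hprod z x + hprod z y"
  and hprod_scale_left: "hprod (hscale q x) y = hscale q (hprod x y)"
  and hprod_scale_right: "hprod x (hscale q y) = hscale q (hprod x y)"
  and hprod_assoc: "hprod (hprod x y) z = hprod x (hprod y z)"
  by (rule hmlg_cases[of x]; rule hmlg_cases[of y]; rule hmlg_cases[of z];
      simp add: hclass_cprod[symmetric] hclass_add[symmetric] hclass_scale[symmetric]
        cyc_add cyc_scale cyc_cprod cprod_lin cprod_assoc)+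

lemma hlinear_hprod: "hlinear (hprod x)" "hlinear (\<lambda>y. hprod y x)"
  by (auto intro!: hlinearI simp: hprod_add_left hprod_add_right hprod_scale_left hprod_scale_right)

lemma hprod_zero [simp]: "hprod 0 x = 0" "hprod x 0 = 0"
  using hlinear_zero[OF hlinear_hprod(1)] hlinear_zero[OF hlinear_hprod(2)] by auto

lemma sing_class_empty_left [simp]: "hprod (sing_class {}) x = x"
  and sing_class_empty_right [simp]: "hprod x (sing_class {}) = x"
  by (rule hmlg_cases[of x]; simp add: sing_class_def hclass_cprod[symmetric] singles_cyc[of "{}", simplified])+

section \<open>The homology of \<open>cell(S,2)\<close>\<close>

lemma H_I: "Poly_Mapping.keys c \<subseteq> kcell k S \<Longrightarrow> bd c = 0 \<Longrightarrow> hclass c \<in> H k S"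
  unfolding H_def kcell_def by force

lemma H_sing_class:
  assumes "z \<in> H k S"
  obtains c where "z = hclass c" "c \<in> cyc" "Poly_Mapping.keys c \<subseteq> kcell k S"
proof -
  from assms obtain c where c: "z = hclass c" "Poly_Mapping.keys c \<subseteq> {e \<in> cell2 S. card S - length e = k}" "bd c = 0"
    by (auto simp: H_def)
  have "Poly_Mapping.keys c \<subseteq> kcell k S"
    using c(2) cell2_kcell by blast
  moreover from this have "c \<in> cyc" using c(3) kcell_sub(2) by (auto simp: cyc_def C2_def)
  ultimately show ?thesis using that c(1) by blast
qed

lemma H_subspace: "hm.subspace (H k S)"
proof (rule hm.subspaceI)
  show "0 \<in> H k S" using H_I[of 0] by simp
  show "x + y \<in> H k S" if xy: "x \<in> H k S" "y \<in> H k S" for x y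
  proof -
    from xy obtain c d where *: "x = hclass c" "c \<in> cyc" "Poly_Mapping.keys c \<subseteq> kcell k S"
      "y = hclass d" "d \<in> cyc" "Poly_Mapping.keys d \<subseteq> kcell k S" by (metis H_sing_class)
    have "hclass (c + d) \<in> H k S"
      using * Poly_Mapping.keys_add[of c d] by (intro H_I) (auto simp: bd_add cyc_def)
    thus ?thesis using * by (simp add: hclass_add)
  qed
  show "hscale q x \<in> H k S" if x: "x \<in> H k S" for q x
  proof -
    from x obtain c where *: "x = hclass c" "c \<in> cyc" "Poly_Mapping.keys c \<subseteq> kcell k S" by (rule H_sing_class)
    have "hclass (qscale q c) \<in> H k S"
      using * by (intro H_I) (auto simp: bd_scale cyc_def in_keys_iff)
    thus ?thesis using * by (simp add: hclass_scale)
  qed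
qed

lemmas H_add = hm.subspace_add[OF H_subspace]
lemmas H_scale = hm.subspace_scale[OF H_subspace]
lemmas H_zero = hm.subspace_0[OF H_subspace]

lemma H_hprod:
  assumes "x \<in> H i S" "y \<in> H j T" "S \<inter> T = {}" "finite S" "finite T"
  shows "hprod x y \<in> H (i + j) (S \<union> T)"
proof -
  from assms(1,2) obtain c d where *: "x = hclass c" "c \<in> cyc" "Poly_Mapping.keys c \<subseteq> kcell i S"
      "y = hclass d" "d \<in> cyc" "Poly_Mapping.keys d \<subseteq> kcell j T" by (metis H_sing_class)
  have "hclass (cprod c d) \<in> H (i + j) (S \<union> T)"
  proof (rule H_I)
    show "Poly_Mapping.keys (cprod c d) \<subseteq> kcell (i + j) (S \<union> T)"
      by (rule keys_cprod[OF *(3,6)]) (rule kcell_append; use assms in simp)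
    show "bd (cprod c d) = 0" using cyc_cprod[OF *(2,5)] by (simp add: cyc_def)
  qed
  thus ?thesis using * by (simp add: hclass_cprod)
qed

lemma H_E0: "finite D \<Longrightarrow> sing_class D \<in> H 0 D"
  unfolding sing_class_def using singles_valid[of D] singles_cyc[of D] by (intro H_I) (auto simp: cyc_def)

lemma H_letter_class: "letter_ok l \<Longrightarrow> letter_class l \<in> H 1 (letter_labels l)"
  unfolding letter_class_def using keys_letter_cycle letter_cycle_cyc by (intro H_I) (auto simp: cyc_def)

lemma H_word_class: "word_on S ls D \<Longrightarrow> word_class ls D \<in> H (length ls) S"
proof (induction ls arbitrary: S)
  case Nil
  thus ?case by (simp add: word_class_def H_E0)
next
  case (Cons l ls)
  hence "hprod (letter_class l) (word_class ls D) \<in> H (1 + length ls) (letter_labels l \<union> (S - letter_labels l))"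
    by (intro H_hprod H_letter_class) (auto simp: letter_labels_finite)
  moreover have "letter_labels l \<union> (S - letter_labels l) = S" using Cons.prems by auto
  ultimately show ?case by (simp add: word_class_def)
qed

lemma H_eq_span: "finite S \<Longrightarrow> H k S = hm.span (case_prod word_class ` words_on k S)"
proof (rule equalityI)
  show "hm.span (case_prod word_class ` words_on k S) \<subseteq> H k S"
    by (rule hm.span_minimal[OF _ H_subspace]) (use H_word_class in \<open>auto simp: words_on_def\<close>)
qed (rule H_span_word_class)

text \<open>Independence of an indexed family covers injectivity, by taking a relation with two
  terms.\<close>
lemma family_inj_independent:
  assumes "\<And>W c w. finite W \<Longrightarrow> W \<subseteq> I \<Longrightarrow> (\<Sum>w\<in>W. hscale (c w) (f w)) = 0 \<Longrightarrow> w \<in> W \<Longrightarrow> c w = 0"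
  shows "inj_on f I" "hm.independent (f ` I)"
proof -
  show inj: "inj_on f I"
  proof (rule inj_onI, rule ccontr)
    fix x y assume *: "x \<in> I" "y \<in> I" "f x = f y" "x \<noteq> y"
    have "(\<Sum>w\<in>{x,y}. hscale (if w = x then 1 else - 1) (f w)) = 0"
      using * by simp
    from assms[OF _ _ this, of x] * show False by simp
  qed
  show "hm.independent (f ` I)"
  proof (rule ccontr)
    assume "\<not> hm.independent (f ` I)"
    then obtain T u where T: "finite T" "T \<subseteq> f ` I" "(\<Sum>v\<in>T. hscale (u v) v) = 0" "\<exists>v\<in>T. u v \<noteq> 0"
      unfolding hm.dependent_explicit by blast
    then obtain v where v: "v \<in> T" "u v \<noteq> 0" by blast
    from T(2) obtain W where W: "W \<subseteq> I" "T = f ` W" by (auto simp: subset_image_iff)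
    have injW: "inj_on f W" using inj W inj_on_subset by blast
    hence "finite W" using T W finite_imageD by blast
    moreover have "(\<Sum>w\<in>W. hscale (u (f w)) (f w)) = 0"
      using T(3) unfolding W(2) sum.reindex[OF injW] by simp
    ultimately show False using assms[of W "\<lambda>w. u (f w)"] W v by auto
  qed
qed

lemma word_class_inj: "inj_on (case_prod word_class) words"
  and word_class_independent: "hm.independent (case_prod word_class ` words)"
  using family_inj_independent[of words "case_prod word_class"] word_class_coeffs_zero by blast+

section \<open>Relabeling in homology\<close>

lemma crelabel_cyc: "c \<in> cyc \<Longrightarrow> crelabel f c \<in> cyc"
  using hrelabel.rsp unfolding cyc_hrel rel_fun_def by blast

lemma hrelabel_hclass: "c \<in> cyc \<Longrightarrow> hrelabel f (hclass c) = hclass (crelabel f c)"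
  by (simp add: hrelabel.abs_eq cyc_hrel)

lemma hrelabel_add: "hrelabel f (x + y) = hrelabel f x + hrelabel f y"
  and hrelabel_scale: "hrelabel f (hscale q x) = hscale q (hrelabel f x)"
  and hrelabel_hprod: "hrelabel f (hprod x y) = hprod (hrelabel f x) (hrelabel f y)"
  by (rule hmlg_cases[of x]; rule hmlg_cases[of y];
      simp add: hclass_add[symmetric] hclass_scale[symmetric] hclass_cprod[symmetric] cyc_add cyc_scale cyc_cprod
        hrelabel_hclass crelabel_cyc crelabel_add crelabel_scale crelabel_cprod)+

lemma hlinear_hrelabel: "hlinear (hrelabel f)"
  by (intro hlinearI hrelabel_add hrelabel_scale)

lemma rsymb_kcell: "e \<in> kcell k S \<Longrightarrow> inj_on f S \<Longrightarrow>
    rsymb f e = gen (map (map f) e) \<and> map (map f) e \<in> kcell k (f ` S)"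
proof -
  assume e: "e \<in> kcell k S" and f: "inj_on f S"
  have l: "labels e = S" using kcell_labels[OF e] .
  have d: "distinct (concat e)" "[] \<notin> set e" "\<forall>g\<in>set e. length g \<le> 2" "length e + k = card S"
    using e by (auto simp: kcell_def cell2_def cell_def)
  have "concat (map (map f) e) = map f (concat e)" by (simp add: map_concat)
  moreover have "distinct (map f (concat e))" using d(1) f l by (simp only: distinct_map simp_thms)
  moreover have "set (map f (concat e)) = f ` S" using l by (simp only: set_map)
  ultimately have "distinct (concat (map (map f) e))" "labels (map (map f) e) = f ` S" by (simp_all only:)
  moreover have "[] \<notin> set (map (map f) e)" "\<forall>g\<in>set (map (map f) e). length g \<le> 2"
    "length (map (map f) e) + k = card (f ` S)" using d card_image[OF f] by auto
  ultimately have "map (map f) e \<in> kcell k (f ` S)"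
    unfolding kcell_def cell2_def cell_def mem_Collect_eq by (intro conjI)
  moreover have "rsymb f e = gen (map (map f) e)" unfolding rsymb_def l using f by (rule if_P)
  ultimately show ?thesis by blast
qed

lemma crelabel_comp:
  assumes "Poly_Mapping.keys c \<subseteq> kcell k S" "inj_on f S" "inj_on g (f ` S)"
  shows "crelabel g (crelabel f c) = crelabel (g \<circ> f) c"
  using assms(1)
proof (induction c rule: fvec_induct)
  case (gen e)
  from rsymb_kcell[OF gen assms(2)] have 1: "rsymb f e = gen (map (map f) e)" "map (map f) e \<in> kcell k (f ` S)" by auto
  from rsymb_kcell[OF 1(2) assms(3)] rsymb_kcell[OF gen comp_inj_on[OF assms(2,3)]] 1
  show ?case by (simp add: comp_def)
qed (simp_all add: crelabel_add crelabel_scale)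

lemma crelabel_cong:
  assumes "Poly_Mapping.keys c \<subseteq> kcell k S" "\<And>x. x \<in> S \<Longrightarrow> f x = g x"
  shows "crelabel f c = crelabel g c"
  unfolding crelabel_def
proof (rule linext_cong)
  fix e assume "e \<in> Poly_Mapping.keys c"
  hence l: "labels e = S" using assms(1) kcell_labels by blast
  have "map (map f) e = map (map g) e" using l assms(2) by auto
  moreover have "inj_on f (labels e) = inj_on g (labels e)"
    unfolding l using assms(2) by (intro inj_on_cong) auto
  ultimately show "rsymb f e = rsymb g e" by (simp only: rsymb_def)
qed

lemma H_hrelabel: "z \<in> H k S \<Longrightarrow> inj_on f S \<Longrightarrow> hrelabel f z \<in> H k (f ` S)"
proof -
  assume z: "z \<in> H k S" and f: "inj_on f S"
  obtain c where c: "z = hclass c" "c \<in> cyc" "Poly_Mapping.keys c \<subseteq> kcell k S" using z by (rule H_sing_class)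
  have "Poly_Mapping.keys (crelabel f c) \<subseteq> kcell k (f ` S)"
    unfolding crelabel_def by (rule keys_linext[OF c(3)]) (use rsymb_kcell[OF _ f] in auto)
  hence "hclass (crelabel f c) \<in> H k (f ` S)"
    using crelabel_cyc[OF c(2)] by (intro H_I) (auto simp: cyc_def)
  thus ?thesis using c by (simp add: hrelabel_hclass)
qed

lemma hrelabel_comp: "z \<in> H k S \<Longrightarrow> inj_on f S \<Longrightarrow> inj_on g (f ` S) \<Longrightarrow>
    hrelabel g (hrelabel f z) = hrelabel (g \<circ> f) z"
  by (erule H_sing_class) (simp add: hrelabel_hclass crelabel_cyc crelabel_comp)

lemma hrelabel_cong: "z \<in> H k S \<Longrightarrow> (\<And>x. x \<in> S \<Longrightarrow> f x = g x) \<Longrightarrow> hrelabel f z = hrelabel g z"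
proof -
  assume z: "z \<in> H k S" and fg: "\<And>x. x \<in> S \<Longrightarrow> f x = g x"
  obtain c where c: "z = hclass c" "c \<in> cyc" "Poly_Mapping.keys c \<subseteq> kcell k S" using z by (rule H_sing_class)
  have "crelabel f c = crelabel g c" using c(3) fg by (rule crelabel_cong)
  thus ?thesis by (simp only: c(1) hrelabel_hclass[OF c(2)])
qed

lemma hrelabel_id: "z \<in> H k S \<Longrightarrow> (\<And>x. x \<in> S \<Longrightarrow> f x = x) \<Longrightarrow> hrelabel f z = z"
proof -
  assume z: "z \<in> H k S" and f: "\<And>x. x \<in> S \<Longrightarrow> f x = x"
  have "crelabel id c = c" if "Poly_Mapping.keys c \<subseteq> kcell k S" for c
    using that by (induction c rule: fvec_induct) (simp_all add: crelabel_add crelabel_scale rsymb_def)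
  hence "hrelabel id z = z" using z by (elim H_sing_class) (simp add: hrelabel_hclass)
  thus ?thesis using hrelabel_cong[OF z, of f id] f by simp
qed

section \<open>Singletons commute\<close>

definition sing_list_class :: "nat list \<Rightarrow> hmlg" where
  "sing_list_class xs = hclass (gen (map (\<lambda>i. [i]) xs))"

lemma sing_list_class_cyc: "distinct xs \<Longrightarrow> gen (map (\<lambda>i. [i]) xs) \<in> cyc"
  by (auto simp: cyc_def C2_def valid2_def valid_def concat_map_singleton)

lemma sing_list_class_append:
  assumes "distinct (xs @ ys)" shows "sing_list_class (xs @ ys) = hprod (sing_list_class xs) (sing_list_class ys)"
proof -
  have "set xs \<inter> set ys = {}" "distinct xs" "distinct ys" using assms by auto
  thus ?thesis unfolding sing_list_class_def
    by (simp add: hclass_cprod[symmetric] sing_list_class_cyc scat_def)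
qed

text \<open>The difference is the boundary of the two-element block.\<close>
lemma sing_list_class_swap: "a \<noteq> b \<Longrightarrow> sing_list_class [a,b] = sing_list_class [b,a]"
proof -
  assume ab: "a \<noteq> b"
  have "gen [[a,b]] \<in> C2" using ab by (auto simp: C2_def valid2_def valid_def)
  moreover have "gen [[a],[b]] - gen [[b],[a]] = bd (gen [[a,b]])"
    using ab by (simp add: bd_block_pair)
  ultimately have "gen [[a],[b]] - gen [[b],[a]] \<in> bd ` C2" by blast
  thus ?thesis using hclass_eq_iff[OF sing_list_class_cyc sing_list_class_cyc, of "[a,b]" "[b,a]"] ab by (simp add: sing_list_class_def)
qed

lemma sing_list_class_front:
  assumes "distinct xs" "a \<in> set xs" shows "sing_list_class xs = sing_list_class (a # remove1 a xs)"
  using assms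
proof (induction xs)
  case (Cons x xs)
  show ?case
  proof (cases "x = a")
    case False
    with Cons have d: "distinct (x # remove1 a xs)" "a \<notin> set (remove1 a xs)" "distinct (a # remove1 a xs)" "distinct xs"
      "a \<in> set xs" by auto
    have "sing_list_class (x # xs) = hprod (sing_list_class [x]) (sing_list_class (a # remove1 a xs))"
      using sing_list_class_append[of "[x]" xs] Cons.prems(1) Cons.IH[OF d(4,5)] by simp
    also have "\<dots> = sing_list_class ([x,a] @ remove1 a xs)"
      using sing_list_class_append[of "[x]" "a # remove1 a xs"] d False by simp
    also have "\<dots> = hprod (sing_list_class [a,x]) (sing_list_class (remove1 a xs))"
      using sing_list_class_append[of "[x,a]" "remove1 a xs"] d False sing_list_class_swap[of x a] by simp
    also have "\<dots> = sing_list_class (a # remove1 a (x # xs))"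
      using sing_list_class_append[of "[a,x]" "remove1 a xs"] d False by simp
    finally show ?thesis .
  qed simp
qed simp

lemma sing_list_class_perm: "distinct xs \<Longrightarrow> distinct ys \<Longrightarrow> set xs = set ys \<Longrightarrow> sing_list_class xs = sing_list_class ys"
proof (induction xs arbitrary: ys)
  case (Cons x xs)
  have "sing_list_class ys = sing_list_class ([x] @ remove1 x ys)" using sing_list_class_front[of ys x] Cons.prems by auto
  also have "\<dots> = hprod (sing_list_class [x]) (sing_list_class (remove1 x ys))" using Cons.prems by (intro sing_list_class_append) auto
  also have "sing_list_class (remove1 x ys) = sing_list_class xs" using Cons.prems by (intro Cons.IH[symmetric]) auto
  also have "hprod (sing_list_class [x]) (sing_list_class xs) = sing_list_class (x # xs)" using sing_list_class_append[of "[x]" xs] Cons.prems by simp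
  finally show ?case by simp
qed simp

lemma sing_class_sing_list_class: "finite S \<Longrightarrow> sing_class S = sing_list_class (rev (sorted_list_of_set S))"
  by (simp add: sing_class_def sing_list_class_def singles_def)

lemma sing_class_set: "distinct xs \<Longrightarrow> sing_class (set xs) = sing_list_class xs"
  unfolding sing_class_sing_list_class[OF finite_set] by (rule sing_list_class_perm) auto

lemma sing_class_union:
  assumes "finite S" "finite T" "S \<inter> T = {}"
  shows "hprod (sing_class S) (sing_class T) = sing_class (S \<union> T)"
proof -
  obtain xs ys where *: "set xs = S" "distinct xs" "set ys = T" "distinct ys"
    using assms finite_distinct_list by meson
  thus ?thesis using sing_class_set[of "xs @ ys"] sing_class_set[of xs] sing_class_set[of ys] sing_list_class_append[of xs ys] assms by simp
qed

lemma sing_class_union_left: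
  "finite S \<Longrightarrow> finite T \<Longrightarrow> S \<inter> T = {} \<Longrightarrow> hprod (sing_class S) (hprod (sing_class T) x) = hprod (sing_class (S \<union> T)) x"
  by (simp add: hprod_assoc[symmetric] sing_class_union)

lemma hrelabel_sing_class:
  assumes "finite S" "inj_on f S" shows "hrelabel f (sing_class S) = sing_class (f ` S)"
proof -
  obtain xs where xs: "set xs = S" "distinct xs" using assms finite_distinct_list by meson
  have "hrelabel f (sing_list_class xs) = sing_list_class (map f xs)"
    using xs assms unfolding sing_list_class_def
    by (simp add: hrelabel_hclass sing_list_class_cyc rsymb_def concat_map_singleton comp_def)
  thus ?thesis using sing_class_set[of xs] sing_class_set[of "map f xs"] xs assms by (simp add: distinct_map)
qed

section \<open>Inserting singletons between the factors of a product\<close>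

lemma word_class_simps [simp]: "word_class [] D = sing_class D" "word_class (l # ls) D = hprod (letter_class l) (word_class ls D)"
  by (simp_all add: word_class_def)

lemma H_linear_ext_word_class:
  assumes "finite S" "hlinear f" "hlinear g" "z \<in> H k S"
    "\<And>ls D. word_on S ls D \<Longrightarrow> length ls = k \<Longrightarrow> f (word_class ls D) = g (word_class ls D)"
  shows "f z = g z"
  by (rule hp.linear_eq_on_span[OF assms(2,3), of "case_prod word_class ` words_on k S"])
     (use assms H_eq_span[OF assms(1), of k] in \<open>auto simp: words_on_def\<close>)

text \<open>The set \<open>P i\<close> is inserted after the \<open>i\<close>-th letter, \<open>P
  0\<close> at the far left.\<close>
fun insert_word :: "(nat \<Rightarrow> nat set) \<Rightarrow> letter list \<Rightarrow> nat set \<Rightarrow> hmlg" where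
  "insert_word P [] D = hprod (sing_class (P 0)) (sing_class D)"
| "insert_word P (l # ls) D = hprod (sing_class (P 0)) (hprod (letter_class l) (insert_word (P \<circ> Suc) ls D))"

text \<open>Defined on the basis of words. Only the values on words are prescribed; they determine
  the map on each \<open>H k S\<close> with \<open>S\<close> finite.\<close>
definition insert_sing :: "(nat \<Rightarrow> nat set) \<Rightarrow> hmlg \<Rightarrow> hmlg" where
  "insert_sing P = (SOME f. hlinear f \<and> (\<forall>(ls,D)\<in>words. f (word_class ls D) = insert_word P ls D))"

lemma insert_sing_spec: "hlinear (insert_sing P) \<and> (\<forall>(ls,D)\<in>words. insert_sing P (word_class ls D) = insert_word P ls D)"
proof -
  obtain f where f: "hlinear f" "\<forall>x\<in>case_prod word_class ` words. f x = case_prod (insert_word P) (the_inv_into words (case_prod word_class) x)"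
    using hp.linear_independent_extend[OF word_class_independent,
        of "\<lambda>x. case_prod (insert_word P) (the_inv_into words (case_prod word_class) x)"] by blast
  have "f (word_class ls D) = insert_word P ls D" if "(ls,D) \<in> words" for ls D
  proof -
    have "f (case_prod word_class (ls,D)) = case_prod (insert_word P) (the_inv_into words (case_prod word_class) (case_prod word_class (ls,D)))"
      using f(2) that by blast
    also have "the_inv_into words (case_prod word_class) (case_prod word_class (ls,D)) = (ls,D)"
      by (rule the_inv_into_f_f[OF word_class_inj that])
    finally show ?thesis by simp
  qed
  with f(1) have "\<exists>f. hlinear f \<and> (\<forall>(ls,D)\<in>words. f (word_class ls D) = insert_word P ls D)" by blast
  thus ?thesis unfolding insert_sing_def by (rule someI_ex)
qed

lemma insert_sing_linear: "hlinear (insert_sing P)" using insert_sing_spec by blast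

lemma insert_sing_word_class: "word_on S ls D \<Longrightarrow> insert_sing P (word_class ls D) = insert_word P ls D"
proof -
  assume "word_on S ls D"
  hence "(ls,D) \<in> words" unfolding words_def by blast
  thus ?thesis using insert_sing_spec[of P] by blast
qed

lemmas hlinext_simps = hlinear_add[OF insert_sing_linear] hlinear_scale[OF insert_sing_linear] hprod_add_left hprod_add_right
  hprod_scale_left hprod_scale_right hrelabel_add hrelabel_scale

lemma insert_sing_letter:
  assumes "letter_ok l" "letter_labels l \<inter> V = {}" "finite V" "v \<in> H j V"
  shows "insert_sing P (hprod (letter_class l) v) = hprod (sing_class (P 0)) (hprod (letter_class l) (insert_sing (P \<circ> Suc) v))"
proof (rule H_linear_ext_word_class[OF assms(3) _ _ assms(4)])
  show "hlinear (\<lambda>v. insert_sing P (hprod (letter_class l) v))"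
    "hlinear (\<lambda>v. hprod (sing_class (P 0)) (hprod (letter_class l) (insert_sing (P \<circ> Suc) v)))"
    by (intro hlinearI; simp add: hlinext_simps)+
  fix ls D assume w: "word_on V ls D"
  have "letter_labels l \<union> V - letter_labels l = V" using assms by auto
  hence "word_on (letter_labels l \<union> V) (l # ls) D" using w assms letter_labels_finite[of l] by simp
  from insert_sing_word_class[OF this, of P] insert_sing_word_class[OF w] show "insert_sing P (hprod (letter_class l) (word_class ls D)) =
      hprod (sing_class (P 0)) (hprod (letter_class l) (insert_sing (P \<circ> Suc) (word_class ls D)))" by simp
qed

text \<open>A concatenation of one-dimensional classes \<open>b\<close> on label sets
  \<open>B\<close> with sets of singletons before, between and after them. Each entry of the list
  carries the set \<open>T\<close> of the singletons that follow it.\<close>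
fun spaced :: "nat set \<Rightarrow> (hmlg \<times> nat set \<times> nat set) list \<Rightarrow> hmlg" where
  "spaced S [] = sing_class S"
| "spaced S ((b,B,T) # l) = hprod (sing_class S) (hprod b (spaced T l))"

fun spaced_ok :: "nat set \<Rightarrow> nat set \<Rightarrow> (hmlg \<times> nat set \<times> nat set) list \<Rightarrow> bool" where
  "spaced_ok U S [] \<longleftrightarrow> finite U \<and> S = U"
| "spaced_ok U S ((b,B,T) # l) \<longleftrightarrow> finite U \<and> S \<subseteq> U \<and> B \<subseteq> U - S \<and> b \<in> H 1 B \<and> spaced_ok (U - S - B) T l"

fun add_slots :: "(nat \<Rightarrow> nat set) \<Rightarrow> (hmlg \<times> nat set \<times> nat set) list \<Rightarrow> (hmlg \<times> nat set \<times> nat set) list" where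
  "add_slots P [] = []"
| "add_slots P ((b,B,T) # l) = (b, B, T \<union> P (Suc 0)) # add_slots (P \<circ> Suc) l"

definition relabel_spaced :: "(nat \<Rightarrow> nat) \<Rightarrow> (hmlg \<times> nat set \<times> nat set) list \<Rightarrow> (hmlg \<times> nat set \<times> nat set) list" where
  "relabel_spaced f l = map (\<lambda>(b,B,T). (hrelabel f b, f ` B, f ` T)) l"

lemma relabel_spaced_simps [simp]: "relabel_spaced f [] = []" "relabel_spaced f ((b,B,T) # l) = (hrelabel f b, f ` B, f ` T) # relabel_spaced f l"
  by (simp_all add: relabel_spaced_def)

lemma length_relabel_spaced [simp]: "length (relabel_spaced f l) = length l"
  by (simp add: relabel_spaced_def)

lemma length_add_slots [simp]: "length (add_slots P l) = length l"
  by (induction P l rule: add_slots.induct) (auto simp: comp_def)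

definition slot_ok :: "nat \<Rightarrow> (nat \<Rightarrow> nat set) \<Rightarrow> nat set \<Rightarrow> bool" where
  "slot_ok k P U \<longleftrightarrow> (\<forall>i\<le>k. finite (P i) \<and> P i \<inter> U = {}) \<and> (\<forall>i\<le>k. \<forall>j\<le>k. i \<noteq> j \<longrightarrow> P i \<inter> P j = {})"

lemma slot_ok_Suc: "slot_ok (Suc k) P U \<Longrightarrow> slot_ok k (P \<circ> Suc) (U \<union> P 0)"
  unfolding slot_ok_def by (auto simp: Int_Un_distrib)

lemma slot_ok_mono: "slot_ok k P U \<Longrightarrow> V \<subseteq> U \<Longrightarrow> slot_ok k P V"
  unfolding slot_ok_def by blast

lemma spaced_ok_finite: "spaced_ok U S l \<Longrightarrow> finite U \<and> S \<subseteq> U \<and> finite S"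
  by (cases l) (auto elim: rev_finite_subset)

lemma spaced_sing_class_left:
  assumes "spaced_ok U T l" "finite D" "D \<inter> U = {}"
  shows "hprod (sing_class D) (spaced T l) = spaced (D \<union> T) l" "spaced_ok (D \<union> U) (D \<union> T) l"
proof -
  have T: "T \<subseteq> U" "finite T" "finite U" using spaced_ok_finite[OF assms(1)] by auto
  have "D \<inter> T = {}" using T assms by auto
  thus "hprod (sing_class D) (spaced T l) = spaced (D \<union> T) l"
    using assms T by (cases l) (auto simp: sing_class_union sing_class_union_left)
  show "spaced_ok (D \<union> U) (D \<union> T) l"
  proof (cases l)
    case (Cons x xs)
    obtain b B T' where x: "x = (b,B,T')" by (cases x)
    have "D \<union> U - (D \<union> T) - B = U - T - B" using assms by auto
    thus ?thesis using assms by (auto simp: Cons x)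
  qed (use assms in auto)
qed

lemma spaced_in_H: "spaced_ok U S l \<Longrightarrow> spaced S l \<in> H (length l) U"
proof (induction U S l rule: spaced_ok.induct)
  case (1 U S)
  thus ?case by (simp add: H_E0)
next
  case (2 U S b B T l)
  hence *: "finite U" "S \<subseteq> U" "B \<subseteq> U - S" "b \<in> H 1 B" "spaced T l \<in> H (length l) (U - S - B)" by auto
  have f: "finite S" "finite B" using * by (auto intro: finite_subset)
  have "hprod (sing_class S) (hprod b (spaced T l)) \<in> H (0 + (1 + length l)) (S \<union> (B \<union> (U - S - B)))"
    by (intro H_hprod H_E0) (use * f in auto)
  moreover have "S \<union> (B \<union> (U - S - B)) = U" using * by auto
  ultimately show ?case by simp
qed

lemma slot_set_eqs:
  fixes U :: "nat set"
  assumes "S \<subseteq> U" "B \<subseteq> U - S" "P \<inter> U = {}" "X \<inter> (U \<union> P) = {}"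
  shows "U \<union> (P \<union> X) - (S \<union> P) - B = U - S - B \<union> X" "S \<union> P \<subseteq> U \<union> (P \<union> X)"
    "B \<subseteq> U \<union> (P \<union> X) - (S \<union> P)"
  using assms by auto

lemma add_slots_spaced_ok:
  "spaced_ok U S l \<Longrightarrow> slot_ok (length l) P U \<Longrightarrow> spaced_ok (U \<union> (\<Union>i\<le>length l. P i)) (S \<union> P 0) (add_slots P l)"
proof (induction U S l arbitrary: P rule: spaced_ok.induct)
  case (1 U S)
  thus ?case by (auto simp: slot_ok_def)
next
  case (2 U S b B T l)
  let ?V = "U - S - B" and ?Q = "P \<circ> Suc"
  have w: "spaced_ok ?V T l" using 2 by simp
  have s: "slot_ok (length l) ?Q ?V"
    using slot_ok_Suc[of "length l" P U] 2(3) by (auto intro: slot_ok_mono)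
  from 2(1)[OF _ s] 2(2) have IH: "spaced_ok (?V \<union> (\<Union>i\<le>length l. ?Q i)) (T \<union> P (Suc 0)) (add_slots ?Q l)" by (simp add: comp_def)
  have e: "(\<Union>i\<le>Suc (length l). P i) = P 0 \<union> (\<Union>i\<le>length l. ?Q i)"
    by (simp add: atMost_Suc_eq_insert_0 comp_def)
  have d: "P 0 \<inter> U = {}" "\<And>i. i \<le> length l \<Longrightarrow> P (Suc i) \<inter> (U \<union> P 0) = {}" "\<And>i. i \<le> Suc (length l) \<Longrightarrow> finite (P i)"
    using slot_ok_Suc[of "length l" P U] 2(3) by (auto simp: slot_ok_def)
  let ?X = "\<Union>i\<le>Suc (length l). P i"
  have dQ: "(\<Union>i\<le>length l. ?Q i) \<inter> (U \<union> P 0) = {}" using d(2) by (auto simp: comp_def)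
  have SB: "S \<subseteq> U" "B \<subseteq> U - S" "b \<in> H 1 B" "finite U" using 2(2) by auto
  note eqs = slot_set_eqs[OF SB(1,2) d(1) dQ]
  have eqn: "U \<union> ?X - (S \<union> P 0) - B = ?V \<union> (\<Union>i\<le>length l. ?Q i)"
    unfolding e by (rule eqs(1))
  have c: "finite (U \<union> ?X)" using d(3) SB(4) by auto
  have c2: "S \<union> P 0 \<subseteq> U \<union> ?X" "B \<subseteq> U \<union> ?X - (S \<union> P 0)" unfolding e by (rule eqs)+
  have "spaced_ok (U \<union> ?X) (S \<union> P 0) ((b,B,T \<union> P (Suc 0)) # add_slots ?Q l)"
    unfolding spaced_ok.simps eqn by (intro conjI c c2 SB(3) IH)
  thus ?case by (simp only: add_slots.simps list.size add_Suc_right add_0_right)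
qed

text \<open>The formula that defines the insertion on words holds for all one-dimensional factors.
  By linearity the first factor may be taken to be a word with one letter; the singletons after
  that letter then move to the next slot, where they commute with the ones that are there.\<close>
theorem insert_sing_spaced:
  "spaced_ok U S l \<Longrightarrow> slot_ok (length l) P U \<Longrightarrow> insert_sing P (spaced S l) = spaced (S \<union> P 0) (add_slots P l)"
proof (induction l arbitrary: U S P)
  case Nil
  hence "word_on S [] S" and *: "finite S" "finite (P 0)" "P 0 \<inter> S = {}" by (simp_all add: slot_ok_def)
  from insert_sing_word_class[OF this(1), of P] sing_class_union[OF *(2,1,3)] show ?case
    by (simp only: word_class_simps insert_word.simps spaced.simps add_slots.simps Un_commute)
next
  case (Cons x l)
  obtain b B T where x: "x = (b,B,T)" by (cases x)
  have *: "finite U" "S \<subseteq> U" "B \<subseteq> U - S" "b \<in> H 1 B" "spaced_ok (U - S - B) T l" using Cons.prems by (auto simp: x)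
  have fin: "finite S" "finite B" "finite (P 0)" "finite (P (Suc 0))"
  proof -
    show "finite S" using *(1,2) by (rule rev_finite_subset)
    have "B \<subseteq> U" using *(3) by blast
    with *(1) show "finite B" by (rule rev_finite_subset)
    show "finite (P 0)" "finite (P (Suc 0))" using Cons.prems(2) by (simp_all add: slot_ok_def)
  qed
  let ?v = "spaced T l" and ?v' = "spaced (T \<union> P (Suc 0)) (add_slots (P \<circ> Suc) l)"
  have s: "slot_ok (length l) (P \<circ> Suc) (U \<union> P 0)" using slot_ok_Suc Cons.prems(2) by simp
  have x1: "hprod (sing_class S) b \<in> H 1 (S \<union> B)"
  proof -
    have "S \<inter> B = {}" using *(3) by auto
    from H_hprod[OF H_E0[OF fin(1)] *(4) this fin(1,2)] show ?thesis by simp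
  qed
  have "insert_sing P (hprod (hprod (sing_class S) b) ?v) = hprod (sing_class (P 0)) (hprod (hprod (sing_class S) b) ?v')"
  proof (rule H_linear_ext_word_class[OF _ _ _ x1])
    show "finite (S \<union> B)" using fin by simp
    show "hlinear (\<lambda>x. insert_sing P (hprod x ?v))" "hlinear (\<lambda>x. hprod (sing_class (P 0)) (hprod x ?v'))"
      by (intro hlinearI; simp add: hlinext_simps)+
    fix ls D assume w: "word_on (S \<union> B) ls D" "length ls = 1"
    then obtain l' where l': "ls = [l']" by (auto simp: length_Suc_conv)
    have w': "letter_ok l'" "letter_labels l' \<subseteq> S \<union> B" "D = S \<union> B - letter_labels l'" using w by (auto simp: l')
    have D: "D \<inter> (U - S - B) = {}" "finite D" using w' fin by auto
    have Q: "(P \<circ> Suc) 0 = P (Suc 0)" by simp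
    have sV: "slot_ok (length l) (P \<circ> Suc) (D \<union> (U - S - B))"
      by (rule slot_ok_mono[OF s]) (use w' * in auto)
    note a = spaced_sing_class_left[OF *(5) D(2,1)]
    have lv: "letter_labels l' \<inter> (D \<union> (U - S - B)) = {}" using w' by auto
    have fV: "finite (D \<union> (U - S - B))" using D * by simp
    have "hprod (word_class ls D) ?v = hprod (letter_class l') (spaced (D \<union> T) l)"
      by (simp add: l' hprod_assoc a(1))
    hence "insert_sing P (hprod (word_class ls D) ?v) = hprod (sing_class (P 0)) (hprod (letter_class l') (insert_sing (P \<circ> Suc) (spaced (D \<union> T) l)))"
      using insert_sing_letter[OF w'(1) lv fV spaced_in_H[OF a(2)]] by simp
    also have "insert_sing (P \<circ> Suc) (spaced (D \<union> T) l) = spaced (D \<union> T \<union> P (Suc 0)) (add_slots (P \<circ> Suc) l)"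
      using Cons.IH[OF a(2) sV] by (simp add: comp_def)
    also have "\<dots> = hprod (sing_class D) ?v'"
    proof -
      have s2: "slot_ok (length l) (P \<circ> Suc) (U - S - B)" by (rule slot_ok_mono[OF s]) auto
      from add_slots_spaced_ok[OF *(5) s2] have "spaced_ok (U - S - B \<union> (\<Union>i\<le>length l. (P \<circ> Suc) i)) (T \<union> P (Suc 0)) (add_slots (P \<circ> Suc) l)" by simp
      moreover have "D \<inter> (U - S - B \<union> (\<Union>i\<le>length l. (P \<circ> Suc) i)) = {}"
      proof -
        have "P (Suc i) \<inter> D = {}" if "i \<le> length l" for i using sV that unfolding slot_ok_def comp_def by blast
        thus ?thesis using D by auto
      qed
      ultimately show ?thesis using spaced_sing_class_left(1)[OF _ D(2)] by (simp only: Un_assoc)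
    qed
    finally show "insert_sing P (hprod (word_class ls D) ?v) = hprod (sing_class (P 0)) (hprod (word_class ls D) ?v')"
      by (simp add: l' hprod_assoc)
  qed
  moreover have "P 0 \<inter> U = {}" using Cons.prems(2) unfolding slot_ok_def by blast
  hence "P 0 \<inter> S = {}" using *(2) by blast
  from sing_class_union_left[OF fin(3,1) this] have "hprod (sing_class (P 0)) (hprod (hprod (sing_class S) b) ?v') = hprod (sing_class (S \<union> P 0)) (hprod b ?v')"
    by (simp only: hprod_assoc Un_commute)
  moreover have "insert_sing P (spaced S (x # l)) = insert_sing P (hprod (hprod (sing_class S) b) ?v)"
    by (simp only: x spaced.simps hprod_assoc)
  ultimately show ?case by (simp only: x spaced.simps add_slots.simps)
qed

lemma word_class_spaced: "word_on S ls D \<Longrightarrow> \<exists>T l. spaced_ok S T l \<and> length l = length ls \<and> spaced T l = word_class ls D"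
proof (induction ls arbitrary: S)
  case Nil
  thus ?case by (intro exI[of _ D] exI[of _ "[]"]) auto
next
  case (Cons a ls)
  hence *: "letter_ok a" "letter_labels a \<subseteq> S" "finite S" "word_on (S - letter_labels a) ls D" by auto
  from Cons.IH[OF *(4)] obtain T l where "spaced_ok (S - letter_labels a) T l" "length l = length ls" "spaced T l = word_class ls D" by blast
  thus ?case using * H_letter_class[OF *(1)]
    by (intro exI[of _ "{}"] exI[of _ "(letter_class a, letter_labels a, T) # l"]) simp
qed

text \<open>Words are a special case of concatenations with spaces.\<close>
lemma H_linear_ext:
  assumes "finite S" "hlinear f" "hlinear g" "z \<in> H k S"
    "\<And>T l. spaced_ok S T l \<Longrightarrow> length l = k \<Longrightarrow> f (spaced T l) = g (spaced T l)"
  shows "f z = g z"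
proof (rule H_linear_ext_word_class[OF assms(1-4)])
  fix ls D assume "word_on S ls D" "length ls = k"
  with word_class_spaced[OF this(1)] obtain T l where w: "spaced_ok S T l" "length l = k" "spaced T l = word_class ls D" by blast
  with assms(5)[OF w(1,2)] show "f (word_class ls D) = g (word_class ls D)" by simp
qed

lemma insert_sing_in_H:
  assumes "finite S" "z \<in> H k S" "slot_ok k P S"
  shows "insert_sing P z \<in> H k (S \<union> (\<Union>i\<le>k. P i))"
proof -
  have "z \<in> hm.span (case_prod word_class ` words_on k S)" using assms H_eq_span by auto
  thus ?thesis
  proof (induction rule: hm.span_induct_alt)
    case base
    show ?case using H_zero hlinear_zero[OF insert_sing_linear] by simp
  next
    case (step q x y)
    then obtain ls D where x: "x = word_class ls D" "word_on S ls D" "length ls = k" by (auto simp: words_on_def)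
    from word_class_spaced[OF x(2)] obtain T l where w: "spaced_ok S T l" "length l = k" "spaced T l = x" using x by auto
    have "insert_sing P x \<in> H k (S \<union> (\<Union>i\<le>k. P i))"
      using insert_sing_spaced[OF w(1)] spaced_in_H[OF add_slots_spaced_ok[OF w(1)]] assms(3) w by simp
    thus ?case using step(2) by (simp add: hlinear_add[OF insert_sing_linear] hlinear_scale[OF insert_sing_linear] H_add H_scale)
  qed
qed

lemma hrelabel_spaced:
  assumes "spaced_ok U S l" "inj_on f U"
  shows "hrelabel f (spaced S l) = spaced (f ` S) (relabel_spaced f l)" "spaced_ok (f ` U) (f ` S) (relabel_spaced f l)"
proof -
  have "hrelabel f (spaced S l) = spaced (f ` S) (relabel_spaced f l) \<and> spaced_ok (f ` U) (f ` S) (relabel_spaced f l)"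
    using assms
  proof (induction U S l rule: spaced_ok.induct)
    case (1 U S)
    thus ?case by (simp add: hrelabel_sing_class)
  next
    case (2 U S b B T l)
    hence *: "finite U" "S \<subseteq> U" "B \<subseteq> U - S" "b \<in> H 1 B" "spaced_ok (U - S - B) T l" by auto
    have i: "inj_on f (U - S - B)" "inj_on f S" "inj_on f B"
      by (rule inj_on_subset[OF 2(3)]; use * in blast)+
    have BU: "B \<subseteq> U" using * by blast
    have e: "f ` U - f ` S - f ` B = f ` (U - S - B)"
      using inj_on_image_set_diff[OF 2(3), of U S] inj_on_image_set_diff[OF 2(3), of "U - S" B] * BU by auto
    have "f ` B \<subseteq> f ` U - f ` S"
      using inj_on_image_set_diff[OF 2(3), of U S] * by blast
    moreover have "finite S" using *(1,2) by (rule rev_finite_subset)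
    ultimately show ?case using 2(1)[OF *(5) i(1)] * i H_hrelabel[OF *(4) i(3)]
      by (auto simp: hrelabel_hprod hrelabel_sing_class e)
  qed
  thus "hrelabel f (spaced S l) = spaced (f ` S) (relabel_spaced f l)" "spaced_ok (f ` U) (f ` S) (relabel_spaced f l)" by auto
qed

lemma add_slots_relabel_spaced_comp:
  assumes "spaced_ok U S l" "inj_on f' U" "inj_on f (f' ` U)"
  shows "add_slots P (relabel_spaced f (add_slots P' (relabel_spaced f' l))) = add_slots (\<lambda>i. f ` P' i \<union> P i) (relabel_spaced (f \<circ> f') l)"
  using assms
proof (induction U S l arbitrary: P P' rule: spaced_ok.induct)
  case (2 U S b B T l)
  hence *: "B \<subseteq> U" "b \<in> H 1 B" "spaced_ok (U - S - B) T l" by auto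
  have i: "inj_on f' (U - S - B)" "inj_on f' B"
    by (rule inj_on_subset[OF 2(3)]; use * in blast)+
  have i2: "inj_on f (f' ` (U - S - B))" "inj_on f (f' ` B)"
    by (rule inj_on_subset[OF 2(4)]; use * in blast)+
  have "hrelabel f (hrelabel f' b) = hrelabel (f \<circ> f') b" using hrelabel_comp[OF *(2) i(2) i2(2)] .
  moreover have "(\<lambda>i. f ` P' i \<union> P i) \<circ> Suc = (\<lambda>i. f ` (P' \<circ> Suc) i \<union> (P \<circ> Suc) i)" by (simp add: comp_def)
  ultimately show ?case using 2(1)[OF *(3) i(1) i2(1), of "P \<circ> Suc" "P' \<circ> Suc"]
    by (simp add: image_Un image_comp Un_assoc comp_def)
qed simp

text \<open>The map that a morphism with injection \<open>f\<close> induces when the new labels in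
  \<open>P i\<close> have the color of \<open>[\<iota>\<^sub>i]\<close>.\<close>
definition relabel_insert :: "(nat \<Rightarrow> nat) \<Rightarrow> (nat \<Rightarrow> nat set) \<Rightarrow> hmlg \<Rightarrow> hmlg" where
  "relabel_insert f P z = insert_sing P (hrelabel f z)"

lemma relabel_insert_linear: "hlinear (relabel_insert f P)"
  unfolding relabel_insert_def by (intro hlinearI; simp add: hlinext_simps)

lemma relabel_insert_spaced:
  assumes "spaced_ok U S l" "inj_on f U" "slot_ok (length l) P (f ` U)"
  shows "relabel_insert f P (spaced S l) = spaced (f ` S \<union> P 0) (add_slots P (relabel_spaced f l))"
  unfolding relabel_insert_def using hrelabel_spaced[OF assms(1,2)] insert_sing_spaced[of "f ` U" "f ` S" "relabel_spaced f l" P] assms(3) by simp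

lemma relabel_insert_in_H:
  assumes "finite S" "z \<in> H k S" "inj_on f S" "slot_ok k P (f ` S)"
  shows "relabel_insert f P z \<in> H k (f ` S \<union> (\<Union>i\<le>k. P i))"
  unfolding relabel_insert_def using assms by (intro insert_sing_in_H H_hrelabel) auto

lemma slot_ok_comp:
  assumes "slot_ok k P' (f' ` S)" "S' = f' ` S \<union> (\<Union>i\<le>k. P' i)"
    "inj_on f S'" "slot_ok k P (f ` S')"
  shows "slot_ok k (\<lambda>i. f ` P' i \<union> P i) ((f \<circ> f') ` S)"
  unfolding slot_ok_def
proof (intro conjI allI impI)
  have sub: "f' ` S \<subseteq> S'" "\<And>i. i \<le> k \<Longrightarrow> P' i \<subseteq> S'" using assms(2) by auto
  have img: "f ` A \<inter> f ` B = {}" if "A \<inter> B = {}" "A \<subseteq> S'" "B \<subseteq> S'" for A B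
    using inj_on_image_Int[OF assms(3) that(2,3)] that(1) by simp
  have P: "P i \<inter> f ` A = {}" if "i \<le> k" "A \<subseteq> S'" for i A
    using assms(4) that by (auto simp: slot_ok_def)
  fix i assume i: "i \<le> k"
  show "finite (f ` P' i \<union> P i)" using assms i by (auto simp: slot_ok_def)
  have "P' i \<inter> f' ` S = {}" using assms(1) i by (auto simp: slot_ok_def)
  from img[OF this sub(2)[OF i] sub(1)] P[OF i sub(1)] show "(f ` P' i \<union> P i) \<inter> (f \<circ> f') ` S = {}"
    unfolding image_comp[symmetric] Int_Un_distrib2 by simp
  fix j assume j: "j \<le> k" "i \<noteq> j"
  have 1: "P' i \<inter> P' j = {}" "P i \<inter> P j = {}" using assms(1,4) i j by (simp_all add: slot_ok_def)
  from img[OF 1(1) sub(2)[OF i] sub(2)[OF j(1)]] P[OF i sub(2)[OF j(1)]] P[OF j(1) sub(2)[OF i]] 1(2)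
  show "(f ` P' i \<union> P i) \<inter> (f ` P' j \<union> P j) = {}"
    unfolding Int_Un_distrib Int_Un_distrib2 by (simp add: Int_commute)
qed

text \<open>Functoriality: on concatenations with spaces both sides insert the same sets in the
  same slots.\<close>
theorem relabel_insert_comp:
  assumes "finite S" "z \<in> H k S" "inj_on f' S" "slot_ok k P' (f' ` S)" "S' = f' ` S \<union> (\<Union>i\<le>k. P' i)"
    "inj_on f S'" "slot_ok k P (f ` S')"
  shows "relabel_insert f P (relabel_insert f' P' z) = relabel_insert (f \<circ> f') (\<lambda>i. f ` P' i \<union> P i) z"
proof (rule H_linear_ext[OF assms(1) _ _ assms(2)])
  show "hlinear (\<lambda>z. relabel_insert f P (relabel_insert f' P' z))" "hlinear (relabel_insert (f \<circ> f') (\<lambda>i. f ` P' i \<union> P i))"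
    by (intro hlinearI; simp add: hlinear_add[OF relabel_insert_linear] hlinear_scale[OF relabel_insert_linear])+
  fix T l assume w: "spaced_ok S T l" "length l = k"
  have s: "slot_ok k (\<lambda>i. f ` P' i \<union> P i) ((f \<circ> f') ` S)" by (rule slot_ok_comp[OF assms(4-7)])
  have i: "inj_on f (f' ` S)" "inj_on (f \<circ> f') S"
    by (rule inj_on_subset[OF assms(6)], use assms(5) in blast,
        rule comp_inj_on[OF assms(3)], rule inj_on_subset[OF assms(6)], use assms(5) in blast)
  have "spaced_ok S' (f' ` T \<union> P' 0) (add_slots P' (relabel_spaced f' l))"
    using add_slots_spaced_ok[OF hrelabel_spaced(2)[OF w(1) assms(3)], of P'] assms(4,5) w by simp
  moreover have "relabel_insert f' P' (spaced T l) = spaced (f' ` T \<union> P' 0) (add_slots P' (relabel_spaced f' l))"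
    using relabel_insert_spaced[OF w(1) assms(3)] assms(4) w by simp
  ultimately have "relabel_insert f P (relabel_insert f' P' (spaced T l)) = spaced (f ` (f' ` T \<union> P' 0) \<union> P 0) (add_slots P (relabel_spaced f (add_slots P' (relabel_spaced f' l))))"
    using relabel_insert_spaced[of S' _ _ f P] assms(6,7) w by simp
  also have "\<dots> = spaced ((f \<circ> f') ` T \<union> (f ` P' 0 \<union> P 0)) (add_slots (\<lambda>i. f ` P' i \<union> P i) (relabel_spaced (f \<circ> f') l))"
    using add_slots_relabel_spaced_comp[OF w(1) assms(3) i(1)] by (simp add: image_Un image_comp Un_assoc)
  also have "\<dots> = relabel_insert (f \<circ> f') (\<lambda>i. f ` P' i \<union> P i) (spaced T l)"
    using relabel_insert_spaced[OF w(1) i(2)] s w by simp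
  finally show "relabel_insert f P (relabel_insert f' P' (spaced T l)) = relabel_insert (f \<circ> f') (\<lambda>i. f ` P' i \<union> P i) (spaced T l)" .
qed

lemma hrelabel_relabel_insert: "finite S \<Longrightarrow> z \<in> H k S \<Longrightarrow> inj_on f S \<Longrightarrow> hrelabel f z = relabel_insert f (\<lambda>_. {}) z"
proof (rule H_linear_ext[of S _ _ z k])
  assume f: "inj_on f S"
  fix T l assume w: "spaced_ok S T l"
  have "add_slots (\<lambda>_. {}) l = l" for l
  proof (induction l)
    case (Cons x l) thus ?case by (cases x) (simp add: comp_def)
  qed simp
  thus "hrelabel f (spaced T l) = relabel_insert f (\<lambda>_. {}) (spaced T l)"
    using relabel_insert_spaced[OF w f, of "\<lambda>_. {}"] hrelabel_spaced(1)[OF w f] by (simp add: slot_ok_def)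
qed (auto intro: hlinear_hrelabel relabel_insert_linear)

section \<open>Critical symbols and high insertion\<close>

lemma piece_cases:
  assumes "piece p"
  obtains i where "p = [[i]]" | a b where "p = [[a,b]]" "a < b"
  | a b c where "p = [[a],[c,b]]" "a < b" "b < c"
  using assms unfolding piece_def barrier_def by blast

lemma piece_single: "piece [[i]]" "\<not> barrier [[i]]"
  by (simp_all add: piece_def barrier_def)

lemma piece_hd:
  assumes "piece p" "p @ r = [c,b] # s" shows "c < b"
  by (rule piece_cases[OF assms(1)]) (use assms(2) in auto)

text \<open>If one sequence continues with the singleton \<open>a\<close> and the other one with a
  barrier \<open>a|c b\<close>, then the former goes on with the decreasing block \<open>c
  b\<close>, with which no piece starts.\<close>
lemma pieces_unique:
  "\<forall>p\<in>set ps. piece p \<Longrightarrow> \<forall>q\<in>set qs. piece q \<Longrightarrow> concat ps = concat qs \<Longrightarrow> ps = qs"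
proof (induction ps arbitrary: qs)
  case Nil
  then show ?case by (cases qs) (auto elim: piece_cases)
next
  case (Cons p ps)
  have p: "piece p" and ps: "\<forall>p\<in>set ps. piece p" using Cons.prems by auto
  have "qs \<noteq> []" using Cons.prems(3) p by (auto elim: piece_cases)
  then obtain q qs' where qs: "qs = q # qs'" by (cases qs) auto
  have q: "piece q" and qs': "\<forall>p\<in>set qs'. piece p" using Cons.prems qs by auto
  have eq: "p @ concat ps = q @ concat qs'" using Cons.prems(3) qs by simp
  have no: "\<not> b < c" if "concat rs = [c,b] # s" "\<forall>p\<in>set rs. piece p" for rs :: "symb list" and c b s
    using that by (cases rs) (auto dest: piece_hd)
  have "p = q"
    by (rule piece_cases[OF p]; rule piece_cases[OF q]) (use eq no[OF _ ps] no[OF _ qs'] no[OF sym ps] no[OF sym qs'] in auto)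
  moreover have "ps = qs'" using Cons.IH[OF ps qs'] eq \<open>p = q\<close> by simp
  ultimately show ?case using qs by simp
qed

lemma pieces_concat: "\<forall>p\<in>set ps. piece p \<Longrightarrow> pieces (concat ps) = ps"
  unfolding pieces_def by (rule the_equality) (use pieces_unique in blast)+

text \<open>The decompositions into pieces of runs, letters and words.\<close>
definition sing_pieces :: "nat set \<Rightarrow> symb list" where
  "sing_pieces D = map (\<lambda>g. [g]) (singles D)"

definition letter_pieces :: "letter \<Rightarrow> symb list" where
  "letter_pieces = (\<lambda>(D,u,v). if u < v then sing_pieces D @ [[[u,v]]] else sing_pieces (D - {Min D}) @ [[[Min D],[u,v]]])"

definition word_pieces :: "letter list \<Rightarrow> nat set \<Rightarrow> symb list" where
  "word_pieces ls D = concat (map letter_pieces ls) @ sing_pieces D"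

lemma sing_pieces_pieces: "p \<in> set (sing_pieces D) \<Longrightarrow> piece p \<and> \<not> barrier p"
  by (auto simp: sing_pieces_def singles_def piece_single)

lemma concat_sing_pieces: "concat (sing_pieces D) = singles D"
  by (simp add: sing_pieces_def concat_map_singleton)

lemma letter_ok_barrier:
  assumes "letter_ok (D,u,v)" "\<not> u < v"
  shows "Min D < v" "v < u" "finite D" "D \<noteq> {}" "singles D = singles (D - {Min D}) @ [[Min D]]"
  using assms by (auto simp: letter_ok_def intro: singles_Min)

lemma letter_pieces_props:
  assumes "letter_ok l"
  shows "concat (letter_pieces l) = letter_symb l" "\<forall>p\<in>set (letter_pieces l). piece p" "\<exists>ps b. letter_pieces l = ps @ [b] \<and> barrier b \<and> (\<forall>p\<in>set ps. \<not> barrier p)"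
proof -
  obtain D u v where l: "l = (D,u,v)" by (cases l)
  have "concat (letter_pieces l) = letter_symb l \<and> (\<forall>p\<in>set (letter_pieces l). piece p) \<and> (\<exists>ps b. letter_pieces l = ps @ [b] \<and> barrier b \<and> (\<forall>p\<in>set ps. \<not> barrier p))"
  proof (cases "u < v")
    case True
    hence "barrier [[u,v]]" by (simp add: barrier_def)
    thus ?thesis using True sing_pieces_pieces by (auto simp: letter_pieces_def l letter_symb_def concat_sing_pieces piece_def)
  next
    case False
    note b = letter_ok_barrier[OF assms[unfolded l] False]
    have "barrier [[Min D],[u,v]]" using b by (simp add: barrier_def)
    thus ?thesis using False sing_pieces_pieces b(5) by (auto simp: letter_pieces_def l letter_symb_def concat_sing_pieces piece_def)
  qed
  thus "concat (letter_pieces l) = letter_symb l" "\<forall>p\<in>set (letter_pieces l). piece p" "\<exists>ps b. letter_pieces l = ps @ [b] \<and> barrier b \<and> (\<forall>p\<in>set ps. \<not> barrier p)"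
    by auto
qed

lemma word_pieces_props:
  assumes "word_on S ls D"
  shows "concat (word_pieces ls D) = word_symb ls D \<and> (\<forall>p\<in>set (word_pieces ls D). piece p)"
  using assms
proof (induction ls arbitrary: S)
  case Nil
  thus ?case using sing_pieces_pieces by (auto simp: word_pieces_def word_symb_def concat_sing_pieces)
next
  case (Cons l ls)
  hence "letter_ok l" "concat (word_pieces ls D) = word_symb ls D \<and> (\<forall>p\<in>set (word_pieces ls D). piece p)" by auto
  thus ?case using letter_pieces_props[of l] by (auto simp: word_pieces_def word_symb_def)
qed

lemma pieces_word_symb: "word_on S ls D \<Longrightarrow> pieces (word_symb ls D) = word_pieces ls D"
  using pieces_concat word_pieces_props by metis

definition fold_z :: "symb list \<Rightarrow> chain \<Rightarrow> chain" where
  "fold_z ps x = foldr cprod (map zpiece ps) x"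

lemma fold_z_simps [simp]: "fold_z [] x = x" "fold_z (p # ps) x = cprod (zpiece p) (fold_z ps x)" "fold_z (ps @ qs) x = fold_z ps (fold_z qs x)"
  by (simp_all add: fold_z_def)

lemma fold_z_sing_pieces: "finite D \<Longrightarrow> fold_z (sing_pieces D) x = cprod (gen (singles D)) x"
proof -
  assume "finite D"
  have "fold_z (map (\<lambda>i. [[i]]) xs) x = cprod (gen (map (\<lambda>i. [i]) xs)) x" if "distinct xs" for xs
    using that
  proof (induction xs)
    case (Cons i xs)
    have "cprod (gen [[i]]) (gen (map (\<lambda>i. [i]) xs)) = gen (map (\<lambda>i. [i]) (i # xs))"
      using Cons.prems by (simp add: scat_def)
    thus ?case using Cons by (simp add: cprod_assoc[symmetric])
  qed simp
  thus ?thesis by (simp add: sing_pieces_def singles_def comp_def)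
qed

lemma fold_z_letter_pieces: "letter_ok l \<Longrightarrow> fold_z (letter_pieces l) x = cprod (letter_cycle l) x"
  by (cases l) (auto simp: letter_pieces_def letter_cycle_def fold_z_sing_pieces cprod_assoc letter_ok_def simp del: zpiece.simps)

lemma fold_z_word_pieces: "word_on S ls D \<Longrightarrow> fold_z (word_pieces ls D) (gen []) = word_cycle ls D"
proof (induction ls arbitrary: S)
  case Nil
  thus ?case by (simp add: word_pieces_def word_cycle_def fold_z_sing_pieces)
next
  case (Cons l ls)
  hence "letter_ok l" "fold_z (word_pieces ls D) (gen []) = word_cycle ls D" by auto
  thus ?case by (simp add: word_pieces_def word_cycle_def fold_z_letter_pieces)
qed

lemma zclass_word_symb: "word_on S ls D \<Longrightarrow> zclass (word_symb ls D) = word_class ls D"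
  using pieces_word_symb fold_z_word_pieces word_cycle_leading by (metis fold_z_def zclass_def)

definition one_slot :: "nat \<Rightarrow> nat set \<Rightarrow> nat \<Rightarrow> nat set" where
  "one_slot j X i = (if i = j then X else {})"

lemma one_slot_Suc: "one_slot (Suc j) X \<circ> Suc = one_slot j X" "one_slot 0 X \<circ> Suc = (\<lambda>_. {})"
  "one_slot (Suc j) X 0 = {}" "one_slot 0 X 0 = X"
  by (auto simp: one_slot_def)

lemma insert_word_empty: "insert_word (\<lambda>_. {}) ls D = word_class ls D"
  by (induction ls) (simp_all add: comp_def)

text \<open>A letter contains exactly one barrier, at its end.\<close>
lemma insert_after_letter:
  assumes "letter_ok l"
  shows "insert_after (Suc j) x (letter_pieces l @ ps) = letter_pieces l @ insert_after j x ps"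
proof -
  obtain qs b where *: "letter_pieces l = qs @ [b]" "barrier b" "\<forall>p\<in>set qs. \<not> barrier p" using letter_pieces_props[OF assms] by blast
  from *(3) have "insert_after (Suc j) x (qs @ b # ps) = qs @ b # insert_after j x ps"
    by (induction qs) (use *(2) in auto)
  thus ?thesis using * by simp
qed

lemma insert_after_pieces:
  "\<forall>p\<in>set ps. piece p \<Longrightarrow> piece x \<Longrightarrow> \<forall>p\<in>set (insert_after j x ps). piece p"
  by (induction j x ps rule: insert_after.induct) auto

lemma fold_z_insert_after:
  assumes "word_on S ls D" "j \<le> length ls"
  shows "fold_z (insert_after j [[p]] (word_pieces ls D)) (gen []) \<in> cyc \<and>
    hclass (fold_z (insert_after j [[p]] (word_pieces ls D)) (gen [])) = insert_word (one_slot j {p}) ls D"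
  using assms
proof (induction ls arbitrary: S j)
  case Nil
  hence z: "word_cycle [] D \<in> cyc" "hclass (word_cycle [] D) = word_class [] D" using word_cycle_leading[of S "[]" D] by auto
  have p: "gen [[p]] \<in> cyc" using singles_cyc[of "{p}"] by (simp add: singles_def)
  have "sing_class {p} = hclass (gen [[p]])" by (simp add: sing_class_def singles_def)
  moreover have "fold_z (insert_after 0 [[p]] (word_pieces [] D)) (gen []) = cprod (gen [[p]]) (word_cycle [] D)"
    using fold_z_word_pieces[OF Nil(1)] by simp
  ultimately show ?case using Nil cyc_cprod[OF p z(1)] hclass_cprod[OF p z(1)] z by (simp add: one_slot_def)
next
  case (Cons l ls)
  have l: "letter_ok l" and w: "word_on (S - letter_labels l) ls D" using Cons.prems by auto
  have word_pieces: "word_pieces (l # ls) D = letter_pieces l @ word_pieces ls D" by (simp add: word_pieces_def)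
  show ?case
  proof (cases j)
    case 0
    have z: "word_cycle (l # ls) D \<in> cyc" "hclass (word_cycle (l # ls) D) = word_class (l # ls) D"
      using word_cycle_leading[OF Cons.prems(1)] by blast+
    have p: "gen [[p]] \<in> cyc" using singles_cyc[of "{p}"] by (simp add: singles_def)
    have "sing_class {p} = hclass (gen [[p]])" by (simp add: sing_class_def singles_def)
    moreover have "fold_z (insert_after 0 [[p]] (word_pieces (l # ls) D)) (gen []) = cprod (gen [[p]]) (word_cycle (l # ls) D)"
      using fold_z_word_pieces[OF Cons.prems(1)] by simp
    moreover have "insert_word (one_slot 0 {p}) (l # ls) D = hprod (sing_class {p}) (word_class (l # ls) D)"
      by (simp add: one_slot_Suc insert_word_empty)
    ultimately show ?thesis using cyc_cprod[OF p z(1)] hclass_cprod[OF p z(1)] z 0 by simp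
  next
    case (Suc i)
    let ?F = "fold_z (insert_after i [[p]] (word_pieces ls D)) (gen [])"
    have IH: "?F \<in> cyc" "hclass ?F = insert_word (one_slot i {p}) ls D" using Cons.IH[OF w, of i] Cons.prems(2) Suc by auto
    have "fold_z (insert_after j [[p]] (word_pieces (l # ls) D)) (gen []) = cprod (letter_cycle l) ?F"
      unfolding word_pieces Suc insert_after_letter[OF l] by (simp add: fold_z_letter_pieces[OF l])
    moreover have "insert_word (one_slot j {p}) (l # ls) D = hprod (letter_class l) (insert_word (one_slot i {p}) ls D)"
      by (simp add: Suc one_slot_Suc)
    ultimately show ?thesis using cyc_cprod[OF letter_cycle_cyc[OF l] IH(1)] hclass_cprod[OF letter_cycle_cyc[OF l] IH(1)] IH(2)
      by (simp add: letter_class_def)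
  qed
qed

lemma zclass_iota_symb:
  assumes "word_on S ls D" "j \<le> length ls"
  shows "zclass (iota_symb n j (word_symb ls D)) = insert_sing (one_slot j {Suc n}) (word_class ls D)"
proof -
  let ?ps = "insert_after j [[Suc n]] (word_pieces ls D)"
  have "\<forall>p\<in>set ?ps. piece p"
    using word_pieces_props[OF assms(1)] by (intro insert_after_pieces) (auto simp: piece_single)
  hence "pieces (concat ?ps) = ?ps" by (rule pieces_concat)
  hence "zclass (concat ?ps) = hclass (fold_z ?ps (gen []))" unfolding zclass_def fold_z_def by simp
  thus ?thesis using fold_z_insert_after[OF assms] insert_sing_word_class[OF assms(1)] pieces_word_symb[OF assms(1)]
    by (simp add: iota_symb_def)
qed

lemma good_nth:
  "good ctx e \<longleftrightarrow> (\<forall>i<length e. ok_block (if i = 0 then ctx else single_of (e ! (i - 1))) (e ! i))"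
proof (induction e arbitrary: ctx)
  case (Cons g e)
  have "(\<forall>i<length (g # e). ok_block (if i = 0 then ctx else single_of ((g # e) ! (i - 1))) ((g # e) ! i)) \<longleftrightarrow>
    ok_block ctx g \<and> (\<forall>i<length e. ok_block (single_of ((g # e) ! i)) (e ! i))"
    by (auto simp: less_Suc_eq_0_disj)
  also have "(\<forall>i<length e. ok_block (single_of ((g # e) ! i)) (e ! i)) \<longleftrightarrow>
    (\<forall>i<length e. ok_block (if i = 0 then single_of g else single_of (e ! (i - 1))) (e ! i))"
    by (intro all_cong) (auto simp: nth_Cons split: nat.splits)
  finally show ?case using Cons by simp
qed simp

lemma single_of_eq_Some: "single_of g = Some a \<longleftrightarrow> g = [a]"
  by (auto simp: single_of_def split: list.splits)

lemma critical_good: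
  assumes "e \<in> cell2 {1..n}"
  shows "critical n e \<longleftrightarrow> good None e"
proof -
  have young_block: "(\<exists>a. e ! i = [a]) \<or> (\<exists>a b. e ! i = [a,b] \<and> a \<noteq> b)" if "i < length e" for i
  proof -
    have "e ! i \<in> set e" using that by simp
    moreover from this have "distinct (e ! i)" using assms by (auto simp: cell2_def cell_def distinct_concat_iff)
    ultimately have "length (e ! i) \<le> 2" "e ! i \<noteq> []" "distinct (e ! i)" using assms by (auto simp: cell2_def cell_def)
    thus ?thesis using length_2_cases[of "e ! i"] by auto
  qed
  show ?thesis
  proof
    assume c: "critical n e"
    show "good None e" unfolding good_nth
    proof (intro allI impI)
      fix i assume i: "i < length e"
      from young_block[OF i] show "ok_block (if i = 0 then None else single_of (e ! (i - 1))) (e ! i)"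
      proof (elim disjE exE conjE)
        fix a assume a: "e ! i = [a]"
        show ?thesis
        proof (cases i)
          case (Suc j)
          thus ?thesis using c a i by (auto simp: critical_def single_of_eq_Some)
        qed (use a in simp)
      next
        fix u v assume uv: "e ! i = [u,v]" "u \<noteq> v"
        show ?thesis
        proof (cases "u < v")
          case False
          hence "follower e i" using c uv i by (auto simp: critical_def)
          thus ?thesis using uv False by (auto simp: follower_def single_of_eq_Some)
        qed (use uv in simp)
      qed
    qed
  next
    assume g: "good None e"
    show "critical n e" unfolding critical_def
    proof (intro conjI allI impI)
      fix i a b assume *: "Suc i < length e \<and> e ! i = [a] \<and> e ! Suc i = [b]"
      with g[unfolded good_nth, rule_format, of "Suc i"] show "b < a" by simp
    next
      fix i a b assume *: "i < length e \<and> e ! i = [a,b] \<and> b < a"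
      with g[unfolded good_nth, rule_format, of i] show "follower e i"
        by (auto simp: follower_def single_of_eq_Some split: if_splits)
    qed (use assms in simp)
  qed
qed

lemma num_pairs_kcell: "e \<in> cell2 S \<Longrightarrow> length e + num_pairs e = card S"
proof -
  assume e: "e \<in> cell2 S"
  have "length e + num_pairs e = length (concat e)" if "\<forall>g\<in>set e. length g \<le> 2" "[] \<notin> set e" for e :: symb
    using that
  proof (induction e)
    case (Cons g e)
    thus ?case using length_2_cases[of g] by (auto simp: num_pairs_def)
  qed (simp add: num_pairs_def)
  moreover have "length (concat e) = card (labels e)"
    using e by (intro distinct_card[symmetric]) (auto simp: cell2_def cell_def)
  ultimately show ?thesis using e by (auto simp: cell2_def cell_def)
qed

lemma critical_word: "critical n e \<and> num_pairs e = k \<longleftrightarrow> (\<exists>ls D. word_on {1..n} ls D \<and> length ls = k \<and> e = word_symb ls D)"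
proof
  assume *: "critical n e \<and> num_pairs e = k"
  hence e: "e \<in> cell2 {1..n}" by (simp add: critical_def)
  with * num_pairs_kcell[OF e] have "e \<in> kcell k {1..n}" by (auto simp: kcell_def)
  from good_word_of[OF this] * critical_good[OF e] show "\<exists>ls D. word_on {1..n} ls D \<and> length ls = k \<and> e = word_symb ls D" by metis
next
  assume "\<exists>ls D. word_on {1..n} ls D \<and> length ls = k \<and> e = word_symb ls D"
  then obtain ls D where w: "word_on {1..n} ls D" "length ls = k" "e = word_symb ls D" by blast
  from word_cycle_leading[OF w(1)] have "e \<in> kcell k {1..n}" "good None e" using w by auto
  moreover from this have "e \<in> cell2 {1..n}" using kcell_sub by blast
  ultimately show "critical n e \<and> num_pairs e = k"
    using critical_good num_pairs_kcell[of e "{1..n}"] by (auto simp: kcell_def)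
qed

text \<open>Both are linear and agree on the classes of critical symbols, so the choice in the
  definition of \<open>iota\<close> is immaterial on \<open>H k {1..n}\<close>.\<close>
theorem iota_insert_sing:
  assumes "j \<le> k" "z \<in> H k {1..n}"
  shows "iota k n j z = insert_sing (one_slot j {Suc n}) z"
proof -
  let ?P = "\<lambda>f. hlinear f \<and> (\<forall>e. critical n e \<and> num_pairs e = k \<longrightarrow> f (zclass e) = zclass (iota_symb n j e))"
  have "insert_sing (one_slot j {Suc n}) (zclass e) = zclass (iota_symb n j e)" if "critical n e \<and> num_pairs e = k" for e
  proof -
    from that obtain ls D where w: "word_on {1..n} ls D" "length ls = k" "e = word_symb ls D" unfolding critical_word by blast
    show ?thesis using zclass_word_symb[OF w(1)] zclass_iota_symb[OF w(1)] assms(1) w by simp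
  qed
  with insert_sing_linear have "\<exists>f. ?P f" by blast
  hence i: "?P (iota k n j)" unfolding iota_def by (rule someI_ex)
  show ?thesis
  proof (rule H_linear_ext_word_class[OF _ _ insert_sing_linear assms(2)])
    show "hlinear (iota k n j)" using i by blast
    fix ls D assume w: "word_on {1..n} ls D" "length ls = k"
    hence "critical n (word_symb ls D) \<and> num_pairs (word_symb ls D) = k" using critical_word by blast
    with i have "iota k n j (zclass (word_symb ls D)) = zclass (iota_symb n j (word_symb ls D))" by blast
    thus "iota k n j (word_class ls D) = insert_sing (one_slot j {Suc n}) (word_class ls D)"
      using zclass_word_symb[OF w(1)] zclass_iota_symb[OF w(1)] w assms(1) by simp
  qed simp
qed

section \<open>Critical symbols with one pair\<close>

lemma one_pair_word:
  assumes "finite D0" "finite D" "xs = rev (sorted_list_of_set D0) @ [u,v] @ rev (sorted_list_of_set D)"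
  shows "one_pair_symb (card D0) xs = word_symb [(D0,u,v)] D"
  using assms by (simp add: one_pair_symb_def word_symb_def letter_symb_def singles_def nth_append)

lemma one_pair_zclass:
  assumes "word_on {1..n} [(D0,u,v)] D"
  defines "xs \<equiv> rev (sorted_list_of_set D0) @ [u,v] @ rev (sorted_list_of_set D)"
  shows "word_class [(D0,u,v)] D = zclass (one_pair_symb (card D0) xs)" "distinct xs" "set xs = {1..n}"
    "sorted_wrt (>) (take (card D0) xs)" "sorted_wrt (>) (drop (card D0 + 2) xs)"
    "xs ! card D0 = u" "xs ! (card D0 + 1) = v" "D0 \<noteq> {} \<Longrightarrow> xs ! (card D0 - 1) = Min D0"
    "card D0 + 2 + card D = n"
proof -
  have f: "finite D0" "finite D" "u \<notin> D0" "v \<notin> D0" "u \<noteq> v" and D: "letter_labels (D0,u,v) \<subseteq> {1..n}" "D = {1..n} - letter_labels (D0,u,v)"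
    using assms(1) by (auto simp: letter_ok_def)
  show "word_class [(D0,u,v)] D = zclass (one_pair_symb (card D0) xs)"
    using zclass_word_symb[OF assms(1)] one_pair_word[OF f(1,2)] by (simp add: xs_def)
  show d: "distinct xs" using f D by (auto simp: xs_def letter_labels_def)
  show s: "set xs = {1..n}" using f D by (auto simp: xs_def letter_labels_def)
  show "sorted_wrt (>) (take (card D0) xs)" "sorted_wrt (>) (drop (card D0 + 2) xs)"
    using f by (simp_all add: xs_def sorted_wrt_rev_list)
  show "xs ! card D0 = u" "xs ! (card D0 + 1) = v" by (simp_all add: xs_def nth_append)
  show "xs ! (card D0 - 1) = Min D0" if "D0 \<noteq> {}"
  proof -
    have c: "card D0 > 0" using that f by (simp add: card_gt_0_iff)
    have "sorted_list_of_set D0 = Min D0 # sorted_list_of_set (D0 - {Min D0})"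
      by (rule sorted_list_of_set_nonempty) (use that f in auto)
    moreover have "xs ! (card D0 - 1) = sorted_list_of_set D0 ! 0"
      using c by (simp add: xs_def nth_append rev_nth)
    ultimately show ?thesis by simp
  qed
  show "card D0 + 2 + card D = n" using distinct_card[OF d] s f by (simp add: xs_def)
qed

lemma word_class_one_AB:
  assumes "word_on {1..n} [(D0,u,v)] D"
  shows "u < v \<Longrightarrow> word_class [(D0,u,v)] D \<in> B_set n (card D0)"
    "\<not> u < v \<Longrightarrow> word_class [(D0,u,v)] D \<in> A_set n (card D0)"
proof -
  let ?xs = "rev (sorted_list_of_set D0) @ [u,v] @ rev (sorted_list_of_set D)"
  note o = one_pair_zclass[OF assms]
  show "u < v \<Longrightarrow> word_class [(D0,u,v)] D \<in> B_set n (card D0)"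
    unfolding B_set_def mem_Collect_eq o(1) by (intro exI[of _ ?xs] conjI refl o(2-5)) (simp only: o(6,7))
  assume uv: "\<not> u < v"
  have "letter_ok (D0,u,v)" using assms by simp
  note b = letter_ok_barrier[OF this uv]
  show "word_class [(D0,u,v)] D \<in> A_set n (card D0)"
    unfolding A_set_def mem_Collect_eq o(1)
    by (intro exI[of _ ?xs] conjI refl o(2-5)) (simp_all only: o(6,7) o(8)[OF b(4)] b(1,2))
qed

text \<open>For \<open>S = {1..m+2}\<close> the classes of these letters form \<open>A_set (m+2)
  m\<close>: all remaining labels form the run before a decreasing pair.\<close>
definition A_letters :: "nat set \<Rightarrow> letter set" where
  "A_letters S = {(D,u,v). letter_ok (D,u,v) \<and> v < u \<and> letter_labels (D,u,v) = S}"

lemma A_set_letters: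
  assumes "1 \<le> m" shows "A_set (m + 2) m \<subseteq> letter_class ` A_letters {1..m+2}"
proof
  fix z assume "z \<in> A_set (m + 2) m"
  then obtain xs where xs: "z = zclass (one_pair_symb m xs)" "distinct xs" "set xs = {1..m+2}"
    "sorted_wrt (>) (take m xs)" "xs ! m > xs ! (m + 1)" "xs ! (m + 1) > xs ! (m - 1)"
    by (auto simp: A_set_def)
  have len: "length xs = m + 2" using distinct_card[OF xs(2)] xs(3) by simp
  define D0 where "D0 = set (take m xs)"
  define u where "u = xs ! m"
  define v where "v = xs ! (m + 1)"
  have x: "xs = take m xs @ [u,v]"
    using len by (intro nth_equalityI) (auto simp: nth_append u_def v_def less_Suc_eq)
  have dx: "distinct (take m xs @ [u,v])" "set (take m xs @ [u,v]) = {1..m+2}"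
    using xs(2,3) unfolding x[symmetric] by simp_all
  have d: "u \<notin> D0" "v \<notin> D0" "u \<noteq> v" "distinct (take m xs)"
    using dx by (auto simp: D0_def)
  have c: "card D0 = m" using distinct_card[OF d(4)] len by (simp add: D0_def)
  have s: "rev (sorted_list_of_set D0) = take m xs"
  proof -
    have "singles D0 = map (\<lambda>i. [i]) (take m xs)" using singles_decreasing[OF xs(4)] by (simp add: D0_def)
    thus ?thesis unfolding singles_def by (simp add: inj_map_eq_map inj_def)
  qed
  have labs: "letter_labels (D0,u,v) = {1..m+2}"
    using dx(2) by (auto simp: letter_labels_def D0_def)
  have "D0 \<noteq> {}" using c assms by auto
  moreover have "Min D0 \<le> xs ! (m - 1)"
    using assms len by (intro Min_le) (auto simp: D0_def in_set_conv_nth intro!: exI[of _ "m - 1"])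
  moreover have "v < u" "xs ! (m - 1) < v" using xs(5,6) by (simp_all add: u_def v_def)
  moreover have "finite D0" by (simp add: D0_def)
  ultimately have lk: "letter_ok (D0,u,v)" using d by (simp add: letter_ok_def)
  have w: "word_on {1..m+2} [(D0,u,v)] {}" using lk labs by simp
  have "xs = rev (sorted_list_of_set D0) @ [u,v] @ rev (sorted_list_of_set {})"
    by (simp only: s sorted_list_of_set_empty rev.simps append_Nil2) (rule x)
  from one_pair_word[OF _ _ this] have "one_pair_symb m xs = word_symb [(D0,u,v)] {}"
    by (simp only: c) (simp add: D0_def)
  hence "z = letter_class (D0,u,v)" using xs(1) zclass_word_symb[OF w] by simp
  moreover have "(D0,u,v) \<in> A_letters {1..m+2}" using lk labs xs(5) by (simp add: A_letters_def u_def v_def)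
  ultimately show "z \<in> letter_class ` A_letters {1..m+2}" by blast
qed

section \<open>Order-preserving relabelings\<close>

text \<open>The increasing bijection from \<open>{1..card S}\<close> to \<open>S\<close>; outside
  that interval the values are irrelevant.\<close>
definition order_iso :: "nat set \<Rightarrow> nat \<Rightarrow> nat" where
  "order_iso S i = sorted_list_of_set S ! (i - 1)"

lemma order_iso_unique:
  assumes "strict_mono_on {1..n} f" "f ` {1..n} = S" "i \<in> {1..n}"
  shows "f i = order_iso S i"
proof -
  have s: "sorted (map f [1..<Suc n])" "distinct (map f [1..<Suc n])"
  proof -
    have "sorted_wrt (<) (map f [1..<Suc n])"
      using assms(1) by (auto simp: sorted_wrt_iff_nth_less strict_mono_on_def simp del: upt_Suc)
    thus "sorted (map f [1..<Suc n])" "distinct (map f [1..<Suc n])" by (simp_all only: strict_sorted_iff)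
  qed
  have "set (map f [1..<Suc n]) = S" using assms(2) by (simp add: atLeastLessThanSuc_atLeastAtMost del: upt_Suc)
  hence "sorted_list_of_set S = map f [1..<Suc n]"
    using sorted_list_of_set.idem_if_sorted_distinct[OF s] by simp
  moreover obtain j where "i = Suc j" "j < n" using assms(3) by (cases i) auto
  ultimately show ?thesis using nth_map_upt[of j "Suc n" 1 f] by (simp add: order_iso_def del: upt_Suc)
qed

lemma order_iso_props:
  assumes "finite S"
  shows "strict_mono_on {1..card S} (order_iso S)" "bij_betw (order_iso S) {1..card S} S"
proof -
  let ?l = "sorted_list_of_set S"
  have len: "length ?l = card S" by simp
  show m: "strict_mono_on {1..card S} (order_iso S)"
  proof (rule strict_mono_onI)
    fix i j assume "i \<in> {1..card S}" "j \<in> {1..card S}" "i < j"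
    hence "i - 1 < j - 1" "j - 1 < length ?l" by auto
    thus "order_iso S i < order_iso S j" unfolding order_iso_def
      using sorted_wrt_nth_less[OF strict_sorted_list_of_set] by blast
  qed
  have "order_iso S ` {1..card S} = (!) ?l ` {..<card S}"
  proof -
    have "(\<lambda>i. i - 1) ` {1..card S} = {..<card S}"
    proof (intro equalityI subsetI)
      fix x assume "x \<in> {..<card S}"
      thus "x \<in> (\<lambda>i. i - 1) ` {1..card S}" by (intro image_eqI[of _ _ "Suc x"]) auto
    qed auto
    thus ?thesis unfolding order_iso_def by (metis image_image)
  qed
  also have "\<dots> = set ?l" using len by (auto simp: set_conv_nth)
  finally show "bij_betw (order_iso S) {1..card S} S"
    using assms strict_mono_on_imp_inj_on[OF m] by (simp add: bij_betw_def)
qed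

lemma order_iso_inj: "finite S \<Longrightarrow> card S = n \<Longrightarrow> inj_on (order_iso S) {1..n}"
  and order_iso_image: "finite S \<Longrightarrow> card S = n \<Longrightarrow> order_iso S ` {1..n} = S"
  using order_iso_props(2)[of S] by (auto simp: bij_betw_def)

lemma order_iso_mono_comp:
  assumes "finite S" "strict_mono_on S f" "i \<in> {1..card S}"
  shows "f (order_iso S i) = order_iso (f ` S) i"
proof -
  note o = order_iso_props[OF assms(1)]
  have "strict_mono_on {1..card S} (f \<circ> order_iso S)"
  proof (rule strict_mono_onI)
    fix i j assume ij: "i \<in> {1..card S}" "j \<in> {1..card S}" "i < j"
    have "order_iso S i \<in> S" "order_iso S j \<in> S" using o(2) ij by (auto simp: bij_betw_def)
    thus "(f \<circ> order_iso S) i < (f \<circ> order_iso S) j"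
      using strict_mono_onD[OF o(1) ij] strict_mono_onD[OF assms(2)] by simp
  qed
  moreover have "(f \<circ> order_iso S) ` {1..card S} = f ` S"
    using bij_betw_imp_surj_on[OF o(2)] by (simp only: image_comp[symmetric])
  ultimately show ?thesis using order_iso_unique[of "card S" "f \<circ> order_iso S" "f ` S" i] assms(3) by simp
qed

definition relabel_letter :: "(nat \<Rightarrow> nat) \<Rightarrow> letter \<Rightarrow> letter" where
  "relabel_letter f = (\<lambda>(D,u,v). (f ` D, f u, f v))"

lemma letter_labels_relabel_letter: "letter_labels (relabel_letter f l) = f ` letter_labels l"
  by (auto simp: letter_labels_def relabel_letter_def split: prod.splits)

lemma strict_mono_on_less:
  fixes f :: "nat \<Rightarrow> nat"
  shows "strict_mono_on S f \<Longrightarrow> x \<in> S \<Longrightarrow> y \<in> S \<Longrightarrow> f x < f y \<longleftrightarrow> x < y"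
  using strict_mono_onD[of S f x y] strict_mono_onD[of S f y x] by (cases x y rule: linorder_cases) auto

lemma letter_ok_relabel_letter:
  assumes "letter_ok l" "strict_mono_on (letter_labels l) f"
  shows "letter_ok (relabel_letter f l)"
proof -
  obtain D u v where l: "l = (D,u,v)" by (cases l)
  have i: "inj_on f (letter_labels l)" using assms(2) by (rule strict_mono_on_imp_inj_on)
  have c: "finite D" "u \<notin> D" "v \<notin> D" using assms(1) by (auto simp: letter_ok_def l)
  have m: "u \<in> letter_labels l" "v \<in> letter_labels l" "D \<subseteq> letter_labels l" by (auto simp: letter_labels_def l)
  have 1: "f u \<notin> f ` D" "f v \<notin> f ` D" using i c m by (auto simp: inj_on_def)
  have 2: "Min (f ` D) < f v" if "D \<noteq> {}" "Min D < v"
  proof -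
    have "Min D \<in> D" using c that by simp
    moreover from this have "f (Min D) < f v" using strict_mono_onD[OF assms(2)] that m by blast
    ultimately show ?thesis using c by (auto intro: order_le_less_trans[OF Min_le])
  qed
  show ?thesis using assms(1) 1 2 c strict_mono_on_less[OF assms(2)] m
    by (auto simp: letter_ok_def l relabel_letter_def)
qed

lemma relabel_letter_inj:
  assumes "inj_on f S" "letter_labels l \<subseteq> S" "letter_labels l' \<subseteq> S" "relabel_letter f l = relabel_letter f l'"
  shows "l = l'"
proof -
  obtain D u v D' u' v' where l: "l = (D,u,v)" "l' = (D',u',v')" by (cases l, cases l')
  have "D \<subseteq> S" "u \<in> S" "v \<in> S" "D' \<subseteq> S" "u' \<in> S" "v' \<in> S" using assms(2,3) by (auto simp: letter_labels_def l)
  thus ?thesis using assms(4) inj_on_image_eq_iff[OF assms(1), of D D'] inj_onD[OF assms(1)]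
    by (simp add: l relabel_letter_def)
qed

text \<open>An increasing pair does not interact with the run before it. This makes the singletons
  inserted before a factor from \<open>B\<^sub>2\<close> part of a letter.\<close>
lemma letter_class_B_split: "letter_ok (D,u,v) \<Longrightarrow> u < v \<Longrightarrow> letter_class (D,u,v) = hprod (sing_class D) (letter_class ({},u,v))"
proof -
  assume l: "letter_ok (D,u,v)" "u < v"
  have l0: "letter_ok ({},u,v)" using l by (auto simp: letter_ok_def)
  have "letter_cycle (D,u,v) = cprod (gen (singles D)) (letter_cycle ({},u,v))"
    using l by (simp add: letter_cycle_def)
  thus ?thesis using hclass_cprod[OF singles_cyc letter_cycle_cyc[OF l0], of D] l
    by (simp add: letter_class_def sing_class_def letter_ok_def)
qed

lemma hrelabel_letter_class_B:
  assumes "letter_ok (D,u,v)" "u < v" "inj_on f (letter_labels (D,u,v))" "f u < f v"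
  shows "hrelabel f (letter_class (D,u,v)) = letter_class (relabel_letter f (D,u,v))"
proof -
  have l: "finite D" "u \<notin> D" "v \<notin> D" using assms by (auto simp: letter_ok_def)
  have l0: "letter_ok ({},u,v)" using assms by (auto simp: letter_ok_def)
  have i: "inj_on f D" "f u \<notin> f ` D" "f v \<notin> f ` D" using assms(3) l by (auto simp: letter_labels_def inj_on_def)
  have "crelabel f (letter_cycle ({},u,v)) = letter_cycle ({},f u,f v)"
    using assms by (simp add: letter_cycle_def crelabel_add rsymb_def inj_on_def)
  hence "hrelabel f (letter_class ({},u,v)) = letter_class ({},f u,f v)"
    using hrelabel_hclass[OF letter_cycle_cyc[OF l0]] by (simp add: letter_class_def)
  moreover have "letter_ok (f ` D, f u, f v)" using assms i l by (simp add: letter_ok_def)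
  ultimately show ?thesis using letter_class_B_split[OF assms(1,2)] letter_class_B_split[of "f ` D" "f u" "f v"] assms(4) i l
    by (simp add: hrelabel_hprod hrelabel_sing_class relabel_letter_def)
qed

lemma B_set_words:
  assumes "m + 2 \<le> n" "z \<in> B_set n m"
  shows "\<exists>D0 u v D. word_on {1..n} [(D0,u,v)] D \<and> u < v \<and> z = word_class [(D0,u,v)] D"
proof -
  obtain xs where xs: "z = zclass (one_pair_symb m xs)" "distinct xs" "set xs = {1..n}"
    "sorted_wrt (>) (take m xs)" "sorted_wrt (>) (drop (m + 2) xs)" "xs ! (m + 1) > xs ! m"
    using assms(2) by (auto simp: B_set_def)
  have len: "length xs = n" using distinct_card[OF xs(2)] xs(3) by simp
  define D0 where "D0 = set (take m xs)"
  define D where "D = set (drop (m + 2) xs)"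
  define u where "u = xs ! m"
  define v where "v = xs ! (m + 1)"
  have x: "xs = take m xs @ [u,v] @ drop (m + 2) xs"
  proof -
    have "drop m xs = u # v # drop (m + 2) xs"
      using len assms(1) by (simp add: u_def v_def Cons_nth_drop_Suc[symmetric])
    thus ?thesis using append_take_drop_id[of m xs] by simp
  qed
  have dx: "distinct (take m xs @ [u,v] @ drop (m + 2) xs)" "set (take m xs @ [u,v] @ drop (m + 2) xs) = {1..n}"
    using xs(2,3) unfolding x[symmetric] by simp_all
  have d: "u \<notin> D0" "v \<notin> D0" "D \<inter> D0 = {}" "u \<notin> D" "v \<notin> D" "distinct (take m xs)"
    using dx(1) by (auto simp: D0_def D_def)
  have un: "insert u (insert v D0) \<union> D = {1..n}" using dx(2) by (auto simp: D0_def D_def)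
  have uv: "u < v" using xs(6) by (simp add: u_def v_def)
  have c: "card D0 = m" using distinct_card[OF d(6)] len assms(1) by (simp add: D0_def)
  have letter_symb: "rev (sorted_list_of_set (set ys)) = ys" if "sorted_wrt (>) ys" for ys :: "nat list"
    using singles_decreasing[OF that] unfolding singles_def by (simp add: inj_map_eq_map inj_def)
  have f: "finite D0" "finite D" by (simp_all add: D0_def D_def)
  have "xs = rev (sorted_list_of_set D0) @ [u,v] @ rev (sorted_list_of_set D)"
    unfolding D0_def D_def letter_symb[OF xs(4)] letter_symb[OF xs(5)] by (rule x)
  from one_pair_word[OF f this] have o: "one_pair_symb m xs = word_symb [(D0,u,v)] D" by (simp only: c)
  have lk: "letter_ok (D0,u,v)" using d uv f by (simp add: letter_ok_def)
  have lb: "letter_labels (D0,u,v) = insert u (insert v D0)" by (simp add: letter_labels_def)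
  have w: "word_on {1..n} [(D0,u,v)] D"
    using lk un d by (auto simp: lb)
  show ?thesis using w uv xs(1) zclass_word_symb[OF w] unfolding o by blast
qed

section \<open>The basis given by an admissible family\<close>

lemma finite_words_on: "finite S \<Longrightarrow> finite (words_on k S)"
proof -
  assume S: "finite S"
  have "case_prod word_symb ` words_on k S \<subseteq> cell2 S"
  proof (rule image_subsetI)
    fix w assume "w \<in> words_on k S"
    then obtain ls D where w: "w = (ls,D)" "word_on S ls D" by (auto simp: words_on_def)
    thus "case_prod word_symb w \<in> cell2 S" using word_on_labels[OF w(2)] kcell_sub(1)[of "length ls" S] by (simp add: w(1) subset_iff)
  qed
  moreover have "inj_on (case_prod word_symb) (words_on k S)"
  proof (rule inj_onI)
    fix w w' assume *: "w \<in> words_on k S" "w' \<in> words_on k S" "case_prod word_symb w = case_prod word_symb w'"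
    obtain ls D ls' D' where w: "w = (ls,D)" "w' = (ls',D')" by (cases w, cases w')
    show "w = w'" using * word_symb_inj[of ls D ls' D' S S] by (simp add: w words_on_def)
  qed
  ultimately show ?thesis using finite_cell2[OF S] finite_subset finite_imageD by blast
qed

lemma finite_A_letters: "finite S \<Longrightarrow> finite (A_letters S)"
proof -
  assume S: "finite S"
  have "A_letters S \<subseteq> Pow S \<times> S \<times> S" by (auto simp: A_letters_def letter_labels_def)
  thus ?thesis by (rule finite_subset) (intro finite_SigmaI finite_Pow_iff[THEN iffD2] S)
qed

locale admissible_family =
  fixes A' :: "nat \<Rightarrow> nat \<Rightarrow> hmlg set"
  assumes adm: "admissible A'"
begin

text \<open>The representation \<open>\<Lambda>\<^sup>2 Std\<close> inside the homology.\<close>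
definition A_span :: "nat \<Rightarrow> hmlg set" where
  "A_span m = hm.span (A' (m + 2) m)"

lemma adm_props:
  assumes "3 \<le> n" "1 \<le> m" "m \<le> n - 2"
  shows "finite (A' n m)" "A' n m \<subseteq> H 1 {1..n}" "hm.independent (A' n m)" "card (A' n m) = card (A_set n m)"
    "hm.span (B_set n 0 \<union> (\<Union>l\<in>{1..m}. A' n l \<union> B_set n l)) =
       hm.span (B_set n 0 \<union> (\<Union>l\<in>{1..m}. A_set n l \<union> B_set n l))"
    "hm.span (A' n m) = generated 1 {1} (m + 2) (A_span m) n"
    "rep_iso (m + 2) (hsub (A_span m), hrelabel) (ext_square (std_rep (m + 2)))"
  using adm[unfolded admissible_def Let_def, rule_format, of n m] assms unfolding A_span_def by blast+

lemma A'_props: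
  assumes "1 \<le> m"
  shows "finite (A' (m+2) m)" "A' (m+2) m \<subseteq> H 1 {1..m+2}" "hm.independent (A' (m+2) m)"
    "card (A' (m+2) m) = card (A_set (m+2) m)"
    "rep_iso (m + 2) (hsub (A_span m), hrelabel) (ext_square (std_rep (m + 2)))"
  using adm_props[of "m + 2" m] assms by auto

lemma A_span_sub: "1 \<le> m \<Longrightarrow> A_span m \<subseteq> H 1 {1..m+2}"
  unfolding A_span_def by (intro hm.span_minimal A'_props H_subspace)

lemma A_span_stable: "1 \<le> m \<Longrightarrow> \<sigma> permutes {1..m+2} \<Longrightarrow> v \<in> A_span m \<Longrightarrow> hrelabel \<sigma> v \<in> A_span m"
  using A'_props(5)[of m] by (auto simp: rep_iso_def is_rep_def lin_map_def hsub_def Pi_def)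

text \<open>Any injection will do: only the number of letters matters, since independence is
  obtained by counting.\<close>
definition letter_of :: "nat \<Rightarrow> hmlg \<Rightarrow> letter" where
  "letter_of m = (SOME h. inj_on h (A' (m + 2) m) \<and> h ` A' (m + 2) m \<subseteq> A_letters {1..m+2})"

lemma letter_of_props:
  assumes "1 \<le> m"
  shows "inj_on (letter_of m) (A' (m + 2) m)" "letter_of m ` A' (m + 2) m \<subseteq> A_letters {1..m+2}"
proof -
  have f: "finite (A_letters {1..m+2})" by (rule finite_A_letters) simp
  have "card (A_set (m+2) m) \<le> card (letter_class ` A_letters {1..m+2})"
    by (rule card_mono[OF finite_imageI[OF f] A_set_letters[OF assms]])
  also have "\<dots> \<le> card (A_letters {1..m+2})" by (rule card_image_le[OF f])
  finally have "card (A' (m + 2) m) \<le> card (A_letters {1..m+2})" using A'_props(4)[OF assms] by simp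
  then obtain h where "h ` A' (m + 2) m \<subseteq> A_letters {1..m+2} \<and> inj_on h (A' (m + 2) m)"
    using card_le_inj[OF A'_props(1)[OF assms] f] by blast
  hence "\<exists>h. inj_on h (A' (m + 2) m) \<and> h ` A' (m + 2) m \<subseteq> A_letters {1..m+2}" by blast
  hence "inj_on (letter_of m) (A' (m + 2) m) \<and> letter_of m ` A' (m + 2) m \<subseteq> A_letters {1..m+2}"
    unfolding letter_of_def by (rule someI_ex)
  thus "inj_on (letter_of m) (A' (m + 2) m)" "letter_of m ` A' (m + 2) m \<subseteq> A_letters {1..m+2}" by auto
qed

definition A_letter :: "nat \<Rightarrow> nat set \<Rightarrow> hmlg \<Rightarrow> letter" where
  "A_letter m S x = relabel_letter (order_iso S) (letter_of m x)"

text \<open>The class by which a letter is replaced. Letters with increasing pair keep their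
  class. By \<open>adm_word_class_basis\<close> the value 0 does not occur for letters satisfying
  \<open>letter_ok\<close>.\<close>
definition adm_class :: "letter \<Rightarrow> hmlg" where
  "adm_class l = (let S = letter_labels l; m = card S - 2; P = (\<lambda>x. x \<in> A' (m + 2) m \<and> A_letter m S x = l) in
     if fst (snd l) < snd (snd l) then letter_class l else if 1 \<le> m \<and> (\<exists>x. P x) then hrelabel (order_iso S) (THE x. P x) else 0)"

lemma A_letter_props:
  assumes "1 \<le> m" "finite S" "card S = m + 2" "x \<in> A' (m + 2) m"
  shows "letter_ok (A_letter m S x)" "letter_labels (A_letter m S x) = S" "snd (snd (A_letter m S x)) < fst (snd (A_letter m S x))"
proof -
  have gx: "letter_of m x \<in> A_letters {1..m+2}" using letter_of_props(2)[OF assms(1)] assms(4) by blast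
  obtain D u v where l: "letter_of m x = (D,u,v)" by (cases "letter_of m x")
  have l': "letter_ok (D,u,v)" "v < u" "letter_labels (D,u,v) = {1..m+2}" using gx by (auto simp: A_letters_def l)
  note o = order_iso_props[OF assms(2), unfolded assms(3)]
  show "letter_ok (A_letter m S x)" unfolding A_letter_def l by (rule letter_ok_relabel_letter) (use l' o in auto)
  show "letter_labels (A_letter m S x) = S" unfolding A_letter_def letter_labels_relabel_letter l l'(3) using o(2) by (rule bij_betw_imp_surj_on)
  have "u \<in> {1..m+2}" "v \<in> {1..m+2}" unfolding l'(3)[symmetric] by (auto simp: letter_labels_def)
  thus "snd (snd (A_letter m S x)) < fst (snd (A_letter m S x))"
    using strict_mono_onD[OF o(1)] l'(2) by (simp add: A_letter_def l relabel_letter_def)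
qed

lemma A_letter_inj:
  assumes "1 \<le> m" "finite S" "card S = m + 2" "x \<in> A' (m + 2) m" "y \<in> A' (m + 2) m" "A_letter m S x = A_letter m S y"
  shows "x = y"
proof -
  have gx: "letter_labels (letter_of m x) = {1..m+2}" "letter_labels (letter_of m y) = {1..m+2}" using letter_of_props(2)[OF assms(1)] assms(4,5) by (auto simp: A_letters_def)
  have "letter_of m x = letter_of m y"
    by (rule relabel_letter_inj[OF order_iso_inj[OF assms(2,3)]]) (use gx assms(6) in \<open>auto simp: A_letter_def\<close>)
  thus ?thesis using letter_of_props(1)[OF assms(1)] assms(4,5) by (auto dest: inj_onD)
qed

lemma adm_class_B: "u < v \<Longrightarrow> adm_class (D,u,v) = letter_class (D,u,v)"
  by (simp add: adm_class_def Let_def)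

lemma adm_class_A:
  assumes "1 \<le> m" "finite S" "card S = m + 2" "x \<in> A' (m + 2) m"
  shows "adm_class (A_letter m S x) = hrelabel (order_iso S) x"
proof -
  have "(THE y. y \<in> A' (m + 2) m \<and> A_letter m S y = A_letter m S x) = x"
  proof (rule the_equality)
    show "x \<in> A' (m + 2) m \<and> A_letter m S x = A_letter m S x" using assms(4) by simp
    fix y assume "y \<in> A' (m + 2) m \<and> A_letter m S y = A_letter m S x"
    thus "y = x" by (intro A_letter_inj[OF assms(1-3) _ assms(4)]) simp_all
  qed
  moreover have e: "1 \<le> m \<and> (\<exists>y. y \<in> A' (m + 2) m \<and> A_letter m S y = A_letter m S x)" using assms(1,4) by blast
  have c: "card S - 2 = m" using assms by simp
  have l: "letter_labels (A_letter m S x) = S" "\<not> fst (snd (A_letter m S x)) < snd (snd (A_letter m S x))"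
    using A_letter_props[OF assms] by simp_all
  have "adm_class (A_letter m S x) = hrelabel (order_iso S) (THE y. y \<in> A' (m + 2) m \<and> A_letter m S y = A_letter m S x)"
    unfolding adm_class_def Let_def l(1) c if_not_P[OF l(2)] by (rule if_P[OF e])
  ultimately show ?thesis by (simp only:)
qed

lemma adm_class_cases:
  assumes "letter_ok l"
  obtains "fst (snd l) < snd (snd l)" "adm_class l = letter_class l" | m x where "1 \<le> m" "card (letter_labels l) = m + 2" "x \<in> A' (m + 2) m"
      "l = A_letter m (letter_labels l) x" "adm_class l = hrelabel (order_iso (letter_labels l)) x"
  | "\<not> fst (snd l) < snd (snd l)" "\<not> (\<exists>m x. 1 \<le> m \<and> card (letter_labels l) = m + 2 \<and> x \<in> A' (m + 2) m \<and> l = A_letter m (letter_labels l) x)" "adm_class l = 0"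
proof -
  have f: "finite (letter_labels l)" using assms by (rule letter_labels_finite)
  show thesis
  proof (cases "fst (snd l) < snd (snd l)")
    case True
    hence "adm_class l = letter_class l" unfolding adm_class_def Let_def by (rule if_P)
    thus ?thesis by (rule that(1)[OF True])
  next
    case False
    show ?thesis
    proof (cases "\<exists>m x. 1 \<le> m \<and> card (letter_labels l) = m + 2 \<and> x \<in> A' (m + 2) m \<and> l = A_letter m (letter_labels l) x")
      case True
      then obtain m x where *: "1 \<le> m" "card (letter_labels l) = m + 2" "x \<in> A' (m + 2) m" "l = A_letter m (letter_labels l) x" by blast
      have "adm_class (A_letter m (letter_labels l) x) = hrelabel (order_iso (letter_labels l)) x" by (rule adm_class_A[OF *(1) f *(2,3)])
      with *(4) have "adm_class l = hrelabel (order_iso (letter_labels l)) x" by simp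
      thus ?thesis by (rule that(2)[OF *])
    next
      case n: False
      define m where "m = card (letter_labels l) - 2"
      have "\<not> (1 \<le> m \<and> (\<exists>x. x \<in> A' (m + 2) m \<and> A_letter m (letter_labels l) x = l))"
      proof
        assume *: "1 \<le> m \<and> (\<exists>x. x \<in> A' (m + 2) m \<and> A_letter m (letter_labels l) x = l)"
        from * have "card (letter_labels l) = m + 2" using conjunct1[OF *] unfolding m_def by linarith
        moreover obtain x where "x \<in> A' (m + 2) m" "A_letter m (letter_labels l) x = l" using * by blast
        ultimately show False using n conjunct1[OF *] by (auto simp del: One_nat_def)
      qed
      hence "adm_class l = 0" unfolding adm_class_def Let_def m_def[symmetric] if_not_P[OF False] by (rule if_not_P)
      thus ?thesis by (rule that(3)[OF False n])
    qed
  qed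
qed

lemma H_adm_class: "letter_ok l \<Longrightarrow> adm_class l \<in> H 1 (letter_labels l)"
proof -
  assume l: "letter_ok l"
  have f: "finite (letter_labels l)" using l by (rule letter_labels_finite)
  from l show ?thesis
  proof (cases rule: adm_class_cases)
    case (2 m x)
    have "x \<in> H 1 {1..m+2}" using A'_props(2)[OF 2(1)] 2(3) by blast
    from H_hrelabel[OF this order_iso_inj[OF f 2(2)]] show ?thesis
      unfolding order_iso_image[OF f 2(2)] by (simp only: 2(5))
  qed (use l H_letter_class H_zero in auto)
qed

lemma hrelabel_adm_class:
  assumes "letter_ok l" "strict_mono_on (letter_labels l) f"
  shows "hrelabel f (adm_class l) = adm_class (relabel_letter f l)"
proof -
  have f: "finite (letter_labels l)" using assms(1) by (rule letter_labels_finite)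
  have i: "inj_on f (letter_labels l)" using assms(2) by (rule strict_mono_on_imp_inj_on)
  have lk: "letter_ok (relabel_letter f l)" by (rule letter_ok_relabel_letter[OF assms])
  obtain D u v where l: "l = (D,u,v)" by (cases l)
  have uv: "u \<in> letter_labels l" "v \<in> letter_labels l" unfolding l letter_labels_def by simp_all
  have o: "order_iso (f ` S) i = f (order_iso S i)" if "S = letter_labels l" "card S = n" "i \<in> {1..n}" for S n i
  proof -
    have "i \<in> {1..card (letter_labels l)}" using that by simp
    from order_iso_mono_comp[OF f assms(2) this] show ?thesis unfolding that(1) by (rule sym)
  qed
  have ci: "card (f ` letter_labels l) = card (letter_labels l)" by (rule card_image[OF i])
  have AA: "A_letter m (f ` letter_labels l) x = relabel_letter f (A_letter m (letter_labels l) x)" if "1 \<le> m" "card (letter_labels l) = m + 2" "x \<in> A' (m + 2) m" for m x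
  proof -
    have "letter_labels (letter_of m x) = {1..m+2}" using letter_of_props(2)[OF that(1)] that(3) by (auto simp: A_letters_def)
    moreover obtain D u v where gl: "letter_of m x = (D,u,v)" by (cases "letter_of m x")
    ultimately have "D \<subseteq> {1..m+2}" "u \<in> {1..m+2}" "v \<in> {1..m+2}" by (auto simp: letter_labels_def)
    moreover have o': "order_iso (f ` letter_labels l) i = f (order_iso (letter_labels l) i)" if "i \<in> {1..m+2}" for i
      by (rule o[OF refl \<open>card (letter_labels l) = m + 2\<close> that])
    moreover from calculation have "order_iso (f ` letter_labels l) ` D = (\<lambda>i. f (order_iso (letter_labels l) i)) ` D"
      by (intro image_cong refl o') blast
    ultimately show ?thesis unfolding A_letter_def gl relabel_letter_def prod.case image_image by (intro prod_eqI) simp_all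
  qed
  from assms(1) show ?thesis
  proof (cases rule: adm_class_cases)
    case 1
    hence "u < v" by (simp add: l)
    moreover from this have "f u < f v" using strict_mono_onD[OF assms(2) uv] by simp
    ultimately show ?thesis using hrelabel_letter_class_B[of D u v f] assms(1) i 1(2) adm_class_B[of "f u" "f v" "f ` D"]
      by (simp add: l relabel_letter_def)
  next
    case (2 m x)
    have x: "x \<in> H 1 {1..m+2}" using A'_props(2)[OF 2(1)] 2(3) by blast
    have "relabel_letter f l = A_letter m (f ` letter_labels l) x" using AA[OF 2(1-3)] 2(4) by simp
    hence "adm_class (relabel_letter f l) = hrelabel (order_iso (f ` letter_labels l)) x"
      using adm_class_A[OF 2(1) _ _ 2(3), of "f ` letter_labels l"] f ci 2(2) by simp
    also have "\<dots> = hrelabel (f \<circ> order_iso (letter_labels l)) x"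
      by (rule hrelabel_cong[OF x]) (use o[OF refl 2(2)] in simp)
    also have "\<dots> = hrelabel f (hrelabel (order_iso (letter_labels l)) x)"
      using hrelabel_comp[OF x order_iso_inj[OF f 2(2)]] i order_iso_image[OF f 2(2)] by simp
    finally show ?thesis using 2(5) by simp
  next
    case 3
    have "adm_class (relabel_letter f l) = 0"
      using lk
    proof (cases rule: adm_class_cases)
      case 1
      hence "f u < f v" by (simp add: l relabel_letter_def)
      hence "u < v" using strict_mono_on_less[OF assms(2) uv] by simp
      thus ?thesis using 3(1) by (simp add: l)
    next
      case (2 m x)
      have c: "card (letter_labels l) = m + 2" using 2(2) ci by (simp add: letter_labels_relabel_letter)
      have "relabel_letter f l = relabel_letter f (A_letter m (letter_labels l) x)" using 2(4) AA[OF 2(1) c 2(3)] by (simp add: letter_labels_relabel_letter)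
      hence "l = A_letter m (letter_labels l) x"
        using relabel_letter_inj[OF i, of l "A_letter m (letter_labels l) x"] A_letter_props(2)[OF 2(1) f c 2(3)] by simp
      thus ?thesis using 3(2) 2(1,3) c by blast
    qed
    thus ?thesis using 3(3) hlinear_zero[OF hlinear_hrelabel] by simp
  qed
qed

end

context admissible_family
begin

definition adm_word_class :: "letter list \<Rightarrow> nat set \<Rightarrow> hmlg" where
  "adm_word_class ls D = foldr hprod (map adm_class ls) (sing_class D)"

lemma adm_word_class_simps [simp]: "adm_word_class [] D = sing_class D" "adm_word_class (l # ls) D = hprod (adm_class l) (adm_word_class ls D)"
  by (simp_all add: adm_word_class_def)

lemma H_adm_word_class: "word_on S ls D \<Longrightarrow> adm_word_class ls D \<in> H (length ls) S"
proof (induction ls arbitrary: S)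
  case Nil
  thus ?case by (simp add: H_E0)
next
  case (Cons l ls)
  hence "hprod (adm_class l) (adm_word_class ls D) \<in> H (1 + length ls) (letter_labels l \<union> (S - letter_labels l))"
    by (intro H_hprod H_adm_class) (auto simp: letter_labels_finite)
  moreover have "letter_labels l \<union> (S - letter_labels l) = S" using Cons.prems by auto
  ultimately show ?case by simp
qed

text \<open>The part of the first homology reached by single replaced letters with trailing
  singletons.\<close>
definition adm_H1 :: "nat set \<Rightarrow> hmlg set" where
  "adm_H1 S = hm.span (case_prod adm_word_class ` words_on 1 S)"

lemma adm_H1_base: "word_on S [l] D \<Longrightarrow> hprod (adm_class l) (sing_class D) \<in> adm_H1 S"
proof -
  assume w: "word_on S [l] D"
  have "([l],D) \<in> words_on 1 S" using w by (simp add: words_on_def)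
  hence "case_prod adm_word_class ([l],D) \<in> adm_H1 S" unfolding adm_H1_def by (intro hm.span_base imageI)
  thus ?thesis by simp
qed

lemma adm_H1_subspace: "hm.subspace (adm_H1 S)"
  unfolding adm_H1_def by (rule hm.subspace_span)

text \<open>As the span is a representation, an arbitrary injection of labels may be replaced by
  the increasing one.\<close>
lemma A_span_relabel:
  assumes "1 \<le> m" "inj_on h {1..m+2}" "S = h ` {1..m+2}" "v \<in> A_span m"
  shows "\<exists>v'\<in>A_span m. hrelabel h v = hrelabel (order_iso S) v'"
proof -
  have S: "finite S" "card S = m + 2" using assms(2,3) card_image[OF assms(2)] by auto
  define \<sigma> where "\<sigma> i = (if i \<in> {1..m+2} then inv_into {1..m+2} (order_iso S) (h i) else i)" for i
  have o: "bij_betw (order_iso S) {1..m+2} S" using order_iso_props(2)[OF S(1)] S(2) by simp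
  have b: "bij_betw (inv_into {1..m+2} (order_iso S)) S {1..m+2}" using o by (rule bij_betw_inv_into)
  have h: "bij_betw h {1..m+2} S" using assms(2,3) by (simp add: bij_betw_def)
  have "bij_betw \<sigma> {1..m+2} {1..m+2}"
    by (rule bij_betw_cong[THEN iffD2, OF _ bij_betw_trans[OF h b]]) (simp add: \<sigma>_def)
  hence p: "\<sigma> permutes {1..m+2}" by (rule bij_imp_permutes) (simp only: \<sigma>_def if_False)
  have v: "v \<in> H 1 {1..m+2}" using A_span_sub[OF assms(1)] assms(4) by blast
  have e: "h i = (order_iso S \<circ> \<sigma>) i" if "i \<in> {1..m+2}" for i
  proof -
    have "h i \<in> order_iso S ` {1..m+2}" using that assms(3) bij_betw_imp_surj_on[OF o] by simp
    hence "order_iso S (inv_into {1..m+2} (order_iso S) (h i)) = h i" by (rule f_inv_into_f)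
    thus ?thesis using that by (simp add: \<sigma>_def)
  qed
  have "hrelabel h v = hrelabel (order_iso S \<circ> \<sigma>) v" by (rule hrelabel_cong[OF v e])
  also have "\<dots> = hrelabel (order_iso S) (hrelabel \<sigma> v)"
    by (rule hrelabel_comp[OF v, symmetric])
       (use permutes_inj_on[OF p] order_iso_inj[OF S] permutes_image[OF p] in simp_all)
  finally show ?thesis using A_span_stable[OF assms(1) p assms(4)] by blast
qed

lemma A_span_in_adm_H1:
  assumes "1 \<le> m" "inj_on h {1..m+2}" "S = h ` {1..m+2}" "v \<in> A_span m" "finite D" "S \<inter> D = {}"
  shows "hprod (hrelabel h v) (sing_class D) \<in> adm_H1 (S \<union> D)"
proof -
  have S: "finite S" "card S = m + 2" using assms(2,3) card_image[OF assms(2)] by auto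
  obtain v' where v': "v' \<in> A_span m" "hrelabel h v = hrelabel (order_iso S) v'" using A_span_relabel[OF assms(1-4)] by blast
  have "hprod (hrelabel (order_iso S) v') (sing_class D) \<in> adm_H1 (S \<union> D)"
    using v'(1) unfolding A_span_def
  proof (induction rule: hm.span_induct_alt)
    case base
    show ?case by (simp add: hlinear_zero[OF hlinear_hrelabel] hm.subspace_0[OF adm_H1_subspace])
  next
    case (step q x y)
    note A_letter = A_letter_props[OF assms(1) S step(1)]
    have "S \<union> D - S = D" using assms(6) by auto
    hence "word_on (S \<union> D) [A_letter m S x] D" using A_letter S assms(5,6) by simp
    from adm_H1_base[OF this] have "hprod (hrelabel (order_iso S) x) (sing_class D) \<in> adm_H1 (S \<union> D)"
      unfolding adm_class_A[OF assms(1) S step(1)] .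
    thus ?case using step(2)
      by (simp add: hlinext_simps hm.subspace_add[OF adm_H1_subspace] hm.subspace_scale[OF adm_H1_subspace])
  qed
  thus ?thesis using v'(2) by simp
qed

lemma insert_sing_spaced_one:
  assumes "finite T" "finite B" "B \<inter> T = {}" "b \<in> H 1 B" "p \<notin> B \<union> T"
  shows "insert_sing (one_slot 1 {p}) (hprod b (sing_class T)) = hprod b (sing_class (insert p T))"
proof -
  have w: "spaced_ok (B \<union> T) {} [(b,B,T)]" using assms by auto
  have s: "slot_ok (length [(b,B,T)]) (one_slot 1 {p}) (B \<union> T)" using assms(5) by (auto simp: slot_ok_def one_slot_def)
  have "spaced {} [(b,B,T)] = hprod b (sing_class T)" by simp
  moreover have "spaced ({} \<union> one_slot 1 {p} 0) (add_slots (one_slot 1 {p}) [(b,B,T)]) = hprod b (sing_class (insert p T))"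
    by (simp add: one_slot_def)
  ultimately show ?thesis using insert_sing_spaced[OF w s] by simp
qed

text \<open>Since \<open>[\<iota>\<^sub>1]\<close> inserts after the only barrier, it adds to the
  trailing singletons, so the classes padded on the right are stable under relabeling and
  \<open>[\<iota>\<^sub>1]\<close>.\<close>
lemma generated_bound:
  assumes "1 \<le> m"
  shows "generated 1 {1} (m + 2) (A_span m) n \<subseteq> adm_H1 {1..n}"
proof -
  let ?ok = "\<lambda>n h v. inj_on h {1..m+2} \<and> h ` {1..m+2} \<subseteq> {1..n} \<and> v \<in> A_span m"
  let ?e = "\<lambda>n h v. hprod (hrelabel h v) (sing_class ({1..n} - h ` {1..m+2}))"
  define W where "W n = hm.span {?e n h v | h v. ?ok n h v}" for n
  have H1: "hrelabel h v \<in> H 1 (h ` {1..m+2})" if "?ok n h v" for n h v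
    using that A_span_sub[OF assms] by (intro H_hrelabel) auto
  have lin: "f ` W n \<subseteq> X" if "hlinear f" "hm.subspace X" "\<And>h v. ?ok n h v \<Longrightarrow> f (?e n h v) \<in> X" for f X n
  proof (rule image_subsetI)
    fix x assume "x \<in> W n"
    thus "f x \<in> X" unfolding W_def
    proof (induction rule: hm.span_induct_alt)
      case base
      show ?case using hlinear_zero[OF that(1)] hm.subspace_0[OF that(2)] by simp
    next
      case (step q x y)
      then obtain h v where "?ok n h v" "x = ?e n h v" by blast
      thus ?case using step(2) that(3)[of h v] hm.subspace_add[OF that(2)] hm.subspace_scale[OF that(2)]
        by (simp add: hlinear_add[OF that(1)] hlinear_scale[OF that(1)])
    qed
  qed
  have id: "hlinear (\<lambda>x. x)" by (intro hlinearI) simp_all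
  have WQ: "W n \<subseteq> adm_H1 {1..n}" for n
  proof -
    have "(\<lambda>x. x) ` W n \<subseteq> adm_H1 {1..n}"
    proof (rule lin[OF id adm_H1_subspace])
      fix h v assume ok: "?ok n h v"
      have "h ` {1..m+2} \<union> ({1..n} - h ` {1..m+2}) = {1..n}" using ok by auto
      with A_span_in_adm_H1[OF assms _ refl, of h v "{1..n} - h ` {1..m+2}"] ok show "?e n h v \<in> adm_H1 {1..n}" by simp
    qed
    thus ?thesis by simp
  qed
  have QH: "adm_H1 {1..n} \<subseteq> H 1 {1..n}" for n
    unfolding adm_H1_def by (rule hm.span_minimal[OF _ H_subspace]) (use H_adm_word_class in \<open>force simp: words_on_def\<close>)
  have "stable_seq 1 {1} W"
    unfolding stable_seq_def
  proof (intro allI conjI impI ballI)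
    fix n
    show "hm.subspace (W n)" unfolding W_def by (rule hm.subspace_span)
    show "W n \<subseteq> H 1 {1..n}" using WQ QH by (rule order_trans)
    show "hrelabel \<sigma> ` W n \<subseteq> W n" if s: "\<sigma> permutes {1..n}" for \<sigma>
    proof (rule lin[OF hlinear_hrelabel])
      show "hm.subspace (W n)" unfolding W_def by (rule hm.subspace_span)
      fix h v assume ok: "?ok n h v"
      let ?B = "h ` {1..m+2}"
      have v: "v \<in> H 1 {1..m+2}" using ok A_span_sub[OF assms] by blast
      have i: "inj_on \<sigma> A" for A using permutes_inj_on[OF s] .
      have "\<sigma> ` ({1..n} - ?B) = {1..n} - (\<sigma> \<circ> h) ` {1..m+2}"
        using image_set_diff[OF permutes_inj[OF s]] permutes_image[OF s] by (simp only: image_comp)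
      hence "hrelabel \<sigma> (?e n h v) = ?e n (\<sigma> \<circ> h) v"
        using ok hrelabel_comp[OF v _ i] by (simp add: hrelabel_hprod hrelabel_sing_class i)
      moreover have "?ok n (\<sigma> \<circ> h) v"
        using ok permutes_image[OF s] by (auto simp: image_comp[symmetric] intro!: comp_inj_on i)
      ultimately show "hrelabel \<sigma> (?e n h v) \<in> W n" unfolding W_def by (intro hm.span_base) blast
    qed
    fix j :: nat assume "j \<in> {1}"
    hence j: "j = 1" by simp
    have "insert_sing (one_slot 1 {Suc n}) ` W n \<subseteq> W (Suc n)"
    proof (rule lin[OF insert_sing_linear])
      show "hm.subspace (W (Suc n))" unfolding W_def by (rule hm.subspace_span)
      fix h v assume ok: "?ok n h v"
      have "insert (Suc n) ({1..n} - h ` {1..m+2}) = {1..Suc n} - h ` {1..m+2}" using ok by fastforce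
      moreover have "insert_sing (one_slot 1 {Suc n}) (?e n h v) = hprod (hrelabel h v) (sing_class (insert (Suc n) ({1..n} - h ` {1..m+2})))"
        by (rule insert_sing_spaced_one[OF _ _ _ H1[OF ok]]) (use ok in fastforce)+
      moreover have "?ok (Suc n) h v" using ok by fastforce
      ultimately show "insert_sing (one_slot 1 {Suc n}) (?e n h v) \<in> W (Suc n)" unfolding W_def
        by (intro hm.span_base) auto
    qed
    moreover have "iota 1 n j x = insert_sing (one_slot 1 {Suc n}) x" if "x \<in> W n" for x
      unfolding j by (rule iota_insert_sing) (use that WQ QH in \<open>blast | simp\<close>)+
    ultimately show "iota 1 n j ` W n \<subseteq> W (Suc n)" by auto
  qed
  moreover have "A_span m \<subseteq> W (m + 2)"
  proof
    fix v assume v: "v \<in> A_span m"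
    have "hrelabel id v = v" using A_span_sub[OF assms] v by (intro hrelabel_id[of v 1 "{1..m+2}"]) auto
    hence "?e (m + 2) id v = v" by simp
    moreover have "?ok (m + 2) id v" using v by simp
    ultimately have "v \<in> {?e (m + 2) h v | h v. ?ok (m + 2) h v}"
      by (intro CollectI exI[of _ id] exI[of _ v]) simp
    thus "v \<in> W (m + 2)" unfolding W_def by (rule hm.span_base)
  qed
  ultimately have "generated 1 {1} (m + 2) (A_span m) n \<subseteq> W n" unfolding generated_def by blast
  thus ?thesis using WQ by blast
qed

text \<open>A letter with increasing pair is not changed. A letter with decreasing pair lies in
  the span of all \<open>A_set n l\<close> and \<open>B_set n l\<close>, which by admissibility is
  the span of the classes from \<open>A'\<close> and \<open>B\<close>; the former are generated
  from degree \<open>l + 2\<close>.\<close>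
lemma H1_adm_H1_interval: "H 1 {1..n} \<subseteq> adm_H1 {1..n}"
proof -
  have B: "word_class [(D0,u,v)] D \<in> adm_H1 {1..n}" if "word_on {1..n} [(D0,u,v)] D" "u < v" for D0 u v D
    using adm_H1_base[OF that(1)] adm_class_B[OF that(2)] by simp
  have BS: "B_set n l \<subseteq> adm_H1 {1..n}" if "l + 2 \<le> n" for l
  proof
    fix z assume "z \<in> B_set n l"
    from B_set_words[OF that this] obtain D0 u v D where
      "word_on {1..n} [(D0,u,v)] D" "u < v" "z = word_class [(D0,u,v)] D" by blast
    thus "z \<in> adm_H1 {1..n}" using B by blast
  qed
  have "case_prod word_class w \<in> adm_H1 {1..n}" if w: "w \<in> words_on 1 {1..n}" for w
  proof -
    obtain ls D where "w = (ls,D)" by (cases w)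
    with w obtain l where l: "w = ([l],D)" "word_on {1..n} [l] D" by (auto simp: words_on_def length_Suc_conv)
    obtain D0 u v where l': "l = (D0,u,v)" by (cases l)
    note wk = l(2)[unfolded l']
    show ?thesis
    proof (cases "u < v")
      case True
      thus ?thesis using B[OF wk] by (simp add: l l')
    next
      case False
      have "letter_ok (D0,u,v)" using wk by simp
      note bar = letter_ok_barrier[OF this False]
      have c: "card D0 + 2 + card D = n" using one_pair_zclass(9)[OF wk] .
      have c1: "1 \<le> card D0" using bar(3,4) by (simp add: Suc_le_eq card_gt_0_iff)
      (* Admissibility at m = n - 2 covers all values of l at once. *)
      have n: "3 \<le> n" "1 \<le> n - 2" "n - 2 \<le> n - 2" using c c1 by linarith+
      have "word_class [(D0,u,v)] D \<in> A_set n (card D0)" by (rule word_class_one_AB(2)[OF wk False])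
      moreover have "card D0 \<in> {1..n-2}" using c c1 by simp
      ultimately have "word_class [(D0,u,v)] D \<in> hm.span (B_set n 0 \<union> (\<Union>l\<in>{1..n-2}. A_set n l \<union> B_set n l))"
        by (intro hm.span_base) blast
      also have "\<dots> = hm.span (B_set n 0 \<union> (\<Union>l\<in>{1..n-2}. A' n l \<union> B_set n l))"
        by (rule adm_props(5)[OF n, symmetric])
      also have "\<dots> \<subseteq> adm_H1 {1..n}"
      proof (rule hm.span_minimal[OF _ adm_H1_subspace])
        have "A' n l \<union> B_set n l \<subseteq> adm_H1 {1..n}" if l: "l \<in> {1..n-2}" for l
        proof -
          have ll: "1 \<le> l" "l \<le> n - 2" "l + 2 \<le> n" using l n by auto
          have "A' n l \<subseteq> hm.span (A' n l)" by (rule hm.span_superset)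
          also have "\<dots> \<subseteq> adm_H1 {1..n}" unfolding adm_props(6)[OF n(1) ll(1,2)] by (rule generated_bound[OF ll(1)])
          finally show ?thesis using BS[OF ll(3)] by blast
        qed
        moreover have "B_set n 0 \<subseteq> adm_H1 {1..n}" using BS[of 0] n by simp
        ultimately show "B_set n 0 \<union> (\<Union>l\<in>{1..n-2}. A' n l \<union> B_set n l) \<subseteq> adm_H1 {1..n}" by blast
      qed
      finally show ?thesis by (simp add: l l')
    qed
  qed
  hence "case_prod word_class ` words_on 1 {1..n} \<subseteq> adm_H1 {1..n}" by blast
  from hm.span_minimal[OF this adm_H1_subspace] show ?thesis by (simp add: H_eq_span)
qed

lemma H1_adm_H1:
  assumes "finite S" shows "H 1 S \<subseteq> adm_H1 S"
proof
  fix z assume z: "z \<in> H 1 S"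
  define n where "n = card S"
  let ?o = "order_iso S" and ?i = "inv_into {1..n} (order_iso S)"
  have o: "bij_betw ?o {1..n} S" and m: "strict_mono_on {1..n} ?o" using order_iso_props[OF assms] by (simp_all add: n_def)
  have b: "bij_betw ?i S {1..n}" using o by (rule bij_betw_inv_into)
  have "hrelabel ?i z \<in> H 1 {1..n}" using H_hrelabel[OF z, of ?i] b by (simp add: bij_betw_def)
  hence q: "hrelabel ?i z \<in> adm_H1 {1..n}" using H1_adm_H1_interval by blast
  have "hrelabel ?o y \<in> adm_H1 S" if "y \<in> adm_H1 {1..n}" for y
    using that unfolding adm_H1_def
  proof (induction rule: hm.span_induct_alt)
    case base
    show ?case using hm.span_zero hlinear_zero[OF hlinear_hrelabel] by simp
  next
    case (step q x y)
    then obtain ls D where "x = adm_word_class ls D" "word_on {1..n} ls D" "length ls = 1" by (auto simp: words_on_def)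
    then obtain l where l: "x = adm_word_class [l] D" "word_on {1..n} [l] D" by (auto simp: length_Suc_conv)
    have lm0: "letter_ok l" "D = {1..n} - letter_labels l" "letter_labels l \<subseteq> {1..n}" using l(2) by auto
    have lm: "letter_ok l" "strict_mono_on (letter_labels l) ?o" "D = {1..n} - letter_labels l" "letter_labels l \<subseteq> {1..n}"
      using lm0 monotone_on_subset[OF m lm0(3)] by auto
    have inj: "inj_on ?o {1..n}" using o by (simp add: bij_betw_def)
    have iD: "inj_on ?o D" by (rule inj_on_subset[OF inj]) (use lm in blast)
    have D: "?o ` D = S - ?o ` letter_labels l"
      using inj_on_image_set_diff[OF inj, of "{1..n}" "letter_labels l"] lm bij_betw_imp_surj_on[OF o] by auto
    have "hrelabel ?o x = hprod (adm_class (relabel_letter ?o l)) (sing_class (?o ` D))"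
      using l(1) hrelabel_adm_class[OF lm(1,2)] iD lm(3) by (simp add: hrelabel_hprod hrelabel_sing_class)
    moreover have "?o ` letter_labels l \<subseteq> S" using image_mono[OF lm(4), of ?o] bij_betw_imp_surj_on[OF o] by simp
    moreover from this have "word_on S [relabel_letter ?o l] (?o ` D)"
      using letter_ok_relabel_letter[OF lm(1,2)] D assms lm(4) bij_betw_imp_surj_on[OF o] by (auto simp: letter_labels_relabel_letter)
    ultimately have "hrelabel ?o x \<in> adm_H1 S" using adm_H1_base by simp
    thus ?case using step(2) unfolding adm_H1_def
      by (simp add: hrelabel_add hrelabel_scale hm.span_add hm.span_scale)
  qed
  from this[OF q] have "hrelabel ?o (hrelabel ?i z) \<in> adm_H1 S" .
  moreover have "hrelabel ?o (hrelabel ?i z) = hrelabel (?o \<circ> ?i) z"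
    using b o by (intro hrelabel_comp[OF z]) (auto simp: bij_betw_def)
  moreover have "hrelabel (?o \<circ> ?i) z = z"
    by (rule hrelabel_id[OF z]) (use o in \<open>simp add: bij_betw_inv_into_right\<close>)
  ultimately show "z \<in> adm_H1 S" by simp
qed

text \<open>Replace the first letter of a word: it becomes a combination of new letters with
  trailing singletons, which are then absorbed by the rest of the word, and the induction
  hypothesis applies to that rest.\<close>
theorem adm_word_class_span: "finite S \<Longrightarrow> H k S \<subseteq> hm.span (case_prod adm_word_class ` words_on k S)"
proof (induction k arbitrary: S)
  case 0
  have "words_on 0 S = {([],S)}" using 0 by (auto simp: words_on_def)
  thus ?case using H_eq_span[OF 0, of 0] by simp
next
  case (Suc k)
  let ?X = "hm.span (case_prod adm_word_class ` words_on (Suc k) S)"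
  have "case_prod word_class w \<in> ?X" if w: "w \<in> words_on (Suc k) S" for w
  proof -
    obtain ls0 D where "w = (ls0,D)" by (cases w)
    with w obtain l ls where l: "w = (l # ls,D)" "word_on S (l # ls) D" "length ls = k" by (auto simp: words_on_def length_Suc_conv)
    have lk: "letter_ok l" "letter_labels l \<subseteq> S" and wl: "word_on (S - letter_labels l) ls D" using l(2) by auto
    have letter_class: "letter_class l \<in> adm_H1 (letter_labels l)" using H1_adm_H1[OF letter_labels_finite[OF lk(1)]] H_letter_class[OF lk(1)] by blast
    have zk: "word_class ls D \<in> H k (S - letter_labels l)" using H_word_class[OF wl] l(3) by simp
    have "hprod x (word_class ls D) \<in> ?X" if "x \<in> adm_H1 (letter_labels l)" for x
      using that unfolding adm_H1_def
    proof (induction rule: hm.span_induct_alt)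
      case base
      show ?case using hm.span_zero by simp
    next
      case (step q x y)
      then obtain ls' D' where "x = adm_word_class ls' D'" "word_on (letter_labels l) ls' D'" "length ls' = 1" by (auto simp: words_on_def)
      then obtain l' where l': "x = hprod (adm_class l') (sing_class D')" "letter_ok l'" "letter_labels l' \<subseteq> letter_labels l" "D' = letter_labels l - letter_labels l'"
        by (auto simp: length_Suc_conv)
      have fD: "finite D'" using l'(4) letter_labels_finite[OF lk(1)] by simp
      have fS: "finite (S - letter_labels l)" using Suc.prems by simp
      have di: "D' \<inter> (S - letter_labels l) = {}" using l'(4) by auto
      have un: "D' \<union> (S - letter_labels l) = S - letter_labels l'" using l'(3,4) lk(2) by auto
      have "hprod (sing_class D') (word_class ls D) \<in> H (0 + k) (D' \<union> (S - letter_labels l))"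
        by (rule H_hprod[OF H_E0[OF fD] zk di fD fS])
      hence "hprod (sing_class D') (word_class ls D) \<in> hm.span (case_prod adm_word_class ` words_on k (S - letter_labels l'))"
        using Suc.IH[of "S - letter_labels l'"] Suc.prems un by auto
      hence "hprod (adm_class l') (hprod (sing_class D') (word_class ls D)) \<in> ?X"
      proof (induction rule: hm.span_induct_alt)
        case base
        show ?case using hm.span_zero by simp
      next
        case (step q a b)
        then obtain ms D2 where a: "a = adm_word_class ms D2" "word_on (S - letter_labels l') ms D2" "length ms = k" by (auto simp: words_on_def)
        have "(l' # ms, D2) \<in> words_on (Suc k) S" using a l' lk Suc.prems by (auto simp: words_on_def)
        hence "case_prod adm_word_class (l' # ms, D2) \<in> ?X" by (intro hm.span_base imageI)
        hence "hprod (adm_class l') a \<in> ?X" using a(1) by simp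
        thus ?case using step(2) by (simp add: hprod_add_right hprod_scale_right hm.span_add hm.span_scale)
      qed
      hence "hprod x (word_class ls D) \<in> ?X" using l'(1) by (simp add: hprod_assoc)
      thus ?case using step(2) by (simp add: hprod_add_left hprod_scale_left hm.span_add hm.span_scale)
    qed
    from this[OF letter_class] show ?thesis by (simp add: l)
  qed
  hence "case_prod word_class ` words_on (Suc k) S \<subseteq> ?X" by blast
  from hm.span_minimal[OF this hm.subspace_span] show ?case by (simp add: H_eq_span[OF Suc.prems])
qed

text \<open>A spanning family with as many members as a basis.\<close>
theorem adm_word_class_basis:
  assumes "finite S"
  shows "inj_on (case_prod adm_word_class) (words_on k S)" "hm.independent (case_prod adm_word_class ` words_on k S)"
proof -
  let ?W = "words_on k S" and ?z = "case_prod word_class" and ?z' = "case_prod adm_word_class"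
  have fW: "finite ?W" by (rule finite_words_on[OF assms])
  have Ww: "?W \<subseteq> words" by (auto simp: words_on_def words_def)
  obtain B where B: "B \<subseteq> ?z' ` ?W" "hm.independent B" "?z' ` ?W \<subseteq> hm.span B"
    by (rule hm.maximal_independent_subset)
  have fB: "finite B" using B(1) fW finite_subset by blast
  have iz: "hm.independent (?z ` ?W)" by (rule hm.independent_mono[OF word_class_independent image_mono[OF Ww]])
  have "?z ` ?W \<subseteq> H k S" using H_eq_span[OF assms, of k] hm.span_superset by blast
  also have "\<dots> \<subseteq> hm.span (?z' ` ?W)" by (rule adm_word_class_span[OF assms])
  also have "\<dots> \<subseteq> hm.span B" by (rule hm.span_minimal[OF B(3) hm.subspace_span])
  finally have "card (?z ` ?W) \<le> card B" using hm.independent_span_bound[OF fB iz] by blast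
  moreover have "card (?z ` ?W) = card ?W" by (rule card_image[OF inj_on_subset[OF word_class_inj Ww]])
  moreover have "card B \<le> card (?z' ` ?W)" by (rule card_mono[OF finite_imageI[OF fW] B(1)])
  moreover have "card (?z' ` ?W) \<le> card ?W" by (rule card_image_le[OF fW])
  ultimately have c: "card (?z' ` ?W) = card ?W" "card B = card (?z' ` ?W)" by linarith+
  show "inj_on ?z' ?W" by (rule eq_card_imp_inj_on[OF fW c(1)])
  have "B = ?z' ` ?W" by (rule card_subset_eq[OF finite_imageI[OF fW] B(1) c(2)])
  thus "hm.independent (?z' ` ?W)" using B(2) by simp
qed

end

section \<open>The \<open>FI\<^sub>d\<close>-module structure on homology\<close>

lemma FI_homE:
  assumes "\<phi> \<in> FI_hom d m n"
  shows "fst \<phi> \<in> {1..m} \<rightarrow>\<^sub>E {1..n}" "inj_on (fst \<phi>) {1..m}" "fst \<phi> ` {1..m} \<subseteq> {1..n}"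
    "snd \<phi> \<in> ({1..n} - fst \<phi> ` {1..m}) \<rightarrow>\<^sub>E {..<d}"
proof -
  obtain f g where p: "\<phi> = (f,g)" by (cases \<phi>)
  show 1: "fst \<phi> \<in> {1..m} \<rightarrow>\<^sub>E {1..n}" "inj_on (fst \<phi>) {1..m}"
    "snd \<phi> \<in> ({1..n} - fst \<phi> ` {1..m}) \<rightarrow>\<^sub>E {..<d}" using assms by (simp_all add: p FI_hom_def)
  show "fst \<phi> ` {1..m} \<subseteq> {1..n}"
  proof (rule image_subsetI)
    fix x assume "x \<in> {1..m}" thus "fst \<phi> x \<in> {1..n}" using 1(1) by (rule PiE_mem[rotated])
  qed
qed

lemma FI_comp_simps:
  "fst (FI_comp l m n \<phi> \<psi>) = compose {1..l} (fst \<phi>) (fst \<psi>)"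
  "snd (FI_comp l m n \<phi> \<psi>) = (\<lambda>x\<in>{1..n} - (fst \<phi> \<circ> fst \<psi>) ` {1..l}.
        if x \<notin> fst \<phi> ` {1..m} then snd \<phi> x else snd \<psi> (inv_into {1..m} (fst \<phi>) x))"
  unfolding FI_comp_def by (simp_all only: case_prod_beta fst_conv snd_conv)

lemma compose_image: "compose A f g ` A = (f \<circ> g) ` A"
  by (intro image_cong) (simp_all add: compose_eq)

lemma FI_comp_closed:
  assumes "\<phi> \<in> FI_hom d m n" "\<psi> \<in> FI_hom d l m"
  shows "FI_comp l m n \<phi> \<psi> \<in> FI_hom d l n"
proof -
  note p = FI_homE[OF assms(1)] and q = FI_homE[OF assms(2)]
  have 1: "compose {1..l} (fst \<phi>) (fst \<psi>) \<in> {1..l} \<rightarrow>\<^sub>E {1..n}"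
    using p(3) q(3) by (auto simp: compose_def)
  have 2: "inj_on (compose {1..l} (fst \<phi>) (fst \<psi>)) {1..l}"
  proof -
    have "inj_on (fst \<phi> \<circ> fst \<psi>) {1..l}" by (rule comp_inj_on[OF q(2) inj_on_subset[OF p(2) q(3)]])
    thus ?thesis by (rule inj_on_cong[THEN iffD1, rotated]) (simp add: compose_eq)
  qed
  have 3: "(if x \<notin> fst \<phi> ` {1..m} then snd \<phi> x else snd \<psi> (inv_into {1..m} (fst \<phi>) x)) < d"
    if x: "x \<in> {1..n} - (fst \<phi> \<circ> fst \<psi>) ` {1..l}" for x
  proof (cases "x \<in> fst \<phi> ` {1..m}")
    case True
    then obtain y where y: "y \<in> {1..m}" "x = fst \<phi> y" by blast
    have "y \<notin> fst \<psi> ` {1..l}" using x y(2) by auto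
    hence "snd \<psi> y \<in> {..<d}" using y(1) by (intro PiE_mem[OF q(4)]) simp
    thus ?thesis using True y by (simp add: inv_into_f_f[OF p(2)] del: One_nat_def)
  next
    case False
    hence "snd \<phi> x \<in> {..<d}" using x by (intro PiE_mem[OF p(4)]) simp
    thus ?thesis using False by simp
  qed
  have a: "(compose {1..l} (fst \<phi>) (fst \<psi>), snd (FI_comp l m n \<phi> \<psi>)) \<in> FI_hom d l n"
    unfolding FI_hom_def mem_Collect_eq prod.case compose_image FI_comp_simps(2)
    using 1 2 3 by (intro conjI) (auto intro!: restrict_PiE_iff[THEN iffD2])
  have b: "FI_comp l m n \<phi> \<psi> = (compose {1..l} (fst \<phi>) (fst \<psi>), snd (FI_comp l m n \<phi> \<psi>))"
    by (rule prod_eqI) (simp_all only: FI_comp_simps(1) fst_conv snd_conv)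
  show ?thesis using a unfolding b[symmetric] .
qed

lemma perm_mor_hom: "\<sigma> permutes {1..n} \<Longrightarrow> perm_mor n \<sigma> \<in> FI_hom d n n"
proof -
  assume s: "\<sigma> permutes {1..n}"
  have im: "restrict \<sigma> {1..n} ` {1..n} = {1..n}" using permutes_image[OF s] by simp
  have "restrict \<sigma> {1..n} \<in> {1..n} \<rightarrow>\<^sub>E {1..n}"
    unfolding restrict_PiE_iff using permutes_in_image[OF s] by blast
  moreover have "inj_on (restrict \<sigma> {1..n}) {1..n}" using permutes_inj_on[OF s] by (simp add: inj_on_restrict_eq)
  ultimately show ?thesis unfolding perm_mor_def FI_hom_def mem_Collect_eq prod.case im by simp
qed

lemma std_incl_hom: "c < d \<Longrightarrow> std_incl n c \<in> FI_hom d n (Suc n)"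
  by (auto simp: std_incl_def FI_hom_def inj_on_def restrict_def PiE_def extensional_def)

text \<open>The new labels whose color belongs to \<open>[\<iota>\<^sub>i]\<close>.\<close>
definition color_slots :: "nat list \<Rightarrow> nat \<Rightarrow> nat \<Rightarrow> mor \<Rightarrow> nat \<Rightarrow> nat set" where
  "color_slots js m n \<phi> i = {p \<in> {1..n} - fst \<phi> ` {1..m}. js ! (snd \<phi> p) = i}"

definition FI_act :: "nat list \<Rightarrow> nat \<Rightarrow> nat \<Rightarrow> mor \<Rightarrow> hmlg \<Rightarrow> hmlg" where
  "FI_act js m n \<phi> = relabel_insert (fst \<phi>) (color_slots js m n \<phi>)"

definition H_FI_mod :: "nat \<Rightarrow> nat list \<Rightarrow> hmlg fimod" where
  "H_FI_mod k js = (\<lambda>n. hsub (H k {1..n}), FI_act js)"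

lemma color_slots_slot_ok: "slot_ok k (color_slots js m n \<phi>) (fst \<phi> ` {1..m})"
  by (auto simp: slot_ok_def color_slots_def)

lemma color_slots_union:
  assumes "\<phi> \<in> FI_hom (length js) m n" "\<forall>j\<in>set js. j \<le> k"
  shows "fst \<phi> ` {1..m} \<union> (\<Union>i\<le>k. color_slots js m n \<phi> i) = {1..n}"
proof -
  note p = FI_homE[OF assms(1)]
  have "js ! (snd \<phi> x) \<le> k" if "x \<in> {1..n} - fst \<phi> ` {1..m}" for x
    using PiE_mem[OF p(4) that] assms(2) by simp
  hence "(\<Union>i\<le>k. color_slots js m n \<phi> i) = {1..n} - fst \<phi> ` {1..m}" by (auto simp: color_slots_def)
  thus ?thesis using p(3) by blast
qed

lemma relabel_insert_cong:
  assumes "finite S" "z \<in> H k S" "inj_on f S" "slot_ok k P (f ` S)" "\<And>x. x \<in> S \<Longrightarrow> f x = f' x"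
    "\<And>i. i \<le> k \<Longrightarrow> P i = P' i"
  shows "relabel_insert f P z = relabel_insert f' P' z"
proof -
  have "hrelabel f z = hrelabel f' z" using assms(2,5) by (rule hrelabel_cong)
  moreover have "insert_sing P x = insert_sing P' x" if "x \<in> H k (f ` S)" for x
  proof (rule H_linear_ext[OF _ insert_sing_linear insert_sing_linear that])
    fix T l assume w: "spaced_ok (f ` S) T l" "length l = k"
    have s: "slot_ok k P' (f ` S)" using assms(4,6) unfolding slot_ok_def by simp
    have "add_slots P l = add_slots P' l" if "\<And>i. i \<le> length l \<Longrightarrow> P i = P' i" for P P' l
      using that
    proof (induction P l arbitrary: P' rule: add_slots.induct)
      case (2 P b B T l)
      have "P (Suc 0) = P' (Suc 0)" using 2(2)[of "Suc 0"] by simp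
      moreover have "add_slots (P \<circ> Suc) l = add_slots (P' \<circ> Suc) l" by (rule 2(1)) (use 2(2) in simp)
      ultimately show ?case by simp
    qed simp
    from this[of l P P'] have "add_slots P l = add_slots P' l" using assms(6) w(2) by simp
    moreover have "P 0 = P' 0" using assms(6) by simp
    ultimately show "insert_sing P (spaced T l) = insert_sing P' (spaced T l)" using insert_sing_spaced[OF w(1)] w(2) assms(4) s by simp
  qed (use assms(1) in simp)
  ultimately show ?thesis using H_hrelabel[OF assms(2,3)] by (simp add: relabel_insert_def)
qed

lemma FI_act_in_H:
  assumes "\<phi> \<in> FI_hom (length js) m n" "\<forall>j\<in>set js. j \<le> k" "z \<in> H k {1..m}"
  shows "FI_act js m n \<phi> z \<in> H k {1..n}"
  using relabel_insert_in_H[OF _ assms(3) FI_homE(2)[OF assms(1)] color_slots_slot_ok[of k js m n]] color_slots_union[OF assms(1,2)]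
  by (simp add: FI_act_def)

lemma FI_act_linear: "hlinear (FI_act js m n \<phi>)"
  unfolding FI_act_def by (rule relabel_insert_linear)

lemma FI_act_perm:
  assumes "\<sigma> permutes {1..n}" "z \<in> H k {1..n}"
  shows "FI_act js n n (perm_mor n \<sigma>) z = hrelabel \<sigma> z"
proof -
  have P: "color_slots js n n (perm_mor n \<sigma>) = (\<lambda>_. {})"
    using permutes_image[OF assms(1)] by (auto simp: color_slots_def perm_mor_def)
  have i: "inj_on \<sigma> {1..n}" by (rule permutes_inj_on[OF assms(1)])
  have "hrelabel \<sigma> z = relabel_insert \<sigma> (\<lambda>_. {}) z" by (rule hrelabel_relabel_insert[OF _ assms(2) i]) simp
  also have "\<dots> = relabel_insert (restrict \<sigma> {1..n}) (\<lambda>_. {}) z"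
    by (rule relabel_insert_cong[OF _ assms(2) i]) (auto simp: slot_ok_def)
  finally show ?thesis unfolding FI_act_def P by (simp add: perm_mor_def)
qed

lemma FI_act_comp:
  assumes "\<phi> \<in> FI_hom (length js) m n" "\<psi> \<in> FI_hom (length js) l m" "\<forall>j\<in>set js. j \<le> k" "z \<in> H k {1..l}"
  shows "FI_act js l n (FI_comp l m n \<phi> \<psi>) z = FI_act js m n \<phi> (FI_act js l m \<psi> z)"
proof -
  note p = FI_homE[OF assms(1)] and q = FI_homE[OF assms(2)]
  let ?f = "fst \<phi>" and ?f' = "fst \<psi>"
  note U = color_slots_union[OF assms(2,3)]
  let ?P = "\<lambda>i. ?f ` color_slots js l m \<psi> i \<union> color_slots js m n \<phi> i"
  have c: "FI_act js m n \<phi> (FI_act js l m \<psi> z) = relabel_insert (?f \<circ> ?f') ?P z" unfolding FI_act_def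
    by (rule relabel_insert_comp[OF _ assms(4) q(2) color_slots_slot_ok U[symmetric] p(2) color_slots_slot_ok]) simp
  have i: "inj_on (?f \<circ> ?f') {1..l}" by (rule comp_inj_on[OF q(2) inj_on_subset[OF p(2) q(3)]])
  have s: "slot_ok k ?P ((?f \<circ> ?f') ` {1..l})"
    by (rule slot_ok_comp[OF color_slots_slot_ok U[symmetric] p(2) color_slots_slot_ok])
  have P: "color_slots js l n (FI_comp l m n \<phi> \<psi>) i = ?P i" for i
  proof (intro equalityI subsetI)
    fix x assume "x \<in> color_slots js l n (FI_comp l m n \<phi> \<psi>) i"
    hence x0: "x \<in> {1..n} - (?f \<circ> ?f') ` {1..l}" "js ! snd (FI_comp l m n \<phi> \<psi>) x = i"
      unfolding color_slots_def FI_comp_simps(1) compose_image by blast+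
    have "snd (FI_comp l m n \<phi> \<psi>) x = (if x \<notin> ?f ` {1..m} then snd \<phi> x else snd \<psi> (inv_into {1..m} ?f x))"
      unfolding FI_comp_simps(2) by (rule restrict_apply'[OF x0(1)])
    with x0 have x: "x \<in> {1..n} - (?f \<circ> ?f') ` {1..l}"
      "js ! (if x \<notin> ?f ` {1..m} then snd \<phi> x else snd \<psi> (inv_into {1..m} ?f x)) = i" by simp_all
    show "x \<in> ?P i"
    proof (cases "x \<in> ?f ` {1..m}")
      case True
      then obtain y where y: "y \<in> {1..m}" "x = ?f y" by blast
      have "y \<notin> ?f' ` {1..l}" using x(1) y(2) by auto
      hence "y \<in> color_slots js l m \<psi> i" using y x(2) True by (simp add: color_slots_def inv_into_f_f[OF p(2)] del: One_nat_def)
      thus ?thesis using y(2) by blast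
    next
      case False
      thus ?thesis using x by (simp add: color_slots_def)
    qed
  next
    fix x assume "x \<in> ?P i"
    thus "x \<in> color_slots js l n (FI_comp l m n \<phi> \<psi>) i"
    proof
      assume "x \<in> ?f ` color_slots js l m \<psi> i"
      then obtain y where y: "y \<in> {1..m}" "y \<notin> ?f' ` {1..l}" "js ! snd \<psi> y = i" "x = ?f y" by (auto simp: color_slots_def)
      have "x \<notin> (?f \<circ> ?f') ` {1..l}"
      proof
        assume "x \<in> (?f \<circ> ?f') ` {1..l}"
        then obtain w where w: "w \<in> {1..l}" "?f y = ?f (?f' w)" using y(4) by auto
        have "?f' w \<in> {1..m}" using q(3) w(1) by blast
        hence "y = ?f' w" using inj_onD[OF p(2) w(2) y(1)] by blast
        thus False using y(2) w(1) by blast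
      qed
      moreover have "x \<in> {1..n}" using p(3) y(1,4) by blast
      moreover have "x \<in> ?f ` {1..m}" using y(1,4) by blast
      ultimately show ?thesis using y by (simp add: color_slots_def FI_comp_simps compose_image inv_into_f_f[OF p(2)] del: One_nat_def)
    next
      assume "x \<in> color_slots js m n \<phi> i"
      hence x: "x \<in> {1..n}" "x \<notin> ?f ` {1..m}" "js ! snd \<phi> x = i" by (auto simp: color_slots_def)
      have "x \<notin> (?f \<circ> ?f') ` {1..l}" using x(2) q(3) by (auto simp: image_comp[symmetric])
      thus ?thesis using x by (simp add: color_slots_def FI_comp_simps compose_image)
    qed
  qed
  have "relabel_insert (?f \<circ> ?f') ?P z = relabel_insert (compose {1..l} ?f ?f') (color_slots js l n (FI_comp l m n \<phi> \<psi>)) z"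
    by (rule relabel_insert_cong[OF _ assms(4) i s]) (simp_all add: compose_eq P)
  thus ?thesis unfolding c by (simp add: FI_act_def FI_comp_simps)
qed

lemma FI_act_incl:
  assumes "c < length js" "\<forall>j\<in>set js. j \<le> k" "z \<in> H k {1..n}"
  shows "FI_act js n (Suc n) (std_incl n c) z = iota k n (js ! c) z"
proof -
  have i: "inj_on (\<lambda>i\<in>{1..n}. i) {1..n}" by (simp add: inj_on_def)
  have im: "(\<lambda>i\<in>{1..n}. i) ` {1..n} = {1..n}" by simp
  have P: "color_slots js n (Suc n) (std_incl n c) = one_slot (js ! c) {Suc n}"
    by (rule ext) (auto simp: color_slots_def std_incl_def one_slot_def)
  have "hrelabel (\<lambda>i\<in>{1..n}. i) z = z" by (rule hrelabel_id[OF assms(3)]) simp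
  hence "FI_act js n (Suc n) (std_incl n c) z = insert_sing (one_slot (js ! c) {Suc n}) z"
    unfolding FI_act_def P relabel_insert_def by (simp add: std_incl_def)
  moreover have "js ! c \<le> k" using assms(1,2) by simp
  ultimately show ?thesis using iota_insert_sing[OF _ assms(3)] by simp
qed

lemma module_hsub:
  assumes "hm.subspace W" shows "Module.module rat_ring (hsub W)"
proof -
  have "cring rat_ring"
  proof (rule cringI)
    show "abelian_group rat_ring"
    proof (rule abelian_groupI)
      fix x :: rat assume "x \<in> carrier rat_ring"
      show "\<exists>y\<in>carrier rat_ring. y \<oplus>\<^bsub>rat_ring\<^esub> x = \<zero>\<^bsub>rat_ring\<^esub>"
        by (intro bexI[of _ "- x"]) (simp_all add: rat_ring_def)
    qed (simp_all add: rat_ring_def)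
    show "comm_monoid rat_ring" by (rule comm_monoidI) (simp_all add: rat_ring_def)
  qed (simp add: rat_ring_def algebra_simps)
  moreover have "abelian_group (hsub W)"
  proof (rule abelian_groupI)
    fix x assume "x \<in> carrier (hsub W)"
    thus "\<exists>y\<in>carrier (hsub W). y \<oplus>\<^bsub>hsub W\<^esub> x = \<zero>\<^bsub>hsub W\<^esub>"
      using hm.subspace_neg[OF assms] by (intro bexI[of _ "- x"]) (simp_all add: hsub_def)
  qed (use hm.subspace_add[OF assms] hm.subspace_0[OF assms] in \<open>simp_all add: hsub_def add.assoc add.commute\<close>)
  ultimately show ?thesis
  proof (rule module.intro)
    show "module_axioms rat_ring (hsub W)"
      by unfold_locales (use hm.subspace_scale[OF assms] in
        \<open>simp_all add: hsub_def rat_ring_def hm.scale_left_distrib hm.scale_right_distrib\<close>)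
  qed
qed

lemma lin_map_hsub: "hlinear f \<Longrightarrow> f ` W \<subseteq> W' \<Longrightarrow> lin_map (hsub W) (hsub W') f"
  by (auto simp: lin_map_def hsub_def hlinear_add hlinear_scale)

lemma FI_module_hsub:
  assumes "\<forall>j\<in>set js. j \<le> k" "\<And>n. hm.subspace (W n)" "\<And>n. W n \<subseteq> H k {1..n}"
    "\<And>m n \<phi>. \<phi> \<in> FI_hom (length js) m n \<Longrightarrow> FI_act js m n \<phi> ` W m \<subseteq> W n"
  shows "FI_module (length js) (\<lambda>n. hsub (W n), FI_act js)"
  unfolding FI_module_def fst_conv snd_conv
proof (intro conjI allI ballI)
  show "Module.module rat_ring (hsub (W n))" for n by (rule module_hsub[OF assms(2)])
  show "lin_map (hsub (W m)) (hsub (W n)) (FI_act js m n \<phi>)" if "\<phi> \<in> FI_hom (length js) m n" for m n \<phi>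
    by (rule lin_map_hsub[OF FI_act_linear assms(4)[OF that]])
  show "FI_act js n n (perm_mor n id) x = x" if x: "x \<in> carrier (hsub (W n))" for n x
  proof -
    have z: "x \<in> H k {1..n}" using x assms(3) by (auto simp: hsub_def)
    show ?thesis using FI_act_perm[OF permutes_id z] hrelabel_id[OF z, of id] by simp
  qed
  show "FI_act js l n (FI_comp l m n \<phi> \<psi>) x = FI_act js m n \<phi> (FI_act js l m \<psi> x)"
    if "\<phi> \<in> FI_hom (length js) m n" "\<psi> \<in> FI_hom (length js) l m" "x \<in> carrier (hsub (W l))" for l m n \<phi> \<psi> x
    by (rule FI_act_comp[OF that(1,2) assms(1)]) (use that(3) assms(3) in \<open>auto simp: hsub_def\<close>)
qed

theorem H_FI_H_FI_mod:
  assumes "\<forall>j\<in>set js. j \<le> k"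
  shows "H_FI k js (H_FI_mod k js)"
  unfolding H_FI_def
proof (intro conjI allI impI ballI)
  show "FI_module (length js) (H_FI_mod k js)" unfolding H_FI_mod_def
    by (rule FI_module_hsub[OF assms H_subspace]) (use FI_act_in_H[OF _ assms] in auto)
  show "fst (H_FI_mod k js) n = hsub (H k {1..n})" for n by (simp add: H_FI_mod_def)
  show "snd (H_FI_mod k js) n n (perm_mor n \<sigma>) x = hrelabel \<sigma> x" if "\<sigma> permutes {1..n}" "x \<in> H k {1..n}" for n \<sigma> x
    using FI_act_perm[OF that] by (simp add: H_FI_mod_def)
  show "snd (H_FI_mod k js) n (Suc n) (std_incl n c) x = iota k n (js ! c) x" if "c < length js" "x \<in> H k {1..n}" for n c x
    using FI_act_incl[OF that(1) assms that(2)] by (simp add: H_FI_mod_def)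
qed

section \<open>Generated submodules\<close>

definition FI_span :: "nat list \<Rightarrow> nat \<Rightarrow> hmlg set \<Rightarrow> nat \<Rightarrow> hmlg set" where
  "FI_span js n V n' = hm.span {FI_act js n n' \<phi> w | \<phi> w. \<phi> \<in> FI_hom (length js) n n' \<and> w \<in> V}"

lemma FI_span_subspace: "hm.subspace (FI_span js n V n')"
  unfolding FI_span_def by (rule hm.subspace_span)

lemma FI_span_lin:
  assumes "hlinear f" "hm.subspace X" "\<And>\<phi> w. \<phi> \<in> FI_hom (length js) n n' \<Longrightarrow> w \<in> V \<Longrightarrow> f (FI_act js n n' \<phi> w) \<in> X"
  shows "f ` FI_span js n V n' \<subseteq> X"
proof (rule image_subsetI)
  fix x assume "x \<in> FI_span js n V n'"
  thus "f x \<in> X" unfolding FI_span_def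
  proof (induction rule: hm.span_induct_alt)
    case base
    show ?case using hlinear_zero[OF assms(1)] hm.subspace_0[OF assms(2)] by simp
  next
    case (step q x y)
    then obtain \<phi> w where "\<phi> \<in> FI_hom (length js) n n'" "w \<in> V" "x = FI_act js n n' \<phi> w" by blast
    thus ?case using step(2) assms(3)[of \<phi> w] hm.subspace_add[OF assms(2)] hm.subspace_scale[OF assms(2)]
      by (simp add: hlinear_add[OF assms(1)] hlinear_scale[OF assms(1)])
  qed
qed

lemma FI_span_H:
  assumes "\<forall>j\<in>set js. j \<le> k" "V \<subseteq> H k {1..n}"
  shows "FI_span js n V n' \<subseteq> H k {1..n'}"
proof -
  have "hlinear (\<lambda>x. x)" by (rule hlinearI) simp_all
  hence "(\<lambda>x. x) ` FI_span js n V n' \<subseteq> H k {1..n'}"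
  proof (rule FI_span_lin[OF _ H_subspace])
    show "FI_act js n n' \<phi> w \<in> H k {1..n'}" if "\<phi> \<in> FI_hom (length js) n n'" "w \<in> V" for \<phi> w
      by (rule FI_act_in_H[OF that(1) assms(1)]) (use that(2) assms(2) in blast)
  qed
  thus ?thesis by simp
qed

lemma FI_span_base: "\<phi> \<in> FI_hom (length js) n n' \<Longrightarrow> w \<in> V \<Longrightarrow> FI_act js n n' \<phi> w \<in> FI_span js n V n'"
  unfolding FI_span_def by (intro hm.span_base) blast

lemma FI_span_closed:
  assumes "\<forall>j\<in>set js. j \<le> k" "V \<subseteq> H k {1..n}" "\<phi> \<in> FI_hom (length js) m n'"
  shows "FI_act js m n' \<phi> ` FI_span js n V m \<subseteq> FI_span js n V n'"
proof (rule FI_span_lin[OF FI_act_linear FI_span_subspace])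
  fix \<psi> w assume *: "\<psi> \<in> FI_hom (length js) n m" "w \<in> V"
  have "FI_act js m n' \<phi> (FI_act js n m \<psi> w) = FI_act js n n' (FI_comp n m n' \<phi> \<psi>) w"
    by (rule FI_act_comp[OF assms(3) *(1) assms(1), symmetric]) (use *(2) assms(2) in blast)
  thus "FI_act js m n' \<phi> (FI_act js n m \<psi> w) \<in> FI_span js n V n'"
    using FI_span_base[OF FI_comp_closed[OF assms(3) *(1)] *(2)] by simp
qed

text \<open>Any morphism is built from high insertions and permutations. If a new label
  \<open>p\<close> is present, transposing it with the largest label reduces to a map that is a
  high insertion after a map to one label less; otherwise the morphism is a permutation.\<close>
lemma stable_relabel_insert:
  assumes st: "stable_seq k (set js) W" and X: "V \<subseteq> W n" "V \<subseteq> H k {1..n}" and w: "w \<in> V"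
    and js: "\<forall>j\<in>set js. j \<le> k"
  shows "inj_on f {1..n} \<Longrightarrow> slot_ok k P (f ` {1..n}) \<Longrightarrow> f ` {1..n} \<union> (\<Union>i\<le>k. P i) = {1..n'} \<Longrightarrow>
    (\<And>i. i \<le> k \<Longrightarrow> P i \<noteq> {} \<Longrightarrow> i \<in> set js) \<Longrightarrow> relabel_insert f P w \<in> W n'"
proof (induction n' arbitrary: f P)
  case (0 f P)
  have "f ` {1..n} = {}" using 0(3) by auto
  hence n: "n = 0" by simp
  have z: "w \<in> H k {1..n}" using X w by blast
  have e: "P i = {}" if "i \<le> k" for i using 0(3) that by auto
  have "relabel_insert f P w = relabel_insert f (\<lambda>_. {}) w" by (rule relabel_insert_cong[OF _ z 0(1,2)]) (simp_all add: e)
  also have "\<dots> = hrelabel f w" by (rule hrelabel_relabel_insert[OF _ z 0(1), symmetric]) simp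
  also have "\<dots> = w" by (rule hrelabel_id[OF z]) (simp add: n)
  finally show ?case using X(1) w n by auto
next
  case (Suc n'' f P)
  let ?n = "Suc n''"
  have z: "w \<in> H k {1..n}" using X w by blast
  show ?case
  proof (cases "\<exists>i\<le>k. P i \<noteq> {}")
    case False
    hence im: "f ` {1..n} = {1..?n}" using Suc.prems(3) by auto
    hence "n = ?n" using card_image[OF Suc.prems(1)] by simp
    define \<sigma> where "\<sigma> i = (if i \<in> {1..n} then f i else i)" for i
    have "bij_betw \<sigma> {1..n} {1..n}"
      by (rule bij_betw_cong[THEN iffD1, of _ f]) (use im Suc.prems(1) \<open>n = ?n\<close> in \<open>simp_all add: \<sigma>_def bij_betw_def\<close>)
    hence p: "\<sigma> permutes {1..n}" by (rule bij_imp_permutes) (simp only: \<sigma>_def if_False)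
    have "relabel_insert f P w = relabel_insert f (\<lambda>_. {}) w" by (rule relabel_insert_cong[OF _ z Suc.prems(1,2)]) (use False in auto)
    also have "\<dots> = hrelabel f w" by (rule hrelabel_relabel_insert[OF _ z Suc.prems(1), symmetric]) simp
    also have "\<dots> = hrelabel \<sigma> w" by (rule hrelabel_cong[OF z]) (simp add: \<sigma>_def)
    also have "\<dots> \<in> W n" using st p X(1) w unfolding stable_seq_def by blast
    finally show ?thesis using \<open>n = ?n\<close> by simp
  next
    case True
    then obtain i p where i: "i \<le> k" "p \<in> P i" by blast
    have ij: "i \<in> set js" using Suc.prems(4)[of i] i by blast
    let ?t = "transpose p ?n"
    have p: "p \<in> {1..?n}" using Suc.prems(3) i by blast
    have tp: "?t permutes {1..?n}" by (rule permutes_swap_id[OF p]) simp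
    have ti: "inj_on ?t A" for A by (rule permutes_inj_on[OF tp])
    have tt: "?t (?t x) = x" for x by simp
    have pf: "p \<notin> f ` {1..n}" using Suc.prems(2) i by (auto simp: slot_ok_def)
    have pP: "p \<notin> P i'" if "i' \<le> k" "i' \<noteq> i" for i'
    proof -
      have "P i \<inter> P i' = {}" using Suc.prems(2) i(1) that by (simp add: slot_ok_def)
      thus ?thesis using i(2) by blast
    qed
    have nt: "?n \<in> ?t ` A \<longleftrightarrow> p \<in> A" for A
    proof
      assume "?n \<in> ?t ` A" then obtain a where "a \<in> A" "?n = ?t a" by blast
      from \<open>?n = ?t a\<close> have "?t ?n = ?t (?t a)" by (rule arg_cong)
      hence "p = a" by (simp only: tt transpose_apply_second)
      thus "p \<in> A" using \<open>a \<in> A\<close> by simp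
    next
      assume "p \<in> A" hence "?t p \<in> ?t ` A" by (rule imageI)
      thus "?n \<in> ?t ` A" by simp
    qed
    define f2 where "f2 = ?t \<circ> f"
    define P2 where "P2 i' = ?t ` P i' - {?n}" for i'
    have i2: "inj_on f2 {1..n}" unfolding f2_def by (rule comp_inj_on[OF Suc.prems(1) ti])
    have fi: "f2 ` {1..n} = ?t ` f ` {1..n}" by (simp add: f2_def image_comp)
    have tdis: "?t ` A \<inter> ?t ` B = {}" if "A \<inter> B = {}" for A B
      using that by (simp add: image_Int[OF ti[of UNIV], symmetric])
    have s2: "slot_ok k P2 (f2 ` {1..n})"
      unfolding slot_ok_def
    proof (intro conjI allI impI)
      fix a assume a: "a \<le> k"
      show "finite (P2 a)" using Suc.prems(2) a by (simp add: slot_ok_def P2_def)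
      have "P a \<inter> f ` {1..n} = {}" using Suc.prems(2) a by (simp add: slot_ok_def)
      from tdis[OF this] show "P2 a \<inter> f2 ` {1..n} = {}" unfolding fi P2_def by blast
      fix b assume b: "b \<le> k" "a \<noteq> b"
      have "P a \<inter> P b = {}" using Suc.prems(2) a b by (simp add: slot_ok_def)
      from tdis[OF this] show "P2 a \<inter> P2 b = {}" unfolding P2_def by blast
    qed
    have U2: "f2 ` {1..n} \<union> (\<Union>i\<le>k. P2 i) = {1..n''}"
    proof -
      have "?n \<notin> f2 ` {1..n}" unfolding fi nt by (rule pf)
      hence "f2 ` {1..n} \<union> (\<Union>i\<le>k. P2 i) = ?t ` (f ` {1..n} \<union> (\<Union>i\<le>k. P i)) - {?n}"
      proof -
        have gen: "A \<union> (\<Union>i\<le>k. B i - {c}) = A \<union> (\<Union>i\<le>k. B i) - {c}" if "c \<notin> A" for A c and B :: "nat \<Rightarrow> nat set"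
          using that by auto
        have "f2 ` {1..n} \<union> (\<Union>i\<le>k. ?t ` P i - {?n}) = f2 ` {1..n} \<union> (\<Union>i\<le>k. ?t ` P i) - {?n}"
          by (rule gen[OF \<open>?n \<notin> f2 ` {1..n}\<close>])
        thus ?thesis by (simp only: P2_def image_Un image_UN fi)
      qed
      also have "\<dots> = {1..?n} - {?n}" unfolding Suc.prems(3) permutes_image[OF tp] ..
      also have "{1..?n} - {?n} = {1..n''}" by auto
      finally show ?thesis .
    qed
    have "relabel_insert f2 P2 w \<in> W n''"
      by (rule Suc.IH[OF i2 s2 U2]) (use Suc.prems(4) in \<open>auto simp: P2_def\<close>)
    hence a: "iota k n'' i (relabel_insert f2 P2 w) \<in> W ?n" using st ij unfolding stable_seq_def by blast
    have h2: "relabel_insert f2 P2 w \<in> H k {1..n''}" using relabel_insert_in_H[OF _ z i2 s2] unfolding U2 by simp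
    let ?P3 = "\<lambda>i'. id ` P2 i' \<union> one_slot i {?n} i'"
    have s3: "slot_ok k (one_slot i {?n}) (id ` {1..n''})" by (auto simp: slot_ok_def one_slot_def)
    have "iota k n'' i (relabel_insert f2 P2 w) = insert_sing (one_slot i {?n}) (relabel_insert f2 P2 w)" by (rule iota_insert_sing[OF i(1) h2])
    also have "\<dots> = relabel_insert id (one_slot i {?n}) (relabel_insert f2 P2 w)" unfolding relabel_insert_def[of id] using hrelabel_id[OF h2, of id] by simp
    also have "\<dots> = relabel_insert (id \<circ> f2) ?P3 w"
      by (rule relabel_insert_comp[OF _ z i2 s2 U2[symmetric] _ s3]) simp_all
    finally have b: "iota k n'' i (relabel_insert f2 P2 w) = relabel_insert f2 ?P3 w" by simp
    have s4: "slot_ok k ?P3 (f2 ` {1..n})"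
      using slot_ok_comp[OF s2 U2[symmetric] _ s3] by simp
    have U4: "{1..?n} = f2 ` {1..n} \<union> (\<Union>i'\<le>k. ?P3 i')"
    proof -
      have "(\<Union>i'\<le>k. one_slot i {?n} i') = {?n}" using i(1) by (auto simp: one_slot_def split: if_splits)
      hence "f2 ` {1..n} \<union> (\<Union>i'\<le>k. ?P3 i') = {1..n''} \<union> {?n}"
        by (simp only: UN_Un_distrib image_id id_apply Un_assoc[symmetric] U2)
      thus ?thesis by auto
    qed
    have s5: "slot_ok k (\<lambda>_. {}) (?t ` {1..?n})" by (simp add: slot_ok_def)
    have z4: "relabel_insert f2 ?P3 w \<in> H k {1..?n}" using relabel_insert_in_H[OF _ z i2 s4] unfolding U4 by simp
    have "hrelabel ?t (relabel_insert f2 ?P3 w) = relabel_insert ?t (\<lambda>_. {}) (relabel_insert f2 ?P3 w)"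
      by (rule hrelabel_relabel_insert[OF _ z4 ti]) simp
    also have "\<dots> = relabel_insert (?t \<circ> f2) (\<lambda>i'. ?t ` ?P3 i' \<union> {}) w"
      by (rule relabel_insert_comp[OF _ z i2 s4 U4 ti s5]) simp
    also have "\<dots> = relabel_insert f P w"
    proof (rule relabel_insert_cong[OF _ z, symmetric])
      fix i' assume i': "i' \<le> k"
      show "P i' = ?t ` ?P3 i' \<union> {}"
      proof (cases "i' = i")
        case True
        have "?P3 i' = ?t ` P i'" using nt[of "P i"] i(2) True by (auto simp: P2_def one_slot_def)
        thus ?thesis by (simp add: image_image)
      next
        case False
        have "?P3 i' = ?t ` P i'" using nt[of "P i'"] pP[OF i' False] False by (auto simp: P2_def one_slot_def)
        thus ?thesis by (simp add: image_image)
      qed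
    qed (use Suc.prems(1,2) in \<open>simp_all add: f2_def\<close>)
    finally have "relabel_insert f P w = hrelabel ?t (relabel_insert f2 ?P3 w)" by simp
    moreover have "hrelabel ?t (relabel_insert f2 ?P3 w) \<in> W ?n"
      using st tp a unfolding b stable_seq_def by blast
    ultimately show ?thesis by simp
  qed
qed

text \<open>The span is stable by functoriality, and \<open>stable_relabel_insert\<close> shows
  that it is contained in every stable sequence.\<close>
theorem generated_FI_span:
  assumes js: "\<forall>j\<in>set js. j \<le> k" and X: "X \<subseteq> H k {1..n}"
  shows "generated k (set js) n X n' = FI_span js n (hm.span X) n'"
proof (rule equalityI)
  let ?V = "hm.span X"
  have V: "?V \<subseteq> H k {1..n}" by (rule hm.span_minimal[OF X H_subspace])
  have "stable_seq k (set js) (FI_span js n ?V)"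
    unfolding stable_seq_def
  proof (intro allI conjI ballI impI)
    fix m
    show "hm.subspace (FI_span js n ?V m)" by (rule FI_span_subspace)
    show H: "FI_span js n ?V m \<subseteq> H k {1..m}" by (rule FI_span_H[OF js V])
    show "hrelabel \<sigma> ` FI_span js n ?V m \<subseteq> FI_span js n ?V m" if s: "\<sigma> permutes {1..m}" for \<sigma>
    proof -
      have "FI_act js m m (perm_mor m \<sigma>) ` FI_span js n ?V m \<subseteq> FI_span js n ?V m"
        by (rule FI_span_closed[OF js V perm_mor_hom[OF s]])
      moreover have "FI_act js m m (perm_mor m \<sigma>) x = hrelabel \<sigma> x" if "x \<in> FI_span js n ?V m" for x
        by (rule FI_act_perm[OF s]) (use that H in blast)
      ultimately show ?thesis by auto
    qed
    show "iota k m j ` FI_span js n ?V m \<subseteq> FI_span js n ?V (Suc m)" if j: "j \<in> set js" for j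
    proof -
      obtain c where c: "c < length js" "j = js ! c" using j by (auto simp: in_set_conv_nth)
      have "FI_act js m (Suc m) (std_incl m c) ` FI_span js n ?V m \<subseteq> FI_span js n ?V (Suc m)"
        by (rule FI_span_closed[OF js V std_incl_hom[OF c(1)]])
      moreover have "FI_act js m (Suc m) (std_incl m c) x = iota k m j x" if "x \<in> FI_span js n ?V m" for x
        unfolding c(2) by (rule FI_act_incl[OF c(1) js]) (use that H in blast)
      ultimately show ?thesis by auto
    qed
  qed
  moreover have "X \<subseteq> FI_span js n ?V n"
  proof
    fix x assume x: "x \<in> X"
    hence z: "x \<in> H k {1..n}" using X by blast
    have "FI_act js n n (perm_mor n id) x \<in> FI_span js n ?V n"
      by (rule FI_span_base[OF perm_mor_hom[OF permutes_id]]) (rule hm.span_base[OF x])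
    thus "x \<in> FI_span js n ?V n" using FI_act_perm[OF permutes_id z] hrelabel_id[OF z, of id] by simp
  qed
  ultimately show "generated k (set js) n X n' \<subseteq> FI_span js n ?V n'" unfolding generated_def by blast
  show "FI_span js n ?V n' \<subseteq> generated k (set js) n X n'"
    unfolding generated_def
  proof (rule Inter_greatest)
    fix Y assume "Y \<in> {W n' | W. stable_seq k (set js) W \<and> X \<subseteq> W n}"
    then obtain W where W: "Y = W n'" "stable_seq k (set js) W" "X \<subseteq> W n" by blast
    have sub: "hm.subspace (W m)" for m using W(2) by (simp add: stable_seq_def)
    have VW: "?V \<subseteq> W n" by (rule hm.span_minimal[OF W(3) sub])
    have "FI_act js n n' \<phi> w \<in> W n'" if p: "\<phi> \<in> FI_hom (length js) n n'" and w: "w \<in> ?V" for \<phi> w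
      unfolding FI_act_def
    proof (rule stable_relabel_insert[OF W(2) VW V w js FI_homE(2)[OF p] color_slots_slot_ok color_slots_union[OF p js]])
      fix i assume "color_slots js n n' \<phi> i \<noteq> {}"
      then obtain x where x: "x \<in> {1..n'} - fst \<phi> ` {1..n}" "js ! snd \<phi> x = i" by (auto simp: color_slots_def)
      have "snd \<phi> x < length js" using PiE_mem[OF FI_homE(4)[OF p] x(1)] by simp
      thus "i \<in> set js" using x(2) by auto
    qed
    hence "{FI_act js n n' \<phi> w | \<phi> w. \<phi> \<in> FI_hom (length js) n n' \<and> w \<in> ?V} \<subseteq> W n'" by blast
    from hm.span_minimal[OF this sub] show "FI_span js n ?V n' \<subseteq> Y" unfolding W(1) FI_span_def .
  qed
qed

section \<open>Presented vector spaces\<close>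

definition hlinext :: "('a \<Rightarrow> hmlg) \<Rightarrow> 'a fvec \<Rightarrow> hmlg" where
  "hlinext f c = (\<Sum>a\<in>Poly_Mapping.keys c. hscale (Poly_Mapping.lookup c a) (f a))"

lemma hlinext_superset:
  assumes "finite A" "Poly_Mapping.keys c \<subseteq> A"
  shows "hlinext f c = (\<Sum>a\<in>A. hscale (Poly_Mapping.lookup c a) (f a))"
  unfolding hlinext_def using assms
  by (intro sum.mono_neutral_left) (auto simp: in_keys_iff)

lemma hlinext_zero [simp]: "hlinext f 0 = 0"
  and hlinext_gen [simp]: "hlinext f (gen a) = f a"
  by (simp_all add: hlinext_def)

lemma hlinext_add: "hlinext f (c + d) = hlinext f c + hlinext f d"
proof -
  let ?A = "Poly_Mapping.keys c \<union> Poly_Mapping.keys d"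
  have "hlinext f (c + d) = (\<Sum>a\<in>?A. hscale (Poly_Mapping.lookup (c + d) a) (f a))"
    by (rule hlinext_superset) (use Poly_Mapping.keys_add[of c d] in auto)
  also have "\<dots> = hlinext f c + hlinext f d"
    by (subst (1 2) hlinext_superset[of ?A]) (auto simp: lookup_add hm.scale_left_distrib sum.distrib)
  finally show ?thesis .
qed

lemma hlinext_scale: "hlinext f (qscale q c) = hscale q (hlinext f c)"
proof -
  have "hlinext f (qscale q c) = (\<Sum>a\<in>Poly_Mapping.keys c. hscale (Poly_Mapping.lookup (qscale q c) a) (f a))"
    by (rule hlinext_superset) (auto simp: in_keys_iff)
  thus ?thesis by (simp add: hlinext_def hm.scale_sum_right)
qed

lemma hlinext_diff: "hlinext f (c - d) = hlinext f c - hlinext f d"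
  using hlinext_add[of f "c - d" d] by simp

lemma hlinext_linext: "hlinext f (linext (\<lambda>x. gen (h x)) c) = hlinext (\<lambda>x. f (h x)) c"
  by (induction c rule: fvec_induct_all) (simp_all add: linext_add linext_scale hlinext_add hlinext_scale)

lemma hlinext_map:
  assumes "Poly_Mapping.keys c \<subseteq> X" "\<And>x. x \<in> X \<Longrightarrow> f' x = L (f x)" "hlinear L"
  shows "hlinext f' c = L (hlinext f c)"
  using assms(1) by (induction c rule: fvec_induct)
    (simp_all add: assms(2) hlinext_add hlinext_scale hlinear_add[OF assms(3)] hlinear_scale[OF assms(3)] hlinear_zero[OF assms(3)])

lemma hlinext_in_span: "Poly_Mapping.keys c \<subseteq> X \<Longrightarrow> hlinext f c \<in> hm.span (f ` X)"
  by (induction c rule: fvec_induct) (auto simp: hlinext_add hlinext_scale hm.span_add hm.span_scale hm.span_base hm.span_zero)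

lemma span_hlinext:
  assumes "w \<in> hm.span (f ` X)"
  shows "\<exists>c. Poly_Mapping.keys c \<subseteq> X \<and> hlinext f c = w"
  using assms
proof (induction rule: hm.span_induct_alt)
  case base
  show ?case by (rule exI[of _ 0]) simp
next
  case (step q x y)
  then obtain c a where c: "Poly_Mapping.keys c \<subseteq> X" "hlinext f c = y" "a \<in> X" "x = f a" by blast
  have "Poly_Mapping.keys (qscale q (gen a) + c) \<subseteq> X"
    using Poly_Mapping.keys_add[of "qscale q (gen a)" c] c(1,3)
    by (auto simp: in_keys_iff lookup_single when_def split: if_splits)
  thus ?case using c by (intro exI[of _ "qscale q (gen a) + c"]) (simp add: hlinext_add hlinext_scale)
qed

lemma span_gen_keys: "c \<in> fvec.span (gen ` N) \<Longrightarrow> Poly_Mapping.keys c \<subseteq> N"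
proof (induction rule: fvec.span_induct_alt)
  case (step q x y)
  then obtain a where "a \<in> N" "x = gen a" by blast
  thus ?case using step Poly_Mapping.keys_add[of "qscale q x" y]
    by (auto simp: in_keys_iff lookup_single when_def split: if_splits)
qed simp

lemma gen_span_keys: "Poly_Mapping.keys c \<subseteq> X \<Longrightarrow> (\<And>x. x \<in> X \<Longrightarrow> gen x \<in> fvec.span T) \<Longrightarrow> c \<in> fvec.span T"
  by (induction c rule: fvec_induct) (auto intro: fvec.span_add fvec.span_scale fvec.span_zero)

lemma keys_add_sub: "Poly_Mapping.keys c \<subseteq> X \<Longrightarrow> Poly_Mapping.keys d \<subseteq> X \<Longrightarrow> Poly_Mapping.keys (c + d) \<subseteq> X"
  and keys_scale_sub: "Poly_Mapping.keys c \<subseteq> X \<Longrightarrow> Poly_Mapping.keys (qscale q c) \<subseteq> X"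
  and keys_diff_sub: "Poly_Mapping.keys c \<subseteq> X \<Longrightarrow> Poly_Mapping.keys d \<subseteq> X \<Longrightarrow> Poly_Mapping.keys (c - d) \<subseteq> X"
  using Poly_Mapping.keys_add[of c d] Poly_Mapping.keys_diff[of c d] by (auto simp: in_keys_iff)

lemma coset_eq_iff: "coset R c = coset R d \<longleftrightarrow> c - d \<in> fvec.span R"
proof
  assume "coset R c = coset R d"
  moreover have "c \<in> coset R c" unfolding coset_def using fvec.span_zero[of R] by force
  ultimately have "c \<in> coset R d" by simp
  then obtain r where "r \<in> fvec.span R" "c = d + r" by (auto simp: coset_def)
  thus "c - d \<in> fvec.span R" by simp
next
  have sub: "coset R c \<subseteq> coset R d" if "c - d \<in> fvec.span R" for c d
  proof
    fix x assume "x \<in> coset R c"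
    then obtain r where r: "r \<in> fvec.span R" "x = c + r" by (auto simp: coset_def)
    have "x = d + ((c - d) + r)" using r by simp
    thus "x \<in> coset R d" unfolding coset_def using fvec.span_add[OF that r(1)] by blast
  qed
  assume "c - d \<in> fvec.span R"
  moreover from fvec.span_neg[OF this] have "d - c \<in> fvec.span R" by simp
  ultimately show "coset R c = coset R d" using sub by blast
qed

lemma coset_self: "c \<in> coset R c"
  unfolding coset_def using fvec.span_zero[of R] by force

lemma presented_simps:
  "carrier (presented X R) = coset R ` {c. Poly_Mapping.keys c \<subseteq> X}" "zero (presented X R) = coset R 0"
  "coset R c \<oplus>\<^bsub>presented X R\<^esub> coset R d = coset R (c + d)"
  "q \<odot>\<^bsub>presented X R\<^esub> coset R c = coset R (qscale q c)"
proof -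
  show "carrier (presented X R) = coset R ` {c. Poly_Mapping.keys c \<subseteq> X}" "zero (presented X R) = coset R 0"
    by (simp_all add: presented_def)
  have "{x + y | x y. x \<in> coset R c \<and> y \<in> coset R d} = coset R (c + d)"
  proof (intro equalityI subsetI)
    fix z assume "z \<in> {x + y | x y. x \<in> coset R c \<and> y \<in> coset R d}"
    then obtain r s where *: "r \<in> fvec.span R" "s \<in> fvec.span R" "z = (c + r) + (d + s)" by (auto simp: coset_def)
    have "z = (c + d) + (r + s)" using *(3) by (simp add: algebra_simps)
    thus "z \<in> coset R (c + d)" unfolding coset_def using fvec.span_add[OF *(1,2)] by blast
  next
    fix z assume "z \<in> coset R (c + d)"
    then obtain r where r: "r \<in> fvec.span R" "z = (c + d) + r" by (auto simp: coset_def)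
    have "z = c + (d + r)" using r(2) by (simp add: algebra_simps)
    moreover have "d + r \<in> coset R d" unfolding coset_def using r(1) by blast
    ultimately show "z \<in> {x + y | x y. x \<in> coset R c \<and> y \<in> coset R d}" using coset_self[of c R] by blast
  qed
  thus "coset R c \<oplus>\<^bsub>presented X R\<^esub> coset R d = coset R (c + d)" by (simp add: presented_def)
  have "{qscale q x + r | x r. x \<in> coset R c \<and> r \<in> fvec.span R} = coset R (qscale q c)"
  proof (intro equalityI subsetI)
    fix z assume "z \<in> {qscale q x + r | x r. x \<in> coset R c \<and> r \<in> fvec.span R}"
    then obtain r s where *: "r \<in> fvec.span R" "s \<in> fvec.span R" "z = qscale q (c + r) + s" by (auto simp: coset_def)
    have "z = qscale q c + (qscale q r + s)" using *(3) by (simp add: fvec.scale_right_distrib algebra_simps)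
    thus "z \<in> coset R (qscale q c)" unfolding coset_def using fvec.span_add[OF fvec.span_scale[OF *(1)] *(2)] by blast
  next
    fix z assume "z \<in> coset R (qscale q c)"
    then obtain r where "r \<in> fvec.span R" "z = qscale q c + r" by (auto simp: coset_def)
    thus "z \<in> {qscale q x + r | x r. x \<in> coset R c \<and> r \<in> fvec.span R}" using coset_self[of c R] by blast
  qed
  thus "q \<odot>\<^bsub>presented X R\<^esub> coset R c = coset R (qscale q c)" by (simp add: presented_def)
qed

text \<open>Closure under the operations is all that remains to be known of a module record once
  it is identified with a subspace; see \<open>module_transport\<close>.\<close>
definition ops_closed :: "'v qmod \<Rightarrow> bool" where
  "ops_closed M \<longleftrightarrow> \<zero>\<^bsub>M\<^esub> \<in> carrier M \<and> (\<forall>x\<in>carrier M. \<forall>y\<in>carrier M. x \<oplus>\<^bsub>M\<^esub> y \<in> carrier M) \<and>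
     (\<forall>q. \<forall>x\<in>carrier M. q \<odot>\<^bsub>M\<^esub> x \<in> carrier M)"

lemma opscD:
  assumes "ops_closed M"
  shows "\<zero>\<^bsub>M\<^esub> \<in> carrier M" "x \<in> carrier M \<Longrightarrow> y \<in> carrier M \<Longrightarrow> x \<oplus>\<^bsub>M\<^esub> y \<in> carrier M"
    "x \<in> carrier M \<Longrightarrow> q \<odot>\<^bsub>M\<^esub> x \<in> carrier M"
  using assms by (auto simp: ops_closed_def)

lemma ops_closed_presented: "ops_closed (presented X R)"
  unfolding ops_closed_def presented_simps(1,2)
proof (intro conjI ballI allI)
  show "coset R 0 \<in> coset R ` {c. Poly_Mapping.keys c \<subseteq> X}" by (rule imageI) simp
  fix x assume "x \<in> coset R ` {c. Poly_Mapping.keys c \<subseteq> X}"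
  then obtain c where c: "x = coset R c" "Poly_Mapping.keys c \<subseteq> X" by blast
  show "q \<odot>\<^bsub>presented X R\<^esub> x \<in> coset R ` {c. Poly_Mapping.keys c \<subseteq> X}" for q
    unfolding c(1) presented_simps by (intro imageI CollectI keys_scale_sub c(2))
  fix y assume "y \<in> coset R ` {c. Poly_Mapping.keys c \<subseteq> X}"
  then obtain d where d: "y = coset R d" "Poly_Mapping.keys d \<subseteq> X" by blast
  show "x \<oplus>\<^bsub>presented X R\<^esub> y \<in> coset R ` {c. Poly_Mapping.keys c \<subseteq> X}"
    unfolding c(1) d(1) presented_simps by (intro imageI CollectI keys_add_sub c(2) d(2))
qed

lemma module_cring: "Module.module rat_ring M \<Longrightarrow> cring rat_ring"
  by (simp add: Module.module_def)

lemma ops_closed_module: "Module.module rat_ring M \<Longrightarrow> ops_closed M"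
proof -
  assume m: "Module.module rat_ring M"
  interpret Module.module rat_ring M by (rule m)
  show ?thesis unfolding ops_closed_def using M.zero_closed M.add.m_closed smult_closed by (auto simp: rat_ring_def)
qed

lemma lin_isoD:
  assumes "lin_iso M (hsub W) T"
  shows "x \<in> carrier M \<Longrightarrow> T x \<in> W" "x \<in> carrier M \<Longrightarrow> y \<in> carrier M \<Longrightarrow> T (x \<oplus>\<^bsub>M\<^esub> y) = T x + T y"
    "x \<in> carrier M \<Longrightarrow> T (q \<odot>\<^bsub>M\<^esub> x) = hscale q (T x)" "bij_betw T (carrier M) W"
    "inj_on T (carrier M)" "w \<in> W \<Longrightarrow> \<exists>x\<in>carrier M. T x = w"
proof -
  have b: "bij_betw T (carrier M) W" and l: "lin_map M (hsub W) T" using assms by (auto simp: lin_iso_def hsub_def)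
  show "bij_betw T (carrier M) W" "inj_on T (carrier M)" using b by (auto simp: bij_betw_def)
  show "x \<in> carrier M \<Longrightarrow> T x \<in> W" "w \<in> W \<Longrightarrow> \<exists>x\<in>carrier M. T x = w" using b by (auto simp: bij_betw_def)
  show "x \<in> carrier M \<Longrightarrow> y \<in> carrier M \<Longrightarrow> T (x \<oplus>\<^bsub>M\<^esub> y) = T x + T y"
    "x \<in> carrier M \<Longrightarrow> T (q \<odot>\<^bsub>M\<^esub> x) = hscale q (T x)" using l by (auto simp: lin_map_def hsub_def)
qed

lemma lin_isoI:
  assumes "bij_betw T (carrier M) W" "\<And>x y. x \<in> carrier M \<Longrightarrow> y \<in> carrier M \<Longrightarrow> T (x \<oplus>\<^bsub>M\<^esub> y) = T x + T y"
    "\<And>q x. x \<in> carrier M \<Longrightarrow> T (q \<odot>\<^bsub>M\<^esub> x) = hscale q (T x)"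
  shows "lin_iso M (hsub W) T"
  using assms by (auto simp: lin_iso_def lin_map_def hsub_def bij_betw_def)

lemma lin_iso_zero:
  assumes "lin_iso M (hsub W) T" "ops_closed M" "T \<zero>\<^bsub>M\<^esub> = 0" "x \<in> carrier M"
  shows "0 \<odot>\<^bsub>M\<^esub> x = \<zero>\<^bsub>M\<^esub>"
  by (rule inj_onD[OF lin_isoD(5)[OF assms(1)]])
     (use lin_isoD(3)[OF assms(1,4)] assms opscD[OF assms(2)] in simp_all)

lemma module_transport:
  assumes T: "lin_iso M (hsub W) T" and o: "ops_closed M" and z: "T \<zero>\<^bsub>M\<^esub> = 0" and W: "Module.module rat_ring (hsub W')"
  shows "Module.module rat_ring M"
proof -
  note tD = lin_isoD[OF T] and oD = opscD[OF o]
  have eq: "x = y" if "T x = T y" "x \<in> carrier M" "y \<in> carrier M" for x y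
    using inj_onD[OF tD(5) that] .
  have "abelian_group M"
  proof (rule abelian_groupI)
    fix x assume x: "x \<in> carrier M"
    show "\<exists>y\<in>carrier M. y \<oplus>\<^bsub>M\<^esub> x = \<zero>\<^bsub>M\<^esub>"
    proof (rule bexI[of _ "(-1) \<odot>\<^bsub>M\<^esub> x"])
      show "(-1) \<odot>\<^bsub>M\<^esub> x \<oplus>\<^bsub>M\<^esub> x = \<zero>\<^bsub>M\<^esub>"
        by (rule eq) (use x z in \<open>simp_all add: tD oD\<close>)
    qed (rule oD(3)[OF x])
    show "\<zero>\<^bsub>M\<^esub> \<oplus>\<^bsub>M\<^esub> x = x" by (rule eq) (use x z in \<open>simp_all add: tD oD\<close>)
    fix y assume y: "y \<in> carrier M"
    show "x \<oplus>\<^bsub>M\<^esub> y \<in> carrier M" by (rule oD(2)[OF x y])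
    show "x \<oplus>\<^bsub>M\<^esub> y = y \<oplus>\<^bsub>M\<^esub> x" by (rule eq) (use x y in \<open>simp_all add: tD oD add.commute\<close>)
    fix w assume w: "w \<in> carrier M"
    show "x \<oplus>\<^bsub>M\<^esub> y \<oplus>\<^bsub>M\<^esub> w = x \<oplus>\<^bsub>M\<^esub> (y \<oplus>\<^bsub>M\<^esub> w)"
      by (rule eq) (use x y w in \<open>simp_all add: tD oD add.assoc\<close>)
  qed (rule oD(1))
  moreover have "module_axioms rat_ring M"
  proof (rule module_axioms.intro)
    fix a b x y assume x: "x \<in> carrier M"
    show "a \<odot>\<^bsub>M\<^esub> x \<in> carrier M" by (rule oD(3)[OF x])
    show "(a \<oplus>\<^bsub>rat_ring\<^esub> b) \<odot>\<^bsub>M\<^esub> x = a \<odot>\<^bsub>M\<^esub> x \<oplus>\<^bsub>M\<^esub> b \<odot>\<^bsub>M\<^esub> x"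
      by (rule eq) (use x in \<open>simp_all add: tD oD rat_ring_def hm.scale_left_distrib\<close>)
    show "(a \<otimes>\<^bsub>rat_ring\<^esub> b) \<odot>\<^bsub>M\<^esub> x = a \<odot>\<^bsub>M\<^esub> (b \<odot>\<^bsub>M\<^esub> x)"
      by (rule eq) (use x in \<open>simp_all add: tD oD rat_ring_def\<close>)
    show "\<one>\<^bsub>rat_ring\<^esub> \<odot>\<^bsub>M\<^esub> x = x"
      by (rule eq) (use x in \<open>simp_all add: tD oD rat_ring_def\<close>)
    assume y: "y \<in> carrier M"
    show "a \<odot>\<^bsub>M\<^esub> (x \<oplus>\<^bsub>M\<^esub> y) = a \<odot>\<^bsub>M\<^esub> x \<oplus>\<^bsub>M\<^esub> a \<odot>\<^bsub>M\<^esub> y"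
      by (rule eq) (use x y in \<open>simp_all add: tD oD hm.scale_right_distrib\<close>)
  qed
  ultimately show ?thesis using module_cring[OF W] by (intro module.intro)
qed

lemma lin_iso_inverse:
  assumes T: "lin_iso V W T" and o: "ops_closed V"
  shows "lin_iso W V (inv_into (carrier V) T)"
proof -
  let ?I = "inv_into (carrier V) T"
  have b: "bij_betw T (carrier V) (carrier W)" using T by (simp add: lin_iso_def)
  have bI: "bij_betw ?I (carrier W) (carrier V)" by (rule bij_betw_inv_into[OF b])
  have lin: "\<And>x y. x \<in> carrier V \<Longrightarrow> y \<in> carrier V \<Longrightarrow> T (x \<oplus>\<^bsub>V\<^esub> y) = T x \<oplus>\<^bsub>W\<^esub> T y"
    "\<And>q x. x \<in> carrier V \<Longrightarrow> T (q \<odot>\<^bsub>V\<^esub> x) = q \<odot>\<^bsub>W\<^esub> T x" using T by (auto simp: lin_iso_def lin_map_def)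
  have I: "?I w \<in> carrier V" "T (?I w) = w" if "w \<in> carrier W" for w
    using bij_betwE[OF bI] bij_betw_inv_into_right[OF b that] that by blast+
  have IT: "?I (T x) = x" if "x \<in> carrier V" for x using bij_betw_inv_into_left[OF b that] .
  have "?I (w \<oplus>\<^bsub>W\<^esub> w') = ?I w \<oplus>\<^bsub>V\<^esub> ?I w'" if "w \<in> carrier W" "w' \<in> carrier W" for w w'
    using IT[OF opscD(2)[OF o I(1)[OF that(1)] I(1)[OF that(2)]]] lin(1)[OF I(1)[OF that(1)] I(1)[OF that(2)]] I(2) that by simp
  moreover have "?I (q \<odot>\<^bsub>W\<^esub> w) = q \<odot>\<^bsub>V\<^esub> ?I w" if "w \<in> carrier W" for q w
    using IT[OF opscD(3)[OF o I(1)[OF that]]] lin(2)[OF I(1)[OF that]] I(2) that by simp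
  ultimately show ?thesis unfolding lin_iso_def lin_map_def using bI I(1) by blast
qed

lemma module_span_induct:
  assumes T: "lin_iso M (hsub (hm.span \<beta>)) T" and o: "ops_closed M" and z: "T \<zero>\<^bsub>M\<^esub> = 0"
    and P: "P \<zero>\<^bsub>M\<^esub>" "\<And>x y. x \<in> carrier M \<Longrightarrow> y \<in> carrier M \<Longrightarrow> P x \<Longrightarrow> P y \<Longrightarrow> P (x \<oplus>\<^bsub>M\<^esub> y)"
      "\<And>q x. x \<in> carrier M \<Longrightarrow> P x \<Longrightarrow> P (q \<odot>\<^bsub>M\<^esub> x)" "\<And>b. b \<in> \<beta> \<Longrightarrow> P (inv_into (carrier M) T b)"
    and v: "v \<in> carrier M"
  shows "P v"
proof -
  note tD = lin_isoD[OF T] and oD = opscD[OF o]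
  have "\<exists>x\<in>carrier M. T x = w \<and> P x" if "w \<in> hm.span \<beta>" for w
    using that
  proof (induction rule: hm.span_induct_alt)
    case base
    show ?case using oD(1) z P(1) by blast
  next
    case (step q b y)
    then obtain x where x: "x \<in> carrier M" "T x = y" "P x" by blast
    have bs: "b \<in> hm.span \<beta>" by (rule hm.span_base[OF step(1)])
    let ?b = "inv_into (carrier M) T b"
    have b: "?b \<in> carrier M" "T ?b = b"
      using bij_betwE[OF bij_betw_inv_into[OF tD(4)]] bs bij_betw_inv_into_right[OF tD(4) bs] by blast+
    have "P (q \<odot>\<^bsub>M\<^esub> ?b \<oplus>\<^bsub>M\<^esub> x)" by (intro P(2,3,4) oD(3) b x step(1))
    moreover have "T (q \<odot>\<^bsub>M\<^esub> ?b \<oplus>\<^bsub>M\<^esub> x) = hscale q b + y" using b x oD(3)[OF b(1)] by (simp add: tD)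
    moreover have "q \<odot>\<^bsub>M\<^esub> ?b \<oplus>\<^bsub>M\<^esub> x \<in> carrier M" by (intro oD b x)
    ultimately show ?case by blast
  qed
  from this[OF tD(1)[OF v]] obtain x where "x \<in> carrier M" "T x = T v" "P x" by blast
  thus ?thesis using inj_onD[OF tD(5), of x v] v by blast
qed

text \<open>A presentation of a subspace of the homology: the relations hold there, and modulo the
  relations every generator is a combination of generators in \<open>N\<close>, which have
  independent images.\<close>
locale presentation =
  fixes X :: "'a set" and R :: "'a fvec set" and f :: "'a \<Rightarrow> hmlg" and N :: "'a set"
  assumes RX: "r \<in> R \<Longrightarrow> Poly_Mapping.keys r \<subseteq> X" and Rf: "r \<in> R \<Longrightarrow> hlinext f r = 0"
    and NX: "N \<subseteq> X" and inj: "inj_on f N" and ind: "hm.independent (f ` N)"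
    and gens: "x \<in> X \<Longrightarrow> gen x \<in> fvec.span (gen ` N \<union> R)"
begin

lemma span_R: "r \<in> fvec.span R \<Longrightarrow> Poly_Mapping.keys r \<subseteq> X \<and> hlinext f r = 0"
proof (induction rule: fvec.span_induct_alt)
  case (step q x y)
  thus ?case using RX[of x] Rf[of x] keys_add_sub[OF keys_scale_sub[of x X q], of y]
    by (simp add: hlinext_add hlinext_scale)
qed simp

lemma kernel:
  assumes "Poly_Mapping.keys c \<subseteq> X" "hlinext f c = 0"
  shows "c \<in> fvec.span R"
proof -
  have "c \<in> fvec.span (gen ` N \<union> R)" by (rule gen_span_keys[OF assms(1) gens])
  then obtain n r where n: "c = n + r" "n \<in> fvec.span (gen ` N)" "r \<in> fvec.span R"
    unfolding fvec.span_Un by blast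
  have kn: "Poly_Mapping.keys n \<subseteq> N" by (rule span_gen_keys[OF n(2)])
  have z: "(\<Sum>a\<in>Poly_Mapping.keys n. hscale (Poly_Mapping.lookup n a) (f a)) = 0"
    using assms(2) span_R[OF n(3)] unfolding n(1) hlinext_add hlinext_def[symmetric] by simp
  have injn: "inj_on f (Poly_Mapping.keys n)" by (rule inj_on_subset[OF inj kn])
  have z0: "Poly_Mapping.lookup n a = 0" if a: "a \<in> Poly_Mapping.keys n" for a
  proof -
    let ?u = "\<lambda>v. Poly_Mapping.lookup n (the_inv_into (Poly_Mapping.keys n) f v)"
    have "(\<Sum>v\<in>f ` Poly_Mapping.keys n. hscale (?u v) v) = 0"
      using z by (simp add: sum.reindex[OF injn] the_inv_into_f_f[OF injn])
    moreover have "finite (f ` Poly_Mapping.keys n)" by simp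
    ultimately have "?u (f a) = 0"
      using hm.independentD[OF ind _ image_mono[OF kn], of ?u "f a"] imageI[OF a, of f] by blast
    thus ?thesis by (simp add: the_inv_into_f_f[OF injn a])
  qed
  have "Poly_Mapping.keys n = {}"
  proof (rule equals0I)
    fix a assume "a \<in> Poly_Mapping.keys n"
    with z0[OF this] show False by (simp add: in_keys_iff)
  qed
  hence "n = 0" by simp
  thus ?thesis using n by simp
qed

definition quot_map :: "'a fvec set \<Rightarrow> hmlg" where
  "quot_map a = hlinext f (SOME c. Poly_Mapping.keys c \<subseteq> X \<and> a = coset R c)"

lemma coset_iff:
  assumes "Poly_Mapping.keys c \<subseteq> X" "Poly_Mapping.keys d \<subseteq> X"
  shows "coset R c = coset R d \<longleftrightarrow> hlinext f c = hlinext f d"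
  unfolding coset_eq_iff using span_R[of "c - d"] kernel[OF keys_diff_sub[OF assms]]
  by (auto simp: hlinext_diff)

lemma quot_map_coset: "Poly_Mapping.keys c \<subseteq> X \<Longrightarrow> quot_map (coset R c) = hlinext f c"
proof -
  assume c: "Poly_Mapping.keys c \<subseteq> X"
  let ?d = "SOME d. Poly_Mapping.keys d \<subseteq> X \<and> coset R c = coset R d"
  have "\<exists>d. Poly_Mapping.keys d \<subseteq> X \<and> coset R c = coset R d" using c by blast
  hence "Poly_Mapping.keys ?d \<subseteq> X \<and> coset R c = coset R ?d" by (rule someI_ex)
  thus ?thesis unfolding quot_map_def using coset_iff[OF c, of ?d] by simp
qed

lemma quot_map_iso: "lin_iso (presented X R) (hsub (hm.span (f ` X))) quot_map"
proof (rule lin_isoI)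
  show "bij_betw quot_map (carrier (presented X R)) (hm.span (f ` X))"
    unfolding bij_betw_def
  proof
    show "inj_on quot_map (carrier (presented X R))"
    proof (rule inj_onI)
      fix x y assume "x \<in> carrier (presented X R)" "y \<in> carrier (presented X R)" "quot_map x = quot_map y"
      then obtain c d where c: "x = coset R c" "Poly_Mapping.keys c \<subseteq> X" "y = coset R d" "Poly_Mapping.keys d \<subseteq> X"
        "quot_map x = quot_map y" unfolding presented_simps(1) by blast
      from c(5) show "x = y" unfolding c(1,3) quot_map_coset[OF c(2)] quot_map_coset[OF c(4)] coset_iff[OF c(2,4)] .
    qed
    show "quot_map ` carrier (presented X R) = hm.span (f ` X)"
    proof (intro equalityI subsetI)
      fix w assume "w \<in> quot_map ` carrier (presented X R)"
      thus "w \<in> hm.span (f ` X)" unfolding presented_simps(1) by (auto simp: quot_map_coset hlinext_in_span)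
    next
      fix w assume "w \<in> hm.span (f ` X)"
      from span_hlinext[OF this] obtain c where c: "Poly_Mapping.keys c \<subseteq> X" "hlinext f c = w" by blast
      hence "quot_map (coset R c) = w" by (simp add: quot_map_coset)
      thus "w \<in> quot_map ` carrier (presented X R)" unfolding presented_simps(1) using c(1) by blast
    qed
  qed
  fix x assume "x \<in> carrier (presented X R)"
  then obtain c where c: "x = coset R c" "Poly_Mapping.keys c \<subseteq> X" unfolding presented_simps(1) by blast
  show "quot_map (q \<odot>\<^bsub>presented X R\<^esub> x) = hscale q (quot_map x)" for q
    unfolding c(1) presented_simps(4) quot_map_coset[OF c(2)] quot_map_coset[OF keys_scale_sub[OF c(2)]] by (rule hlinext_scale)
  fix y assume "y \<in> carrier (presented X R)"
  then obtain d where d: "y = coset R d" "Poly_Mapping.keys d \<subseteq> X" unfolding presented_simps(1) by blast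
  show "quot_map (x \<oplus>\<^bsub>presented X R\<^esub> y) = quot_map x + quot_map y"
    unfolding c(1) d(1) presented_simps(3) quot_map_coset[OF c(2)] quot_map_coset[OF d(2)] quot_map_coset[OF keys_add_sub[OF c(2) d(2)]]
    by (rule hlinext_add)
qed

lemma quot_map_zero: "quot_map \<zero>\<^bsub>presented X R\<^esub> = 0"
  unfolding presented_simps(2) by (subst quot_map_coset) simp_all

lemma induced:
  assumes "presentation X' R' f' N'" "\<And>x. x \<in> X \<Longrightarrow> h x \<in> X'" "\<And>x. x \<in> X \<Longrightarrow> f' (h x) = L (f x)" "hlinear L"
    "a \<in> carrier (presented X R)"
  shows "induced R' h a \<in> carrier (presented X' R')" "presentation.quot_map X' R' f' (induced R' h a) = L (quot_map a)"
proof -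
  interpret P': presentation X' R' f' N' by (rule assms(1))
  from assms(5) obtain c where c: "a = coset R c" "Poly_Mapping.keys c \<subseteq> X" unfolding presented_simps(1) by blast
  let ?l = "linext (\<lambda>x. gen (h x))"
  have kl: "Poly_Mapping.keys (?l d) \<subseteq> X'" if "Poly_Mapping.keys d \<subseteq> X" for d
    by (rule keys_linext[OF that]) (use assms(2) in simp)
  have hl: "hlinext f' (?l d) = L (hlinext f d)" if "Poly_Mapping.keys d \<subseteq> X" for d
    unfolding hlinext_linext by (rule hlinext_map[OF that assms(3,4)])
  have "coset R' (?l d) = coset R' (?l c)" if "d \<in> a" for d
  proof -
    from that obtain r where r: "d = c + r" "r \<in> fvec.span R" unfolding c(1) coset_def by blast
    have kd: "Poly_Mapping.keys d \<subseteq> X" unfolding r(1) using keys_add_sub[OF c(2)] span_R[OF r(2)] by blast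
    have "hlinext f d = hlinext f c" unfolding r(1) hlinext_add using span_R[OF r(2)] by simp
    thus ?thesis unfolding P'.coset_iff[OF kl[OF kd] kl[OF c(2)]] hl[OF kd] hl[OF c(2)] by simp
  qed
  moreover have "a \<noteq> {}" unfolding c(1) using coset_self by blast
  ultimately have i: "induced R' h a = coset R' (?l c)" unfolding induced_def by blast
  show "induced R' h a \<in> carrier (presented X' R')" unfolding i presented_simps(1) using kl[OF c(2)] by blast
  show "presentation.quot_map X' R' f' (induced R' h a) = L (quot_map a)"
    unfolding i P'.quot_map_coset[OF kl[OF c(2)]] hl[OF c(2)] unfolding c(1) quot_map_coset[OF c(2)] ..
qed

end

section \<open>Transport of module structures along isomorphisms\<close>

lemma is_rep_hsub:
  assumes "hm.subspace W" "W \<subseteq> H k {1..n}" "\<And>\<sigma>. \<sigma> permutes {1..n} \<Longrightarrow> hrelabel \<sigma> ` W \<subseteq> W"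
  shows "is_rep n (hsub W, hrelabel)"
  unfolding is_rep_def fst_conv snd_conv
proof (intro conjI allI impI ballI)
  show "Module.module rat_ring (hsub W)" by (rule module_hsub[OF assms(1)])
  show "lin_map (hsub W) (hsub W) (hrelabel \<sigma>)" if "\<sigma> permutes {1..n}" for \<sigma>
    by (rule lin_map_hsub[OF hlinear_hrelabel assms(3)[OF that]])
  fix x assume "x \<in> carrier (hsub W)"
  hence x: "x \<in> H k {1..n}" using assms(2) by (auto simp: hsub_def)
  show "hrelabel id x = x" by (rule hrelabel_id[OF x]) simp
  show "hrelabel (\<sigma> \<circ> \<tau>) x = hrelabel \<sigma> (hrelabel \<tau> x)" if "\<sigma> permutes {1..n} \<and> \<tau> permutes {1..n}" for \<sigma> \<tau>
    by (rule hrelabel_comp[OF x, symmetric]) (use that permutes_inj_on in blast)+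
qed

text \<open>All module and representation laws on the presented side follow from those in the
  homology, since \<open>T\<close> is injective.\<close>
lemma rep_iso_transport:
  assumes W: "hm.subspace W" "W \<subseteq> H k {1..n}" "\<And>\<sigma>. \<sigma> permutes {1..n} \<Longrightarrow> hrelabel \<sigma> ` W \<subseteq> W"
    and T: "lin_iso P (hsub W) T" "ops_closed P" "T \<zero>\<^bsub>P\<^esub> = 0"
    and act: "\<And>\<sigma> x. \<sigma> permutes {1..n} \<Longrightarrow> x \<in> carrier P \<Longrightarrow> act \<sigma> x \<in> carrier P"
      "\<And>\<sigma> x. \<sigma> permutes {1..n} \<Longrightarrow> x \<in> carrier P \<Longrightarrow> T (act \<sigma> x) = hrelabel \<sigma> (T x)"
  shows "rep_iso n (hsub W, hrelabel) (P, act)"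
proof -
  note tD = lin_isoD[OF T(1)] and oD = opscD[OF T(2)]
  have eq: "x = y" if "T x = T y" "x \<in> carrier P" "y \<in> carrier P" for x y
    using inj_onD[OF tD(5) that] .
  have rW: "is_rep n (hsub W, hrelabel)" by (rule is_rep_hsub[OF W])
  have "is_rep n (P, act)" unfolding is_rep_def fst_conv snd_conv
  proof (intro conjI allI impI ballI)
    show "Module.module rat_ring P" by (rule module_transport[OF T module_hsub[OF W(1)]])
    show "lin_map P P (act \<sigma>)" if s: "\<sigma> permutes {1..n}" for \<sigma>
      unfolding lin_map_def
    proof (intro conjI ballI allI)
      show "act \<sigma> \<in> carrier P \<rightarrow> carrier P" using act(1)[OF s] by blast
      fix x assume x: "x \<in> carrier P"
      show "act \<sigma> (q \<odot>\<^bsub>P\<^esub> x) = q \<odot>\<^bsub>P\<^esub> act \<sigma> x" for q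
        by (rule eq) (use x act[OF s] in \<open>simp_all add: tD oD hrelabel_scale\<close>)
      fix y assume y: "y \<in> carrier P"
      show "act \<sigma> (x \<oplus>\<^bsub>P\<^esub> y) = act \<sigma> x \<oplus>\<^bsub>P\<^esub> act \<sigma> y"
        by (rule eq) (use x y act[OF s] in \<open>simp_all add: tD oD hrelabel_add\<close>)
    qed
    fix x assume x: "x \<in> carrier P"
    hence z: "T x \<in> H k {1..n}" using tD(1) W(2) by blast
    show "act id x = x"
      by (rule eq[OF _ act(1)[OF permutes_id x] x]) (simp only: act(2)[OF permutes_id x], rule hrelabel_id[OF z], simp)
    fix \<sigma> \<tau> assume st: "\<sigma> permutes {1..n} \<and> \<tau> permutes {1..n}"
    hence s: "\<sigma> permutes {1..n}" and t: "\<tau> permutes {1..n}" by auto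
    note c = permutes_compose[OF t s]
    have "hrelabel (\<sigma> \<circ> \<tau>) (T x) = hrelabel \<sigma> (hrelabel \<tau> (T x))"
      by (rule hrelabel_comp[OF z permutes_inj_on[OF t] permutes_inj_on[OF s], symmetric])
    hence "T (act (\<sigma> \<circ> \<tau>) x) = T (act \<sigma> (act \<tau> x))"
      by (simp only: act(2)[OF c x] act(2)[OF s act(1)[OF t x]] act(2)[OF t x])
    thus "act (\<sigma> \<circ> \<tau>) x = act \<sigma> (act \<tau> x)"
      by (rule eq[OF _ act(1)[OF c x] act(1)[OF s act(1)[OF t x]]])
  qed
  moreover have "inv_into (carrier P) T (hrelabel \<sigma> w) = act \<sigma> (inv_into (carrier P) T w)"
    if s: "\<sigma> permutes {1..n}" and w: "w \<in> W" for \<sigma> w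
  proof -
    obtain x where x: "x \<in> carrier P" "T x = w" using tD(6)[OF w] by blast
    have "inv_into (carrier P) T (T x) = x" by (rule inv_into_f_f[OF tD(5) x(1)])
    moreover have "inv_into (carrier P) T (T (act \<sigma> x)) = act \<sigma> x" by (rule inv_into_f_f[OF tD(5) act(1)[OF s x(1)]])
    ultimately show ?thesis using act(2)[OF s x(1)] x(2) by simp
  qed
  ultimately show ?thesis unfolding rep_iso_def fst_conv snd_conv
    using rW lin_iso_inverse[OF T(1,2)] by (intro conjI exI[of _ "inv_into (carrier P) T"]) (auto simp: hsub_def)
qed

lemma FI_iso_transport:
  fixes am :: "nat \<Rightarrow> nat \<Rightarrow> mor \<Rightarrow> hmlg \<Rightarrow> hmlg" and act :: "nat \<Rightarrow> nat \<Rightarrow> mor \<Rightarrow> 'v \<Rightarrow> 'v"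
  assumes M: "FI_module d (\<lambda>n. hsub (W n), am)" and W: "\<And>n. hm.subspace (W n)"
    and T: "\<And>n. lin_iso (P n) (hsub (W n)) (T n)" "\<And>n. ops_closed (P n)" "\<And>n. T n \<zero>\<^bsub>P n\<^esub> = 0"
    and act: "\<And>m n \<phi> x. \<phi> \<in> FI_hom d m n \<Longrightarrow> x \<in> carrier (P m) \<Longrightarrow> act m n \<phi> x \<in> carrier (P n)"
      "\<And>m n \<phi> x. \<phi> \<in> FI_hom d m n \<Longrightarrow> x \<in> carrier (P m) \<Longrightarrow> T n (act m n \<phi> x) = am m n \<phi> (T m x)"
  shows "FI_iso d (\<lambda>n. hsub (W n), am) (P, act)"
proof -
  note tD = lin_isoD[OF T(1)] and oD = opscD[OF T(2)]
  have eq: "x = y" if "T n x = T n y" "x \<in> carrier (P n)" "y \<in> carrier (P n)" for x y n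
    using inj_onD[OF tD(5) that] .
  have M1: "lin_map (hsub (W m)) (hsub (W n)) (am m n \<phi>)" if "\<phi> \<in> FI_hom d m n" for m n \<phi>
    using M that unfolding FI_module_def fst_conv snd_conv by blast
  have M1a: "am m n \<phi> (x + y) = am m n \<phi> x + am m n \<phi> y"
    if "\<phi> \<in> FI_hom d m n" "x \<in> W m" "y \<in> W m" for m n \<phi> x y
    using M1[OF that(1)] that(2,3) by (simp add: lin_map_def hsub_def)
  have M1b: "am m n \<phi> (hscale q x) = hscale q (am m n \<phi> x)"
    if "\<phi> \<in> FI_hom d m n" "x \<in> W m" for m n \<phi> x q
    using M1[OF that(1)] that(2) by (simp add: lin_map_def hsub_def)
  have M2: "am n n (perm_mor n id) x = x" if "x \<in> W n" for n x
    using M that unfolding FI_module_def fst_conv snd_conv by (simp add: hsub_def)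
  have M3: "am l n (FI_comp l m n \<phi> \<psi>) x = am m n \<phi> (am l m \<psi> x)"
    if "\<phi> \<in> FI_hom d m n" "\<psi> \<in> FI_hom d l m" "x \<in> W l" for l m n \<phi> \<psi> x
    using M that unfolding FI_module_def fst_conv snd_conv by (simp add: hsub_def)
  have "FI_module d (P, act)" unfolding FI_module_def fst_conv snd_conv
  proof (intro conjI allI ballI)
    show "Module.module rat_ring (P n)" for n by (rule module_transport[OF T(1,2,3) module_hsub[OF W]])
    show "lin_map (P m) (P n) (act m n \<phi>)" if s: "\<phi> \<in> FI_hom d m n" for m n \<phi>
      unfolding lin_map_def
    proof (intro conjI ballI allI)
      show "act m n \<phi> \<in> carrier (P m) \<rightarrow> carrier (P n)" using act(1)[OF s] by blast
      fix x assume x: "x \<in> carrier (P m)"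
      show "act m n \<phi> (q \<odot>\<^bsub>P m\<^esub> x) = q \<odot>\<^bsub>P n\<^esub> act m n \<phi> x" for q
        by (rule eq[where n = n]) (use x act[OF s] M1b[OF s] in \<open>simp_all add: tD oD\<close>)
      fix y assume y: "y \<in> carrier (P m)"
      show "act m n \<phi> (x \<oplus>\<^bsub>P m\<^esub> y) = act m n \<phi> x \<oplus>\<^bsub>P n\<^esub> act m n \<phi> y"
        by (rule eq[where n = n]) (use x y act[OF s] M1a[OF s] in \<open>simp_all add: tD oD\<close>)
    qed
    show "act n n (perm_mor n id) x = x" if x: "x \<in> carrier (P n)" for n x
      by (rule eq[OF _ act(1)[OF perm_mor_hom[OF permutes_id] x] x])
         (simp only: act(2)[OF perm_mor_hom[OF permutes_id] x] M2[OF tD(1)[OF x]])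
    show "act l n (FI_comp l m n \<phi> \<psi>) x = act m n \<phi> (act l m \<psi> x)"
      if s: "\<phi> \<in> FI_hom d m n" and t: "\<psi> \<in> FI_hom d l m" and x: "x \<in> carrier (P l)" for l m n \<phi> \<psi> x
      by (rule eq[OF _ act(1)[OF FI_comp_closed[OF s t] x] act(1)[OF s act(1)[OF t x]]])
         (simp only: act(2)[OF FI_comp_closed[OF s t] x] act(2)[OF s act(1)[OF t x]] act(2)[OF t x] M3[OF s t tD(1)[OF x]])
  qed
  moreover have "inv_into (carrier (P n)) (T n) (am m n \<phi> w) = act m n \<phi> (inv_into (carrier (P m)) (T m) w)"
    if s: "\<phi> \<in> FI_hom d m n" and w: "w \<in> W m" for m n \<phi> w
  proof -
    obtain x where x: "x \<in> carrier (P m)" "T m x = w" using tD(6)[OF w] by blast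
    have "inv_into (carrier (P m)) (T m) (T m x) = x" by (rule inv_into_f_f[OF tD(5) x(1)])
    moreover have "inv_into (carrier (P n)) (T n) (T n (act m n \<phi> x)) = act m n \<phi> x"
      by (rule inv_into_f_f[OF tD(5) act(1)[OF s x(1)]])
    ultimately show ?thesis using act(2)[OF s x(1)] x(2) by simp
  qed
  moreover have "lin_iso (hsub (W n)) (P n) (inv_into (carrier (P n)) (T n))" for n
    by (rule lin_iso_inverse[OF T(1,2)])
  ultimately show ?thesis unfolding FI_iso_def fst_conv snd_conv
    using M by (intro conjI exI[of _ "\<lambda>n. inv_into (carrier (P n)) (T n)"]) (auto simp: hsub_def)
qed

section \<open>Presentations of balanced and multilinear tensor products\<close>

lemma (in presentation) span_N: "hm.span (f ` X) = hm.span (f ` N)"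
proof (rule equalityI)
  have "hlinext f c \<in> hm.span (f ` N)" if "c \<in> fvec.span (gen ` N \<union> R)" for c
    using that
  proof (induction rule: fvec.span_induct_alt)
    case base
    show ?case using hm.span_zero by simp
  next
    case (step q x y)
    have "hlinext f x \<in> hm.span (f ` N)" using step(1) Rf hm.span_zero hm.span_base[of _ "f ` N"] by auto
    thus ?case using step(2) by (simp add: hlinext_add hlinext_scale hm.span_add hm.span_scale)
  qed
  hence "f x \<in> hm.span (f ` N)" if "x \<in> X" for x using gens[OF that] hlinext_gen[of f x] by metis
  hence "f ` X \<subseteq> hm.span (f ` N)" by blast
  thus "hm.span (f ` X) \<subseteq> hm.span (f ` N)" by (rule hm.span_minimal[OF _ hm.subspace_span])
  show "hm.span (f ` N) \<subseteq> hm.span (f ` X)" by (rule hm.span_mono[OF image_mono[OF NX]])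
qed

lemma gen_keys_sub: "x \<in> X \<Longrightarrow> Poly_Mapping.keys (gen x) \<subseteq> X"
  by simp

text \<open>A balanced tensor product \<open>\<rat>[X] \<otimes>\<^bsub>\<rat>[G]\<^esub>
  V\<close> is spanned by the pairs of an orbit representative and a basis element; the
  independence of their images makes them a basis. This is used for induced representations and
  for \<open>M(U)\<close>.\<close>
lemma bal_presentation:
  fixes Rp :: "'v rep" and act :: "'x \<Rightarrow> (nat \<Rightarrow> nat) \<Rightarrow> 'x" and ev :: "'x \<Rightarrow> hmlg \<Rightarrow> hmlg"
  assumes G: "lin_iso (fst Rp) (hsub (hm.span \<beta>)) G" "ops_closed (fst Rp)" "G \<zero>\<^bsub>fst Rp\<^esub> = 0"
    and ev: "\<And>x. hlinear (ev x)"
    and actX: "\<And>x h. x \<in> X \<Longrightarrow> h \<in> Gp \<Longrightarrow> act x h \<in> X"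
    and rep: "\<And>h v. h \<in> Gp \<Longrightarrow> v \<in> carrier (fst Rp) \<Longrightarrow> snd Rp h v \<in> carrier (fst Rp)"
    and bal: "\<And>x h v. x \<in> X \<Longrightarrow> h \<in> Gp \<Longrightarrow> v \<in> carrier (fst Rp) \<Longrightarrow> ev (act x h) (G v) = ev x (G (snd Rp h v))"
    and ordered_mors: "ordered_mors \<subseteq> X" "\<And>x. x \<in> X \<Longrightarrow> \<exists>x0\<in>ordered_mors. \<exists>h\<in>Gp. x = act x0 h"
    and ind: "inj_on (\<lambda>(x,b). ev x b) (ordered_mors \<times> \<beta>)" "hm.independent ((\<lambda>(x,b). ev x b) ` (ordered_mors \<times> \<beta>))"
  shows "presentation (X \<times> carrier (fst Rp)) (bal_rels X act Gp Rp) (\<lambda>(x,v). ev x (G v))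
      ((\<lambda>(x,b). (x, inv_into (carrier (fst Rp)) G b)) ` (ordered_mors \<times> \<beta>))"
    "(\<lambda>(x,v). ev x (G v)) ` (X \<times> carrier (fst Rp)) = {ev x w | x w. x \<in> X \<and> w \<in> hm.span \<beta>}"
    "hm.span ((\<lambda>(x,v). ev x (G v)) ` (X \<times> carrier (fst Rp))) = hm.span ((\<lambda>(x,b). ev x b) ` (ordered_mors \<times> \<beta>))"
proof -
  note gD = lin_isoD[OF G(1)] and oD = opscD[OF G(2)]
  let ?M = "fst Rp" and ?R = "bal_rels X act Gp Rp" and ?f = "\<lambda>(x,v). ev x (G v)"
  let ?I = "inv_into (carrier (fst Rp)) G"
  let ?N = "(\<lambda>(x,b). (x, ?I b)) ` (ordered_mors \<times> \<beta>)"
  have I: "?I b \<in> carrier ?M" "G (?I b) = b" if "b \<in> \<beta>" for b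
  proof -
    have b: "b \<in> hm.span \<beta>" by (rule hm.span_base[OF that])
    show "?I b \<in> carrier ?M" using bij_betwE[OF bij_betw_inv_into[OF gD(4)]] b by blast
    show "G (?I b) = b" by (rule bij_betw_inv_into_right[OF gD(4) b])
  qed
  have R1: "gen (x, u \<oplus>\<^bsub>?M\<^esub> v) - gen (x, u) - gen (x, v) \<in> ?R" if "x \<in> X" "u \<in> carrier ?M" "v \<in> carrier ?M" for x u v
    using that unfolding bal_rels_def by blast
  have R2: "gen (x, q \<odot>\<^bsub>?M\<^esub> v) - qscale q (gen (x, v)) \<in> ?R" if "x \<in> X" "v \<in> carrier ?M" for x q v
    using that unfolding bal_rels_def by blast
  have R3: "gen (act x h, v) - gen (x, snd Rp h v) \<in> ?R" if "x \<in> X" "h \<in> Gp" "v \<in> carrier ?M" for x h v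
    using that unfolding bal_rels_def by blast
  let ?Sp = "fvec.span (gen ` ?N \<union> ?R)"
  have RS: "r \<in> ?Sp" if "r \<in> ?R" for r by (rule fvec.span_base) (use that in blast)
  have inR: "Poly_Mapping.keys r \<subseteq> X \<times> carrier ?M \<and> hlinext ?f r = 0" if "r \<in> ?R" for r
    using that unfolding bal_rels_def
  proof (elim UnE CollectE exE conjE)
    fix x u v assume *: "r = gen (x, u \<oplus>\<^bsub>?M\<^esub> v) - gen (x, u) - gen (x, v)" "x \<in> X" "u \<in> carrier ?M" "v \<in> carrier ?M"
    have "Poly_Mapping.keys r \<subseteq> X \<times> carrier ?M" unfolding *(1)
      by (intro keys_diff_sub gen_keys_sub) (use * oD in auto)
    thus ?thesis using * by (simp add: hlinext_diff gD hlinear_add[OF ev])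
  next
    fix x q v assume *: "r = gen (x, q \<odot>\<^bsub>?M\<^esub> v) - qscale q (gen (x, v))" "x \<in> X" "v \<in> carrier ?M"
    have "Poly_Mapping.keys r \<subseteq> X \<times> carrier ?M" unfolding *(1)
      by (intro keys_diff_sub keys_scale_sub gen_keys_sub) (use * oD in auto)
    thus ?thesis using * by (simp add: hlinext_diff hlinext_scale gD hlinear_scale[OF ev])
  next
    fix x h v assume *: "r = gen (act x h, v) - gen (x, snd Rp h v)" "x \<in> X" "h \<in> Gp" "v \<in> carrier ?M"
    have "Poly_Mapping.keys r \<subseteq> X \<times> carrier ?M" unfolding *(1)
      by (intro keys_diff_sub gen_keys_sub) (use * actX rep in auto)
    thus ?thesis using * bal by (simp add: hlinext_diff)
  qed
  have g0: "gen (x, v) \<in> ?Sp" if x: "x \<in> ordered_mors" and v: "v \<in> carrier ?M" for x v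
  proof (rule module_span_induct[OF G, of "\<lambda>v. gen (x, v) \<in> ?Sp"])
    have xX: "x \<in> X" using x ordered_mors(1) by blast
    have "0 \<odot>\<^bsub>?M\<^esub> \<zero>\<^bsub>?M\<^esub> = \<zero>\<^bsub>?M\<^esub>" by (rule lin_iso_zero[OF G oD(1)])
    with RS[OF R2[OF xX oD(1), of 0]] show "gen (x, \<zero>\<^bsub>?M\<^esub>) \<in> ?Sp" by simp
    show "gen (x, u \<oplus>\<^bsub>?M\<^esub> v) \<in> ?Sp" if "u \<in> carrier ?M" "v \<in> carrier ?M" "gen (x, u) \<in> ?Sp" "gen (x, v) \<in> ?Sp" for u v
    proof -
      have "gen (x, u \<oplus>\<^bsub>?M\<^esub> v) = (gen (x, u \<oplus>\<^bsub>?M\<^esub> v) - gen (x, u) - gen (x, v)) + (gen (x, u) + gen (x, v))" by simp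
      also have "\<dots> \<in> ?Sp" by (intro fvec.span_add RS R1 xX that)
      finally show ?thesis .
    qed
    show "gen (x, q \<odot>\<^bsub>?M\<^esub> v) \<in> ?Sp" if "v \<in> carrier ?M" "gen (x, v) \<in> ?Sp" for q v
    proof -
      have "gen (x, q \<odot>\<^bsub>?M\<^esub> v) = (gen (x, q \<odot>\<^bsub>?M\<^esub> v) - qscale q (gen (x, v))) + qscale q (gen (x, v))" by simp
      also have "\<dots> \<in> ?Sp" by (intro fvec.span_add fvec.span_scale RS R2 xX that)
      finally show ?thesis .
    qed
    show "gen (x, ?I b) \<in> ?Sp" if "b \<in> \<beta>" for b
      by (rule fvec.span_base) (use x that in force)
  qed (rule v)
  have fNeq: "?f ` ?N = (\<lambda>(x,b). ev x b) ` (ordered_mors \<times> \<beta>)"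
    unfolding image_image by (rule image_cong) (auto simp: I(2))
  show pres: "presentation (X \<times> carrier ?M) ?R ?f ?N"
  proof
    show "Poly_Mapping.keys r \<subseteq> X \<times> carrier ?M" "hlinext ?f r = 0" if "r \<in> ?R" for r using inR[OF that] by auto
    show "?N \<subseteq> X \<times> carrier ?M" using ordered_mors(1) I(1) by auto
    have fN: "?f (x, ?I b) = ev x b" if "b \<in> \<beta>" for x b using I(2)[OF that] by simp
    show "inj_on ?f ?N"
    proof (rule inj_onI)
      fix y z assume "y \<in> ?N" "z \<in> ?N" "?f y = ?f z"
      then obtain x b x' b' where *: "x \<in> ordered_mors" "b \<in> \<beta>" "y = (x, ?I b)" "x' \<in> ordered_mors" "b' \<in> \<beta>" "z = (x', ?I b')" by auto
      have "ev x b = ev x' b'" using \<open>?f y = ?f z\<close> fN * by simp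
      hence "(x,b) = (x',b')" using inj_onD[OF ind(1), of "(x,b)" "(x',b')"] * by simp
      thus "y = z" using * by simp
    qed
    have "?f ` ?N = (\<lambda>(x,b). ev x b) ` (ordered_mors \<times> \<beta>)"
      unfolding image_image by (rule image_cong) (auto simp: I(2))
    thus "hm.independent (?f ` ?N)" using ind(2) by simp
    show "gen y \<in> ?Sp" if yX: "y \<in> X \<times> carrier ?M" for y
    proof -
      obtain x v where y: "y = (x,v)" "x \<in> X" "v \<in> carrier ?M" using yX by auto
      obtain x0 h where x0: "x0 \<in> ordered_mors" "h \<in> Gp" "x = act x0 h" using ordered_mors(2)[OF y(2)] by blast
      have "gen y = (gen (act x0 h, v) - gen (x0, snd Rp h v)) + gen (x0, snd Rp h v)" by (simp add: y x0)
      also have "\<dots> \<in> ?Sp" by (intro fvec.span_add RS R3 g0 x0 y rep) (use x0 ordered_mors in blast)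
      finally show ?thesis .
    qed
  qed
  show "hm.span (?f ` (X \<times> carrier ?M)) = hm.span ((\<lambda>(x,b). ev x b) ` (ordered_mors \<times> \<beta>))"
    using presentation.span_N[OF pres] unfolding fNeq .
  show "?f ` (X \<times> carrier ?M) = {ev x w | x w. x \<in> X \<and> w \<in> hm.span \<beta>}"
  proof (intro equalityI subsetI)
    fix z assume "z \<in> ?f ` (X \<times> carrier ?M)"
    thus "z \<in> {ev x w | x w. x \<in> X \<and> w \<in> hm.span \<beta>}" using gD(1) by auto
  next
    fix z assume "z \<in> {ev x w | x w. x \<in> X \<and> w \<in> hm.span \<beta>}"
    then obtain x w where *: "z = ev x w" "x \<in> X" "w \<in> hm.span \<beta>" by blast
    then obtain v where "v \<in> carrier ?M" "G v = w" using gD(6) by blast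
    thus "z \<in> ?f ` (X \<times> carrier ?M)" using * by (intro image_eqI[of _ _ "(x,v)"]) auto
  qed
qed

lemma map_nth_upd: "i < length vs \<Longrightarrow> map (\<lambda>j. F j ((vs[i := x]) ! j)) [0..<length vs] =
    (map (\<lambda>j. F j (vs ! j)) [0..<length vs])[i := F i x]"
  by (intro nth_equalityI) (auto simp: nth_list_update)

text \<open>The same for tensor products, spanned by the tuples of basis elements. The reduction
  of an arbitrary tuple to such tuples proceeds slot by slot.\<close>
lemma multilin_presentation:
  fixes Vs :: "'v qmod list" and \<mu> :: "hmlg list \<Rightarrow> hmlg"
  assumes k: "length Vs = k"
    and G: "\<And>j. j < k \<Longrightarrow> lin_iso (Vs ! j) (hsub (hm.span (\<beta> j))) (Gs j)" "\<And>j. j < k \<Longrightarrow> ops_closed (Vs ! j)"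
      "\<And>j. j < k \<Longrightarrow> Gs j \<zero>\<^bsub>Vs ! j\<^esub> = 0"
    and \<mu>: "\<And>ys i x y. length ys = k \<Longrightarrow> i < k \<Longrightarrow> \<mu> (ys[i := x + y]) = \<mu> (ys[i := x]) + \<mu> (ys[i := y])"
      "\<And>ys i x q. length ys = k \<Longrightarrow> i < k \<Longrightarrow> \<mu> (ys[i := hscale q x]) = hscale q (\<mu> (ys[i := x]))"
    and ind: "inj_on \<mu> {bs. length bs = k \<and> (\<forall>j<k. bs ! j \<in> \<beta> j)}"
      "hm.independent (\<mu> ` {bs. length bs = k \<and> (\<forall>j<k. bs ! j \<in> \<beta> j)})"
  shows "hm.span ((\<lambda>vs. \<mu> (map (\<lambda>j. Gs j (vs ! j)) [0..<k])) ` tuples Vs) = hm.span (\<mu> ` {bs. length bs = k \<and> (\<forall>j<k. bs ! j \<in> \<beta> j)})"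
    "presentation (tuples Vs) (multilin_rels Vs) (\<lambda>vs. \<mu> (map (\<lambda>j. Gs j (vs ! j)) [0..<k]))
      ((\<lambda>bs. map (\<lambda>j. inv_into (carrier (Vs ! j)) (Gs j) (bs ! j)) [0..<k]) ` {bs. length bs = k \<and> (\<forall>j<k. bs ! j \<in> \<beta> j)})"
proof -
  note gD = lin_isoD[OF G(1)] and oD = opscD[OF G(2)]
  let ?f = "\<lambda>vs. \<mu> (map (\<lambda>j. Gs j (vs ! j)) [0..<k])" and ?R = "multilin_rels Vs"
  let ?I = "\<lambda>j. inv_into (carrier (Vs ! j)) (Gs j)"
  let ?B = "{bs. length bs = k \<and> (\<forall>j<k. bs ! j \<in> \<beta> j)}"
  let ?N = "(\<lambda>bs. map (\<lambda>j. ?I j (bs ! j)) [0..<k]) ` ?B"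
  let ?Sp = "fvec.span (gen ` ?N \<union> ?R)"
  have I: "?I j b \<in> carrier (Vs ! j)" "Gs j (?I j b) = b" if "j < k" "b \<in> hm.span (\<beta> j)" for j b
    using bij_betwE[OF bij_betw_inv_into[OF gD(4)[OF that(1)]]] bij_betw_inv_into_right[OF gD(4)[OF that(1)] that(2)] that(2) by blast+
  have tl: "length vs = k" "\<And>j. j < k \<Longrightarrow> vs ! j \<in> carrier (Vs ! j)" if "vs \<in> tuples Vs" for vs
    using that k by (auto simp: tuples_def)
  have tu: "vs[i := x] \<in> tuples Vs" if "vs \<in> tuples Vs" "i < k" "x \<in> carrier (Vs ! i)" for vs i x
    using that k by (auto simp: tuples_def nth_list_update)
  have fu: "?f (vs[i := x]) = \<mu> ((map (\<lambda>j. Gs j (vs ! j)) [0..<k])[i := Gs i x])" if "vs \<in> tuples Vs" "i < k" for vs i x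
    using map_nth_upd[of i vs Gs x] tl(1)[OF that(1)] that(2) by simp
  have R1: "gen (vs[i := x \<oplus>\<^bsub>Vs ! i\<^esub> y]) - gen (vs[i := x]) - gen (vs[i := y]) \<in> ?R"
    if "vs \<in> tuples Vs" "i < k" "x \<in> carrier (Vs ! i)" "y \<in> carrier (Vs ! i)" for vs i x y
    using that k unfolding multilin_rels_def by blast
  have R2: "gen (vs[i := q \<odot>\<^bsub>Vs ! i\<^esub> x]) - qscale q (gen (vs[i := x])) \<in> ?R"
    if "vs \<in> tuples Vs" "i < k" "x \<in> carrier (Vs ! i)" for vs i x q
    using that k unfolding multilin_rels_def by blast
  have RS: "r \<in> ?Sp" if "r \<in> ?R" for r by (rule fvec.span_base) (use that in blast)
  have inR: "Poly_Mapping.keys r \<subseteq> tuples Vs \<and> hlinext ?f r = 0" if "r \<in> ?R" for r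
    using that unfolding multilin_rels_def k
  proof (elim UnE CollectE exE conjE)
    fix vs i x y
    assume *: "r = gen (vs[i := x \<oplus>\<^bsub>Vs ! i\<^esub> y]) - gen (vs[i := x]) - gen (vs[i := y])" "vs \<in> tuples Vs" "i < k"
      "x \<in> carrier (Vs ! i)" "y \<in> carrier (Vs ! i)"
    have "Poly_Mapping.keys r \<subseteq> tuples Vs" unfolding *(1)
      by (intro keys_diff_sub gen_keys_sub tu * oD(2))
    moreover have "hlinext ?f r = 0" unfolding *(1) hlinext_diff hlinext_gen fu[OF *(2,3)] gD(2)[OF *(3-5)]
      using \<mu>(1) *(3) by simp
    ultimately show ?thesis by blast
  next
    fix vs i q x
    assume *: "r = gen (vs[i := q \<odot>\<^bsub>Vs ! i\<^esub> x]) - qscale q (gen (vs[i := x]))" "vs \<in> tuples Vs" "i < k" "x \<in> carrier (Vs ! i)"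
    have "Poly_Mapping.keys r \<subseteq> tuples Vs" unfolding *(1)
      by (intro keys_diff_sub keys_scale_sub gen_keys_sub tu * oD(3))
    moreover have "hlinext ?f r = 0" unfolding *(1) hlinext_diff hlinext_scale hlinext_gen fu[OF *(2,3)] gD(3)[OF *(3,4)]
      using \<mu>(2) *(3) by simp
    ultimately show ?thesis by blast
  qed
  have g0: "gen vs \<in> ?Sp" if "i \<le> k" "vs \<in> tuples Vs" "\<And>j. i \<le> j \<Longrightarrow> j < k \<Longrightarrow> \<exists>b\<in>\<beta> j. vs ! j = ?I j b" for i vs
    using that
  proof (induction i arbitrary: vs)
    case 0
    have "\<forall>j. \<exists>b. j < k \<longrightarrow> b \<in> \<beta> j \<and> vs ! j = ?I j b" using 0(3) by blast
    then obtain b where b: "\<And>j. j < k \<Longrightarrow> b j \<in> \<beta> j \<and> vs ! j = ?I j (b j)" by metis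
    have "vs = map (\<lambda>j. ?I j (map b [0..<k] ! j)) [0..<k]"
      using tl(1)[OF 0(2)] b by (intro nth_equalityI) simp_all
    moreover have "map b [0..<k] \<in> ?B" using b by simp
    ultimately have "vs \<in> ?N" by (rule image_eqI)
    thus ?case by (intro fvec.span_base UnI1 imageI)
  next
    case (Suc i)
    have i: "i < k" using Suc.prems(1) by simp
    note vs = Suc.prems(2)
    let ?M = "Vs ! i"
    have "gen (vs[i := x]) \<in> ?Sp" if x: "x \<in> carrier ?M" for x
    proof (rule module_span_induct[OF G(1)[OF i] G(2)[OF i] G(3)[OF i], of "\<lambda>x. gen (vs[i := x]) \<in> ?Sp"])
      have "0 \<odot>\<^bsub>?M\<^esub> \<zero>\<^bsub>?M\<^esub> = \<zero>\<^bsub>?M\<^esub>" by (rule lin_iso_zero[OF G(1)[OF i] G(2)[OF i] G(3)[OF i] oD(1)[OF i]])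
      with RS[OF R2[OF vs i oD(1)[OF i], of 0]] show "gen (vs[i := \<zero>\<^bsub>?M\<^esub>]) \<in> ?Sp" by simp
      show "gen (vs[i := u \<oplus>\<^bsub>?M\<^esub> v]) \<in> ?Sp"
        if "u \<in> carrier ?M" "v \<in> carrier ?M" "gen (vs[i := u]) \<in> ?Sp" "gen (vs[i := v]) \<in> ?Sp" for u v
      proof -
        have "gen (vs[i := u \<oplus>\<^bsub>?M\<^esub> v]) = (gen (vs[i := u \<oplus>\<^bsub>?M\<^esub> v]) - gen (vs[i := u]) - gen (vs[i := v])) + (gen (vs[i := u]) + gen (vs[i := v]))" by simp
        also have "\<dots> \<in> ?Sp" by (intro fvec.span_add RS R1 vs i that)
        finally show ?thesis .
      qed
      show "gen (vs[i := q \<odot>\<^bsub>?M\<^esub> v]) \<in> ?Sp" if "v \<in> carrier ?M" "gen (vs[i := v]) \<in> ?Sp" for q v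
      proof -
        have "gen (vs[i := q \<odot>\<^bsub>?M\<^esub> v]) = (gen (vs[i := q \<odot>\<^bsub>?M\<^esub> v]) - qscale q (gen (vs[i := v]))) + qscale q (gen (vs[i := v]))" by simp
        also have "\<dots> \<in> ?Sp" by (intro fvec.span_add fvec.span_scale RS R2 vs i that)
        finally show ?thesis .
      qed
      show "gen (vs[i := ?I i b]) \<in> ?Sp" if b: "b \<in> \<beta> i" for b
      proof (rule Suc.IH)
        show "i \<le> k" using i by simp
        show "vs[i := ?I i b] \<in> tuples Vs" by (rule tu[OF vs i I(1)[OF i hm.span_base[OF b]]])
        show "\<exists>b'\<in>\<beta> j. vs[i := ?I i b] ! j = ?I j b'" if "i \<le> j" "j < k" for j
          using Suc.prems(3)[of j] that b tl(1)[OF vs] by (cases "j = i") auto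
      qed
    qed (rule x)
    from this[OF tl(2)[OF vs i]] show ?case by simp
  qed
  have fN: "?f (map (\<lambda>j. ?I j (bs ! j)) [0..<k]) = \<mu> bs" if "length bs = k" "\<And>j. j < k \<Longrightarrow> bs ! j \<in> hm.span (\<beta> j)" for bs
  proof -
    have "map (\<lambda>j. Gs j (map (\<lambda>j. ?I j (bs ! j)) [0..<k] ! j)) [0..<k] = bs"
      using that(1) I(2)[OF _ that(2)] by (intro nth_equalityI) simp_all
    thus ?thesis by simp
  qed
  have fB: "?f (map (\<lambda>j. ?I j (bs ! j)) [0..<k]) = \<mu> bs" if "bs \<in> ?B" for bs
    by (rule fN) (use that hm.span_base in auto)
  have fNeq: "?f ` ?N = \<mu> ` ?B" unfolding image_image by (rule image_cong[OF refl fB])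
  show pres: "presentation (tuples Vs) ?R ?f ?N"
  proof
    show "Poly_Mapping.keys r \<subseteq> tuples Vs" "hlinext ?f r = 0" if "r \<in> ?R" for r using inR[OF that] by auto
    show "?N \<subseteq> tuples Vs"
    proof (rule image_subsetI)
      fix bs assume "bs \<in> ?B"
      hence "\<And>j. j < k \<Longrightarrow> ?I j (bs ! j) \<in> carrier (Vs ! j)" using I(1) hm.span_base by blast
      thus "map (\<lambda>j. ?I j (bs ! j)) [0..<k] \<in> tuples Vs" using k by (simp add: tuples_def)
    qed
    show "inj_on ?f ?N"
    proof (rule inj_onI)
      fix y z assume "y \<in> ?N" "z \<in> ?N" "?f y = ?f z"
      then obtain bs cs where *: "bs \<in> ?B" "y = map (\<lambda>j. ?I j (bs ! j)) [0..<k]" "cs \<in> ?B" "z = map (\<lambda>j. ?I j (cs ! j)) [0..<k]" by blast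
      have "\<mu> bs = \<mu> cs" using \<open>?f y = ?f z\<close> unfolding *(2,4) fB[OF *(1)] fB[OF *(3)] .
      hence "bs = cs" by (rule inj_onD[OF ind(1) _ *(1,3)])
      thus "y = z" using * by simp
    qed
    have "?f ` ?N = \<mu> ` ?B" unfolding image_image by (rule image_cong[OF refl fB])
    thus "hm.independent (?f ` ?N)" using ind(2) by simp
    show "gen vs \<in> ?Sp" if "vs \<in> tuples Vs" for vs by (rule g0[OF le_refl that]) simp
  qed
  show "hm.span (?f ` tuples Vs) = hm.span (\<mu> ` ?B)" using presentation.span_N[OF pres] unfolding fNeq .
qed

section \<open>Blocks of consecutive labels\<close>

text \<open>The labels that the Young subgroup assigns to the \<open>j\<close>-th factor.\<close>
definition young_block :: "nat list \<Rightarrow> nat \<Rightarrow> nat set" where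
  "young_block ns j = {offset ns j + 1..offset ns j + ns ! j}"

definition young_shift :: "nat list \<Rightarrow> nat \<Rightarrow> nat \<Rightarrow> nat" where
  "young_shift ns j i = offset ns j + i"

lemma offset_Suc: "j < length ns \<Longrightarrow> offset ns (Suc j) = offset ns j + ns ! j"
  by (simp add: offset_def take_Suc_conv_app_nth)

lemma offset_mono: "i \<le> j \<Longrightarrow> j \<le> length ns \<Longrightarrow> offset ns i \<le> offset ns j"
proof (induction j)
  case (Suc j)
  thus ?case using offset_Suc[of j ns] by (cases "i = Suc j") auto
qed simp

lemma young_shift_image: "young_shift ns j ` {1..ns ! j} = young_block ns j"
proof -
  have "(+) (offset ns j) ` {1..ns ! j} = {offset ns j + 1..offset ns j + ns ! j}" by (simp only: image_add_atLeastAtMost add.commute)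
  thus ?thesis by (simp only: young_block_def young_shift_def[abs_def])
qed

lemma young_shift_inj: "inj_on (young_shift ns j) A"
  by (simp add: young_shift_def inj_on_def)

lemma young_block_disjoint:
  assumes "i < length ns" "j < length ns" "i \<noteq> j"
  shows "young_block ns i \<inter> young_block ns j = {}"
proof -
  have "young_block ns i \<inter> young_block ns j = {}" if "i < j" "j < length ns" for i j
    using offset_Suc[of i ns] offset_mono[of "Suc i" j ns] that by (auto simp: young_block_def)
  from this[of i j] this[of j i] assms show ?thesis by (cases "i < j") auto
qed

lemma young_block_union: "(\<Union>j<length ns. young_block ns j) = {1..sum_list ns}"
proof -
  have "(\<Union>i<j. young_block ns i) = {1..offset ns j}" if "j \<le> length ns" for j
    using that
  proof (induction j)
    case 0
    show ?case by (simp add: offset_def)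
  next
    case (Suc j)
    hence "(\<Union>i<Suc j. young_block ns i) = {1..offset ns j} \<union> young_block ns j" by (simp add: lessThan_Suc Un_commute)
    also have "\<dots> = {1..offset ns (Suc j)}" using offset_Suc[of j ns] Suc.prems by (auto simp: young_block_def)
    finally show ?case .
  qed
  from this[of "length ns"] show ?thesis by (simp add: offset_def)
qed

lemma young_block_sub: "j < length ns \<Longrightarrow> young_block ns j \<subseteq> {1..sum_list ns}"
  using young_block_union[of ns] by blast

lemma glue:
  assumes F: "\<And>j. j < length ns \<Longrightarrow> bij_betw (F j) {1..ns ! j} (S j)"
    and S: "\<And>i j. i < length ns \<Longrightarrow> j < length ns \<Longrightarrow> i \<noteq> j \<Longrightarrow> S i \<inter> S j = {}" "(\<Union>j<length ns. S j) = {1..sum_list ns}"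
  shows "\<exists>\<tau>. \<tau> permutes {1..sum_list ns} \<and> (\<forall>j<length ns. \<forall>i\<in>{1..ns ! j}. \<tau> (young_shift ns j i) = F j i)"
proof -
  let ?n = "sum_list ns"
  define bi where "bi p = (THE j. j < length ns \<and> p \<in> young_block ns j)" for p
  have bi: "bi p = j" if "j < length ns" "p \<in> young_block ns j" for p j
    unfolding bi_def by (rule the_equality) (use that young_block_disjoint[of _ ns j] in blast)+
  define \<tau> where "\<tau> p = (if p \<in> {1..?n} then F (bi p) (p - offset ns (bi p)) else p)" for p
  have t: "\<tau> (young_shift ns j i) = F j i" if "j < length ns" "i \<in> {1..ns ! j}" for i j
  proof -
    have p: "young_shift ns j i \<in> young_block ns j" using young_shift_image[of ns j] that(2) by blast
    hence "young_shift ns j i \<in> {1..?n}" using young_block_sub[OF that(1)] by blast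
    thus ?thesis using bi[OF that(1) p] by (simp add: \<tau>_def young_shift_def)
  qed
  have tb: "\<tau> ` young_block ns j = S j" if "j < length ns" for j
  proof -
    have "\<tau> ` young_block ns j = F j ` {1..ns ! j}" unfolding young_shift_image[symmetric] image_image
      by (rule image_cong) (use t[OF that] in simp_all)
    thus ?thesis using bij_betw_imp_surj_on[OF F[OF that]] by simp
  qed
  have "\<tau> ` {1..?n} = {1..?n}"
    unfolding young_block_union[symmetric] image_UN using tb S(2) young_block_union[of ns] by simp
  moreover from this have "inj_on \<tau> {1..?n}" by (intro eq_card_imp_inj_on) (simp_all only: finite_atLeastAtMost)
  ultimately have "bij_betw \<tau> {1..?n} {1..?n}" by (simp add: bij_betw_def)
  hence "\<tau> permutes {1..?n}" by (rule bij_imp_permutes) (simp only: \<tau>_def if_False)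
  thus ?thesis using t by blast
qed

lemma young_young_block: "g \<in> young ns \<longleftrightarrow> g permutes {1..sum_list ns} \<and> (\<forall>j<length ns. g ` young_block ns j = young_block ns j)"
  by (simp add: young_def young_block_def)

text \<open>The minimal representatives of the cosets of the Young subgroup.\<close>
definition shuffle_perms :: "nat list \<Rightarrow> (nat \<Rightarrow> nat) set" where
  "shuffle_perms ns = {\<tau>. \<tau> permutes {1..sum_list ns} \<and> (\<forall>j<length ns. strict_mono_on (young_block ns j) \<tau>)}"

lemma strict_mono_on_young_block: "strict_mono_on (young_block ns j) h \<longleftrightarrow> strict_mono_on {1..ns ! j} (h \<circ> young_shift ns j)"
proof
  assume a: "strict_mono_on (young_block ns j) h"
  show "strict_mono_on {1..ns ! j} (h \<circ> young_shift ns j)"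
  proof (rule strict_mono_onI)
    fix r s assume rs: "r \<in> {1..ns ! j}" "s \<in> {1..ns ! j}" "r < s"
    have "young_shift ns j r \<in> young_block ns j" "young_shift ns j s \<in> young_block ns j" using rs young_shift_image by blast+
    thus "(h \<circ> young_shift ns j) r < (h \<circ> young_shift ns j) s" using strict_mono_onD[OF a] rs(3) by (simp add: young_shift_def)
  qed
next
  assume a: "strict_mono_on {1..ns ! j} (h \<circ> young_shift ns j)"
  show "strict_mono_on (young_block ns j) h"
  proof (rule strict_mono_onI)
    fix r s assume rs: "r \<in> young_block ns j" "s \<in> young_block ns j" "r < s"
    then obtain r' s' where *: "r' \<in> {1..ns ! j}" "s' \<in> {1..ns ! j}" "r = young_shift ns j r'" "s = young_shift ns j s'"
      unfolding young_shift_image[symmetric] by blast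
    hence "r' < s'" using rs(3) by (simp add: young_shift_def)
    from strict_mono_onD[OF a *(1,2) this] show "h r < h s" using * by simp
  qed
qed

lemma shuffle_perms_young:
  assumes "\<tau> permutes {1..sum_list ns}"
  shows "\<exists>\<tau>0\<in>shuffle_perms ns. \<exists>g\<in>young ns. \<tau> = \<tau>0 \<circ> g"
proof -
  let ?n = "sum_list ns"
  define F where "F j i = order_iso (\<tau> ` young_block ns j) i" for j i
  have inj: "inj_on \<tau> A" for A by (rule permutes_inj_on[OF assms])
  have fin: "finite (\<tau> ` young_block ns j)" "card (\<tau> ` young_block ns j) = ns ! j" for j
    by (simp_all add: card_image[OF inj]) (simp_all add: young_block_def)
  have F: "bij_betw (F j) {1..ns ! j} (\<tau> ` young_block ns j)" for j
    using order_iso_props(2)[OF fin(1)[of j]] unfolding F_def fin(2) .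
  have dis: "\<tau> ` young_block ns i \<inter> \<tau> ` young_block ns j = {}" if "i < length ns" "j < length ns" "i \<noteq> j" for i j
    using image_Int[OF inj[of UNIV], of "young_block ns i" "young_block ns j"] young_block_disjoint[OF that] by simp
  have un: "(\<Union>j<length ns. \<tau> ` young_block ns j) = {1..?n}"
    unfolding image_UN[symmetric] young_block_union by (rule permutes_image[OF assms])
  obtain \<tau>0 where t0: "\<tau>0 permutes {1..?n}" "\<And>j i. j < length ns \<Longrightarrow> i \<in> {1..ns ! j} \<Longrightarrow> \<tau>0 (young_shift ns j i) = F j i"
    using glue[OF F dis un] by blast
  have t0b: "\<tau>0 ` young_block ns j = \<tau> ` young_block ns j" if "j < length ns" for j
  proof -
    have "\<tau>0 ` young_block ns j = F j ` {1..ns ! j}" unfolding young_shift_image[symmetric] image_image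
      by (rule image_cong) (use t0(2)[OF that] in simp_all)
    thus ?thesis using bij_betw_imp_surj_on[OF F] by simp
  qed
  have m: "strict_mono_on (young_block ns j) \<tau>0" if "j < length ns" for j
    unfolding strict_mono_on_young_block
  proof (rule strict_mono_onI)
    fix r s assume rs: "r \<in> {1..ns ! j}" "s \<in> {1..ns ! j}" "r < s"
    have "strict_mono_on {1..ns ! j} (F j)" using order_iso_props(1)[OF fin(1)[of j]] unfolding F_def fin(2) .
    from strict_mono_onD[OF this rs] show "(\<tau>0 \<circ> young_shift ns j) r < (\<tau>0 \<circ> young_shift ns j) s"
      using t0(2)[OF that] rs by simp
  qed
  have i0: "inv_into UNIV \<tau>0 permutes {1..?n}" by (rule permutes_inv[OF t0(1)])
  let ?g = "inv_into UNIV \<tau>0 \<circ> \<tau>"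
  have "?g permutes {1..?n}" by (rule permutes_compose[OF assms i0])
  moreover have "?g ` young_block ns j = young_block ns j" if "j < length ns" for j
    unfolding image_comp[symmetric] t0b[OF that, symmetric] by (simp add: image_comp permutes_inv_o(2)[OF t0(1)])
  ultimately have "?g \<in> young ns" by (simp add: young_young_block)
  moreover have "\<tau>0 \<in> shuffle_perms ns" using t0(1) m by (simp add: shuffle_perms_def)
  moreover have "\<tau> = \<tau>0 \<circ> ?g" by (simp add: comp_assoc[symmetric] permutes_inv_o(1)[OF t0(1)])
  ultimately show ?thesis by blast
qed

lemma young_comp_props:
  assumes "g \<in> young ns" "j < length ns"
  shows "young_comp ns j g permutes {1..ns ! j}" "i \<in> {1..ns ! j} \<Longrightarrow> g (young_shift ns j i) = young_shift ns j (young_comp ns j g i)"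
proof -
  let ?y = "young_comp ns j g"
  have p: "g permutes {1..sum_list ns}" "g ` young_block ns j = young_block ns j" using assms by (auto simp: young_young_block)
  show e: "g (young_shift ns j i) = young_shift ns j (?y i)" if "i \<in> {1..ns ! j}" for i
  proof -
    have "young_shift ns j i \<in> young_block ns j" using young_shift_image[of ns j] that by blast
    hence "g (young_shift ns j i) \<in> young_block ns j" using p(2) by blast
    hence "offset ns j \<le> g (young_shift ns j i)" by (simp add: young_block_def)
    thus ?thesis using that by (simp add: young_comp_def young_shift_def)
  qed
  have "young_shift ns j ` ?y ` {1..ns ! j} = g ` young_shift ns j ` {1..ns ! j}"
    unfolding image_image by (rule image_cong) (use e in simp_all)
  also have "\<dots> = young_shift ns j ` {1..ns ! j}" unfolding young_shift_image by (rule p(2))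
  finally have im: "?y ` {1..ns ! j} = {1..ns ! j}" by (simp only: inj_image_eq_iff[OF young_shift_inj[of ns j UNIV]])
  have "inj_on ?y {1..ns ! j}" by (rule eq_card_imp_inj_on) (simp_all only: im finite_atLeastAtMost)
  hence "bij_betw ?y {1..ns ! j} {1..ns ! j}" using im by (simp add: bij_betw_def)
  thus "?y permutes {1..ns ! j}" by (rule bij_imp_permutes) (simp only: young_comp_def if_False)
qed

text \<open>The morphisms with increasing injection represent the orbits of the symmetric group.\<close>
lemma FI_order_factor:
  assumes "\<phi> \<in> FI_hom d n n'"
  shows "\<exists>\<phi>0\<in>{\<phi> \<in> FI_hom d n n'. strict_mono_on {1..n} (fst \<phi>)}. \<exists>\<sigma>\<in>{\<sigma>. \<sigma> permutes {1..n}}. \<phi> = FI_comp n n n' \<phi>0 (perm_mor n \<sigma>)"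
proof -
  note p = FI_homE[OF assms]
  let ?f = "fst \<phi>" and ?S = "fst \<phi> ` {1..n}"
  have S: "finite ?S" "card ?S = n" using card_image[OF p(2)] by simp_all
  note o = order_iso_props[OF S(1), unfolded S(2)]
  define f0 where "f0 = restrict (order_iso ?S) {1..n}"
  define \<sigma> where "\<sigma> i = (if i \<in> {1..n} then inv_into {1..n} (order_iso ?S) (?f i) else i)" for i
  have b: "bij_betw (inv_into {1..n} (order_iso ?S)) ?S {1..n}" using o(2) by (rule bij_betw_inv_into)
  have h: "bij_betw ?f {1..n} ?S" using p(2) by (simp add: bij_betw_def)
  have "bij_betw \<sigma> {1..n} {1..n}"
    by (rule bij_betw_cong[THEN iffD2, OF _ bij_betw_trans[OF h b]]) (simp add: \<sigma>_def)
  hence s: "\<sigma> permutes {1..n}" by (rule bij_imp_permutes) (simp only: \<sigma>_def if_False)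
  have f0i: "f0 ` {1..n} = ?S" unfolding f0_def using bij_betw_imp_surj_on[OF o(2)] by simp
  have "(f0, snd \<phi>) \<in> FI_hom d n n'"
    unfolding FI_hom_def mem_Collect_eq prod.case f0i
  proof (intro conjI)
    show "f0 \<in> {1..n} \<rightarrow>\<^sub>E {1..n'}" unfolding f0_def restrict_PiE_iff
    proof
      fix i assume "i \<in> {1..n}"
      hence "order_iso ?S i \<in> ?S" using bij_betwE[OF o(2)] by blast
      thus "order_iso ?S i \<in> {1..n'}" using p(3) by blast
    qed
    show "inj_on f0 {1..n}" unfolding f0_def inj_on_restrict_eq using o(2) by (simp add: bij_betw_def)
  qed (rule p(4))
  moreover have "strict_mono_on {1..n} f0"
    using o(1) unfolding f0_def by (auto simp: strict_mono_on_def)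
  moreover have "\<phi> = FI_comp n n n' (f0, snd \<phi>) (perm_mor n \<sigma>)"
  proof (rule prod_eqI)
    have e: "f0 (\<sigma> i) = ?f i" if "i \<in> {1..n}" for i
    proof -
      have "?f i \<in> order_iso ?S ` {1..n}" using that bij_betw_imp_surj_on[OF o(2)] by simp
      hence "order_iso ?S (inv_into {1..n} (order_iso ?S) (?f i)) = ?f i" by (rule f_inv_into_f)
      moreover have "\<sigma> i \<in> {1..n}" using permutes_in_image[OF s] that by blast
      ultimately show ?thesis using that by (simp add: f0_def \<sigma>_def)
    qed
    show "fst \<phi> = fst (FI_comp n n n' (f0, snd \<phi>) (perm_mor n \<sigma>))"
      unfolding FI_comp_simps
    proof (rule extensionalityI[of _ "{1..n}"])
      show "fst \<phi> \<in> extensional {1..n}" using p(1) by (simp add: PiE_def)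
      show "compose {1..n} (fst (f0, snd \<phi>)) (fst (perm_mor n \<sigma>)) \<in> extensional {1..n}" by (rule compose_extensional)
      fix i assume "i \<in> {1..n}"
      thus "fst \<phi> i = compose {1..n} (fst (f0, snd \<phi>)) (fst (perm_mor n \<sigma>)) i"
        using e by (simp add: compose_eq perm_mor_def)
    qed
    have im: "(fst (f0, snd \<phi>) \<circ> fst (perm_mor n \<sigma>)) ` {1..n} = ?S"
      by (rule image_cong) (use e in \<open>simp_all add: perm_mor_def\<close>)
    show "snd \<phi> = snd (FI_comp n n n' (f0, snd \<phi>) (perm_mor n \<sigma>))"
      unfolding FI_comp_simps im
    proof (rule extensionalityI[of _ "{1..n'} - ?S"])
      show "snd \<phi> \<in> extensional ({1..n'} - ?S)" using p(4) by (simp add: PiE_def)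
      fix x assume x: "x \<in> {1..n'} - ?S"
      hence "x \<notin> f0 ` {1..n}" unfolding f0i by blast
      thus "snd \<phi> x = (\<lambda>x\<in>{1..n'} - ?S. if x \<notin> fst (f0, snd \<phi>) ` {1..n} then snd (f0, snd \<phi>) x
          else snd (perm_mor n \<sigma>) (inv_into {1..n} (fst (f0, snd \<phi>)) x)) x"
        using x by (simp del: One_nat_def)
    qed (rule restrict_extensional)
  qed
  ultimately show ?thesis using s by (intro bexI[of _ "(f0, snd \<phi>)"] bexI[of _ \<sigma>]) simp_all
qed

lemma hrelabel_unit: "hrelabel f (sing_class {}) = sing_class {}"
  by (rule trans[OF hrelabel_sing_class]) simp_all

lemma hprods_simps: "hprods [] = sing_class {}" "hprods (x # xs) = hprod x (hprods xs)"
  by (simp_all add: hprods_def sing_class_def)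

lemma hrelabel_hprods: "hrelabel f (hprods xs) = hprods (map (hrelabel f) xs)"
  by (induction xs) (simp_all add: hprods_simps hrelabel_unit hrelabel_hprod)

lemma hprods_add:
  "i < length ys \<Longrightarrow> hprods (ys[i := x + y]) = hprods (ys[i := x]) + hprods (ys[i := y])"
  "i < length ys \<Longrightarrow> hprods (ys[i := hscale q x]) = hscale q (hprods (ys[i := x]))"
proof (induction ys arbitrary: i)
  case (Cons z ys)
  {
    case 1
    thus ?case using Cons.IH(1) by (cases i) (auto simp: hprods_simps hprod_add_left hprod_add_right)
  next
    case 2
    thus ?case using Cons.IH(2) by (cases i) (auto simp: hprods_simps hprod_scale_left hprod_scale_right)
  }
qed simp_all

lemma nth_add_slots: "j < length l \<Longrightarrow> add_slots P l ! j = (case l ! j of (b,B,T) \<Rightarrow> (b, B, T \<union> P (Suc j)))"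
proof (induction P l arbitrary: j rule: add_slots.induct)
  case (2 P b B T l)
  thus ?case by (cases j) (auto simp: comp_def split: prod.splits)
qed simp

lemma spaced_ok_map:
  assumes "distinct js" "\<And>j. j \<in> set js \<Longrightarrow> x j \<in> H 1 (B j) \<and> finite (B j)"
    "\<And>i j. i \<in> set js \<Longrightarrow> j \<in> set js \<Longrightarrow> i \<noteq> j \<Longrightarrow> B i \<inter> B j = {}"
  shows "spaced_ok (\<Union>j\<in>set js. B j) {} (map (\<lambda>j. (x j, B j, {})) js) \<and>
    spaced {} (map (\<lambda>j. (x j, B j, {})) js) = hprods (map x js)"
  using assms
proof (induction js)
  case (Cons a js)
  have IH: "spaced_ok (\<Union>j\<in>set js. B j) {} (map (\<lambda>j. (x j, B j, {})) js)"
    "spaced {} (map (\<lambda>j. (x j, B j, {})) js) = hprods (map x js)"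
    using Cons.IH Cons.prems by simp_all
  have d: "B a \<inter> B j = {}" if "j \<in> set js" for j using Cons.prems(1) Cons.prems(3)[of a j] that by auto
  have e: "(\<Union>j\<in>set (a # js). B j) - {} - B a = (\<Union>j\<in>set js. B j)" using d by auto
  have "finite (\<Union>j\<in>set (a # js). B j)" using Cons.prems(2) by simp
  moreover have "x a \<in> H 1 (B a)" using Cons.prems(2) by simp
  ultimately have "spaced_ok (\<Union>j\<in>set (a # js). B j) {} ((x a, B a, {}) # map (\<lambda>j. (x j, B j, {})) js)"
    unfolding spaced_ok.simps e using IH(1) by simp
  thus ?case using IH(2) by (simp add: hprods_simps)
qed (simp add: hprods_simps)

section \<open>Images of concatenation products as basis words\<close>

lemma zclass_two: "zclass [[1,2]] = letter_class ({},1,2)" "letter_ok ({},1,2)" "zclass [[1,2]] \<in> H 1 {1..2}" "zclass [[1,2]] \<noteq> 0"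
proof -
  have l: "letter_ok ({},1,2)" "letter_labels ({},1,2) = {1..2}" by (auto simp: letter_ok_def letter_labels_def)
  have w: "word_on {1..2} [({},1,2)] {}" using l by simp
  have "word_symb [({},1,2)] {} = [[1,2]]" by (simp add: word_symb_def letter_symb_def singles_def)
  with zclass_word_symb[OF w] show z: "zclass [[1,2]] = letter_class ({},1,2)" by simp
  show "letter_ok ({},1,2)" by (rule l)
  show "zclass [[1,2]] \<in> H 1 {1..2}" unfolding z using H_letter_class[OF l(1)] l(2) by simp
  have "word_class [({},1,2)] {} \<in> case_prod word_class ` words"
    by (rule image_eqI[of _ _ "([({},1,2)],{})"]) (use w in \<open>auto simp: words_def\<close>)
  moreover have "0 \<notin> case_prod word_class ` words" using word_class_independent hm.dependent_zero by blast
  ultimately have "word_class [({},1,2)] {} \<noteq> 0" by metis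
  thus "zclass [[1,2]] \<noteq> 0" unfolding z word_class_simps sing_class_empty_right .
qed

lemma hrelabel_zclass_two:
  assumes "f 1 < f 2"
  shows "hrelabel f (zclass [[1,2]]) = letter_class ({}, f 1, f 2)"
proof -
  have "inj_on f (letter_labels ({},1,2))" using assms by (auto simp: letter_labels_def inj_on_def)
  from hrelabel_letter_class_B[OF zclass_two(2) _ this assms] show ?thesis unfolding zclass_two(1) by (simp add: relabel_letter_def)
qed

text \<open>The cycle \<open>1 2 + 2 1\<close> is symmetric, which yields the trivial
  representation.\<close>
lemma zclass_two_perm:
  assumes "\<sigma> permutes {1..2}"
  shows "hrelabel \<sigma> (zclass [[1,2]]) = zclass [[1,2]]"
proof -
  have s: "\<sigma> ` {1..2} = {1..2}" by (rule permutes_image[OF assms])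
  have e: "{1..2::nat} = {1,2}" by auto
  have "{\<sigma> 1, \<sigma> 2} = {1, 2}" using s unfolding e by (simp only: image_insert image_empty)
  hence "\<sigma> 1 = 1 \<and> \<sigma> 2 = 2 \<or> \<sigma> 1 = 2 \<and> \<sigma> 2 = 1" by (simp only: doubleton_eq_iff)
  thus ?thesis
  proof
    assume "\<sigma> 1 = 1 \<and> \<sigma> 2 = 2"
    thus ?thesis using hrelabel_zclass_two[of \<sigma>] zclass_two(1) by simp
  next
    assume *: "\<sigma> 1 = 2 \<and> \<sigma> 2 = 1"
    let ?c = "gen [[1,2]] + gen [[2,1]] :: chain"
    have "letter_cycle ({},1,2) = ?c" by (simp add: letter_cycle_def singles_def scat_def cprod_lin)
    moreover have "letter_cycle ({},1,2) \<in> cyc" by (rule letter_cycle_cyc[OF zclass_two(2)])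
    ultimately have c: "zclass [[1,2]] = hclass ?c" "?c \<in> cyc" by (simp_all only: zclass_two(1) letter_class_def)
    have "crelabel \<sigma> ?c = gen [[2,1]] + gen [[1,2]]" using * by (simp add: crelabel_add rsymb_def inj_on_def)
    thus ?thesis unfolding c(1) hrelabel_hclass[OF c(2)] by (simp only: add.commute)
  qed
qed

text \<open>The concatenation products of the theorem, with factors from the list
  \<open>Cs\<close>.\<close>
locale product_family = admissible_family +
  fixes Cs :: "ctype list"
  assumes pos: "\<forall>m. TypeA m \<in> set Cs \<longrightarrow> 1 \<le> m"
begin

abbreviation "k \<equiv> length Cs"
abbreviation "ns \<equiv> map ctype_deg Cs"
abbreviation "N \<equiv> sum_list ns"
abbreviation "js \<equiv> insertion_indices Cs"
abbreviation "basis_tuples \<equiv> {bs. length bs = k \<and> (\<forall>j<k. bs ! j \<in> ctype_set A' (Cs ! j))}"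

text \<open>Concatenation of classes on the standard intervals; it is multilinear.\<close>
definition multi_concat :: "hmlg list \<Rightarrow> hmlg" where
  "multi_concat ys = hprods (map (\<lambda>j. hrelabel (young_shift ns j) (ys ! j)) [0..<k])"

text \<open>The letter that the \<open>j\<close>-th factor becomes after relabeling by
  \<open>h\<close> and insertion of \<open>P\<close>: a factor from \<open>B\<^sub>2\<close>
  absorbs the singletons inserted before it.\<close>
definition factor_letter :: "(nat \<Rightarrow> nat) \<Rightarrow> (nat \<Rightarrow> nat set) \<Rightarrow> hmlg list \<Rightarrow> nat \<Rightarrow> letter" where
  "factor_letter h P bs j = (case Cs ! j of TypeA m \<Rightarrow> A_letter m (h ` young_block ns j) (bs ! j)
     | TypeB \<Rightarrow> (P j, h (offset ns j + 1), h (offset ns j + 2)))"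

lemma TypeA_pos: "j < k \<Longrightarrow> Cs ! j = TypeA m \<Longrightarrow> 1 \<le> m"
  using pos nth_mem[of j Cs] by metis

lemma ctype_set_H: "j < k \<Longrightarrow> ctype_set A' (Cs ! j) \<subseteq> H 1 {1..ns ! j}"
proof (cases "Cs ! j")
  case (TypeA m)
  assume j: "j < k"
  show ?thesis using A'_props(2)[OF TypeA_pos[OF j TypeA]] j TypeA by simp
next
  case TypeB
  assume "j < k"
  thus ?thesis using TypeB zclass_two(3) by simp
qed

lemma young_block_H: "y \<in> H 1 {1..ns ! j} \<Longrightarrow> hrelabel (young_shift ns j) y \<in> H 1 (young_block ns j)"
  by (drule H_hrelabel[OF _ young_shift_inj[of ns j]]) (simp only: young_shift_image)

lemma multi_concat_spaced:
  assumes "\<And>j. j < k \<Longrightarrow> ys ! j \<in> H 1 {1..ns ! j}"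
  shows "spaced_ok {1..N} {} (map (\<lambda>j. (hrelabel (young_shift ns j) (ys ! j), young_block ns j, {})) [0..<k])"
    "multi_concat ys = spaced {} (map (\<lambda>j. (hrelabel (young_shift ns j) (ys ! j), young_block ns j, {})) [0..<k])"
proof -
  have "(\<Union>j\<in>set [0..<k]. young_block ns j) = {1..N}" using young_block_union[of ns] by (simp add: lessThan_atLeast0)
  moreover have "spaced_ok (\<Union>j\<in>set [0..<k]. young_block ns j) {} (map (\<lambda>j. (hrelabel (young_shift ns j) (ys ! j), young_block ns j, {})) [0..<k]) \<and>
    spaced {} (map (\<lambda>j. (hrelabel (young_shift ns j) (ys ! j), young_block ns j, {})) [0..<k]) = hprods (map (\<lambda>j. hrelabel (young_shift ns j) (ys ! j)) [0..<k])"
    by (rule spaced_ok_map) (use young_block_H[OF assms] young_block_disjoint[of _ ns] in \<open>auto simp: young_block_def[of ns]\<close>)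
  ultimately show "spaced_ok {1..N} {} (map (\<lambda>j. (hrelabel (young_shift ns j) (ys ! j), young_block ns j, {})) [0..<k])"
    "multi_concat ys = spaced {} (map (\<lambda>j. (hrelabel (young_shift ns j) (ys ! j), young_block ns j, {})) [0..<k])" by (simp_all only: multi_concat_def)
qed

lemma multi_concat_H: "(\<And>j. j < k \<Longrightarrow> ys ! j \<in> H 1 {1..ns ! j}) \<Longrightarrow> multi_concat ys \<in> H k {1..N}"
  using spaced_in_H[OF multi_concat_spaced(1)[of ys]] multi_concat_spaced(2)[of ys] by simp

lemma basis_tuples_H: "bs \<in> basis_tuples \<Longrightarrow> j < k \<Longrightarrow> bs ! j \<in> H 1 {1..ns ! j}"
  using ctype_set_H by blast

lemma factor_letter_props:
  assumes j: "j < k" and h: "strict_mono_on (young_block ns j) h" and P: "finite (P j)" "P j \<inter> h ` young_block ns j = {}"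
    "Cs ! j \<noteq> TypeB \<Longrightarrow> P j = {}" and b: "bs ! j \<in> ctype_set A' (Cs ! j)"
  shows "letter_ok (factor_letter h P bs j)" "letter_labels (factor_letter h P bs j) = P j \<union> h ` young_block ns j"
    "adm_class (factor_letter h P bs j) = hprod (sing_class (P j)) (hrelabel (h \<circ> young_shift ns j) (bs ! j))"
proof -
  have "letter_ok (factor_letter h P bs j) \<and> letter_labels (factor_letter h P bs j) = P j \<union> h ` young_block ns j \<and>
    adm_class (factor_letter h P bs j) = hprod (sing_class (P j)) (hrelabel (h \<circ> young_shift ns j) (bs ! j))"
  proof (cases "Cs ! j")
    case (TypeA m)
    have m: "1 \<le> m" by (rule TypeA_pos[OF j TypeA])
    have n: "ns ! j = m + 2" using j TypeA by simp
    let ?S = "h ` young_block ns j"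
    have S: "finite ?S" "card ?S = m + 2"
      using card_image[OF strict_mono_on_imp_inj_on[OF h]] n by (simp_all add: young_block_def)
    have x: "bs ! j \<in> A' (m + 2) m" using b TypeA by simp
    have l: "factor_letter h P bs j = A_letter m ?S (bs ! j)" by (simp add: factor_letter_def TypeA)
    have P0: "P j = {}" using P(3) TypeA by simp
    have hm: "strict_mono_on {1..m+2} (h \<circ> young_shift ns j)" using h unfolding strict_mono_on_young_block n .
    have hi: "(h \<circ> young_shift ns j) ` {1..m+2} = ?S" unfolding image_comp[symmetric] n[symmetric] young_shift_image ..
    have xH: "bs ! j \<in> H 1 {1..m+2}" using A'_props(2)[OF m] x by blast
    have "hrelabel (h \<circ> young_shift ns j) (bs ! j) = hrelabel (order_iso ?S) (bs ! j)"
      by (rule hrelabel_cong[OF xH order_iso_unique[OF hm hi]])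
    thus ?thesis using A_letter_props[OF m S x] adm_class_A[OF m S x] by (simp add: l P0)
  next
    case TypeB
    have n: "ns ! j = 2" using j TypeB by simp
    let ?u = "h (offset ns j + 1)" and ?v = "h (offset ns j + 2)"
    have B: "young_block ns j = {offset ns j + 1, offset ns j + 2}" unfolding young_block_def n by auto
    have uv: "?u < ?v" by (rule strict_mono_onD[OF h]) (simp_all add: B)
    have l: "factor_letter h P bs j = (P j, ?u, ?v)" by (simp add: factor_letter_def TypeB)
    have lk: "letter_ok (P j, ?u, ?v)" using P(1,2) uv by (auto simp: letter_ok_def B)
    have "letter_labels (P j, ?u, ?v) = P j \<union> h ` young_block ns j" by (auto simp: letter_labels_def B)
    moreover have "bs ! j = zclass [[1,2]]" using b TypeB by simp
    moreover have "hrelabel (h \<circ> young_shift ns j) (zclass [[1,2]]) = letter_class ({}, ?u, ?v)"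
      using hrelabel_zclass_two[of "h \<circ> young_shift ns j"] uv by (simp add: young_shift_def)
    ultimately show ?thesis using lk letter_class_B_split[OF lk uv] adm_class_B[OF uv] by (simp add: l)
  qed
  thus "letter_ok (factor_letter h P bs j)" "letter_labels (factor_letter h P bs j) = P j \<union> h ` young_block ns j"
    "adm_class (factor_letter h P bs j) = hprod (sing_class (P j)) (hrelabel (h \<circ> young_shift ns j) (bs ! j))" by blast+
qed

text \<open>With the allowed insertions the result is a word again, since no singletons are
  inserted before a factor from \<open>A'\<close>.\<close>
lemma adm_word_class_word:
  assumes h: "inj_on h {1..N}" "\<And>j. j < k \<Longrightarrow> strict_mono_on (young_block ns j) h"
    and P: "slot_ok k P (h ` {1..N})" "\<And>j. j < k \<Longrightarrow> Cs ! j \<noteq> TypeB \<Longrightarrow> P j = {}"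
    and b: "\<And>j. j < k \<Longrightarrow> bs ! j \<in> ctype_set A' (Cs ! j)" and i: "i \<le> k"
  shows "word_on ((\<Union>j\<in>{i..<k}. h ` young_block ns j) \<union> (\<Union>j\<in>{i..k}. P j)) (map (factor_letter h P bs) [i..<k]) (P k) \<and>
    adm_word_class (map (factor_letter h P bs) [i..<k]) (P k) =
      spaced (P i) (map (\<lambda>j. (hrelabel (h \<circ> young_shift ns j) (bs ! j), h ` young_block ns j, P (Suc j))) [i..<k])"
  using i
proof (induction i rule: inc_induct)
  case base
  show ?case using P(1) by (simp add: slot_ok_def)
next
  case (step i)
  let ?U = "\<lambda>i. (\<Union>j\<in>{i..<k}. h ` young_block ns j) \<union> (\<Union>j\<in>{i..k}. P j)"
  have ik: "i < k" by (rule step)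
  have hb: "h ` young_block ns j \<subseteq> h ` {1..N}" if "j < k" for j using young_block_sub[of j ns] that by (intro image_mono) simp
  have Ph: "P j \<inter> h ` {1..N} = {}" "finite (P j)" if "j \<le> k" for j using P(1) that by (auto simp: slot_ok_def)
  have Pb: "P j \<inter> h ` young_block ns l = {}" if "j \<le> k" "l < k" for j l using Ph(1)[OF that(1)] hb[OF that(2)] by blast
  have PP: "P j \<inter> P l = {}" if "j \<le> k" "l \<le> k" "j \<noteq> l" for j l using P(1) that by (auto simp: slot_ok_def)
  have bb: "h ` young_block ns j \<inter> h ` young_block ns l = {}" if "j < k" "l < k" "j \<noteq> l" for j l
    using inj_on_image_Int[OF h(1) young_block_sub[of j ns] young_block_sub[of l ns]] young_block_disjoint[of j ns l] that by simp
  note le = less_imp_le[OF ik]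
  have letter_pieces: "letter_ok (factor_letter h P bs i)" "letter_labels (factor_letter h P bs i) = P i \<union> h ` young_block ns i"
    "adm_class (factor_letter h P bs i) = hprod (sing_class (P i)) (hrelabel (h \<circ> young_shift ns i) (bs ! i))"
    using factor_letter_props[where P = P and h = h and j = i and bs = bs, OF ik h(2)[OF ik] Ph(2)[OF le] Pb[OF le ik] P(2)[OF ik] b[OF ik]]
    by simp_all
  have s1: "{i..<k} = insert i {Suc i..<k}" "{i..k} = insert i {Suc i..k}" using ik by auto
  have U1: "?U i = letter_labels (factor_letter h P bs i) \<union> ?U (Suc i)" by (simp only: letter_pieces(2) s1 UN_insert Un_ac)
  have "(P i \<union> h ` young_block ns i) \<inter> ?U (Suc i) = {}"
  proof -
    have "(P i \<union> h ` young_block ns i) \<inter> h ` young_block ns j = {}" if "j \<in> {Suc i..<k}" for j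
      using Pb[of i j] bb[of i j] that ik by auto
    moreover have "(P i \<union> h ` young_block ns i) \<inter> P j = {}" if "j \<in> {Suc i..k}" for j
      using PP[of i j] Pb[of j i] that ik by auto
    ultimately show ?thesis by blast
  qed
  moreover have "(A \<union> B) - A = B" if "A \<inter> B = {}" for A B :: "nat set" using that by blast
  ultimately have U2: "?U i - letter_labels (factor_letter h P bs i) = ?U (Suc i)" unfolding U1 letter_pieces(2) by presburger
  have fin: "finite (?U i)" using Ph(2) by (auto simp: young_block_def)
  have up: "[i..<k] = i # [Suc i..<k]" by (rule upt_conv_Cons[OF ik])
  have "word_on (?U i) (map (factor_letter h P bs) [i..<k]) (P k)"
    unfolding up list.map word_on.simps U2 using fin letter_pieces(1) U1 step.IH by blast
  moreover have "adm_word_class (map (factor_letter h P bs) [i..<k]) (P k) =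
      spaced (P i) (map (\<lambda>j. (hrelabel (h \<circ> young_shift ns j) (bs ! j), h ` young_block ns j, P (Suc j))) [i..<k])"
    unfolding up list.map adm_word_class_simps spaced.simps letter_pieces(3) hprod_assoc conjunct2[OF step.IH] ..
  ultimately show ?case by blast
qed

lemma js_props: "distinct js" "set js = insert k {j. j < k \<and> Cs ! j = TypeB}" "\<forall>j\<in>set js. j \<le> k"
  "length js = card {j. j < k \<and> Cs ! j = TypeB} + 1"
proof -
  have f: "{x \<in> {0..<k}. Cs ! x = TypeB} = {j. j < k \<and> Cs ! j = TypeB}" by auto
  show "distinct js" "set js = insert k {j. j < k \<and> Cs ! j = TypeB}" "\<forall>j\<in>set js. j \<le> k"
    by (auto simp: insertion_indices_def)
  have "length (filter (\<lambda>i. Cs ! i = TypeB) [0..<k]) = card (set (filter (\<lambda>i. Cs ! i = TypeB) [0..<k]))"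
    by (rule distinct_card[symmetric]) simp
  thus "length js = card {j. j < k \<and> Cs ! j = TypeB} + 1" using f by (simp add: insertion_indices_def)
qed

abbreviation "ordered_mors n' \<equiv> {\<phi> \<in> FI_hom (length js) N n'. strict_mono_on {1..N} (fst \<phi>)}"
abbreviation "K n' \<phi> \<tau> bs \<equiv> FI_act js N n' \<phi> (hrelabel \<tau> (multi_concat bs))"
abbreviation "word n' \<phi> \<tau> bs \<equiv> (map (factor_letter (fst \<phi> \<circ> \<tau>) (color_slots js N n' \<phi>) bs) [0..<k], color_slots js N n' \<phi> k)"

lemma color_slots_B: "\<phi> \<in> FI_hom (length js) N n' \<Longrightarrow> j < k \<Longrightarrow> Cs ! j \<noteq> TypeB \<Longrightarrow> color_slots js N n' \<phi> j = {}"
proof (rule equals0I)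
  fix p assume *: "\<phi> \<in> FI_hom (length js) N n'" "j < k" "Cs ! j \<noteq> TypeB" "p \<in> color_slots js N n' \<phi> j"
  hence p: "p \<in> {1..n'} - fst \<phi> ` {1..N}" "js ! snd \<phi> p = j" by (auto simp: color_slots_def)
  have "snd \<phi> p < length js" using PiE_mem[OF FI_homE(4)[OF *(1)] p(1)] by simp
  hence "j \<in> set js" using p(2) nth_mem by blast
  thus False using js_props(2) *(2,3) by auto
qed

lemma comp_mono:
  assumes "\<phi> \<in> ordered_mors n'" "\<tau> \<in> shuffle_perms ns"
  shows "inj_on (fst \<phi> \<circ> \<tau>) {1..N}" "j < k \<Longrightarrow> strict_mono_on (young_block ns j) (fst \<phi> \<circ> \<tau>)"
    "(fst \<phi> \<circ> \<tau>) ` {1..N} = fst \<phi> ` {1..N}"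
proof -
  have t: "\<tau> permutes {1..N}" and m: "\<And>j. j < k \<Longrightarrow> strict_mono_on (young_block ns j) \<tau>" using assms(2) by (auto simp: shuffle_perms_def)
  have f: "strict_mono_on {1..N} (fst \<phi>)" using assms(1) by blast
  show "(fst \<phi> \<circ> \<tau>) ` {1..N} = fst \<phi> ` {1..N}" unfolding image_comp[symmetric] permutes_image[OF t] ..
  show "inj_on (fst \<phi> \<circ> \<tau>) {1..N}"
    by (rule comp_inj_on[OF permutes_inj_on[OF t]]) (unfold permutes_image[OF t], rule strict_mono_on_imp_inj_on[OF f])
  assume j: "j < k"
  show "strict_mono_on (young_block ns j) (fst \<phi> \<circ> \<tau>)"
  proof (rule strict_mono_onI)
    fix r s assume rs: "r \<in> young_block ns j" "s \<in> young_block ns j" "r < s"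
    have "\<tau> r \<in> {1..N}" "\<tau> s \<in> {1..N}" using rs young_block_sub[of j ns] j permutes_in_image[OF t] by auto
    moreover have "\<tau> r < \<tau> s" by (rule strict_mono_onD[OF m[OF j] rs])
    ultimately show "(fst \<phi> \<circ> \<tau>) r < (fst \<phi> \<circ> \<tau>) s" using strict_mono_onD[OF f] by simp
  qed
qed

text \<open>Pushing the morphism through the concatenation leaves each factor relabeled and with
  inserted singletons behind it, which is the situation of \<open>adm_word_class_word\<close>.\<close>
lemma K_word:
  assumes p: "\<phi> \<in> ordered_mors n'" and t: "\<tau> \<in> shuffle_perms ns" and b: "bs \<in> basis_tuples"
  shows "K n' \<phi> \<tau> bs = case_prod adm_word_class (word n' \<phi> \<tau> bs)" "word n' \<phi> \<tau> bs \<in> words_on k {1..n'}"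
proof -
  let ?h = "fst \<phi> \<circ> \<tau>" and ?P = "color_slots js N n' \<phi>"
  note c = comp_mono[OF p t]
  have pF: "\<phi> \<in> FI_hom (length js) N n'" using p by blast
  have tp: "\<tau> permutes {1..N}" using t by (simp add: shuffle_perms_def)
  have bj: "\<And>j. j < k \<Longrightarrow> bs ! j \<in> ctype_set A' (Cs ! j)" using b by blast
  have s: "slot_ok k ?P (?h ` {1..N})" unfolding c(3) by (rule color_slots_slot_ok)
  note z = adm_word_class_word[OF c(1,2) s color_slots_B[OF pF] bj le0]
  have un: "(\<Union>j\<in>{0..<k}. ?h ` young_block ns j) \<union> (\<Union>j\<in>{0..k}. ?P j) = {1..n'}"
  proof -
    have "(\<Union>j\<in>{0..<k}. ?h ` young_block ns j) = ?h ` {1..N}"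
      using young_block_union[of ns] by (simp only: image_UN[symmetric] lessThan_atLeast0 length_map)
    thus ?thesis using color_slots_union[OF pF js_props(3)] unfolding c(3) by (simp only: atMost_atLeast0)
  qed
  show "word n' \<phi> \<tau> bs \<in> words_on k {1..n'}" using z unfolding un by (simp add: words_on_def)
  let ?l = "map (\<lambda>j. (hrelabel (young_shift ns j) (bs ! j), young_block ns j, {})) [0..<k]"
  have m: "spaced_ok {1..N} {} ?l" "multi_concat bs = spaced {} ?l" by (rule multi_concat_spaced, erule basis_tuples_H[OF b])+
  have mH: "multi_concat bs \<in> H k {1..N}" by (rule multi_concat_H[OF basis_tuples_H[OF b]])
  have fi: "inj_on (fst \<phi>) (\<tau> ` {1..N})" unfolding permutes_image[OF tp] by (rule FI_homE(2)[OF pF])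
  have "K n' \<phi> \<tau> bs = relabel_insert ?h ?P (multi_concat bs)"
    unfolding FI_act_def relabel_insert_def hrelabel_comp[OF mH permutes_inj_on[OF tp] fi] ..
  also have "\<dots> = spaced (?h ` {} \<union> ?P 0) (add_slots ?P (relabel_spaced ?h ?l))"
    unfolding m(2) by (rule relabel_insert_spaced[OF m(1) c(1)]) (use s in simp)
  also have "add_slots ?P (relabel_spaced ?h ?l) = map (\<lambda>j. (hrelabel (?h \<circ> young_shift ns j) (bs ! j), ?h ` young_block ns j, ?P (Suc j))) [0..<k]"
  proof (rule nth_equalityI)
    fix j assume "j < length (add_slots ?P (relabel_spaced ?h ?l))"
    hence j: "j < k" by simp
    have "inj_on ?h (young_shift ns j ` {1..ns ! j})" unfolding young_shift_image by (rule strict_mono_on_imp_inj_on[OF c(2)[OF j]])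
    hence e: "hrelabel ?h (hrelabel (young_shift ns j) (bs ! j)) = hrelabel (?h \<circ> young_shift ns j) (bs ! j)"
      by (rule hrelabel_comp[OF basis_tuples_H[OF b j] young_shift_inj])
    have "relabel_spaced ?h ?l ! j = (hrelabel ?h (hrelabel (young_shift ns j) (bs ! j)), ?h ` young_block ns j, ?h ` {})"
      using j by (simp add: relabel_spaced_def)
    hence "add_slots ?P (relabel_spaced ?h ?l) ! j = (hrelabel ?h (hrelabel (young_shift ns j) (bs ! j)), ?h ` young_block ns j, ?P (Suc j))"
      using nth_add_slots[of j "relabel_spaced ?h ?l" ?P] j by simp
    thus "add_slots ?P (relabel_spaced ?h ?l) ! j = map (\<lambda>j. (hrelabel (?h \<circ> young_shift ns j) (bs ! j), ?h ` young_block ns j, ?P (Suc j))) [0..<k] ! j"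
      unfolding e using j by simp
  qed simp
  also have "spaced (?h ` {} \<union> ?P 0) \<dots> = case_prod adm_word_class (word n' \<phi> \<tau> bs)" using z by simp
  finally show "K n' \<phi> \<tau> bs = case_prod adm_word_class (word n' \<phi> \<tau> bs)" .
qed

text \<open>The letters show the label set of every factor and hence, the maps being increasing on
  blocks, the composite \<open>fst \<phi> \<circ> \<tau>\<close>; its image determines the
  increasing map \<open>fst \<phi>\<close>. A new label is found in a slot, which determines its
  color because the indices in \<open>js\<close> are distinct.\<close>
lemma word_inj:
  assumes p: "\<phi> \<in> ordered_mors n'" "\<phi>' \<in> ordered_mors n'" and t: "\<tau> \<in> shuffle_perms ns" "\<tau>' \<in> shuffle_perms ns" and b: "bs \<in> basis_tuples" "bs' \<in> basis_tuples"
    and eq: "word n' \<phi> \<tau> bs = word n' \<phi>' \<tau>' bs'"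
  shows "\<phi> = \<phi>'" "\<tau> = \<tau>'" "bs = bs'"
proof -
  let ?h = "fst \<phi> \<circ> \<tau>" and ?P = "color_slots js N n' \<phi>" and ?h' = "fst \<phi>' \<circ> \<tau>'" and ?P' = "color_slots js N n' \<phi>'"
  note c = comp_mono[OF p(1) t(1)] and c' = comp_mono[OF p(2) t(2)]
  have pF: "\<phi> \<in> FI_hom (length js) N n'" "\<phi>' \<in> FI_hom (length js) N n'" using p by blast+
  have tp: "\<tau> permutes {1..N}" "\<tau>' permutes {1..N}" using t by (auto simp: shuffle_perms_def)
  have leq: "factor_letter ?h ?P bs j = factor_letter ?h' ?P' bs' j" if "j < k" for j
    using arg_cong[OF conjunct1[OF eq[unfolded prod.inject]], of "\<lambda>l. l ! j"] that by simp
  have Pk: "?P k = ?P' k" using eq by simp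
  have main: "?P j = ?P' j \<and> bs ! j = bs' ! j \<and> (\<forall>i\<in>{1..ns ! j}. (?h \<circ> young_shift ns j) i = (?h' \<circ> young_shift ns j) i)" if j: "j < k" for j
  proof (cases "Cs ! j")
    case (TypeA m)
    have m: "1 \<le> m" by (rule TypeA_pos[OF j TypeA])
    have n: "ns ! j = m + 2" using j TypeA by simp
    let ?S = "?h ` young_block ns j" and ?S' = "?h' ` young_block ns j"
    have S: "finite ?S" "card ?S = m + 2"
      using card_image[OF strict_mono_on_imp_inj_on[OF c(2)[OF j]]] n by (simp_all add: young_block_def)
    have S': "finite ?S'" "card ?S' = m + 2"
      using card_image[OF strict_mono_on_imp_inj_on[OF c'(2)[OF j]]] n by (simp_all add: young_block_def)
    have x: "bs ! j \<in> A' (m + 2) m" "bs' ! j \<in> A' (m + 2) m" using b j TypeA by force+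
    have l: "A_letter m ?S (bs ! j) = A_letter m ?S' (bs' ! j)" using leq[OF j] by (simp only: factor_letter_def TypeA ctype.case)
    have SS: "?S = ?S'" using A_letter_props(2)[OF m S x(1)] A_letter_props(2)[OF m S' x(2)] l by simp
    have "bs ! j = bs' ! j" by (rule A_letter_inj[OF m S x]) (use l SS in simp)
    moreover have "?P j = {}" "?P' j = {}" using color_slots_B[OF pF(1) j] color_slots_B[OF pF(2) j] TypeA by simp_all
    moreover have "(?h \<circ> young_shift ns j) i = (?h' \<circ> young_shift ns j) i" if i: "i \<in> {1..ns ! j}" for i
    proof -
      have "(?h \<circ> young_shift ns j) i = order_iso ?S i"
        by (rule order_iso_unique[OF c(2)[OF j, unfolded strict_mono_on_young_block] _ i]) (simp only: image_comp[symmetric] young_shift_image)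
      moreover have "(?h' \<circ> young_shift ns j) i = order_iso ?S' i"
        by (rule order_iso_unique[OF c'(2)[OF j, unfolded strict_mono_on_young_block] _ i]) (simp only: image_comp[symmetric] young_shift_image)
      ultimately show ?thesis using SS by simp
    qed
    ultimately show ?thesis by simp
  next
    case TypeB
    have n: "ns ! j = 2" using j TypeB by simp
    have "?P j = ?P' j" "?h (offset ns j + 1) = ?h' (offset ns j + 1)" "?h (offset ns j + 2) = ?h' (offset ns j + 2)"
      using leq[OF j] by (simp_all add: factor_letter_def TypeB)
    moreover have "bs ! j = zclass [[1,2]]" "bs' ! j = zclass [[1,2]]" using b j TypeB by force+
    moreover have "{1..2::nat} = {1,2}" by auto
    ultimately show ?thesis unfolding n by (simp add: young_shift_def)
  qed
  show "bs = bs'" by (rule nth_equalityI) (use main b in auto)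
  have hh: "?h x = ?h' x" if x: "x \<in> {1..N}" for x
  proof -
    have "x \<in> (\<Union>j<length ns. young_block ns j)" unfolding young_block_union by (rule x)
    then obtain j where j: "j < k" "x \<in> young_block ns j" by auto
    then obtain i where i: "i \<in> {1..ns ! j}" "x = young_shift ns j i" using young_shift_image[of ns j] by blast
    from main[OF j(1)] i(1) have "(?h \<circ> young_shift ns j) i = (?h' \<circ> young_shift ns j) i" by blast
    thus ?thesis using i(2) by simp
  qed
  have im: "fst \<phi> ` {1..N} = fst \<phi>' ` {1..N}"
    unfolding c(3)[symmetric] c'(3)[symmetric] by (rule image_cong[OF refl hh])
  have ff: "fst \<phi> i = fst \<phi>' i" if "i \<in> {1..N}" for i
  proof -
    have "fst \<phi> i = order_iso (fst \<phi> ` {1..N}) i" by (rule order_iso_unique[OF _ refl that]) (use p in blast)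
    moreover have "fst \<phi>' i = order_iso (fst \<phi>' ` {1..N}) i" by (rule order_iso_unique[OF _ refl that]) (use p in blast)
    ultimately show ?thesis using im by simp
  qed
  have f: "fst \<phi> = fst \<phi>'" by (rule PiE_ext[OF FI_homE(1)[OF pF(1)] FI_homE(1)[OF pF(2)] ff])
  show "\<tau> = \<tau>'"
  proof
    fix x
    show "\<tau> x = \<tau>' x"
    proof (cases "x \<in> {1..N}")
      case True
      have "fst \<phi> (\<tau> x) = fst \<phi> (\<tau>' x)" using hh[OF True] f by simp
      thus ?thesis by (rule inj_onD[OF FI_homE(2)[OF pF(1)]]) (use True permutes_in_image[OF tp(1)] permutes_in_image[OF tp(2)] in blast)+
    next
      case False
      thus ?thesis using permutes_not_in[OF tp(1) False] permutes_not_in[OF tp(2) False] by simp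
    qed
  qed
  have "snd \<phi> x = snd \<phi>' x" if x: "x \<in> {1..n'} - fst \<phi> ` {1..N}" for x
  proof -
    have l: "snd \<phi> x < length js" "snd \<phi>' x < length js"
      using PiE_mem[OF FI_homE(4)[OF pF(1)] x] PiE_mem[OF FI_homE(4)[OF pF(2)] x[unfolded im]] by simp_all
    let ?i = "js ! snd \<phi> x"
    have "?i \<le> k" using js_props(3) nth_mem[OF l(1)] by blast
    hence "?P ?i = ?P' ?i" using main Pk by (cases "?i = k") auto
    moreover have "x \<in> ?P ?i" unfolding color_slots_def using x by blast
    ultimately have "x \<in> ?P' ?i" by blast
    hence "js ! snd \<phi>' x = js ! snd \<phi> x" unfolding color_slots_def by blast
    thus ?thesis using nth_eq_iff_index_eq[OF js_props(1) l] by simp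
  qed
  hence "snd \<phi> = snd \<phi>'"
    using FI_homE(4)[OF pF(1)] FI_homE(4)[OF pF(2), folded im] by (intro PiE_ext[of _ _ _ "snd \<phi>'"]) auto
  with f show "\<phi> = \<phi>'" by (rule prod_eqI)
qed

abbreviation "shuffled_basis \<equiv> (\<lambda>(\<tau>,b). hrelabel \<tau> b) ` (shuffle_perms ns \<times> multi_concat ` basis_tuples)"

lemma K_basis:
  "inj_on (\<lambda>(\<phi>,\<tau>,bs). K n' \<phi> \<tau> bs) (ordered_mors n' \<times> shuffle_perms ns \<times> basis_tuples)"
  "hm.independent ((\<lambda>(\<phi>,\<tau>,bs). K n' \<phi> \<tau> bs) ` (ordered_mors n' \<times> shuffle_perms ns \<times> basis_tuples))"
proof -
  note z = adm_word_class_basis[of "{1..n'}" k, OF finite_atLeastAtMost]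
  let ?D = "ordered_mors n' \<times> shuffle_perms ns \<times> basis_tuples"
  show "inj_on (\<lambda>(\<phi>,\<tau>,bs). K n' \<phi> \<tau> bs) ?D"
  proof (rule inj_onI)
    fix x y assume D: "x \<in> ?D" "y \<in> ?D" and e: "(\<lambda>(\<phi>,\<tau>,bs). K n' \<phi> \<tau> bs) x = (\<lambda>(\<phi>,\<tau>,bs). K n' \<phi> \<tau> bs) y"
    obtain \<phi> \<tau> bs \<phi>' \<tau>' bs' where xy: "x = (\<phi>,\<tau>,bs)" "y = (\<phi>',\<tau>',bs')" by (metis prod_cases3)
    have "\<phi> \<in> ordered_mors n'" "\<phi>' \<in> ordered_mors n'" "\<tau> \<in> shuffle_perms ns" "\<tau>' \<in> shuffle_perms ns" "bs \<in> basis_tuples" "bs' \<in> basis_tuples"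
      using D unfolding xy mem_Times_iff fst_conv snd_conv by blast+
    note * = xy this e[unfolded xy prod.case]
    note w = K_word[OF *(3,5,7)] and w' = K_word[OF *(4,6,8)]
    have "case_prod adm_word_class (word n' \<phi> \<tau> bs) = case_prod adm_word_class (word n' \<phi>' \<tau>' bs')"
      using *(9) unfolding w(1) w'(1) .
    from inj_onD[OF z(1) this w(2) w'(2)] have "word n' \<phi> \<tau> bs = word n' \<phi>' \<tau>' bs'" .
    from word_inj[OF *(3-8) this] show "x = y" by (simp only: *(1,2))
  qed
  have "(\<lambda>(\<phi>,\<tau>,bs). K n' \<phi> \<tau> bs) ` ?D \<subseteq> case_prod adm_word_class ` words_on k {1..n'}"
  proof (rule image_subsetI)
    fix x assume "x \<in> ?D"
    then obtain \<phi> \<tau> bs where *: "x = (\<phi>,\<tau>,bs)" "\<phi> \<in> ordered_mors n'" "\<tau> \<in> shuffle_perms ns" "bs \<in> basis_tuples" by blast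
    show "(\<lambda>(\<phi>,\<tau>,bs). K n' \<phi> \<tau> bs) x \<in> case_prod adm_word_class ` words_on k {1..n'}"
      unfolding *(1) prod.case by (rule image_eqI[of _ "case_prod adm_word_class", OF K_word(1)[OF *(2-4)] K_word(2)[OF *(2-4)]])
  qed
  thus "hm.independent ((\<lambda>(\<phi>,\<tau>,bs). K n' \<phi> \<tau> bs) ` ?D)" by (rule hm.independent_mono[OF z(2)])
qed

end

section \<open>Free modules inside homology\<close>

text \<open>Linearity alone does not give this, as the zero of a module record is an independent
  field.\<close>
lemma presented_iso_zero:
  assumes "lin_iso (presented X R) (hsub W) G"
  shows "G \<zero>\<^bsub>presented X R\<^esub> = 0"
proof -
  let ?M = "presented X R"
  have z: "\<zero>\<^bsub>?M\<^esub> \<in> carrier ?M" by (rule opscD(1)[OF ops_closed_presented])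
  have "0 \<odot>\<^bsub>?M\<^esub> \<zero>\<^bsub>?M\<^esub> = \<zero>\<^bsub>?M\<^esub>" by (simp add: presented_simps)
  with lin_isoD(3)[OF assms z, of 0] show ?thesis by simp
qed

definition rep_model :: "(nat \<Rightarrow> nat) set \<Rightarrow> 'v rep \<Rightarrow> hmlg set \<Rightarrow> ('v \<Rightarrow> hmlg) \<Rightarrow> bool" where
  "rep_model Gp U W G \<longleftrightarrow> lin_iso (fst U) (hsub W) G \<and> ops_closed (fst U) \<and> G \<zero>\<^bsub>fst U\<^esub> = 0 \<and>
     (\<forall>\<sigma>\<in>Gp. \<forall>x\<in>carrier (fst U). snd U \<sigma> x \<in> carrier (fst U) \<and> G (snd U \<sigma> x) = hrelabel \<sigma> (G x))"

lemma rep_modelD: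
  assumes "rep_model Gp U W G"
  shows "lin_iso (fst U) (hsub W) G" "ops_closed (fst U)" "G \<zero>\<^bsub>fst U\<^esub> = 0"
    "\<sigma> \<in> Gp \<Longrightarrow> x \<in> carrier (fst U) \<Longrightarrow> snd U \<sigma> x \<in> carrier (fst U)"
    "\<sigma> \<in> Gp \<Longrightarrow> x \<in> carrier (fst U) \<Longrightarrow> G (snd U \<sigma> x) = hrelabel \<sigma> (G x)"
  using assms by (auto simp: rep_model_def)

lemma rep_model_hsub:
  assumes "hm.subspace W" "\<And>\<sigma>. \<sigma> \<in> Gp \<Longrightarrow> hrelabel \<sigma> ` W \<subseteq> W"
  shows "rep_model Gp (hsub W, hrelabel) W (\<lambda>x. x)"
proof -
  have "ops_closed (hsub W)" by (rule ops_closed_module[OF module_hsub[OF assms(1)]])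
  moreover have "lin_iso (hsub W) (hsub W) (\<lambda>x. x)"
    by (rule lin_isoI) (simp_all add: hsub_def bij_betw_def)
  ultimately show ?thesis unfolding rep_model_def using assms(2) by (auto simp: hsub_def)
qed

lemma rep_model_rep_iso:
  assumes "rep_model {\<sigma>. \<sigma> permutes {1..n}} U W G" "hm.subspace W" "W \<subseteq> H k {1..n}"
  shows "rep_iso n (hsub W, hrelabel) U"
proof -
  note r = rep_modelD[OF assms(1)]
  have st: "hrelabel \<sigma> ` W \<subseteq> W" if "\<sigma> permutes {1..n}" for \<sigma>
  proof (rule image_subsetI)
    fix w assume "w \<in> W"
    then obtain x where x: "x \<in> carrier (fst U)" "G x = w" using lin_isoD(6)[OF r(1)] by blast
    have "hrelabel \<sigma> w = G (snd U \<sigma> x)" using r(5)[of \<sigma> x] x that by simp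
    thus "hrelabel \<sigma> w \<in> W" using lin_isoD(1)[OF r(1) r(4)[of \<sigma> x]] x that by simp
  qed
  have "rep_iso n (hsub W, hrelabel) (fst U, snd U)"
    by (rule rep_iso_transport[OF assms(2,3) st r(1-3)]) (use r(4,5) in auto)
  thus ?thesis by simp
qed

lemma triv_rep_model:
  "\<exists>G. rep_model {\<sigma>. \<sigma> permutes {1..2}} triv_rep (hm.span {zclass [[1,2]]}) G"
proof -
  let ?z = "zclass [[1,2]]"
  interpret P: presentation "{[]}" "{}" "\<lambda>_. ?z" "{[]}"
    by unfold_locales (use zclass_two(4) hm.independent_insert[of ?z "{}"] in \<open>auto intro!: fvec.span_base\<close>)
  have fix_sp: "hrelabel \<sigma> w = w" if "\<sigma> permutes {1..2}" "w \<in> hm.span {?z}" for \<sigma> w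
    using that(2)
  proof (induction rule: hm.span_induct_alt)
    case base
    show ?case by (rule hlinear_zero[OF hlinear_hrelabel])
  next
    case (step q x y)
    thus ?case using zclass_two_perm[OF that(1)] by (simp add: hrelabel_add hrelabel_scale)
  qed
  have im: "(\<lambda>_. ?z) ` {[]} = {?z}" by simp
  have iso: "lin_iso (presented {[]} {}) (hsub (hm.span {?z})) P.quot_map" using P.quot_map_iso unfolding im .
  have "P.quot_map x = hrelabel \<sigma> (P.quot_map x)" if "\<sigma> permutes {1..2}" "x \<in> carrier (presented {[]} {})" for \<sigma> x
    using fix_sp[OF that(1) lin_isoD(1)[OF iso that(2)]] by (rule sym)
  hence "rep_model {\<sigma>. \<sigma> permutes {1..2}} triv_rep (hm.span {?z}) P.quot_map"
    unfolding rep_model_def triv_rep_def fst_conv snd_conv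
    using iso ops_closed_presented P.quot_map_zero by (intro conjI ballI) simp_all
  thus ?thesis by blast
qed

text \<open>The maps \<open>\<phi> \<otimes> u \<mapsto> FI_act \<phi> (G u)\<close> identify
  \<open>M(U)\<close> with the submodule generated by the copy of \<open>U\<close>, provided that
  order-preserving morphisms applied to a basis give independent classes.\<close>
lemma MFI_model:
  fixes U :: "'v rep" and \<beta> :: "hmlg set"
  assumes js: "\<forall>j\<in>set js. j \<le> k" and U: "rep_model {\<sigma>. \<sigma> permutes {1..m}} U (hm.span \<beta>) G" and \<beta>: "\<beta> \<subseteq> H k {1..m}"
    and ind: "\<And>n. inj_on (\<lambda>(\<phi>,b). FI_act js m n \<phi> b) ({\<phi> \<in> FI_hom (length js) m n. strict_mono_on {1..m} (fst \<phi>)} \<times> \<beta>)"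
      "\<And>n. hm.independent ((\<lambda>(\<phi>,b). FI_act js m n \<phi> b) ` ({\<phi> \<in> FI_hom (length js) m n. strict_mono_on {1..m} (fst \<phi>)} \<times> \<beta>))"
  shows "\<exists>T. (\<forall>n. lin_iso (fst (MFI (length js) m U) n) (hsub (FI_span js m (hm.span \<beta>) n)) (T n) \<and>
      ops_closed (fst (MFI (length js) m U) n) \<and> T n \<zero>\<^bsub>fst (MFI (length js) m U) n\<^esub> = 0) \<and>
      (\<forall>n n'. \<forall>\<phi>\<in>FI_hom (length js) n n'. \<forall>x\<in>carrier (fst (MFI (length js) m U) n).
        snd (MFI (length js) m U) n n' \<phi> x \<in> carrier (fst (MFI (length js) m U) n') \<and>
        T n' (snd (MFI (length js) m U) n n' \<phi> x) = FI_act js n n' \<phi> (T n x))"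
proof -
  let ?d = "length js" and ?V = "hm.span \<beta>"
  note r = rep_modelD[OF U]
  have V: "?V \<subseteq> H k {1..m}" by (rule hm.span_minimal[OF \<beta> H_subspace])
  have GH: "G u \<in> H k {1..m}" if "u \<in> carrier (fst U)" for u using lin_isoD(1)[OF r(1) that] V by blast
  let ?X = "\<lambda>n. FI_hom ?d m n \<times> carrier (fst U)" and ?f = "\<lambda>n (\<phi>,u). FI_act js m n \<phi> (G u)"
  let ?N = "\<lambda>n. (\<lambda>(x,b). (x, inv_into (carrier (fst U)) G b)) ` ({\<phi> \<in> FI_hom ?d m n. strict_mono_on {1..m} (fst \<phi>)} \<times> \<beta>)"
  have bal: "FI_act js m n (FI_comp m m n \<phi> (perm_mor m h)) (G v) = FI_act js m n \<phi> (G (snd U h v))"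
    if "\<phi> \<in> FI_hom ?d m n" "h \<in> {\<sigma>. \<sigma> permutes {1..m}}" "v \<in> carrier (fst U)" for n \<phi> h v
  proof -
    have h: "h permutes {1..m}" using that(2) by simp
    have "FI_act js m n (FI_comp m m n \<phi> (perm_mor m h)) (G v) = FI_act js m n \<phi> (FI_act js m m (perm_mor m h) (G v))"
      by (rule FI_act_comp[OF that(1) perm_mor_hom[OF h] js GH[OF that(3)]])
    thus ?thesis unfolding FI_act_perm[OF h GH[OF that(3)]] r(5)[OF that(2,3)] .
  qed
  have cl: "FI_comp m m n \<phi> (perm_mor m h) \<in> FI_hom ?d m n" if "\<phi> \<in> FI_hom ?d m n" "h \<in> {\<sigma>. \<sigma> permutes {1..m}}" for n \<phi> h
    by (rule FI_comp_closed[OF that(1) perm_mor_hom]) (use that(2) in simp)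
  note B = bal_presentation[where ev = "FI_act js m n" and X = "FI_hom ?d m n" and Gp = "{\<sigma>. \<sigma> permutes {1..m}}"
    and act = "\<lambda>\<phi> \<sigma>. FI_comp m m n \<phi> (perm_mor m \<sigma>)" and ordered_mors = "{\<phi> \<in> FI_hom ?d m n. strict_mono_on {1..m} (fst \<phi>)}" for n,
    OF r(1-3) FI_act_linear cl r(4) bal _ FI_order_factor ind, folded MFI_rels_def]
  have pres: "presentation (?X n) (MFI_rels ?d m U n) (?f n) (?N n)" for n
    by (rule B(1)) auto
  have im: "?f n ` ?X n = {FI_act js m n \<phi> w | \<phi> w. \<phi> \<in> FI_hom ?d m n \<and> w \<in> ?V}" for n
    by (rule B(2)) auto
  have sing_pieces: "hm.span (?f n ` ?X n) = FI_span js m ?V n" for n unfolding im FI_span_def ..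
  let ?T = "\<lambda>n. presentation.quot_map (?X n) (MFI_rels ?d m U n) (?f n)"
  have ind: "snd (MFI ?d m U) n n' \<phi> x \<in> carrier (fst (MFI ?d m U) n') \<and>
        ?T n' (snd (MFI ?d m U) n n' \<phi> x) = FI_act js n n' \<phi> (?T n x)"
    if p: "\<phi> \<in> FI_hom ?d n n'" and x: "x \<in> carrier (fst (MFI ?d m U) n)" for n n' \<phi> x
  proof -
    have c: "(\<lambda>(\<psi>,u). (FI_comp m n n' \<phi> \<psi>, u)) y \<in> ?X n'" if "y \<in> ?X n" for y
      using that FI_comp_closed[OF p] by auto
    have e: "?f n' ((\<lambda>(\<psi>,u). (FI_comp m n n' \<phi> \<psi>, u)) y) = FI_act js n n' \<phi> (?f n y)" if y: "y \<in> ?X n" for y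
    proof -
      obtain \<psi> u where yy: "y = (\<psi>,u)" "\<psi> \<in> FI_hom ?d m n" "u \<in> carrier (fst U)" using y by blast
      show ?thesis unfolding yy(1) prod.case by (rule FI_act_comp[OF p yy(2) js GH[OF yy(3)]])
    qed
    have x': "x \<in> carrier (presented (?X n) (MFI_rels ?d m U n))" using x by (simp add: MFI_def)
    from presentation.induced[OF pres pres c e FI_act_linear x'] show ?thesis by (simp add: MFI_def)
  qed
  have f: "fst (MFI ?d m U) n = presented (?X n) (MFI_rels ?d m U n)" for n by (simp add: MFI_def)
  show ?thesis
  proof (intro exI[of _ ?T] conjI allI ballI)
    fix n
    show "lin_iso (fst (MFI ?d m U) n) (hsub (FI_span js m ?V n)) (?T n)"
      unfolding f using presentation.quot_map_iso[OF pres] unfolding sing_pieces .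
    show "ops_closed (fst (MFI ?d m U) n)" unfolding f by (rule ops_closed_presented)
    show "?T n \<zero>\<^bsub>fst (MFI ?d m U) n\<^esub> = 0" unfolding f by (rule presentation.quot_map_zero[OF pres])
  next
    fix n n' \<phi> x assume "\<phi> \<in> FI_hom ?d n n'" "x \<in> carrier (fst (MFI ?d m U) n)"
    from ind[OF this] show "snd (MFI ?d m U) n n' \<phi> x \<in> carrier (fst (MFI ?d m U) n')"
      "?T n' (snd (MFI ?d m U) n n' \<phi> x) = FI_act js n n' \<phi> (?T n x)" by blast+
  qed
qed

lemma MFI_iso:
  fixes U :: "'v rep" and \<beta> :: "hmlg set"
  assumes js: "\<forall>j\<in>set js. j \<le> k" and U: "rep_model {\<sigma>. \<sigma> permutes {1..m}} U (hm.span \<beta>) G" and \<beta>: "\<beta> \<subseteq> H k {1..m}"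
    and ind: "\<And>n. inj_on (\<lambda>(\<phi>,b). FI_act js m n \<phi> b) ({\<phi> \<in> FI_hom (length js) m n. strict_mono_on {1..m} (fst \<phi>)} \<times> \<beta>)"
      "\<And>n. hm.independent ((\<lambda>(\<phi>,b). FI_act js m n \<phi> b) ` ({\<phi> \<in> FI_hom (length js) m n. strict_mono_on {1..m} (fst \<phi>)} \<times> \<beta>))"
  shows "FI_iso (length js) (\<lambda>n. hsub (FI_span js m (hm.span \<beta>) n), FI_act js) (MFI (length js) m U)"
proof -
  let ?d = "length js" and ?V = "hm.span \<beta>"
  have V: "?V \<subseteq> H k {1..m}" by (rule hm.span_minimal[OF \<beta> H_subspace])
  obtain T where T: "\<And>n. lin_iso (fst (MFI ?d m U) n) (hsub (FI_span js m ?V n)) (T n)" "\<And>n. ops_closed (fst (MFI ?d m U) n)"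
    "\<And>n. T n \<zero>\<^bsub>fst (MFI ?d m U) n\<^esub> = 0"
    "\<And>n n' \<phi> x. \<phi> \<in> FI_hom ?d n n' \<Longrightarrow> x \<in> carrier (fst (MFI ?d m U) n) \<Longrightarrow> snd (MFI ?d m U) n n' \<phi> x \<in> carrier (fst (MFI ?d m U) n')"
    "\<And>n n' \<phi> x. \<phi> \<in> FI_hom ?d n n' \<Longrightarrow> x \<in> carrier (fst (MFI ?d m U) n) \<Longrightarrow> T n' (snd (MFI ?d m U) n n' \<phi> x) = FI_act js n n' \<phi> (T n x)"
    using MFI_model[OF js U \<beta> ind] by blast
  have M: "FI_module ?d (\<lambda>n. hsub (FI_span js m ?V n), FI_act js)"
    by (rule FI_module_hsub[OF js FI_span_subspace FI_span_H[OF js V] FI_span_closed[OF js V]])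
  have "FI_iso ?d (\<lambda>n. hsub (FI_span js m ?V n), FI_act js) (fst (MFI ?d m U), snd (MFI ?d m U))"
    by (rule FI_iso_transport[OF M FI_span_subspace T(1-3)]) (use T(4,5) in auto)
  thus ?thesis by simp
qed

text \<open>Freeness asks for a direct sum over all degrees; the summands in the degrees other
  than \<open>N\<close> are taken to be zero, so that a family in the sum is determined by its
  component at \<open>N\<close>.\<close>
lemma MFI_free:
  fixes \<beta> :: "hmlg set"
  assumes js: "\<forall>j\<in>set js. j \<le> k" and \<beta>: "\<beta> \<subseteq> H k {1..N}"
    and st: "\<And>\<sigma>. \<sigma> permutes {1..N} \<Longrightarrow> hrelabel \<sigma> ` hm.span \<beta> \<subseteq> hm.span \<beta>"
    and ind: "\<And>n. inj_on (\<lambda>(\<phi>,b). FI_act js N n \<phi> b) ({\<phi> \<in> FI_hom (length js) N n. strict_mono_on {1..N} (fst \<phi>)} \<times> \<beta>)"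
      "\<And>n. hm.independent ((\<lambda>(\<phi>,b). FI_act js N n \<phi> b) ` ({\<phi> \<in> FI_hom (length js) N n. strict_mono_on {1..N} (fst \<phi>)} \<times> \<beta>))"
  shows "FI_free (length js) (\<lambda>n. hsub (FI_span js N (hm.span \<beta>) n), FI_act js)"
proof -
  let ?d = "length js" and ?V = "hm.span \<beta>"
  define bt where "bt m = (if m = N then \<beta> else {})" for m
  define U where "U m = (hsub (hm.span (bt m)), hrelabel)" for m :: nat
  have bH: "bt m \<subseteq> H k {1..m}" for m using \<beta> by (simp add: bt_def)
  have VH: "hm.span (bt m) \<subseteq> H k {1..m}" for m by (rule hm.span_minimal[OF bH H_subspace])
  have sb: "hrelabel \<sigma> ` hm.span (bt m) \<subseteq> hm.span (bt m)" if "\<sigma> permutes {1..m}" for \<sigma> m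
    using st that by (cases "m = N") (simp_all add: bt_def hlinear_zero[OF hlinear_hrelabel])
  have Um: "rep_model {\<sigma>. \<sigma> permutes {1..m}} (U m) (hm.span (bt m)) (\<lambda>x. x)" for m
    unfolding U_def by (rule rep_model_hsub[OF hm.subspace_span]) (use sb in blast)
  have i1: "inj_on (\<lambda>(\<phi>,b). FI_act js m n \<phi> b) ({\<phi> \<in> FI_hom ?d m n. strict_mono_on {1..m} (fst \<phi>)} \<times> bt m)" for m n
    using ind(1)[of n] by (cases "m = N") (simp_all add: bt_def)
  have i2: "hm.independent ((\<lambda>(\<phi>,b). FI_act js m n \<phi> b) ` ({\<phi> \<in> FI_hom ?d m n. strict_mono_on {1..m} (fst \<phi>)} \<times> bt m))" for m n
    using ind(2)[of n] by (cases "m = N") (simp_all add: bt_def hm.independent_empty)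
  let ?M = "\<lambda>m. MFI ?d m (U m)"
  let ?good = "\<lambda>m T. (\<forall>n. lin_iso (fst (?M m) n) (hsub (FI_span js m (hm.span (bt m)) n)) (T n) \<and>
      ops_closed (fst (?M m) n) \<and> T n \<zero>\<^bsub>fst (?M m) n\<^esub> = 0) \<and>
      (\<forall>n n'. \<forall>\<phi>\<in>FI_hom ?d n n'. \<forall>x\<in>carrier (fst (?M m) n).
        snd (?M m) n n' \<phi> x \<in> carrier (fst (?M m) n') \<and> T n' (snd (?M m) n n' \<phi> x) = FI_act js n n' \<phi> (T n x))"
  have "\<exists>T. ?good m T" for m by (rule MFI_model[OF js Um bH i1 i2])
  then obtain TT where "\<And>m. ?good m (TT m)" by metis
  hence T: "\<And>m n. lin_iso (fst (?M m) n) (hsub (FI_span js m (hm.span (bt m)) n)) (TT m n)" "\<And>m n. ops_closed (fst (?M m) n)"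
    "\<And>m n. TT m n \<zero>\<^bsub>fst (?M m) n\<^esub> = 0"
    "\<And>m n n' \<phi> x. \<phi> \<in> FI_hom ?d n n' \<Longrightarrow> x \<in> carrier (fst (?M m) n) \<Longrightarrow> snd (?M m) n n' \<phi> x \<in> carrier (fst (?M m) n')"
    "\<And>m n n' \<phi> x. \<phi> \<in> FI_hom ?d n n' \<Longrightarrow> x \<in> carrier (fst (?M m) n) \<Longrightarrow> TT m n' (snd (?M m) n n' \<phi> x) = FI_act js n n' \<phi> (TT m n x)"
    by blast+
  have zero: "x = \<zero>\<^bsub>fst (?M m) n\<^esub>" if m: "m \<noteq> N" and x: "x \<in> carrier (fst (?M m) n)" for m n x
  proof -
    have "FI_span js m (hm.span (bt m)) n \<subseteq> {0}"
      unfolding FI_span_def using m by (intro hm.span_minimal) (auto simp: bt_def hlinear_zero[OF FI_act_linear] hm.subspace_single_0)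
    hence "TT m n x = 0" using lin_isoD(1)[OF T(1) x] by blast
    hence "TT m n x = TT m n \<zero>\<^bsub>fst (?M m) n\<^esub>" using T(3) by simp
    from inj_onD[OF lin_isoD(5)[OF T(1)] this x opscD(1)[OF T(2)]] show ?thesis .
  qed
  let ?D = "FI_direct_sum ?M"
  have car: "x \<in> carrier (fst ?D n) \<longleftrightarrow> (\<forall>m. x m \<in> carrier (fst (?M m) n))" for x n
  proof -
    have "finite {m. x m \<noteq> \<zero>\<^bsub>fst (?M m) n\<^esub>}" if "\<forall>m. x m \<in> carrier (fst (?M m) n)"
    proof (rule finite_subset[of _ "{N}"])
      show "{m. x m \<noteq> \<zero>\<^bsub>fst (?M m) n\<^esub>} \<subseteq> {N}" using that zero by blast
    qed simp
    thus ?thesis unfolding FI_direct_sum_def by auto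
  qed
  have ops: "(x \<oplus>\<^bsub>fst ?D n\<^esub> y) m = x m \<oplus>\<^bsub>fst (?M m) n\<^esub> y m" "(q \<odot>\<^bsub>fst ?D n\<^esub> x) m = q \<odot>\<^bsub>fst (?M m) n\<^esub> x m"
    "\<zero>\<^bsub>fst ?D n\<^esub> m = \<zero>\<^bsub>fst (?M m) n\<^esub>" "snd ?D n n' \<phi> x m = snd (?M m) n n' \<phi> (x m)" for x y q m n n' \<phi>
    by (simp_all add: FI_direct_sum_def)
  have bN: "bt N = \<beta>" by (simp add: bt_def)
  note TN = T(1)[of N, unfolded bN]
  define TD where "TD n x = TT N n (x N)" for n x
  have iso: "lin_iso (fst ?D n) (hsub (FI_span js N ?V n)) (TD n)" for n
  proof (rule lin_isoI)
    show "TD n (x \<oplus>\<^bsub>fst ?D n\<^esub> y) = TD n x + TD n y" if "x \<in> carrier (fst ?D n)" "y \<in> carrier (fst ?D n)" for x y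
      using that lin_isoD(2)[OF T(1)[of N n]] unfolding TD_def car ops by blast
    show "TD n (q \<odot>\<^bsub>fst ?D n\<^esub> x) = hscale q (TD n x)" if "x \<in> carrier (fst ?D n)" for q x
      using that lin_isoD(3)[OF T(1)[of N n]] unfolding TD_def car ops by blast
    have "inj_on (TD n) (carrier (fst ?D n))"
    proof (rule inj_onI)
      fix x y assume x: "x \<in> carrier (fst ?D n)" and y: "y \<in> carrier (fst ?D n)" and e: "TD n x = TD n y"
      have xm: "x m \<in> carrier (fst (?M m) n)" and ym: "y m \<in> carrier (fst (?M m) n)" for m using x y unfolding car by blast+
      show "x = y"
      proof
        fix m
        show "x m = y m"
        proof (cases "m = N")
          case True
          show ?thesis unfolding True
            by (rule inj_onD[OF lin_isoD(5)[OF T(1)[of N n]] _ xm ym]) (use e in \<open>simp only: TD_def\<close>)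
        next
          case False
          show ?thesis unfolding zero[OF False xm] zero[OF False ym] ..
        qed
      qed
    qed
    moreover have "TD n ` carrier (fst ?D n) = FI_span js N ?V n"
    proof (intro equalityI subsetI)
      fix w assume "w \<in> TD n ` carrier (fst ?D n)"
      then obtain x where x: "x \<in> carrier (fst ?D n)" "w = TT N n (x N)" unfolding TD_def by blast
      from x(1) have "x N \<in> carrier (fst (?M N) n)" unfolding car by blast
      thus "w \<in> FI_span js N ?V n" unfolding x(2) by (rule lin_isoD(1)[OF TN[of n]])
    next
      fix w assume "w \<in> FI_span js N ?V n"
      from lin_isoD(6)[OF TN[of n] this] obtain x where x: "x \<in> carrier (fst (?M N) n)" "TT N n x = w" by blast
      define y where "y m = (if m = N then x else \<zero>\<^bsub>fst (?M m) n\<^esub>)" for m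
      have "y \<in> carrier (fst ?D n)" unfolding car y_def using x(1) opscD(1)[OF T(2)] by simp
      moreover have "TD n y = w" by (simp add: TD_def y_def x(2))
      ultimately show "w \<in> TD n ` carrier (fst ?D n)" by blast
    qed
    ultimately show "bij_betw (TD n) (carrier (fst ?D n)) (FI_span js N ?V n)" by (simp add: bij_betw_def)
  qed
  have op: "ops_closed (fst ?D n)" for n
    unfolding ops_closed_def car ops
  proof (intro conjI allI ballI)
    show "\<zero>\<^bsub>fst (?M m) n\<^esub> \<in> carrier (fst (?M m) n)" for m by (rule opscD(1)[OF T(2)])
    show "x m \<oplus>\<^bsub>fst (?M m) n\<^esub> y m \<in> carrier (fst (?M m) n)"
      if "x \<in> carrier (fst ?D n)" "y \<in> carrier (fst ?D n)" for x y m
      by (rule opscD(2)[OF T(2)]) (use that in \<open>unfold car, blast+\<close>)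
    show "q \<odot>\<^bsub>fst (?M m) n\<^esub> x m \<in> carrier (fst (?M m) n)" if "x \<in> carrier (fst ?D n)" for x m q
      by (rule opscD(3)[OF T(2)]) (use that in \<open>unfold car, blast\<close>)
  qed
  have z: "TD n \<zero>\<^bsub>fst ?D n\<^esub> = 0" for n unfolding TD_def ops by (rule T(3))
  have VN: "?V \<subseteq> H k {1..N}" using VH[of N] unfolding bN .
  have M: "FI_module ?d (\<lambda>n. hsub (FI_span js N ?V n), FI_act js)"
    by (rule FI_module_hsub[OF js FI_span_subspace FI_span_H[OF js VN] FI_span_closed[OF js VN]])
  have "FI_iso ?d (\<lambda>n. hsub (FI_span js N ?V n), FI_act js) (fst ?D, snd ?D)"
  proof (rule FI_iso_transport[where W = "FI_span js N ?V" and T = TD and P = "fst ?D" and am = "FI_act js" and act = "snd ?D"])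
    show "FI_module ?d (\<lambda>n. hsub (FI_span js N ?V n), FI_act js)" by (rule M)
    show "hm.subspace (FI_span js N ?V n)" "lin_iso (fst ?D n) (hsub (FI_span js N ?V n)) (TD n)" "ops_closed (fst ?D n)"
      "TD n \<zero>\<^bsub>fst ?D n\<^esub> = 0" for n by (rule FI_span_subspace iso op z)+
  next
    fix n n' \<phi> x assume p: "\<phi> \<in> FI_hom ?d n n'" and x: "x \<in> carrier (fst ?D n)"
    show "snd ?D n n' \<phi> x \<in> carrier (fst ?D n')" using T(4)[OF p] x unfolding car ops by blast
    show "TD n' (snd ?D n n' \<phi> x) = FI_act js n n' \<phi> (TD n x)" using T(5)[OF p] x unfolding TD_def car ops by blast
  qed
  moreover have "is_rep m (U m)" for m unfolding U_def by (rule is_rep_hsub[OF hm.subspace_span VH sb])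
  ultimately show ?thesis unfolding FI_free_def by (intro exI[of _ U]) simp
qed

section \<open>The span of the concatenation products\<close>

context admissible_family
begin

text \<open>For \<open>A'\<close> this is the isomorphism with \<open>\<Lambda>\<^sup>2
  Std\<close> required of an admissible family, for \<open>B\<^sub>2\<close> the symmetry of
  \<open>z(1 2)\<close>.\<close>
lemma ctype_model:
  assumes "\<And>m. C = TypeA m \<Longrightarrow> 1 \<le> m"
  shows "\<exists>G. rep_model {\<sigma>. \<sigma> permutes {1..ctype_deg C}} (ctype_rep C) (hm.span (ctype_set A' C)) G"
proof (cases C)
  case (TypeA m)
  have m: "1 \<le> m" by (rule assms[OF TypeA])
  let ?M = "ext_square (std_rep (m + 2))"
  have ri: "rep_iso (m + 2) (hsub (A_span m), hrelabel) ?M" by (rule A'_props(5)[OF m])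
  then obtain T where T: "lin_iso (hsub (A_span m)) (fst ?M) T"
    "\<And>\<sigma> x. \<sigma> permutes {1..m+2} \<Longrightarrow> x \<in> A_span m \<Longrightarrow> T (hrelabel \<sigma> x) = snd ?M \<sigma> (T x)"
    unfolding rep_iso_def by (auto simp: hsub_def)
  have "is_rep (m + 2) ?M" using ri by (simp add: rep_iso_def)
  hence lm: "lin_map (fst ?M) (fst ?M) (snd ?M \<sigma>)" if "\<sigma> permutes {1..m+2}" for \<sigma>
    using that by (simp only: is_rep_def)
  have oV: "ops_closed (hsub (A_span m))" unfolding A_span_def by (rule ops_closed_module[OF module_hsub[OF hm.subspace_span]])
  have oM: "ops_closed (fst ?M)" unfolding ext_square_def fst_conv by (rule ops_closed_presented)
  let ?G = "inv_into (carrier (hsub (A_span m))) T"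
  have G: "lin_iso (fst ?M) (hsub (A_span m)) ?G" by (rule lin_iso_inverse[OF T(1) oV])
  have z: "?G \<zero>\<^bsub>fst ?M\<^esub> = 0"
    using G unfolding ext_square_def fst_conv by (rule presented_iso_zero)
  have b: "bij_betw T (A_span m) (carrier (fst ?M))" using T(1) by (simp add: lin_iso_def hsub_def)
  have cV: "carrier (hsub (A_span m)) = A_span m" by (simp add: hsub_def)
  have "snd ?M \<sigma> x \<in> carrier (fst ?M) \<and> ?G (snd ?M \<sigma> x) = hrelabel \<sigma> (?G x)"
    if s: "\<sigma> permutes {1..m+2}" and x: "x \<in> carrier (fst ?M)" for \<sigma> x
  proof
    show "snd ?M \<sigma> x \<in> carrier (fst ?M)" using lm[OF s] x by (auto simp: lin_map_def)
    have v: "?G x \<in> A_span m" by (rule lin_isoD(1)[OF G x])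
    have Tv: "T (?G x) = x" unfolding cV by (rule bij_betw_inv_into_right[OF b x])
    have "snd ?M \<sigma> x = T (hrelabel \<sigma> (?G x))" unfolding T(2)[OF s v] Tv ..
    moreover have "hrelabel \<sigma> (?G x) \<in> A_span m" by (rule A_span_stable[OF m s v])
    ultimately show "?G (snd ?M \<sigma> x) = hrelabel \<sigma> (?G x)" using bij_betw_inv_into_left[OF b] unfolding cV by simp
  qed
  hence "rep_model {\<sigma>. \<sigma> permutes {1..m+2}} ?M (A_span m) ?G"
    unfolding rep_model_def using G oM z by (intro conjI ballI) simp_all
  moreover have "hm.span (ctype_set A' C) = A_span m" by (simp add: TypeA A_span_def)
  ultimately show ?thesis using TypeA by (intro exI[of _ ?G]) simp
next
  case TypeB
  show ?thesis unfolding TypeB ctype_deg.simps ctype_rep.simps ctype_set.simps by (rule triv_rep_model)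
qed

end

lemma inj_on_pair_image:
  assumes "inj_on (\<lambda>(x,c). F x (Q c)) (X \<times> C)"
  shows "inj_on (\<lambda>(x,b). F x b) (X \<times> Q ` C)"
    "(\<lambda>(x,b). F x b) ` (X \<times> Q ` C) = (\<lambda>(x,c). F x (Q c)) ` (X \<times> C)"
proof -
  show "inj_on (\<lambda>(x,b). F x b) (X \<times> Q ` C)"
  proof (rule inj_onI)
    fix y z assume D: "y \<in> X \<times> Q ` C" "z \<in> X \<times> Q ` C" and e: "(\<lambda>(x,b). F x b) y = (\<lambda>(x,b). F x b) z"
    then obtain x c x' c' where *: "y = (x, Q c)" "z = (x', Q c')" "(x,c) \<in> X \<times> C" "(x',c') \<in> X \<times> C" by auto
    have "(x,c) = (x',c')" by (rule inj_onD[OF assms _ *(3,4)]) (use e * in simp)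
    thus "y = z" by (simp add: *)
  qed
qed force

context product_family
begin

lemma span_ctype_H: "j < k \<Longrightarrow> hm.span (ctype_set A' (Cs ! j)) \<subseteq> H 1 {1..ns ! j}"
  by (rule hm.span_minimal[OF ctype_set_H H_subspace])

lemma id_shuffle_perms: "id \<in> shuffle_perms ns"
  by (simp add: shuffle_perms_def permutes_id strict_mono_on_def)

lemma id_ordered_mors: "perm_mor N id \<in> ordered_mors N"
  using perm_mor_hom[OF permutes_id, of N "length js"] by (simp add: perm_mor_def strict_mono_on_def)

text \<open>The special case of the identity morphism, which inserts nothing.\<close>
lemma hrelabel_basis:
  "inj_on (\<lambda>(\<tau>,b). hrelabel \<tau> b) (shuffle_perms ns \<times> multi_concat ` basis_tuples)" "hm.independent shuffled_basis"
proof -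
  let ?D = "shuffle_perms ns \<times> basis_tuples"
  have e: "K N (perm_mor N id) \<tau> bs = hrelabel \<tau> (multi_concat bs)" if "\<tau> \<in> shuffle_perms ns" "bs \<in> basis_tuples" for \<tau> bs
  proof -
    have t: "\<tau> permutes {1..N}" using that(1) by (simp add: shuffle_perms_def)
    have mH: "multi_concat bs \<in> H k {1..N}" by (rule multi_concat_H[OF basis_tuples_H[OF that(2)]])
    have "hrelabel \<tau> (multi_concat bs) \<in> H k (\<tau> ` {1..N})" by (rule H_hrelabel[OF mH permutes_inj_on[OF t]])
    hence h: "hrelabel \<tau> (multi_concat bs) \<in> H k {1..N}" unfolding permutes_image[OF t] .
    show ?thesis unfolding FI_act_perm[OF permutes_id h] by (rule hrelabel_id[OF h]) simp
  qed
  have i: "inj_on (\<lambda>(\<tau>,bs). hrelabel \<tau> (multi_concat bs)) ?D"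
  proof (rule inj_onI)
    fix x y assume D: "x \<in> ?D" "y \<in> ?D" and q: "(\<lambda>(\<tau>,bs). hrelabel \<tau> (multi_concat bs)) x = (\<lambda>(\<tau>,bs). hrelabel \<tau> (multi_concat bs)) y"
    obtain \<tau> bs \<tau>' bs' where xy: "x = (\<tau>,bs)" "y = (\<tau>',bs')" by (metis surj_pair)
    have m: "\<tau> \<in> shuffle_perms ns" "\<tau>' \<in> shuffle_perms ns" "bs \<in> basis_tuples" "bs' \<in> basis_tuples"
      using D unfolding xy mem_Times_iff fst_conv snd_conv by blast+
    have "K N (perm_mor N id) \<tau> bs = K N (perm_mor N id) \<tau>' bs'"
      unfolding e[OF m(1,3)] e[OF m(2,4)] using q unfolding xy prod.case .
    hence "(perm_mor N id, \<tau>, bs) = (perm_mor N id, \<tau>', bs')"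
      by (intro inj_onD[OF K_basis(1)[of N]]) (use m id_ordered_mors in \<open>simp_all only: prod.case mem_Times_iff fst_conv snd_conv simp_thms\<close>)
    thus "x = y" by (simp add: xy)
  qed
  note p = inj_on_pair_image[of hrelabel multi_concat "shuffle_perms ns" basis_tuples, OF i]
  show "inj_on (\<lambda>(\<tau>,b). hrelabel \<tau> b) (shuffle_perms ns \<times> multi_concat ` basis_tuples)" by (rule p(1))
  have "(\<lambda>(\<tau>,bs). hrelabel \<tau> (multi_concat bs)) ` ?D \<subseteq> (\<lambda>(\<phi>,\<tau>,bs). K N \<phi> \<tau> bs) ` (ordered_mors N \<times> shuffle_perms ns \<times> basis_tuples)"
  proof (rule image_subsetI)
    fix x assume D: "x \<in> ?D"
    obtain \<tau> bs where x: "x = (\<tau>,bs)" by (cases x)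
    have m: "\<tau> \<in> shuffle_perms ns" "bs \<in> basis_tuples" using D unfolding x mem_Times_iff fst_conv snd_conv by blast+
    show "(\<lambda>(\<tau>,bs). hrelabel \<tau> (multi_concat bs)) x \<in> (\<lambda>(\<phi>,\<tau>,bs). K N \<phi> \<tau> bs) ` (ordered_mors N \<times> shuffle_perms ns \<times> basis_tuples)"
      by (rule image_eqI[of _ _ "(perm_mor N id, \<tau>, bs)"])
        (use m id_ordered_mors e[OF m] in \<open>simp_all only: x prod.case mem_Times_iff fst_conv snd_conv simp_thms\<close>)
  qed
  from hm.independent_mono[OF K_basis(2)[of N] this] show "hm.independent shuffled_basis" unfolding p(2) .
qed

lemma multi_concat_basis: "inj_on multi_concat basis_tuples" "hm.independent (multi_concat ` basis_tuples)"
proof -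
  have e: "hrelabel id (multi_concat bs) = multi_concat bs" if "bs \<in> basis_tuples" for bs
    by (rule hrelabel_id[OF multi_concat_H[OF basis_tuples_H[OF that]]]) simp_all
  show "hm.independent (multi_concat ` basis_tuples)"
  proof (rule hm.independent_mono[OF hrelabel_basis(2)], rule image_subsetI)
    fix bs assume b: "bs \<in> basis_tuples"
    show "multi_concat bs \<in> shuffled_basis"
      by (rule image_eqI[of _ _ "(id, multi_concat bs)"])
        (use id_shuffle_perms imageI[OF b, of multi_concat] e[OF b] in \<open>simp_all only: prod.case mem_Times_iff fst_conv snd_conv simp_thms\<close>)
  qed
  show "inj_on multi_concat basis_tuples"
  proof (rule inj_onI)
    fix bs bs' assume b: "bs \<in> basis_tuples" "bs' \<in> basis_tuples" and m: "multi_concat bs = multi_concat bs'"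
    have "(perm_mor N id, id :: nat \<Rightarrow> nat, bs) = (perm_mor N id, id, bs')"
      by (rule inj_onD[OF K_basis(1)[of N]])
        (use b m id_ordered_mors id_shuffle_perms in \<open>simp_all only: prod.case mem_Times_iff fst_conv snd_conv simp_thms\<close>)
    thus "bs = bs'" by simp
  qed
qed

lemma multi_concat_linear:
  "length ys = k \<Longrightarrow> i < k \<Longrightarrow> multi_concat (ys[i := x + y]) = multi_concat (ys[i := x]) + multi_concat (ys[i := y])"
  "length ys = k \<Longrightarrow> i < k \<Longrightarrow> multi_concat (ys[i := hscale q x]) = hscale q (multi_concat (ys[i := x]))"
proof -
  assume l: "length ys = k" and i: "i < k"
  have u: "map (\<lambda>j. hrelabel (young_shift ns j) (ys[i := z] ! j)) [0..<k] =
      (map (\<lambda>j. hrelabel (young_shift ns j) (ys ! j)) [0..<k])[i := hrelabel (young_shift ns i) z]" for z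
    using map_nth_upd[of i ys "\<lambda>j. hrelabel (young_shift ns j)" z] l i by simp
  show "multi_concat (ys[i := x + y]) = multi_concat (ys[i := x]) + multi_concat (ys[i := y])"
    "multi_concat (ys[i := hscale q x]) = hscale q (multi_concat (ys[i := x]))"
    unfolding multi_concat_def u hrelabel_add hrelabel_scale using i by (simp_all add: hprods_add)
qed

text \<open>The Young subgroup acts on the factors of a concatenation separately.\<close>
lemma tensor_model: "\<exists>G. rep_model (young ns) (outer_tensor ns (map ctype_rep Cs)) (hm.span (multi_concat ` basis_tuples)) G"
proof -
  have "\<exists>G. rep_model {\<sigma>. \<sigma> permutes {1..ns ! j}} (ctype_rep (Cs ! j)) (hm.span (ctype_set A' (Cs ! j))) G" if "j < k" for j
    using ctype_model[of "Cs ! j", OF TypeA_pos[OF that]] that by simp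
  then obtain Gs where Gs: "\<And>j. j < k \<Longrightarrow>
      rep_model {\<sigma>. \<sigma> permutes {1..ns ! j}} (ctype_rep (Cs ! j)) (hm.span (ctype_set A' (Cs ! j))) (Gs j)" by metis
  note r = rep_modelD[OF Gs]
  let ?Rs = "map ctype_rep Cs" let ?Vs = "map fst ?Rs"
  have v: "?Vs ! j = fst (ctype_rep (Cs ! j))" if "j < k" for j using that by simp
  let ?f = "\<lambda>vs. multi_concat (map (\<lambda>j. Gs j (vs ! j)) [0..<k])"
  let ?N = "(\<lambda>bs. map (\<lambda>j. inv_into (carrier (?Vs ! j)) (Gs j) (bs ! j)) [0..<k]) ` basis_tuples"
  have lV: "length ?Vs = k" by simp
  note M = multilin_presentation[where Vs = ?Vs and \<mu> = multi_concat and Gs = Gs and k = k and \<beta> = "\<lambda>j. ctype_set A' (Cs ! j)", OF lV _ _ _ multi_concat_linear multi_concat_basis]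
  have pres: "presentation (tuples ?Vs) (multilin_rels ?Vs) ?f ?N"
    by (rule M(2)) (use r(1-3) in \<open>simp_all add: v\<close>)
  have sing_pieces: "hm.span (?f ` tuples ?Vs) = hm.span (multi_concat ` basis_tuples)"
    by (rule M(1)) (use r(1-3) in \<open>simp_all add: v\<close>)
  let ?O = "outer_tensor ns ?Rs" and ?G = "presentation.quot_map (tuples ?Vs) (multilin_rels ?Vs) ?f"
  have fO: "fst ?O = presented (tuples ?Vs) (multilin_rels ?Vs)" by (simp add: outer_tensor_def)
  have act: "snd ?O g x \<in> carrier (fst ?O) \<and> ?G (snd ?O g x) = hrelabel g (?G x)"
    if g: "g \<in> young ns" and x: "x \<in> carrier (fst ?O)" for g x
  proof -
    let ?h = "\<lambda>vs. map (\<lambda>j. snd (?Rs ! j) (young_comp ns j g) (vs ! j)) [0..<length ?Rs]"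
    have y: "young_comp ns j g \<in> {\<sigma>. \<sigma> permutes {1..ns ! j}}" if "j < k" for j
      using young_comp_props(1)[OF g, of j] that by simp
    have vj: "vs ! j \<in> carrier (fst (ctype_rep (Cs ! j)))" if "vs \<in> tuples ?Vs" "j < k" for vs j
      using that by (auto simp: tuples_def)
    have c: "?h vs \<in> tuples ?Vs" if "vs \<in> tuples ?Vs" for vs
    proof -
      have "snd (ctype_rep (Cs ! j)) (young_comp ns j g) (vs ! j) \<in> carrier (fst (ctype_rep (Cs ! j)))" if "j < k" for j
        by (rule r(4)[OF that y[OF that] vj[OF \<open>vs \<in> tuples ?Vs\<close> that]])
      thus ?thesis by (simp add: tuples_def)
    qed
    have gi: "inj_on g A" for A using g by (auto simp: young_def intro: permutes_inj_on)
    have e: "?f (?h vs) = hrelabel g (?f vs)" if vs: "vs \<in> tuples ?Vs" for vs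
    proof -
      have "hrelabel (young_shift ns j) (Gs j (snd (ctype_rep (Cs ! j)) (young_comp ns j g) (vs ! j))) =
          hrelabel g (hrelabel (young_shift ns j) (Gs j (vs ! j)))" if j: "j < k" for j
      proof -
        let ?y = "young_comp ns j g" and ?z = "Gs j (vs ! j)"
        have z: "?z \<in> H 1 {1..ns ! j}" using lin_isoD(1)[OF r(1)[OF j] vj[OF vs j]] span_ctype_H[OF j] by blast
        have yp: "?y permutes {1..ns ! j}" using y[OF j] by simp
        have "hrelabel (young_shift ns j) (Gs j (snd (ctype_rep (Cs ! j)) ?y (vs ! j))) = hrelabel (young_shift ns j) (hrelabel ?y ?z)"
          unfolding r(5)[OF j y[OF j] vj[OF vs j]] ..
        also have "\<dots> = hrelabel (young_shift ns j \<circ> ?y) ?z" by (rule hrelabel_comp[OF z permutes_inj_on[OF yp] young_shift_inj])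
        also have "\<dots> = hrelabel (g \<circ> young_shift ns j) ?z"
          by (rule hrelabel_cong[OF z]) (use young_comp_props(2)[OF g, of j] j in simp)
        also have "\<dots> = hrelabel g (hrelabel (young_shift ns j) ?z)" by (rule hrelabel_comp[OF z young_shift_inj gi, symmetric])
        finally show ?thesis .
      qed
      hence "map (\<lambda>j. hrelabel (young_shift ns j) (map (\<lambda>j. Gs j (?h vs ! j)) [0..<k] ! j)) [0..<k] =
        map (hrelabel g) (map (\<lambda>j. hrelabel (young_shift ns j) (map (\<lambda>j. Gs j (vs ! j)) [0..<k] ! j)) [0..<k])"
        by (intro nth_equalityI) simp_all
      thus ?thesis unfolding multi_concat_def hrelabel_hprods by (rule arg_cong[of _ _ hprods])
    qed
    have x': "x \<in> carrier (presented (tuples ?Vs) (multilin_rels ?Vs))" using x unfolding fO .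
    from presentation.induced[OF pres pres c e hlinear_hrelabel x'] show ?thesis
      unfolding outer_tensor_def fst_conv snd_conv by blast
  qed
  have "lin_iso (fst ?O) (hsub (hm.span (multi_concat ` basis_tuples))) ?G" unfolding fO using presentation.quot_map_iso[OF pres] unfolding sing_pieces .
  moreover have "ops_closed (fst ?O)" unfolding fO by (rule ops_closed_presented)
  moreover have "?G \<zero>\<^bsub>fst ?O\<^esub> = 0" unfolding fO by (rule presentation.quot_map_zero[OF pres])
  ultimately have "rep_model (young ns) ?O (hm.span (multi_concat ` basis_tuples)) ?G" unfolding rep_model_def using act by blast
  thus ?thesis by blast
qed

lemma multi_concat_basis_tuples_H: "multi_concat ` basis_tuples \<subseteq> H k {1..N}"
proof (rule image_subsetI)
  fix bs assume "bs \<in> basis_tuples"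
  thus "multi_concat bs \<in> H k {1..N}" by (intro multi_concat_H basis_tuples_H)
qed

lemma Ind_model: "\<exists>G. rep_model {\<sigma>. \<sigma> permutes {1..N}} (Ind_ctypes Cs) (hm.span shuffled_basis) G"
proof -
  let ?O = "outer_tensor ns (map ctype_rep Cs)"
  obtain G where "rep_model (young ns) ?O (hm.span (multi_concat ` basis_tuples)) G" using tensor_model by blast
  note r = rep_modelD[OF this]
  have V: "hm.span (multi_concat ` basis_tuples) \<subseteq> H k {1..N}" by (rule hm.span_minimal[OF multi_concat_basis_tuples_H H_subspace])
  have GH: "G v \<in> H k {1..N}" if "v \<in> carrier (fst ?O)" for v using lin_isoD(1)[OF r(1) that] V by blast
  let ?S = "{\<tau>. \<tau> permutes {1..N}}"
  let ?R = "bal_rels ?S (\<lambda>\<tau> g. \<tau> \<circ> g) (young ns) ?O" and ?X = "?S \<times> carrier (fst ?O)" and ?f = "\<lambda>(\<tau>,v). hrelabel \<tau> (G v)"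
  let ?N = "(\<lambda>(x,b). (x, inv_into (carrier (fst ?O)) G b)) ` (shuffle_perms ns \<times> multi_concat ` basis_tuples)"
  have yp: "g permutes {1..N}" if "g \<in> young ns" for g using that by (simp add: young_def)
  have cl: "\<tau> \<circ> g \<in> ?S" if "\<tau> \<in> ?S" "g \<in> young ns" for \<tau> g
    using permutes_compose[OF yp[OF that(2)]] that(1) by simp
  have bal: "hrelabel (\<tau> \<circ> g) (G v) = hrelabel \<tau> (G (snd ?O g v))"
    if "\<tau> \<in> ?S" "g \<in> young ns" "v \<in> carrier (fst ?O)" for \<tau> g v
  proof -
    have t: "\<tau> permutes {1..N}" using that(1) by simp
    show ?thesis unfolding r(5)[OF that(2,3)]
      by (rule hrelabel_comp[OF GH[OF that(3)] permutes_inj_on[OF yp[OF that(2)]] permutes_inj_on[OF t], symmetric])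
  qed
  have sub: "shuffle_perms ns \<subseteq> ?S" by (auto simp: shuffle_perms_def)
  have dec: "\<exists>\<tau>0\<in>shuffle_perms ns. \<exists>g\<in>young ns. \<tau> = \<tau>0 \<circ> g" if "\<tau> \<in> ?S" for \<tau>
    by (rule shuffle_perms_young) (use that in simp)
  note B = bal_presentation[where ev = hrelabel and X = ?S and Gp = "young ns" and act = "\<lambda>\<tau> g. \<tau> \<circ> g" and ordered_mors = "shuffle_perms ns",
    OF r(1-3) hlinear_hrelabel cl r(4) bal sub dec hrelabel_basis]
  have pres: "presentation ?X ?R ?f ?N" by (rule B(1))
  have sing_pieces: "hm.span (?f ` ?X) = hm.span shuffled_basis" by (rule B(3))
  let ?G = "presentation.quot_map ?X ?R ?f" and ?I = "Ind_ctypes Cs"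
  have I: "fst ?I = presented ?X ?R" "snd ?I \<sigma> = induced ?R (\<lambda>(\<tau>,v). (\<sigma> \<circ> \<tau>, v))" for \<sigma>
    by (simp_all add: Ind_ctypes_def Ind_def Let_def)
  have act: "snd ?I \<sigma> x \<in> carrier (fst ?I) \<and> ?G (snd ?I \<sigma> x) = hrelabel \<sigma> (?G x)"
    if s: "\<sigma> permutes {1..N}" and x: "x \<in> carrier (fst ?I)" for \<sigma> x
  proof -
    have c: "(\<lambda>(\<tau>,v). (\<sigma> \<circ> \<tau>, v)) y \<in> ?X" if "y \<in> ?X" for y
      using that permutes_compose[OF _ s] by auto
    have e: "?f ((\<lambda>(\<tau>,v). (\<sigma> \<circ> \<tau>, v)) y) = hrelabel \<sigma> (?f y)" if y: "y \<in> ?X" for y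
    proof -
      obtain \<tau> v where yy: "y = (\<tau>,v)" "\<tau> permutes {1..N}" "v \<in> carrier (fst ?O)" using y by blast
      show ?thesis unfolding yy(1) prod.case
        by (rule hrelabel_comp[OF GH[OF yy(3)] permutes_inj_on[OF yy(2)] permutes_inj_on[OF s], symmetric])
    qed
    from presentation.induced[OF pres pres c e hlinear_hrelabel] x show ?thesis unfolding I by blast
  qed
  have "lin_iso (fst ?I) (hsub (hm.span shuffled_basis)) ?G" unfolding I using presentation.quot_map_iso[OF pres] unfolding sing_pieces .
  moreover have "ops_closed (fst ?I)" unfolding I by (rule ops_closed_presented)
  moreover have "?G \<zero>\<^bsub>fst ?I\<^esub> = 0" unfolding I by (rule presentation.quot_map_zero[OF pres])
  ultimately have "rep_model ?S ?I (hm.span shuffled_basis) ?G" unfolding rep_model_def using act by blast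
  thus ?thesis by blast
qed

lemma shuffled_basis_alt: "shuffled_basis = (\<lambda>(\<tau>,bs). hrelabel \<tau> (multi_concat bs)) ` (shuffle_perms ns \<times> basis_tuples)"
  by force

lemma shuffled_basis_eq: "shuffled_basis = {hprods (map (\<lambda>j. hrelabel (\<tau> \<circ> young_shift ns j) (bs ! j)) [0..<k]) | \<tau> bs. \<tau> \<in> shuffle_perms ns \<and> bs \<in> basis_tuples}"
proof -
  have e: "hrelabel \<tau> (multi_concat bs) = hprods (map (\<lambda>j. hrelabel (\<tau> \<circ> young_shift ns j) (bs ! j)) [0..<k])"
    if "\<tau> \<in> shuffle_perms ns" "bs \<in> basis_tuples" for \<tau> bs
  proof -
    have t: "\<tau> permutes {1..N}" using that(1) by (simp add: shuffle_perms_def)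
    have "hrelabel \<tau> (hrelabel (young_shift ns j) (bs ! j)) = hrelabel (\<tau> \<circ> young_shift ns j) (bs ! j)" if "j < k" for j
      by (rule hrelabel_comp[OF basis_tuples_H[OF \<open>bs \<in> basis_tuples\<close> that] young_shift_inj permutes_inj_on[OF t]])
    thus ?thesis unfolding multi_concat_def hrelabel_hprods map_map by (intro arg_cong[of _ _ hprods] map_cong) auto
  qed
  show ?thesis
  proof (intro equalityI subsetI)
    fix z assume "z \<in> shuffled_basis"
    then obtain y where y: "y \<in> shuffle_perms ns \<times> basis_tuples" "z = (\<lambda>(\<tau>,bs). hrelabel \<tau> (multi_concat bs)) y" unfolding shuffled_basis_alt by (elim imageE) (rule that)
    obtain \<tau> bs where yy: "y = (\<tau>,bs)" by (cases y)
    have "z = hrelabel \<tau> (multi_concat bs)" "\<tau> \<in> shuffle_perms ns" "bs \<in> basis_tuples"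
      using y unfolding yy mem_Times_iff fst_conv snd_conv prod.case by blast+
    thus "z \<in> {hprods (map (\<lambda>j. hrelabel (\<tau> \<circ> young_shift ns j) (bs ! j)) [0..<k]) | \<tau> bs. \<tau> \<in> shuffle_perms ns \<and> bs \<in> basis_tuples}" using e by blast
  next
    fix z assume "z \<in> {hprods (map (\<lambda>j. hrelabel (\<tau> \<circ> young_shift ns j) (bs ! j)) [0..<k]) | \<tau> bs. \<tau> \<in> shuffle_perms ns \<and> bs \<in> basis_tuples}"
    then obtain \<tau> bs where *: "z = hprods (map (\<lambda>j. hrelabel (\<tau> \<circ> young_shift ns j) (bs ! j)) [0..<k])" "\<tau> \<in> shuffle_perms ns" "bs \<in> basis_tuples" by blast
    have "z = hrelabel \<tau> (multi_concat bs)" unfolding *(1) e[OF *(2,3)] ..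
    thus "z \<in> shuffled_basis" using *(2,3) by blast
  qed
qed

text \<open>Distributing the labels over the factors in an order-preserving way amounts to a
  shuffle.\<close>
lemma concat_products_eq: "concat_products A' Cs N = shuffled_basis"
proof (intro equalityI subsetI)
  fix z assume "z \<in> concat_products A' Cs N"
  then obtain ys S where ys: "z = hprods ys" "length ys = k"
    "\<forall>j<k. \<exists>x\<in>ctype_set A' (Cs ! j). ordered_injected (ctype_deg (Cs ! j)) (S j) x (ys ! j)"
    and S: "\<forall>i<k. \<forall>j<k. i \<noteq> j \<longrightarrow> S i \<inter> S j = {}" "(\<Union>j<k. S j) = {1..N}"
    unfolding concat_products_def by (elim CollectE exE conjE) (rule that)
  have "\<forall>j. \<exists>x f. j < k \<longrightarrow> x \<in> ctype_set A' (Cs ! j) \<and> bij_betw f {1..ns ! j} (S j) \<and> strict_mono_on {1..ns ! j} f \<and> ys ! j = hrelabel f x"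
    using ys(3) unfolding ordered_injected_def by (metis nth_map)
  then obtain x f where xf: "\<And>j. j < k \<Longrightarrow> x j \<in> ctype_set A' (Cs ! j)" "\<And>j. j < k \<Longrightarrow> bij_betw (f j) {1..ns ! j} (S j)"
    "\<And>j. j < k \<Longrightarrow> strict_mono_on {1..ns ! j} (f j)" "\<And>j. j < k \<Longrightarrow> ys ! j = hrelabel (f j) (x j)" by metis
  obtain \<tau> where t: "\<tau> permutes {1..N}" "\<And>j i. j < k \<Longrightarrow> i \<in> {1..ns ! j} \<Longrightarrow> \<tau> (young_shift ns j i) = f j i"
    using glue[of ns f S] xf(2) S by (auto simp: length_map simp del: One_nat_def)
  have "\<tau> \<in> shuffle_perms ns" unfolding shuffle_perms_def strict_mono_on_young_block mem_Collect_eq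
  proof (intro conjI allI impI)
    fix j assume "j < length ns"
    hence j: "j < k" by simp
    show "strict_mono_on {1..ns ! j} (\<tau> \<circ> young_shift ns j)"
    proof (rule strict_mono_onI)
      fix a b assume ab: "a \<in> {1..ns ! j}" "b \<in> {1..ns ! j}" "a < b"
      show "(\<tau> \<circ> young_shift ns j) a < (\<tau> \<circ> young_shift ns j) b"
        unfolding comp_apply t(2)[OF j ab(1)] t(2)[OF j ab(2)] by (rule strict_mono_onD[OF xf(3)[OF j] ab])
    qed
  qed (rule t(1))
  moreover have "map x [0..<k] \<in> basis_tuples" using xf(1) by simp
  moreover have "ys = map (\<lambda>j. hrelabel (\<tau> \<circ> young_shift ns j) (map x [0..<k] ! j)) [0..<k]"
  proof (rule nth_equalityI)
    fix j assume "j < length ys"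
    hence j: "j < k" using ys(2) by simp
    have "x j \<in> H 1 {1..ns ! j}" using xf(1)[OF j] ctype_set_H[OF j] by blast
    hence "hrelabel (f j) (x j) = hrelabel (\<tau> \<circ> young_shift ns j) (x j)"
      by (rule hrelabel_cong) (use t(2)[OF j] in simp)
    thus "ys ! j = map (\<lambda>j. hrelabel (\<tau> \<circ> young_shift ns j) (map x [0..<k] ! j)) [0..<k] ! j" using xf(4)[OF j] j by simp
  qed (use ys(2) in simp)
  ultimately show "z \<in> shuffled_basis" unfolding shuffled_basis_eq ys(1) by blast
next
  fix z assume "z \<in> shuffled_basis"
  then obtain \<tau> bs where *: "z = hprods (map (\<lambda>j. hrelabel (\<tau> \<circ> young_shift ns j) (bs ! j)) [0..<k])" "\<tau> \<in> shuffle_perms ns" "bs \<in> basis_tuples"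
    unfolding shuffled_basis_eq by blast
  have t: "\<tau> permutes {1..N}" and m: "\<And>j. j < k \<Longrightarrow> strict_mono_on (young_block ns j) \<tau>" using *(2) by (auto simp: shuffle_perms_def)
  have i: "inj_on \<tau> A" for A by (rule permutes_inj_on[OF t])
  show "z \<in> concat_products A' Cs N"
    unfolding concat_products_def *(1)
  proof (intro CollectI exI[of _ "map (\<lambda>j. hrelabel (\<tau> \<circ> young_shift ns j) (bs ! j)) [0..<k]"] exI[of _ "\<lambda>j. \<tau> ` young_block ns j"] conjI allI impI)
    show "hprods (map (\<lambda>j. hrelabel (\<tau> \<circ> young_shift ns j) (bs ! j)) [0..<k]) = hprods (map (\<lambda>j. hrelabel (\<tau> \<circ> young_shift ns j) (bs ! j)) [0..<k])" ..
    show "length (map (\<lambda>j. hrelabel (\<tau> \<circ> young_shift ns j) (bs ! j)) [0..<k]) = k" by simp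
    fix j assume j: "j < k"
    have "bij_betw (\<tau> \<circ> young_shift ns j) {1..ns ! j} (\<tau> ` young_block ns j)"
      unfolding bij_betw_def image_comp[symmetric] young_shift_image using comp_inj_on[OF young_shift_inj i] by blast
    moreover have "strict_mono_on {1..ns ! j} (\<tau> \<circ> young_shift ns j)" using m[OF j] unfolding strict_mono_on_young_block .
    moreover have "bs ! j \<in> ctype_set A' (Cs ! j)" using *(3) j by blast
    ultimately show "\<exists>x\<in>ctype_set A' (Cs ! j). ordered_injected (ctype_deg (Cs ! j)) (\<tau> ` young_block ns j) x
        (map (\<lambda>j. hrelabel (\<tau> \<circ> young_shift ns j) (bs ! j)) [0..<k] ! j)"
      unfolding ordered_injected_def using j by (intro bexI[of _ "bs ! j"] exI[of _ "\<tau> \<circ> young_shift ns j"]) simp_all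
  next
    fix a b assume ab: "a < k" "b < k" "a \<noteq> b"
    show "\<tau> ` young_block ns a \<inter> \<tau> ` young_block ns b = {}"
      using image_Int[OF i[of UNIV], of "young_block ns a" "young_block ns b"] young_block_disjoint[of a ns b] ab by simp
  next
    show "(\<Union>j<k. \<tau> ` young_block ns j) = {1..N}"
      using young_block_union[of ns] permutes_image[OF t] by (simp only: image_UN[symmetric] length_map)
  qed
qed

lemma shuffled_basis_H: "shuffled_basis \<subseteq> H k {1..N}"
proof
  fix z assume "z \<in> shuffled_basis"
  then obtain \<tau> b where *: "z = hrelabel \<tau> b" "\<tau> permutes {1..N}" "b \<in> multi_concat ` basis_tuples" by (auto simp: shuffle_perms_def)
  have "b \<in> H k {1..N}" using multi_concat_basis_tuples_H *(3) by blast
  from H_hrelabel[OF this permutes_inj_on[OF *(2)]] show "z \<in> H k {1..N}" unfolding *(1) permutes_image[OF *(2)] .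
qed

lemma FI_act_basis:
  "inj_on (\<lambda>(\<phi>,b). FI_act js N n' \<phi> b) (ordered_mors n' \<times> shuffled_basis)" "hm.independent ((\<lambda>(\<phi>,b). FI_act js N n' \<phi> b) ` (ordered_mors n' \<times> shuffled_basis))"
proof -
  have e: "(\<lambda>(\<phi>,c). FI_act js N n' \<phi> ((\<lambda>(\<tau>,bs). hrelabel \<tau> (multi_concat bs)) c)) = (\<lambda>(\<phi>,\<tau>,bs). K n' \<phi> \<tau> bs)" by auto
  note p = inj_on_pair_image[of "FI_act js N n'" "\<lambda>(\<tau>,bs). hrelabel \<tau> (multi_concat bs)" "ordered_mors n'" "shuffle_perms ns \<times> basis_tuples", unfolded e, OF K_basis(1)]
  show "inj_on (\<lambda>(\<phi>,b). FI_act js N n' \<phi> b) (ordered_mors n' \<times> shuffled_basis)" unfolding shuffled_basis_alt by (rule p(1))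
  show "hm.independent ((\<lambda>(\<phi>,b). FI_act js N n' \<phi> b) ` (ordered_mors n' \<times> shuffled_basis))" unfolding shuffled_basis_alt p(2) by (rule K_basis(2))
qed

lemma products_rep_iso: "rep_iso N (hsub (hm.span (concat_products A' Cs N)), hrelabel) (Ind_ctypes Cs)"
proof -
  obtain G where G: "rep_model {\<sigma>. \<sigma> permutes {1..N}} (Ind_ctypes Cs) (hm.span shuffled_basis) G" using Ind_model by blast
  show ?thesis unfolding concat_products_eq
    by (rule rep_model_rep_iso[OF G hm.subspace_span hm.span_minimal[OF shuffled_basis_H H_subspace]])
qed

lemma generated_products:
  defines "W \<equiv> generated k (set js) N (concat_products A' Cs N)"
  shows "FI_submodule (length js) (H_FI_mod k js) W" "FI_free (length js) (restrict_FI (H_FI_mod k js) W)"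
    "FI_iso (length js) (restrict_FI (H_FI_mod k js) W) (MFI (length js) N (Ind_ctypes Cs))"
proof -
  note jk = js_props(3)
  have W: "W = FI_span js N (hm.span shuffled_basis)"
    unfolding W_def concat_products_eq by (rule ext, rule generated_FI_span[OF jk shuffled_basis_H])
  have VH: "hm.span shuffled_basis \<subseteq> H k {1..N}" by (rule hm.span_minimal[OF shuffled_basis_H H_subspace])
  have R: "restrict_FI (H_FI_mod k js) W = (\<lambda>n. hsub (FI_span js N (hm.span shuffled_basis) n), FI_act js)"
    by (simp add: restrict_FI_def H_FI_mod_def W hsub_def)
  obtain G where G: "rep_model {\<sigma>. \<sigma> permutes {1..N}} (Ind_ctypes Cs) (hm.span shuffled_basis) G" using Ind_model by blast
  show "FI_iso (length js) (restrict_FI (H_FI_mod k js) W) (MFI (length js) N (Ind_ctypes Cs))"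
    unfolding R by (rule MFI_iso[OF jk G shuffled_basis_H FI_act_basis])
  have st: "hrelabel \<sigma> ` hm.span shuffled_basis \<subseteq> hm.span shuffled_basis" if s: "\<sigma> permutes {1..N}" for \<sigma>
  proof (rule image_subsetI)
    note r = rep_modelD[OF G]
    fix w assume "w \<in> hm.span shuffled_basis"
    then obtain x where x: "x \<in> carrier (fst (Ind_ctypes Cs))" "G x = w" using lin_isoD(6)[OF r(1)] by blast
    have s': "\<sigma> \<in> {\<sigma>. \<sigma> permutes {1..N}}" using s by simp
    show "hrelabel \<sigma> w \<in> hm.span shuffled_basis"
      using lin_isoD(1)[OF r(1) r(4)[OF s' x(1)]] unfolding r(5)[OF s' x(1)] x(2) .
  qed
  show "FI_free (length js) (restrict_FI (H_FI_mod k js) W)"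
    unfolding R by (rule MFI_free[OF jk shuffled_basis_H st FI_act_basis])
  show "FI_submodule (length js) (H_FI_mod k js) W"
    unfolding FI_submodule_def
  proof (intro conjI allI ballI)
    fix n
    have m: "Module.module rat_ring (hsub (H k {1..n}))" by (rule module_hsub[OF H_subspace])
    have "submodule (W n) rat_ring (hsub (H k {1..n}))"
    proof (rule Module.module.submoduleI[OF m])
      show "W n \<subseteq> carrier (hsub (H k {1..n}))" unfolding W using FI_span_H[OF jk VH] by (simp add: hsub_def)
      show "\<zero>\<^bsub>hsub (H k {1..n})\<^esub> \<in> W n" unfolding W using hm.subspace_0[OF FI_span_subspace] by (simp add: hsub_def)
      fix a b assume ab: "a \<in> W n" "b \<in> W n"
      show "a \<oplus>\<^bsub>hsub (H k {1..n})\<^esub> b \<in> W n" using hm.subspace_add[OF FI_span_subspace] ab unfolding W by (simp add: hsub_def)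
      interpret Module.module rat_ring "hsub (H k {1..n})" by (rule m)
      have aH: "a \<in> H k {1..n}" using FI_span_H[OF jk VH] ab(1) unfolding W by blast
      have nH: "- a \<in> H k {1..n}" using hm.subspace_neg[OF H_subspace aH] .
      have "\<ominus>\<^bsub>hsub (H k {1..n})\<^esub> a = - a"
        by (rule M.minus_equality) (use aH nH in \<open>simp_all add: hsub_def\<close>)
      thus "\<ominus>\<^bsub>hsub (H k {1..n})\<^esub> a \<in> W n" using hm.subspace_neg[OF FI_span_subspace] ab(1) unfolding W by simp
    next
      fix q x assume "x \<in> W n"
      thus "q \<odot>\<^bsub>hsub (H k {1..n})\<^esub> x \<in> W n" using hm.subspace_scale[OF FI_span_subspace] unfolding W by (simp add: hsub_def)
    qed
    thus "submodule (W n) rat_ring (fst (H_FI_mod k js) n)" by (simp add: H_FI_mod_def)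
  next
    fix m n \<phi> assume "\<phi> \<in> FI_hom (length js) m n"
    from FI_span_closed[OF jk VH this] show "snd (H_FI_mod k js) m n \<phi> ` W m \<subseteq> W n" unfolding W by (simp add: H_FI_mod_def)
  qed
qed

end

theorem theorem5p6:
  fixes A' :: "nat \<Rightarrow> nat \<Rightarrow> hmlg set" and Cs :: "ctype list" and k n d :: nat
  assumes "admissible A'"
    and "k = length Cs"
    and "\<forall>m. TypeA m \<in> set Cs \<longrightarrow> 1 \<le> m"
    and "n = (\<Sum>j<k. ctype_deg (Cs ! j))"
    and "d = card {j. j < k \<and> Cs ! j = TypeB}"
  shows "rep_iso n (hsub (hm.span (concat_products A' Cs n)), hrelabel) (Ind_ctypes Cs) \<and>
    (let js = insertion_indices Cs;
         W = generated k (set js) n (concat_products A' Cs n)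
     in \<exists>M. H_FI k js M \<and> FI_submodule (d + 1) M W \<and>
          FI_free (d + 1) (restrict_FI M W) \<and>
          FI_iso (d + 1) (restrict_FI M W) (MFI (d + 1) n (Ind_ctypes Cs)))"
proof -
  interpret product_family A' Cs using assms(1,3) by unfold_locales
  have n: "n = sum_list (map ctype_deg Cs)"
    unfolding assms(2,4) by (simp add: sum_list_sum_nth lessThan_atLeast0)
  have d: "d + 1 = length (insertion_indices Cs)" unfolding assms(2,5) js_props(4) ..
  have "H_FI (length Cs) (insertion_indices Cs) (H_FI_mod (length Cs) (insertion_indices Cs))"
    by (rule H_FI_H_FI_mod[OF js_props(3)])
  thus ?thesis unfolding n d Let_def assms(2) using products_rep_iso generated_products by blast
qed

end
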